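(* Fix $\rho_o\in L^1(\mathbb{R},[0,R])$ and $y_o\in\mathbb{R}$. Suppose that $f\in C^2([0,R],\mathbb{R})$ is bell-shaped, that condition (B) of the context holds, and that there exists $\alpha>0$ such that $f''(\rho)\le-\alpha$ for all $\rho\in[0,R]$. Suppose also that in the scheme the numerical flux used at the edges $j\ne0$ is the Engquist-Osher flux or the Godunov flux, and that at $j=0$ any other monotone consistent and Lipschitz numerical flux is used. Then, under the CFL condition, the scheme converges to an admissible weak solution to Problem (P) with data $(\rho_o,y_o)$: as $\Delta\to0$, up to the extraction of a subsequence, $y_\Delta$ converges uniformly on $[0,T]$ to some $y$ and $\rho_\Delta$ converges a.e. on $\mathbb{R}\times]0,T[$ to some $\rho$, where $(\rho,y)$ is an admissible weak solution to Problem (P) with data $(\rho_o,y_o)$.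
   Context: $\mathbb{R}^+=[0,+\infty)$. Fix $T>0$, $R>0$. Bell-shaped $f:[0,R]\to\mathbb{R}^+$ means: $f(0)=f(R)=0$ and there exists a unique $\overline\rho\in]0,R[$ with $f'(\rho)(\overline\rho-\rho)>0$ for a.e. $\rho\in]0,R[$. The function $\omega:[0,R]\to\mathbb{R}^+$ is nonincreasing and Lipschitz; $Q:[0,\|\omega\|_{L^\infty}]\to\mathbb{R}^+$ is Lipschitz; $\mu\in BV(\mathbb{R},\mathbb{R}^+)$ is a (bounded, integrable) weight function with $\int\mu=1$. $F(s,\rho)=f(\rho)-s\rho$. Condition (B): for every $s\in[0,\|\omega\|_{L^\infty}]$, $F(s,\cdot)$ has its maximum at a point $\overline\rho_s>0$ and is bell-shaped: $F(s,0)=0$, $F(s,R)\le0$, $\overline\rho_s$ is the unique point of $]0,R[$ with $\partial_\rho F(s,\rho)(\overline\rho_s-\rho)>0$ for a.e. $\rho\in]0,R[$. Problem (P) with data $(\rho_o,y_o)$: $\partial_t\rho+\partial_x(F(\dot y(t),\rho))=0$ in $\mathbb{R}\times]0,T[$, $\rho(x,0)=\rho_o(x+y_o)$, $F(\dot y(t),\rho)|_{x=0}\le Q(\dot y(t))$, $\dot y(t)=\omega(\int_{\mathbb{R}}\rho(x,t)\mu(x)dx)$, $y(0)=y_o$. Let $\Phi_s(a,b)=\mathrm{sign}(a-b)(F(s,a)-F(s,b))$ and $\mathcal{R}_s(k,q)=F(s,k)-\min\{F(s,k),q\}$. $(\rho,y)$ with $\rho\in L^\infty(\mathbb{R}\times]0,T[,[0,R])$,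 $y\in W^{1,\infty}(]0,T[)$ is an admissible weak solution to (P) if, with $q(t)=Q(\dot y(t))$: (i) $\rho\in C([0,T],L^1_{loc}(\mathbb{R}))$, $\rho(\cdot,0)=\rho_o(\cdot+y_o)$; (ii) for all $\varphi\in C_c^\infty(\mathbb{R}\times\mathbb{R}^+,\mathbb{R}^+)$, $k\in[0,R]$, $0\le\tau<\tau'\le T$, $$\int_\tau^{\tau'}\!\!\int_{\mathbb{R}}|\rho-k|\partial_t\varphi+\Phi_{\dot y(t)}(\rho,k)\partial_x\varphi\,dx\,dt+\int_{\mathbb{R}}|\rho(x,\tau)-k|\varphi(x,\tau)dx-\int_{\mathbb{R}}|\rho(x,\tau')-k|\varphi(x,\tau')dx+2\int_\tau^{\tau'}\mathcal{R}_{\dot y(t)}(k,q(t))\varphi(0,t)dt\ge0;$$ (iii) for all $\psi\in C^\infty([0,T],\mathbb{R}^+)$ and some given $\varphi\in C_c^\infty(\mathbb{R},\mathbb{R})$ with $\varphi(0)=1$, for all $0\le\tau<\tau'\le T$, $$-\int_\tau^{\tau'}\!\!\int_{\mathbb{R}^+}\rho\,\partial_t(\varphi\psi)+F(\dot y(t),\rho)\partial_x(\varphi\psi)\,dx\,dt-\int_{\mathbb{R}^+}\rho(x,\tau)\varphi(x)\psi(\tau)dx+\int_{\mathbb{R}^+}\rho(x,\tau')\varphi(x)\psi(\tau')dx\le\int_\tau^{\tau'}q(t)\psi(t)dt;$$ (iv) $y(t)=y_o+\int_0^t\omega(\int_{\mathbb{R}}\rho(x,s)\mu(x)dx)ds$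 for all $t\in[0,T]$. Scheme. For $\Delta=(\Delta x,\Delta t)$ let $x_j=j\Delta x$, $t^n=n\Delta t$, $K_{j+1/2}=]x_j,x_{j+1}[$, $P^n_{j+1/2}=K_{j+1/2}\times[t^n,t^{n+1}[$, $\lambda=\Delta t/\Delta x$, $N\in\mathbb{N}$ with $T\in[t^N,t^{N+1}[$. $\rho^0_{j+1/2}$ and $\mu_{j+1/2}$ are the mean values of $\rho_o(\cdot+y_o)$ and $\mu$ on $K_{j+1/2}$. A numerical flux for $F(s,\cdot)$ is a Lipschitz function $\mathbf{F}^s:[0,R]^2\to\mathbb{R}$; monotone: nondecreasing in the first and nonincreasing in the second variable; consistent: $\mathbf{F}^s(a,a)=F(s,a)$. For each $s\in[0,\|\omega\|_{L^\infty}]$ choose monotone consistent Lipschitz numerical fluxes $\mathbf{F}^s$ (used for $j\neq0$) and $\mathbf{G}^s$ (used for $j=0$). Set $$s^{n+1}=\omega\Big(\sum_{j\in\mathbb{Z}}\rho^n_{j+1/2}\mu_{j+1/2}\Delta x\Big),\quad q^{n+1}=Q(s^{n+1}),$$ $$\rho^{n+1}_{j+1/2}=\rho^n_{j+1/2}-\lambda\big(\mathbf{F}^{n+1}_{j+1}(\rho^n_{j+1/2},\rho^n_{j+3/2})-\mathbf{F}^{n+1}_j(\rho^n_{j-1/2},\rho^n_{j+1/2})\big),$$ with $\mathbf{F}^{n+1}_j=\mathbf{F}^{s^{n+1}}$ if $j\ne0$ and $\mathbf{F}^{n+1}_0=\min\{\mathbf{G}^{s^{n+1}},q^{n+1}\}$.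 Define $\rho_\Delta=\sum_{n=0}^N\sum_{j\in\mathbb{Z}}\rho^n_{j+1/2}\mathbf{1}_{P^n_{j+1/2}}$, $s_\Delta(t)=s^{n+1}$ for $t\in[t^n,t^{n+1}[$, $y_\Delta(t)=y_o+\int_0^ts_\Delta(u)du$. CFL condition: $\lambda L\le1$, where $L=\sup_{s}(\|\partial_1\mathbf{H}^s\|_{L^\infty}+\|\partial_2\mathbf{H}^s\|_{L^\infty})<\infty$, the supremum being over $s\in[0,\|\omega\|_{L^\infty}]$ and $\mathbf{H}^s\in\{\mathbf{F}^s,\mathbf{G}^s\}$. The limit $\Delta\to0$ is taken with $\lambda$ constant and verifying the CFL condition. Godunov flux: $\min_{[a,b]}F(s,\cdot)$ if $a\le b$, $\max_{[b,a]}F(s,\cdot)$ if $a\ge b$. Engquist-Osher flux: $F(s,0)+\int_0^a\max\{\partial_\rho F(s,r),0\}dr+\int_0^b\min\{\partial_\rho F(s,r),0\}dr$. *)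

theory Defs
  imports "HOL-Analysis.Analysis"
begin

section \<open>Function spaces\<close>

definition Linf_norm :: "'a::euclidean_space set \<Rightarrow> ('a \<Rightarrow> real) \<Rightarrow> real" where
  "Linf_norm A g = Inf {C. 0 \<le> C \<and> (AE x in lebesgue_on A. \<bar>g x\<bar> \<le> C)}"

definition ess_bounded_on :: "'a::euclidean_space set \<Rightarrow> ('a \<Rightarrow> real) \<Rightarrow> bool" where
  "ess_bounded_on A g \<longleftrightarrow> g \<in> borel_measurable (lebesgue_on A)
     \<and> (\<exists>C. AE x in lebesgue_on A. \<bar>g x\<bar> \<le> C)"

primrec C_diff :: "nat \<Rightarrow> ('a::real_normed_vector \<Rightarrow> 'b::real_normed_vector) \<Rightarrow> bool" where
  "C_diff 0 g \<longleftrightarrow> continuous_on UNIV g"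
| "C_diff (Suc n) g \<longleftrightarrow>
     (\<forall>x. g differentiable (at x)) \<and> (\<forall>v. C_diff n (\<lambda>x. frechet_derivative g (at x) v))"

definition smooth :: "('a::real_normed_vector \<Rightarrow> 'b::real_normed_vector) \<Rightarrow> bool" where
  "smooth g \<longleftrightarrow> (\<forall>n. C_diff n g)"

text \<open>A smooth function on a closed set (such as a closed half plane or a compact interval) is
  the restriction of a smooth function on the whole space.  Accordingly a test function on \<open>S\<close> is
  given by such an extension; only its values on \<open>S\<close> are ever used.\<close>

definition test_function_on :: "'a::real_normed_vector set \<Rightarrow> ('a \<Rightarrow> real) \<Rightarrow> bool" where
  "test_function_on S \<phi> \<longleftrightarrow>
     smooth \<phi> \<and> (\<exists>K. compact K \<and> K \<subseteq> S \<and> (\<forall>z\<in>S - K. \<phi> z = 0))"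

text \<open>\<open>y \<in> W\<^sup>1\<^sup>,\<^sup>\<infinity>(]0,T[)\<close> with weak derivative \<open>v\<close>, which is unique up to null sets.\<close>

definition W1inf_deriv :: "real \<Rightarrow> (real \<Rightarrow> real) \<Rightarrow> (real \<Rightarrow> real) \<Rightarrow> bool" where
  "W1inf_deriv T y v \<longleftrightarrow> ess_bounded_on {0<..<T} y \<and> ess_bounded_on {0<..<T} v
     \<and> (\<forall>\<phi>. test_function_on {0<..<T} \<phi> \<longrightarrow>
          (LINT t:{0<..<T}|lebesgue. y t * deriv \<phi> t) = - (LINT t:{0<..<T}|lebesgue. v t * \<phi> t))"

text \<open>\<open>BV(\<real>)\<close>: integrable functions whose distributional derivative is a finite measure.\<close>

definition BV :: "(real \<Rightarrow> real) \<Rightarrow> bool" where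
  "BV g \<longleftrightarrow> integrable lebesgue g
     \<and> (\<exists>C. \<forall>\<phi>. \<phi> C1_differentiable_on UNIV \<and> (\<exists>K. compact K \<and> (\<forall>x. x \<notin> K \<longrightarrow> \<phi> x = 0))
              \<and> (\<forall>x. \<bar>\<phi> x\<bar> \<le> 1)
              \<longrightarrow> (LINT x|lebesgue. g x * deriv \<phi> x) \<le> C)"


section \<open>The flux\<close>

definition flux :: "(real \<Rightarrow> real) \<Rightarrow> real \<Rightarrow> real \<Rightarrow> real" where
  "flux f s r = f r - s * r"

definition turning_point :: "real \<Rightarrow> (real \<Rightarrow> real) \<Rightarrow> real \<Rightarrow> bool" where
  "turning_point R g p \<longleftrightarrow> p \<in> {0<..<R}
     \<and> (AE r in lebesgue_on {0<..<R}. g differentiable (at r) \<and> deriv g r * (p - r) > 0)"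

definition bell_shaped :: "real \<Rightarrow> (real \<Rightarrow> real) \<Rightarrow> bool" where
  "bell_shaped R f \<longleftrightarrow> (\<forall>r\<in>{0..R}. 0 \<le> f r) \<and> f 0 = 0 \<and> f R = 0 \<and> (\<exists>!p. turning_point R f p)"

definition condition_B :: "real \<Rightarrow> (real \<Rightarrow> real) \<Rightarrow> real \<Rightarrow> bool" where
  "condition_B R f smax \<longleftrightarrow> (\<forall>s\<in>{0..smax}.
     flux f s 0 = 0 \<and> flux f s R \<le> 0
     \<and> (\<exists>p>0. (\<forall>r\<in>{0..R}. flux f s r \<le> flux f s p)
            \<and> turning_point R (flux f s) p
            \<and> (\<forall>p'. turning_point R (flux f s) p' \<longrightarrow> p' = p)))"


section \<open>Admissible weak solutions\<close>

definition entropy_flux :: "(real \<Rightarrow> real) \<Rightarrow> real \<Rightarrow> real \<Rightarrow> real \<Rightarrow> real" where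
  "entropy_flux f s a b = sgn (a - b) * (flux f s a - flux f s b)"

definition constraint_excess :: "(real \<Rightarrow> real) \<Rightarrow> real \<Rightarrow> real \<Rightarrow> real \<Rightarrow> real" where
  "constraint_excess f s k q = flux f s k - min (flux f s k) q"

definition continuous_L1loc :: "real \<Rightarrow> (real \<Rightarrow> real \<Rightarrow> real) \<Rightarrow> bool" where
  "continuous_L1loc T \<rho> \<longleftrightarrow> (\<forall>K. compact K \<longrightarrow>
     (\<forall>t\<in>{0..T}. set_integrable lebesgue K (\<lambda>x. \<rho> x t))
     \<and> (\<forall>t\<^sub>0\<in>{0..T}.
          ((\<lambda>t. LINT x:K|lebesgue. \<bar>\<rho> x t - \<rho> x t\<^sub>0\<bar>) \<longlongrightarrow> 0) (at t\<^sub>0 within {0..T})))"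

definition entropy_inequality ::
  "real \<Rightarrow> real \<Rightarrow> (real \<Rightarrow> real) \<Rightarrow> (real \<Rightarrow> real) \<Rightarrow> (real \<Rightarrow> real \<Rightarrow> real) \<Rightarrow> (real \<Rightarrow> real) \<Rightarrow> bool"
where
  "entropy_inequality T R f Q \<rho> v \<longleftrightarrow>
    (\<forall>\<phi> k \<tau> \<tau>'. test_function_on (UNIV \<times> {0..}) \<phi> \<and> (\<forall>z\<in>UNIV \<times> {0..}. 0 \<le> \<phi> z)
       \<and> k \<in> {0..R} \<and> 0 \<le> \<tau> \<and> \<tau> < \<tau>' \<and> \<tau>' \<le> T \<longrightarrow>
       (LINT t:{\<tau>..\<tau>'}|lebesgue. LINT x|lebesgue.
           (\<bar>\<rho> x t - k\<bar> * deriv (\<lambda>u. \<phi> (x, u)) t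
            + entropy_flux f (v t) (\<rho> x t) k * deriv (\<lambda>w. \<phi> (w, t)) x))
       + (LINT x|lebesgue. \<bar>\<rho> x \<tau> - k\<bar> * \<phi> (x, \<tau>))
       - (LINT x|lebesgue. \<bar>\<rho> x \<tau>' - k\<bar> * \<phi> (x, \<tau>'))
       + 2 * (LINT t:{\<tau>..\<tau>'}|lebesgue. constraint_excess f (v t) k (Q (v t)) * \<phi> (0, t))
       \<ge> 0)"

definition weak_constraint ::
  "real \<Rightarrow> (real \<Rightarrow> real) \<Rightarrow> (real \<Rightarrow> real) \<Rightarrow> (real \<Rightarrow> real \<Rightarrow> real) \<Rightarrow> (real \<Rightarrow> real) \<Rightarrow> bool"
where
  "weak_constraint T f Q \<rho> v \<longleftrightarrow>
    (\<exists>\<phi>. test_function_on UNIV \<phi> \<and> \<phi> 0 = 1 \<and>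
      (\<forall>\<psi> \<tau> \<tau>'. smooth \<psi> \<and> (\<forall>t\<in>{0..T}. 0 \<le> \<psi> t) \<and> 0 \<le> \<tau> \<and> \<tau> < \<tau>' \<and> \<tau>' \<le> T \<longrightarrow>
        - (LINT t:{\<tau>..\<tau>'}|lebesgue. LINT x:{0..}|lebesgue.
             (\<rho> x t * deriv (\<lambda>u. \<phi> x * \<psi> u) t
              + flux f (v t) (\<rho> x t) * deriv (\<lambda>w. \<phi> w * \<psi> t) x))
        - (LINT x:{0..}|lebesgue. \<rho> x \<tau> * \<phi> x * \<psi> \<tau>)
        + (LINT x:{0..}|lebesgue. \<rho> x \<tau>' * \<phi> x * \<psi> \<tau>')
        \<le> (LINT t:{\<tau>..\<tau>'}|lebesgue. Q (v t) * \<psi> t)))"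

text \<open>In \<open>\<rho> x t\<close> the space variable comes first.  The function \<open>v\<close> is the (weak) derivative of \<open>y\<close>;
  it occurs only under integrals over \<open>t\<close>, so the choice of representative is immaterial.\<close>

definition admissible_weak_solution ::
  "real \<Rightarrow> real \<Rightarrow> (real \<Rightarrow> real) \<Rightarrow> (real \<Rightarrow> real) \<Rightarrow> (real \<Rightarrow> real) \<Rightarrow> (real \<Rightarrow> real) \<Rightarrow>
   (real \<Rightarrow> real) \<Rightarrow> real \<Rightarrow> (real \<Rightarrow> real \<Rightarrow> real) \<Rightarrow> (real \<Rightarrow> real) \<Rightarrow> bool"
where
  "admissible_weak_solution T R f \<omega> Q \<mu> \<rho>\<^sub>o y\<^sub>o \<rho> y \<longleftrightarrow>
     (\<lambda>(x, t). \<rho> x t) \<in> borel_measurable (lebesgue_on (UNIV \<times> {0<..<T}))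
   \<and> (AE (x, t) in lebesgue_on (UNIV \<times> {0<..<T}). \<rho> x t \<in> {0..R})
   \<and> continuous_L1loc T \<rho>
   \<and> (AE x in lebesgue. \<rho> x 0 = \<rho>\<^sub>o (x + y\<^sub>o))
   \<and> (\<exists>v. W1inf_deriv T y v \<and> entropy_inequality T R f Q \<rho> v \<and> weak_constraint T f Q \<rho> v)
   \<and> (\<forall>t\<in>{0..T}. y t = y\<^sub>o + (LINT u:{0..t}|lebesgue. \<omega> (LINT x|lebesgue. \<rho> x u * \<mu> x)))"


section \<open>Numerical fluxes\<close>

definition numerical_flux :: "real \<Rightarrow> (real \<Rightarrow> real) \<Rightarrow> (real \<Rightarrow> real \<Rightarrow> real) \<Rightarrow> bool" where
  "numerical_flux R g H \<longleftrightarrow>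
     (\<exists>C. C-lipschitz_on ({0..R} \<times> {0..R}) (\<lambda>(a, b). H a b))
   \<and> (\<forall>b\<in>{0..R}. mono_on {0..R} (\<lambda>a. H a b))
   \<and> (\<forall>a\<in>{0..R}. antimono_on {0..R} (\<lambda>b. H a b))
   \<and> (\<forall>a\<in>{0..R}. H a a = g a)"

definition godunov :: "(real \<Rightarrow> real) \<Rightarrow> real \<Rightarrow> real \<Rightarrow> real" where
  "godunov g a b = (if a \<le> b then INF r\<in>{a..b}. g r else SUP r\<in>{b..a}. g r)"

definition engquist_osher :: "(real \<Rightarrow> real) \<Rightarrow> real \<Rightarrow> real \<Rightarrow> real" where
  "engquist_osher g a b = g 0 + (LINT r:{0..a}|lebesgue. max (deriv g r) 0)
                              + (LINT r:{0..b}|lebesgue. min (deriv g r) 0)"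

text \<open>The partial derivatives of a Lipschitz flux on the square exist almost everywhere, so the
  value of \<open>deriv\<close> at other points (in particular on the boundary) does not matter.\<close>

definition flux_slope :: "real \<Rightarrow> (real \<Rightarrow> real \<Rightarrow> real) \<Rightarrow> real" where
  "flux_slope R H = Linf_norm ({0..R} \<times> {0..R}) (\<lambda>(a, b). deriv (\<lambda>a'. H a' b) a)
                  + Linf_norm ({0..R} \<times> {0..R}) (\<lambda>(a, b). deriv (\<lambda>b'. H a b') b)"

definition flux_slopes ::
  "real \<Rightarrow> real \<Rightarrow> (real \<Rightarrow> real \<Rightarrow> real \<Rightarrow> real) \<Rightarrow> (real \<Rightarrow> real \<Rightarrow> real \<Rightarrow> real) \<Rightarrow> real set" where
  "flux_slopes R smax FF GG =
     (\<lambda>s. flux_slope R (FF s)) ` {0..smax} \<union> (\<lambda>s. flux_slope R (GG s)) ` {0..smax}"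


section \<open>The scheme\<close>

text \<open>Cells and cell values are indexed by \<open>j :: int\<close>: index \<open>j\<close> stands for \<open>j + 1/2\<close>, that is for
  the cell \<open>]j \<Delta>x, (j+1) \<Delta>x[\<close>.  Edges are also indexed by integers, edge \<open>j\<close> being \<open>x = j \<Delta>x\<close>.\<close>

definition cell :: "real \<Rightarrow> int \<Rightarrow> real set" where
  "cell dx j = {of_int j * dx <..< of_int (j + 1) * dx}"

definition cell_mean :: "real \<Rightarrow> (real \<Rightarrow> real) \<Rightarrow> int \<Rightarrow> real" where
  "cell_mean dx g j = (LINT x:cell dx j|lebesgue. g x) / dx"

definition edge_flux ::
  "(real \<Rightarrow> real) \<Rightarrow> (real \<Rightarrow> real \<Rightarrow> real \<Rightarrow> real) \<Rightarrow> (real \<Rightarrow> real \<Rightarrow> real \<Rightarrow> real) \<Rightarrow>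
   real \<Rightarrow> int \<Rightarrow> real \<Rightarrow> real \<Rightarrow> real" where
  "edge_flux Q FF GG s j a b = (if j = 0 then min (GG s a b) (Q s) else FF s a b)"

definition speed_of :: "(real \<Rightarrow> real) \<Rightarrow> (real \<Rightarrow> real) \<Rightarrow> real \<Rightarrow> (int \<Rightarrow> real) \<Rightarrow> real" where
  "speed_of \<omega> \<mu> dx u = \<omega> (\<Sum>\<^sub>\<infinity>j\<in>UNIV. u j * cell_mean dx \<mu> j * dx)"

definition step ::
  "(real \<Rightarrow> real) \<Rightarrow> (real \<Rightarrow> real \<Rightarrow> real \<Rightarrow> real) \<Rightarrow> (real \<Rightarrow> real \<Rightarrow> real \<Rightarrow> real) \<Rightarrow>
   real \<Rightarrow> real \<Rightarrow> (int \<Rightarrow> real) \<Rightarrow> int \<Rightarrow> real" where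
  "step Q FF GG lam s u j =
     u j - lam * (edge_flux Q FF GG s (j + 1) (u j) (u (j + 1)) - edge_flux Q FF GG s j (u (j - 1)) (u j))"

primrec scheme ::
  "(real \<Rightarrow> real) \<Rightarrow> (real \<Rightarrow> real) \<Rightarrow> (real \<Rightarrow> real) \<Rightarrow>
   (real \<Rightarrow> real \<Rightarrow> real \<Rightarrow> real) \<Rightarrow> (real \<Rightarrow> real \<Rightarrow> real \<Rightarrow> real) \<Rightarrow>
   (real \<Rightarrow> real) \<Rightarrow> real \<Rightarrow> real \<Rightarrow> real \<Rightarrow> nat \<Rightarrow> int \<Rightarrow> real" where
  "scheme \<omega> Q \<mu> FF GG \<rho>\<^sub>o y\<^sub>o lam dx 0 = cell_mean dx (\<lambda>x. \<rho>\<^sub>o (x + y\<^sub>o))"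
| "scheme \<omega> Q \<mu> FF GG \<rho>\<^sub>o y\<^sub>o lam dx (Suc n) =
     (let u = scheme \<omega> Q \<mu> FF GG \<rho>\<^sub>o y\<^sub>o lam dx n in step Q FF GG lam (speed_of \<omega> \<mu> dx u) u)"

text \<open>Throughout, the time step is \<open>lam * dx\<close>.\<close>

definition approx_density ::
  "real \<Rightarrow> (real \<Rightarrow> real) \<Rightarrow> (real \<Rightarrow> real) \<Rightarrow> (real \<Rightarrow> real) \<Rightarrow>
   (real \<Rightarrow> real \<Rightarrow> real \<Rightarrow> real) \<Rightarrow> (real \<Rightarrow> real \<Rightarrow> real \<Rightarrow> real) \<Rightarrow>
   (real \<Rightarrow> real) \<Rightarrow> real \<Rightarrow> real \<Rightarrow> real \<Rightarrow> real \<Rightarrow> real \<Rightarrow> real" where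
  "approx_density T \<omega> Q \<mu> FF GG \<rho>\<^sub>o y\<^sub>o lam dx x t =
     (let dt = lam * dx; N = nat \<lfloor>T / dt\<rfloor> in
      \<Sum>n\<le>N. \<Sum>\<^sub>\<infinity>j\<in>UNIV. scheme \<omega> Q \<mu> FF GG \<rho>\<^sub>o y\<^sub>o lam dx n j
        * indicator (cell dx j \<times> {real n * dt ..< real (n + 1) * dt}) (x, t))"

text \<open>On the \<open>n\<close>-th time interval the approximate speed is \<open>s\<^sup>n\<^sup>+\<^sup>1\<close>, computed from the \<open>n\<close>-th
  density.\<close>

definition approx_position ::
  "(real \<Rightarrow> real) \<Rightarrow> (real \<Rightarrow> real) \<Rightarrow> (real \<Rightarrow> real) \<Rightarrow>
   (real \<Rightarrow> real \<Rightarrow> real \<Rightarrow> real) \<Rightarrow> (real \<Rightarrow> real \<Rightarrow> real \<Rightarrow> real) \<Rightarrow>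
   (real \<Rightarrow> real) \<Rightarrow> real \<Rightarrow> real \<Rightarrow> real \<Rightarrow> real \<Rightarrow> real" where
  "approx_position \<omega> Q \<mu> FF GG \<rho>\<^sub>o y\<^sub>o lam dx t =
     y\<^sub>o + (LINT u:{0..t}|lebesgue.
             speed_of \<omega> \<mu> dx (scheme \<omega> Q \<mu> FF GG \<rho>\<^sub>o y\<^sub>o lam dx (nat \<lfloor>u / (lam * dx)\<rfloor>)))"

end

theory Submission
  imports Defs "HOL-Complex_Analysis.Great_Picard" "HOL-Computational_Algebra.Polynomial"
begin

text \<open>The scheme is monotone, the flux is strongly concave, and the constraint acts at one point only.
Away from that point the density can therefore jump down (from left to right) only by rarefactions,
and rarefactions spread.  Quantitatively, if \<open>D\<close> bounds the drops \<open>\<rho>\<^sub>j - \<rho>\<^sub>j\<^sub>+\<^sub>1\<close> at three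
neighbouring pairs of cells and \<open>D \<le> R\<close>, then one step of the Engquist-Osher or Godunov scheme
leaves a drop of at most \<open>D - D\<^sup>2/\<beta>\<close> with \<open>\<beta> = 4/(\<lambda>\<alpha>)\<close> (\<open>rarefaction_decay\<close>, \<open>upwind_flux_decay\<close>).  Starting
from the trivial bound and losing one cell per step to the unknown behaviour at the constraint, the
drop at step \<open>n\<close> in a cell \<open>j\<close> cells away from the constraint is at most \<open>\<beta>/(min n j + 2)\<close>
(\<open>drop_decay\<close>).  For fixed time \<open>t > 0\<close> and place \<open>x \<noteq> 0\<close> this is of the order of the mesh size, hence
a one-sided Lipschitz bound, uniform in the mesh, on every compact set that avoids \<open>t = 0\<close> and
\<open>x = 0\<close> (\<open>one_sided_Lipschitz\<close>).

This bound replaces a bound on the total variation.  Let \<open>H\<close> be the discrete primitive of the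
density: its space increments are \<open>\<Delta>x \<rho>\<^sub>j\<close> and its time increments are the fluxes through an edge.
Both are bounded, so the primitives are uniformly Lipschitz and a subsequence converges everywhere
to some \<open>P\<close>.  For each \<open>t\<close> the function \<open>P(\<cdot>,t)\<close> is nondecreasing and Lipschitz, so it is
differentiable almost everywhere; and at a point of differentiability a one-sided Lipschitz bound on
the slopes of converging functions forces the slopes to converge to the derivative
(\<open>one_sided_Lipschitz_slopes_converge\<close>).  So the densities converge almost everywhere, at each fixed
time and not merely in the plane.  The same argument along several indices at once gives continuity
of the limit in time for \<open>t > 0\<close>.  At \<open>t = 0\<close> the one-sided bound is lost; there the discrete
Kruzhkov inequality on each cell of one fixed mesh shows that the distance of the density to a step
function on that mesh grows by at most \<open>O(t)\<close> (\<open>interval_estimate\<close>, \<open>local_continuity_at_0\<close>).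

Convergence at each fixed time passes through the weighted mean, so the discrete speeds converge to
\<open>v(t) = \<omega>(\<integral>\<rho>(x,t)\<mu>(x)dx)\<close> for every \<open>t\<close>.  The entropy inequality is the limit of the discrete
Kruzhkov inequality of the monotone scheme, in which the constants fail to be steady only in the two
cells next to the constraint (\<open>step_const\<close>, \<open>step_entropy\<close>); the constraint in weak form is the limit
of the mass balance on the right of the constraint, where the incoming flux is at most \<open>Q\<close> by
construction.  Both limits are instances of \<open>weak_inequality_limit\<close>.

The CFL condition is given through norms of the almost everywhere defined partial derivatives of the
numerical fluxes, whereas the scheme needs bounds on their increments.  These follow because a
monotone Lipschitz function is the integral of its derivative (\<open>numerical_flux_increments\<close>).  This
is applied to the flux at the constraint; its slopes dominate those of the Engquist-Osher and
Godunov fluxes (\<open>GG_slopes_dominate\<close>), so a cell with two different fluxes on its two sides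
satisfies the same CFL condition.\<close>

section \<open>Monotone Lipschitz functions are integrals of their derivatives\<close>

text \<open>Averages of a locally integrable function over intervals \<open>[x, x + h]\<close> converge almost everywhere to
its value, which is the right derivative; the left one follows by reflection.  Assuming the integral
over every interval avoids a choice of base point.\<close>

lemma AE_has_derivative_of_indefinite_integral:
  fixes f P :: "real \<Rightarrow> real"
  assumes P: "\<And>a b. a \<le> b \<Longrightarrow> (f has_integral (P b - P a)) {a..b}"
  shows "AE x in lebesgue. (P has_real_derivative f x) (at x)"
proof -
  have "f integrable_on cbox a b" for a b
    using P[of a b] by (cases "a \<le> b") auto
  from integrable_ccontinuous_explicit[OF this] obtain N where N: "negligible N"
    "\<And>x e. \<lbrakk>x \<notin> N; 0 < e\<rbrakk> \<Longrightarrow> \<exists>d>0. \<forall>h. 0 < h \<and> h < d \<longrightarrow>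
        norm (integral (cbox x (x + h *\<^sub>R One)) f /\<^sub>R h ^ DIM(real) - f x) < e" by blast
  have refl: "((\<lambda>x. f (-x)) has_integral (P (-a) - P (-b))) {a..b}" if "a \<le> b" for a b
    using P[of "-b" "-a"] that has_integral_reflect_real[where a = "-b" and b = "-a" and f = f] by (metis minus_minus neg_le_iff_le)
  have "(\<lambda>x. f (-x)) integrable_on cbox a b" for a b
    using refl[of a b] by (cases "a \<le> b") auto
  from integrable_ccontinuous_explicit[OF this] obtain N' where N': "negligible N'"
    "\<And>x e. \<lbrakk>x \<notin> N'; 0 < e\<rbrakk> \<Longrightarrow> \<exists>d>0. \<forall>h. 0 < h \<and> h < d \<longrightarrow>
        norm (integral (cbox x (x + h *\<^sub>R One)) (\<lambda>x. f (-x)) /\<^sub>R h ^ DIM(real) - f (-x)) < e" by blast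
  have "negligible (uminus ` N')"
    by (rule negligible_locally_Lipschitz_image[OF _ N'(1)])
      (simp, rule exI[of _ UNIV], rule exI[of _ 1], auto simp: abs_minus_commute)
  then have ae: "AE x in lebesgue. x \<notin> N" "AE x in lebesgue. x \<notin> uminus ` N'"
    using N(1) by (auto intro!: AE_not_in simp: negligible_iff_null_sets[symmetric])
  have "(P has_real_derivative f x) (at x)" if x: "x \<notin> N" "x \<notin> uminus ` N'" for x
  proof -
    have "-x \<notin> N'" using x(2) by (metis image_eqI minus_minus)
    have "\<exists>s>0. \<forall>h. h \<noteq> 0 \<and> norm (h - 0) < s \<longrightarrow> norm ((P (x + h) - P x) / h - f x) < e"
      if e: "e > 0" for e
    proof -
      obtain d where d: "d > 0" "\<And>h. 0 < h \<Longrightarrow> h < d \<Longrightarrow>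
        norm (integral (cbox x (x + h *\<^sub>R One)) f /\<^sub>R h ^ DIM(real) - f x) < e"
        using N(2)[OF x(1) e] by blast
      obtain d' where d': "d' > 0" "\<And>h. 0 < h \<Longrightarrow> h < d' \<Longrightarrow>
        norm (integral (cbox (-x) (-x + h *\<^sub>R One)) (\<lambda>x. f (-x)) /\<^sub>R h ^ DIM(real) - f (-(-x))) < e"
        using N'(2)[OF \<open>-x \<notin> N'\<close> e] by blast
      have "norm ((P (x + h) - P x) / h - f x) < e" if "h \<noteq> 0" "norm (h - 0) < min d d'" for h
      proof (cases "h > 0")
        case True
        then have "integral {x..x+h} f = P (x+h) - P x" using P[of x "x+h"] by auto
        then show ?thesis using d(2)[of h] True that by (simp add: divide_inverse_commute)
      next
        case False
        then have "integral {-x..-x + (-h)} (\<lambda>x. f (-x)) = P x - P (x + h)"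
          using refl[of "-x" "-x + (-h)"] that by (intro integral_unique) (simp add: add.commute)
        then have "\<bar>(P x - P (x + h)) / (-h) - f x\<bar> < e"
          using d'(2)[of "-h"] False that by (simp add: divide_inverse_commute)
        moreover have "(P x - P (x + h)) / (-h) = (P (x + h) - P x) / h"
          using that by (simp add: field_simps)
        ultimately show ?thesis by simp
      qed
      then show ?thesis using d(1) d'(1) by (intro exI[of _ "min d d'"]) auto
    qed
    then show ?thesis unfolding DERIV_def LIM_eq by simp
  qed
  then show ?thesis using ae by (auto elim!: eventually_elim2 simp del: AE_all_countable)
qed

text \<open>Adding the identity makes \<open>g\<close> a strictly increasing bijection \<open>G\<close> of the line.  Pushing Lebesgue
measure forward along the inverse of \<open>G\<close> gives a measure that assigns \<open>G b - G a\<close> to an interval and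
that vanishes on null sets, because the Lipschitz function \<open>G\<close> maps null sets to null sets.  Its
Radon-Nikodym density minus 1 is the function sought.\<close>

lemma monotone_lipschitz_is_indefinite_integral:
  fixes g :: "real \<Rightarrow> real"
  assumes g: "mono g" and lip: "C-lipschitz_on UNIV g"
  obtains h where "\<And>a b. a \<le> b \<Longrightarrow> (h has_integral (g b - g a)) {a..b}"
proof -
  define G where "G x = x + g x" for x
  have C: "C \<ge> 0" using lip lipschitz_on_nonneg by blast
  have expand: "b - a \<le> G b - G a" if "a \<le> b" for a b
    using monoD[OF g that] by (simp add: G_def)
  have sm: "strict_mono G"
    by (rule strict_monoI) (use expand in \<open>smt (verit)\<close>)
  have inj: "inj G" using sm strict_mono_imp_inj_on by blast
  have Glip: "(1 + C)-lipschitz_on UNIV G"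
    unfolding G_def by (rule lipschitz_on_add) (auto intro!: lipschitz_intros lip)
  have Gcont: "continuous_on UNIV G"
    using Glip lipschitz_on_continuous_on by blast
  have surj: "\<exists>x. G x = y" for y
  proof -
    define a where "a = min 0 (y - G 0)"
    define b where "b = max 0 (y - G 0)"
    have "G a \<le> y" "y \<le> G b" "a \<le> b"
      using expand[of a 0] expand[of 0 b] by (auto simp: a_def b_def min_def max_def)
    then show ?thesis
      using IVT'[of G a y b] Gcont continuous_on_subset by blast
  qed
  define Gi where "Gi = inv G"
  have GGi: "G (Gi y) = y" for y unfolding Gi_def by (rule f_inv_into_f) (use surj in \<open>metis rangeI\<close>)
  have GiG: "Gi (G x) = x" for x unfolding Gi_def using inj by simp
  have le_iff: "G x \<le> y \<longleftrightarrow> x \<le> Gi y" for x y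
    using sm GGi by (metis strict_mono_less_eq)
  have "mono Gi" by (rule monoI) (metis GGi le_iff order_trans)
  then have Gim[measurable]: "Gi \<in> borel_measurable borel" by (rule borel_measurable_mono)
  define \<nu> where "\<nu> = distr lborel borel Gi"
  have vimage: "Gi -` A = G ` A" for A
    by (auto simp: GiG image_iff) (metis GGi)
  have ac: "absolutely_continuous lborel \<nu>"
    unfolding absolutely_continuous_def
  proof
    fix A :: "real set" assume A: "A \<in> null_sets lborel"
    then have "negligible A" by (metis completion.complete_sets_sandwich negligible_iff_null_sets null_sets_completionI)
    have "negligible (G ` A)"
    proof (rule negligible_locally_Lipschitz_image[OF _ \<open>negligible A\<close>])
      fix x assume "x \<in> A"
      show "\<exists>T B. open T \<and> x \<in> T \<and> (\<forall>y\<in>A \<inter> T. norm (G y - G x) \<le> B * norm (y - x))"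
        using Glip by (intro exI[of _ UNIV] exI[of _ "1 + C"]) (auto simp: lipschitz_on_def dist_norm)
    qed simp
    then have "emeasure lebesgue (G ` A) = 0" by (simp add: negligible_iff_null_sets null_setsD1)
    moreover have "Gi -` A \<in> sets borel" using A measurable_sets[OF Gim, of A] by auto
    ultimately have "emeasure lborel (Gi -` A) = 0" by (simp add: vimage)
    then show "A \<in> null_sets \<nu>" using A by (auto simp: null_sets_def \<nu>_def emeasure_distr)
  qed
  have "sets \<nu> = sets lborel" by (simp add: \<nu>_def)
  from sigma_finite_measure.Radon_Nikodym[OF lborel.sigma_finite_measure_axioms ac this] obtain k where
    k[measurable]: "k \<in> borel_measurable lborel" and dens: "density lborel k = \<nu>" by blast
  have kI: "(\<integral>\<^sup>+x. k x * indicator {a<..b} x \<partial>lborel) = ennreal (G b - G a)" if "a \<le> b" for a b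
  proof -
    have "emeasure \<nu> {a<..b} = emeasure lborel {G a<..G b}"
    proof -
      have "Gi -` {a<..b} = {G a<..G b}"
        using le_iff by (auto simp: not_le[symmetric]) (metis GGi sm strict_mono_less_eq)+
      then show ?thesis by (simp add: \<nu>_def emeasure_distr)
    qed
    also have "\<dots> = ennreal (G b - G a)" using expand[OF that] that by simp
    finally show ?thesis by (simp add: dens[symmetric] emeasure_density)
  qed
  have fin: "AE x in lborel. k x < \<infinity>"
  proof -
    have "AE x in lborel. x \<in> {-real n<..real n} \<longrightarrow> k x < \<infinity>" for n
    proof -
      have "(\<integral>\<^sup>+x. k x * indicator {-real n<..real n} x \<partial>lborel) \<noteq> \<infinity>"
        using kI[of "-real n" "real n"] by simp
      then have "AE x in lborel. k x * indicator {-real n<..real n} x \<noteq> \<infinity>"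
        by (intro nn_integral_PInf_AE) auto
      then show ?thesis by eventually_elim (auto simp: less_top indicator_def)
    qed
    then have "AE x in lborel. \<forall>n::nat. x \<in> {-real n<..real n} \<longrightarrow> k x < \<infinity>"
      by (subst AE_all_countable) blast
    then show ?thesis
    proof eventually_elim
      case (elim x)
      obtain n where "\<bar>x\<bar> < real n" using reals_Archimedean2 by blast
      then show ?case using elim[rule_format, of n] by (auto simp: abs_less_iff)
    qed
  qed
  \<comment> \<open>The density is finite almost everywhere, so it may be replaced by a real function.\<close>
  define kr where "kr x = enn2real (k x)" for x
  have krm[measurable]: "kr \<in> borel_measurable borel" unfolding kr_def by measurable
  have krI: "(kr has_integral (G b - G a)) {a..b}" if "a \<le> b" for a b
  proof -
    have "(\<integral>\<^sup>+x. ennreal (kr x * indicator {a<..b} x) \<partial>lborel) = ennreal (G b - G a)"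
      unfolding kI[OF that, symmetric]
      by (rule nn_integral_cong_AE, use fin in eventually_elim) (auto simp: kr_def indicator_def)
    then have "((\<lambda>x. kr x * indicator {a<..b} x) has_integral (G b - G a)) UNIV"
      using expand[OF that] that by (intro nn_integral_has_integral) (auto simp: kr_def indicator_def)
    then have "((\<lambda>x. if x \<in> {a<..b} then kr x else 0) has_integral (G b - G a)) UNIV"
      by (rule has_integral_eq[rotated]) (auto simp: indicator_def)
    then have "(kr has_integral (G b - G a)) {a<..b}"
      by (simp only: has_integral_restrict_UNIV)
    moreover have "negligible {x \<in> {a<..b} - {a..b}. kr x \<noteq> 0}"
      by (rule negligible_subset[of "{}"]) auto
    moreover have "negligible {x \<in> {a..b} - {a<..b}. kr x \<noteq> 0}"
      by (rule negligible_subset[of "{a}"]) auto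
    ultimately show ?thesis using has_integral_spike_set_eq by blast
  qed
  show ?thesis
  proof (rule that)
    fix a b :: real assume "a \<le> b"
    have "((\<lambda>_. 1::real) has_integral (b - a)) {a..b}"
      using has_integral_const_real[of "1::real" a b] \<open>a \<le> b\<close> by simp
    then have "((\<lambda>x. kr x - 1) has_integral (G b - G a - (b - a))) {a..b}"
      by (intro has_integral_diff krI[OF \<open>a \<le> b\<close>])
    then show "((\<lambda>x. kr x - 1) has_integral (g b - g a)) {a..b}" by (simp add: G_def)
  qed
qed

corollary AE_differentiable_monotone_lipschitz:
  fixes g :: "real \<Rightarrow> real"
  assumes "mono g" and "C-lipschitz_on UNIV g"
  shows "AE x in lebesgue. g differentiable (at x)"
proof -
  obtain h where h: "\<And>a b. a \<le> b \<Longrightarrow> (h has_integral (g b - g a)) {a..b}"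
    using monotone_lipschitz_is_indefinite_integral[OF assms] by blast
  have "AE x in lebesgue. (g has_real_derivative h x) (at x)"
    by (rule AE_has_derivative_of_indefinite_integral) (rule h)
  then show ?thesis
    by eventually_elim (auto simp: real_differentiable_def)
qed

text \<open>The bound on \<open>deriv g\<close> needs to hold only almost everywhere because \<open>g\<close> is the integral of its
derivative.\<close>

lemma monotone_lipschitz_increment_le:
  fixes g :: "real \<Rightarrow> real"
  assumes "mono g" and "C-lipschitz_on UNIV g"
    and "AE x in lebesgue. x \<in> {a<..<b} \<longrightarrow> deriv g x \<le> L" and "a \<le> b"
  shows "g b - g a \<le> L * (b - a)"
proof -
  obtain h where h: "\<And>a b. a \<le> b \<Longrightarrow> (h has_integral (g b - g a)) {a..b}"
    using monotone_lipschitz_is_indefinite_integral[OF assms(1,2)] by blast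
  have "AE x in lebesgue. (g has_real_derivative h x) (at x)"
    by (rule AE_has_derivative_of_indefinite_integral) (rule h)
  then have "AE x in lebesgue. x \<in> {a<..<b} \<longrightarrow> h x \<le> L"
    using assms(3)
    by eventually_elim (auto dest: DERIV_imp_deriv)
  then obtain N where N: "N \<in> null_sets lebesgue" "{x. \<not> (x \<in> {a<..<b} \<longrightarrow> h x \<le> L)} \<subseteq> N"
    by (auto simp: eventually_ae_filter)
  have "negligible (N \<union> {a,b})" using N(1) by (simp add: negligible_iff_null_sets)
  then have "((\<lambda>x. if x \<in> N \<union> {a,b} then L else h x) has_integral (g b - g a)) {a..b}"
    by (rule has_integral_spike) (use h[OF \<open>a \<le> b\<close>] in auto)
  moreover have "((\<lambda>x. L) has_integral L * (b - a)) {a..b}"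
    using has_integral_const_real[of L a b] \<open>a \<le> b\<close> by (simp add: mult.commute)
  ultimately show ?thesis
    by (rule has_integral_le) (use N(2) in force)
qed

section \<open>Slopes of a numerical flux\<close>

text \<open>The infimum in the definition of the norm is attained once some essential bound exists; without one
it would be the infimum of the empty set and bound nothing.\<close>

lemma AE_abs_le_Linf_norm:
  assumes "0 \<le> C" and "AE x in lebesgue_on A. \<bar>g x\<bar> \<le> C"
  shows "AE x in lebesgue_on A. \<bar>g x\<bar> \<le> Linf_norm A g" and "0 \<le> Linf_norm A g"
proof -
  define S where "S = {C. 0 \<le> C \<and> (AE x in lebesgue_on A. \<bar>g x\<bar> \<le> C)}"
  have S: "S \<noteq> {}" "bdd_below S" "Linf_norm A g = Inf S"
    using assms by (auto simp: S_def Linf_norm_def intro!: bdd_belowI[of _ 0])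
  show "0 \<le> Linf_norm A g"
    unfolding S(3) by (rule cInf_greatest[OF S(1)]) (auto simp: S_def)
  have "AE x in lebesgue_on A. \<bar>g x\<bar> \<le> Inf S + 1 / real (Suc n)" for n
  proof -
    have "Inf S < Inf S + 1 / real (Suc n)" by simp
    then obtain c where c: "c \<in> S" "c < Inf S + 1 / real (Suc n)"
      using cInf_less_iff[OF S(1,2)] by blast
    then have "AE x in lebesgue_on A. \<bar>g x\<bar> \<le> c" by (auto simp: S_def)
    then show ?thesis by eventually_elim (use c(2) in linarith)
  qed
  then have "AE x in lebesgue_on A. \<forall>n. \<bar>g x\<bar> \<le> Inf S + 1 / real (Suc n)"
    by (subst AE_all_countable) blast
  then show "AE x in lebesgue_on A. \<bar>g x\<bar> \<le> Linf_norm A g"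
  proof eventually_elim
    case (elim x)
    have "(\<lambda>n. Inf S + 1 / real (Suc n)) \<longlonglongrightarrow> Inf S + 0"
      by (intro tendsto_intros LIMSEQ_Suc[OF lim_1_over_n])
    then have "(\<lambda>n. Inf S + 1 / real (Suc n)) \<longlonglongrightarrow> Inf S" by simp
    then show ?case unfolding S(3) by (rule LIMSEQ_le_const) (use elim in blast)
  qed
qed

lemma AE_lborel_swap:
  fixes P :: "real \<times> real \<Rightarrow> bool"
  assumes "AE z in lborel. P z"
  shows "AE z in lborel. P (snd z, fst z)"
proof -
  have eq: "lborel = distr lborel lborel (\<lambda>(x::real, y::real). (y, x))"
    using lborel_pair.distr_pair_swap[where ?'a=real and ?'b=real] by (simp add: lborel_prod)
  have "AE z in distr lborel lborel (\<lambda>(x::real, y::real). (y, x)). P z"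
    using assms by (subst (asm) eq)
  then have "AE z in lborel. P ((\<lambda>(x::real, y::real). (y, x)) z)"
    by (rule AE_distrD[rotated]) (simp add: lborel_prod[symmetric])
  then show ?thesis by (simp add: case_prod_beta)
qed

lemma Linf_norm_swap:
  "Linf_norm (S \<times> S) (\<lambda>(a::real, b::real). G b a) = Linf_norm (S \<times> S) (\<lambda>(a, b). G a b)"
  if S: "S \<in> sets borel"
proof -
  have SS: "S \<times> S \<in> sets (borel :: (real \<times> real) measure)"
    using S by (simp add: borel_prod[symmetric])
  have "(AE z in lebesgue_on (S \<times> S). \<bar>case z of (a, b) \<Rightarrow> G b a\<bar> \<le> C) \<longleftrightarrow>
        (AE z in lebesgue_on (S \<times> S). \<bar>case z of (a, b) \<Rightarrow> G a b\<bar> \<le> C)" (is "?l \<longleftrightarrow> ?r") for C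
  proof -
    have "?l \<longleftrightarrow> (AE z in lborel. z \<in> S \<times> S \<longrightarrow> \<bar>G (snd z) (fst z)\<bar> \<le> C)"
      using SS by (subst AE_restrict_space_iff) (auto simp: AE_completion_iff case_prod_beta)
    also have "\<dots> \<longleftrightarrow> (AE z in lborel. z \<in> S \<times> S \<longrightarrow> \<bar>G (fst z) (snd z)\<bar> \<le> C)"
      by (rule iffI; drule AE_lborel_swap; simp add: mem_Times_iff conj_commute)
    also have "\<dots> \<longleftrightarrow> ?r"
      using SS by (subst AE_restrict_space_iff) (auto simp: AE_completion_iff case_prod_beta)
    finally show ?thesis .
  qed
  then show ?thesis by (simp add: Linf_norm_def)
qed

text \<open>For a continuous function it is enough to compare difference quotients at rational increments.  This
describes differentiability by countably many conditions, which makes the set of points of partial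
differentiability measurable.\<close>

lemma differentiable_iff_rational_quotients_Cauchy:
  fixes g :: "real \<Rightarrow> real"
  assumes g: "continuous_on UNIV g"
  shows "g differentiable (at y) \<longleftrightarrow> (\<forall>n::nat. \<exists>m::nat. \<forall>h\<in>\<rat>. \<forall>h'\<in>\<rat>.
     h \<noteq> 0 \<and> h' \<noteq> 0 \<and> \<bar>h\<bar> < 1 / Suc m \<and> \<bar>h'\<bar> < 1 / Suc m \<longrightarrow>
     \<bar>(g (y + h) - g y) / h - (g (y + h') - g y) / h'\<bar> \<le> 1 / Suc n)"
    (is "_ \<longleftrightarrow> (\<forall>n. \<exists>m. ?C n m)")
proof
  assume "g differentiable (at y)"
  then obtain D where "(g has_real_derivative D) (at y)" by (auto simp: real_differentiable_def)
  then have D: "\<exists>s>0. \<forall>h. h \<noteq> 0 \<and> \<bar>h\<bar> < s \<longrightarrow> \<bar>(g (y + h) - g y) / h - D\<bar> < e" if "e > 0" for e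
    using that unfolding DERIV_def LIM_eq diff_0_right real_norm_def by blast
  show "\<forall>n. \<exists>m. ?C n m"
  proof
    fix n :: nat
    obtain s where s: "s > 0" "\<And>h. h \<noteq> 0 \<Longrightarrow> \<bar>h\<bar> < s \<Longrightarrow> \<bar>(g (y + h) - g y) / h - D\<bar> < 1 / Suc n / 2"
      using D[of "1 / Suc n / 2"] by auto
    obtain m where m: "1 / Suc m < s" using s(1) nat_approx_posE by blast
    have "?C n m"
    proof (intro ballI impI)
      fix h h' :: real assume "h \<noteq> 0 \<and> h' \<noteq> 0 \<and> \<bar>h\<bar> < 1 / Suc m \<and> \<bar>h'\<bar> < 1 / Suc m"
      then have "\<bar>(g (y + h) - g y) / h - D\<bar> < 1 / Suc n / 2" "\<bar>(g (y + h') - g y) / h' - D\<bar> < 1 / Suc n / 2"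
        using s(2) m by auto
      moreover have tri: "\<bar>A - B\<bar> \<le> e" if "\<bar>A - D\<bar> < e / 2" "\<bar>B - D\<bar> < e / 2" for A B e :: real
        using that by linarith
      ultimately show "\<bar>(g (y + h) - g y) / h - (g (y + h') - g y) / h'\<bar> \<le> 1 / Suc n"
        by (intro tri)
    qed
    then show "\<exists>m. ?C n m" by blast
  qed
next
  assume C: "\<forall>n. \<exists>m. ?C n m"
  define q where "q h = (g (y + h) - g y) / h" for h
  have "isCont (\<lambda>h. g (y + h)) h" for h
    by (rule isCont_o2[where g = g]) (use g in \<open>auto simp: continuous_on_eq_continuous_at\<close>)
  then have qc: "isCont q h" if "h \<noteq> 0" for h
    unfolding q_def using that by (intro isCont_divide isCont_diff continuous_const) auto
  \<comment> \<open>Nonzero rational numbers approaching \<open>h\<close>, chosen on the same side of \<open>0\<close>.\<close>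
  have dense: "\<exists>w. (\<forall>i. w i \<in> \<rat> \<and> w i \<noteq> 0) \<and> w \<longlonglongrightarrow> h" if h: "h \<noteq> 0" for h :: real
  proof -
    have "\<exists>r\<in>\<rat>. \<bar>h\<bar> < r \<and> r < \<bar>h\<bar> + 1 / Suc i" for i
      by (rule Rats_dense_in_real) simp
    then have "\<forall>i. \<exists>r. r \<in> \<rat> \<and> \<bar>h\<bar> < r \<and> r < \<bar>h\<bar> + 1 / Suc i" by blast
    from choice[OF this] obtain w
      where w: "\<And>i. w i \<in> \<rat>" "\<And>i. \<bar>h\<bar> < w i" "\<And>i. w i < \<bar>h\<bar> + 1 / Suc i" by blast
    have lim: "(\<lambda>i. \<bar>h\<bar> + 1 / real (Suc i)) \<longlonglongrightarrow> \<bar>h\<bar> + 0"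
      by (intro tendsto_intros LIMSEQ_Suc[OF lim_1_over_n])
    have "w \<longlonglongrightarrow> \<bar>h\<bar>"
      by (rule real_tendsto_sandwich[OF _ _ tendsto_const, where h="\<lambda>i. \<bar>h\<bar> + 1 / real (Suc i)"])
        (use w lim in \<open>simp_all add: always_eventually less_imp_le\<close>)
    then have "(\<lambda>i. sgn h * w i) \<longlonglongrightarrow> sgn h * \<bar>h\<bar>" by (intro tendsto_intros)
    moreover have "sgn h * w i \<in> \<rat> \<and> sgn h * w i \<noteq> 0" for i
      using w(1,2)[of i] h by (auto simp: sgn_if Rats_minus_iff)
    ultimately show ?thesis
      by (intro exI[of _ "\<lambda>i. sgn h * w i"]) (simp only: mult_sgn_abs, simp)
  qed
  have all: "\<bar>q h - q h'\<bar> \<le> 1 / Suc n"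
    if m: "?C n m" and h: "h \<noteq> 0" "h' \<noteq> 0" "\<bar>h\<bar> < 1 / Suc m" "\<bar>h'\<bar> < 1 / Suc m" for n m h h'
  proof -
    obtain w w' where w: "\<And>i. w i \<in> \<rat>" "\<And>i. w i \<noteq> 0" "w \<longlonglongrightarrow> h"
      and w': "\<And>i. w' i \<in> \<rat>" "\<And>i. w' i \<noteq> 0" "w' \<longlonglongrightarrow> h'"
      using dense[OF h(1)] dense[OF h(2)] by blast
    have l: "(\<lambda>i. \<bar>q (w i) - q (w' i)\<bar>) \<longlonglongrightarrow> \<bar>q h - q h'\<bar>"
      by (intro tendsto_intros isCont_tendsto_compose[OF qc] w w' h)
    have "\<forall>\<^sub>F i in sequentially. \<bar>w i\<bar> < 1 / Suc m" "\<forall>\<^sub>F i in sequentially. \<bar>w' i\<bar> < 1 / Suc m"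
      using order_tendstoD(2)[OF tendsto_rabs[OF w(3)] h(3)] order_tendstoD(2)[OF tendsto_rabs[OF w'(3)] h(4)]
      by auto
    then have "\<forall>\<^sub>F i in sequentially. \<bar>q (w i) - q (w' i)\<bar> \<le> 1 / Suc n"
    proof eventually_elim
      case (elim i)
      show ?case unfolding q_def by (rule m[rule_format]) (use w(1,2) w'(1,2) elim in blast)+
    qed
    then show ?thesis by (rule tendsto_upperbound[OF l]) simp
  qed
  have "Cauchy (\<lambda>k. q (1 / Suc k))"
  proof (rule metric_CauchyI)
    fix e :: real assume "e > 0"
    then obtain n where n: "1 / Suc n < e" using nat_approx_posE by blast
    obtain m where m: "?C n m" using C by blast
    have "dist (q (1 / Suc k)) (q (1 / Suc k')) < e" if "k \<ge> Suc m" "k' \<ge> Suc m" for k k'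
    proof -
      have "\<bar>q (1 / Suc k) - q (1 / Suc k')\<bar> \<le> 1 / Suc n"
        by (rule all[OF m]) (use that in \<open>auto simp: field_simps\<close>)
      then show ?thesis using n unfolding dist_real_def by linarith
    qed
    then show "\<exists>M. \<forall>k\<ge>M. \<forall>k'\<ge>M. dist (q (1 / Suc k)) (q (1 / Suc k')) < e" by blast
  qed
  then obtain D where D: "(\<lambda>k. q (1 / Suc k)) \<longlonglongrightarrow> D" unfolding Cauchy_convergent_iff convergent_def by blast
  have "\<exists>s>0. \<forall>h. h \<noteq> 0 \<and> norm (h - 0) < s \<longrightarrow> norm (q h - D) < e" if "e > 0" for e
  proof -
    obtain n where n: "1 / Suc n < e" using \<open>e > 0\<close> nat_approx_posE by blast
    obtain m where m: "?C n m" using C by blast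
    have "\<bar>q h - D\<bar> \<le> 1 / Suc n" if h: "h \<noteq> 0" "\<bar>h\<bar> < 1 / Suc m" for h
    proof (rule tendsto_upperbound)
      show "(\<lambda>k. \<bar>q h - q (1 / Suc k)\<bar>) \<longlonglongrightarrow> \<bar>q h - D\<bar>" by (intro tendsto_intros D)
      show "\<forall>\<^sub>F k in sequentially. \<bar>q h - q (1 / Suc k)\<bar> \<le> 1 / Suc n"
        using eventually_ge_at_top[of "Suc m"]
        by eventually_elim (rule all[OF m]; use h in \<open>simp add: field_simps\<close>)
    qed simp
    then have "\<forall>h. h \<noteq> 0 \<and> norm (h - 0) < 1 / Suc m \<longrightarrow> norm (q h - D) < e"
      using n unfolding diff_0_right real_norm_def by (blast intro: le_less_trans)
    then show ?thesis by (intro exI[of _ "1 / Suc m"]) simp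
  qed
  then have "(g has_real_derivative D) (at y)" unfolding DERIV_def LIM_eq q_def by blast
  then show "g differentiable (at y)" by (auto simp: real_differentiable_def)
qed

text \<open>On every line \<open>x = const\<close> differentiability holds almost everywhere; Fubini's theorem combines the
lines, since the exceptional set is measurable.\<close>

lemma AE_partial_differentiable:
  fixes K :: "real \<Rightarrow> real \<Rightarrow> real"
  assumes K: "continuous_on UNIV (\<lambda>(x, y). K x y)"
    and mono: "\<And>x. mono (K x)" and lip: "\<And>x. C-lipschitz_on UNIV (K x)"
  shows "AE z in lborel. K (fst z) differentiable (at (snd z))"
proof -
  have m[measurable]: "(\<lambda>z. K (fst z) (snd z)) \<in> borel_measurable (borel \<Otimes>\<^sub>M borel)"
    using borel_measurable_continuous_onI[OF K] by (simp add: borel_prod case_prod_beta')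
  have mh[measurable]: "(\<lambda>z. K (fst z) (snd z + h)) \<in> borel_measurable (borel \<Otimes>\<^sub>M borel)" for h
    using measurable_compose[OF _ m, of "\<lambda>z. (fst z, snd z + h)" "borel \<Otimes>\<^sub>M borel"] by simp
  have Kx: "continuous_on UNIV (K x)" for x
    using lip lipschitz_on_continuous_on by blast
  have "AE z in (lborel \<Otimes>\<^sub>M lborel :: (real \<times> real) measure). K (fst z) differentiable (at (snd z))"
    unfolding differentiable_iff_rational_quotients_Cauchy[OF Kx]
  proof (rule lborel_pair.AE_pair_measure)
    let ?P = "\<lambda>z. \<forall>n::nat. \<exists>m::nat. \<forall>h\<in>\<rat>. \<forall>h'\<in>\<rat>.
     h \<noteq> 0 \<and> h' \<noteq> 0 \<and> \<bar>h\<bar> < 1 / Suc m \<and> \<bar>h'\<bar> < 1 / Suc m \<longrightarrow>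
     \<bar>(K (fst z) (snd z + h) - K (fst z) (snd z)) / h - (K (fst z) (snd z + h') - K (fst z) (snd z)) / h'\<bar> \<le> 1 / Suc n"
    have [measurable]: "Measurable.pred (borel \<Otimes>\<^sub>M borel) (\<lambda>z. \<forall>h\<in>\<rat>. \<forall>h'\<in>\<rat>.
     h \<noteq> 0 \<and> h' \<noteq> 0 \<and> \<bar>h\<bar> < 1 / Suc m \<and> \<bar>h'\<bar> < 1 / Suc m \<longrightarrow>
     \<bar>(K (fst z) (snd z + h) - K (fst z) (snd z)) / h - (K (fst z) (snd z + h') - K (fst z) (snd z)) / h'\<bar> \<le> 1 / Suc n)" for m n
      unfolding Rats_def ball_simps(9) by measurable
    have "Measurable.pred (borel \<Otimes>\<^sub>M borel) ?P" by (intro pred_intros_countable) measurable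
    then have "Measurable.pred (lborel \<Otimes>\<^sub>M lborel) ?P"
      by (subst measurable_cong_sets[OF sets_pair_measure_cong refl]) auto
    then show "{z \<in> space (lborel \<Otimes>\<^sub>M lborel). ?P z} \<in> sets (lborel \<Otimes>\<^sub>M lborel)"
      by (rule predE)
    have "AE y in lborel. K x differentiable (at y)" for x
      using AE_differentiable_monotone_lipschitz[OF mono lip] by (simp add: AE_completion_iff)
    then show "AE x in lborel. AE y in lborel. ?P (x, y)"
      unfolding fst_conv snd_conv differentiable_iff_rational_quotients_Cauchy[OF Kx, symmetric] by simp
  qed
  then show ?thesis by (subst (asm) lborel_prod)
qed

lemma continuous_le_of_AE_le:
  fixes h :: "real \<Rightarrow> real"
  assumes h: "continuous_on UNIV h" and ae: "AE x in lebesgue. x \<in> {a<..<b} \<longrightarrow> h x \<le> c"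
    and x: "x \<in> {a..b}" and "a < b"
  shows "h x \<le> c"
proof (rule ccontr)
  assume "\<not> h x \<le> c"
  have "isCont h x" using h by (simp add: continuous_on_eq_continuous_at)
  then have "(h \<longlongrightarrow> h x) (nhds x)" by (simp add: isCont_def tendsto_at_iff_tendsto_nhds)
  then have "\<forall>\<^sub>F y in nhds x. c < h y" by (rule order_tendstoD(1)) (use \<open>\<not> h x \<le> c\<close> in simp)
  then obtain d where d: "d > 0" "\<And>y. dist y x < d \<Longrightarrow> c < h y" by (auto simp: eventually_nhds_metric)
  define u where "u = max a (x - d)"
  define v where "v = min b (x + d)"
  have uv: "u < v" using x \<open>a < b\<close> d(1) by (auto simp: u_def v_def)
  obtain N where N: "N \<in> null_sets lebesgue" "{x. \<not> (x \<in> {a<..<b} \<longrightarrow> h x \<le> c)} \<subseteq> N"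
    using ae by (auto simp: eventually_ae_filter)
  have "box u v \<subseteq> N"
  proof
    fix y assume "y \<in> box u v"
    then have "y \<in> {a<..<b}" "dist y x < d" by (auto simp: u_def v_def dist_real_def)
    then show "y \<in> N" using d(2)[of y] N(2) by auto
  qed
  then have "negligible (box u v)"
    using N(1) negligible_iff_null_sets negligible_subset by blast
  then have "box u v = {}" by (simp only: negligible_interval)
  then show False using uv by simp
qed

lemma AE_lborel_off_lines:
  "AE z in (lborel :: (real \<times> real) measure). fst z \<noteq> c \<and> snd z \<noteq> d"
proof -
  have "AE z in (lborel \<Otimes>\<^sub>M lborel :: (real \<times> real) measure). fst z \<noteq> c \<and> snd z \<noteq> d"
  proof (rule lborel_pair.AE_pair_measure)
    show "{z \<in> space (lborel \<Otimes>\<^sub>M lborel). fst z \<noteq> c \<and> snd z \<noteq> d} \<in> sets (lborel \<Otimes>\<^sub>M lborel)"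
      by measurable
    show "AE x in lborel. AE y in lborel. fst (x, y) \<noteq> c \<and> snd (x, y) \<noteq> d"
      using AE_lborel_singleton[of c] AE_lborel_singleton[of d] by (auto elim!: eventually_mono)
  qed
  then show ?thesis by (subst (asm) lborel_prod)
qed

text \<open>The sign \<open>\<sigma>\<close> treats nondecreasing and nonincreasing dependence at once.  On almost every line the
increment is the integral of the partial derivative and hence at most \<open>L\<close> times the length; the
remaining lines follow by continuity.  At points where the partial derivative does not exist
\<open>deriv\<close> has an arbitrary value, which does not affect \<open>L\<close> because these points form a null set.\<close>

lemma partial_increment_le_Linf_norm:
  fixes K :: "real \<Rightarrow> real \<Rightarrow> real"
  assumes R: "R > 0" and K: "C-lipschitz_on ({0..R} \<times> {0..R}) (\<lambda>(x, y). K x y)"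
    and \<sigma>: "\<sigma> = 1 \<or> \<sigma> = -1"
    and mono: "\<And>x. x \<in> {0..R} \<Longrightarrow> mono_on {0..R} (\<lambda>y. \<sigma> * K x y)"
  defines "L \<equiv> Linf_norm ({0..R} \<times> {0..R}) (\<lambda>(x, y). deriv (K x) y)"
  shows "0 \<le> L" and "\<And>x y y'. x \<in> {0..R} \<Longrightarrow> 0 \<le> y \<Longrightarrow> y \<le> y' \<Longrightarrow> y' \<le> R \<Longrightarrow>
            \<sigma> * (K x y' - K x y) \<le> L * (y' - y)"
proof -
  \<comment> \<open>Clamping both variables extends the function to the plane and keeps it monotone and Lipschitz.\<close>
  define c where "c x = max 0 (min R x)" for x
  have c: "c x \<in> {0..R}" "x \<in> {0..R} \<Longrightarrow> c x = x" for x using R by (auto simp: c_def)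
  have c_lip: "\<bar>c x - c y\<bar> \<le> \<bar>x - y\<bar>" for x y by (auto simp: c_def)
  have c_mono: "x \<le> y \<Longrightarrow> c x \<le> c y" for x y by (auto simp: c_def)
  define E where "E x y = \<sigma> * K (c x) (c y)" for x y
  have C: "C \<ge> 0" using K lipschitz_on_nonneg by blast
  have E_mono: "mono (E x)" for x
    unfolding E_def by (rule monoI, rule mono_onD[OF mono[OF c(1)]]) (use c(1) c_mono in auto)
  have E_lip: "C-lipschitz_on UNIV (E x)" for x
  proof (rule lipschitz_onI)
    fix y y' :: real
    have "dist (E x y) (E x y') = dist (K (c x) (c y)) (K (c x) (c y'))"
      using \<sigma> by (auto simp: E_def dist_real_def)
    also have "\<dots> \<le> C * dist (c x, c y) (c x, c y')"
      using lipschitz_onD[OF K, of "(c x, c y)" "(c x, c y')"] c(1) by simp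
    also have "\<dots> \<le> C * dist y y'"
      using C c_lip[of y y'] by (intro mult_left_mono) (auto simp: dist_Pair_Pair dist_real_def)
    finally show "dist (E x y) (E x y') \<le> C * dist y y'" .
  qed (rule C)
  have E_cont: "continuous_on UNIV (\<lambda>(x, y). E x y)"
  proof -
    have "continuous_on ({0..R} \<times> {0..R}) (\<lambda>(x, y). K x y)"
      using K lipschitz_on_continuous_on by blast
    moreover have "continuous_on UNIV (\<lambda>z. (c (fst z), c (snd z)))"
      unfolding c_def by (intro continuous_intros)
    ultimately have "continuous_on UNIV (\<lambda>z. case (c (fst z), c (snd z)) of (x, y) \<Rightarrow> K x y)"
      by (rule continuous_on_compose2) (use c(1) in auto)
    then have "continuous_on UNIV (\<lambda>z. \<sigma> * K (c (fst z)) (c (snd z)))"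
      by (intro continuous_intros) simp
    then show ?thesis by (simp add: E_def case_prod_beta')
  qed
  have diff: "AE z in lborel. E (fst z) differentiable (at (snd z))"
    by (rule AE_partial_differentiable[OF E_cont E_mono E_lip])
  \<comment> \<open>In the open square the extension is \<open>\<sigma> K\<close>, so the two derivatives agree up to sign.\<close>
  have deriv_E: "deriv (E x) y = \<sigma> * deriv (K x) y \<and> \<bar>deriv (K x) y\<bar> \<le> C"
    if "x \<in> {0<..<R}" "y \<in> {0<..<R}" and d: "E x differentiable (at y)" for x y
  proof -
    obtain D where D: "(E x has_real_derivative D) (at y)" using d by (auto simp: real_differentiable_def)
    have "((\<lambda>y. \<sigma> * E x y) has_real_derivative \<sigma> * D) (at y)" by (rule DERIV_cmult[OF D])
    moreover have "\<forall>\<^sub>F w in nhds y. \<sigma> * E x w = K x w"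
    proof -
      have "\<forall>\<^sub>F w in nhds y. w \<in> {0<..<R}" using that(2) by (intro eventually_nhds_in_open) auto
      then show ?thesis
        by eventually_elim (use that(1) c(2) \<sigma> in \<open>auto simp: E_def\<close>)
    qed
    ultimately have "(K x has_real_derivative \<sigma> * D) (at y)"
      using DERIV_cong_ev[OF refl, of "\<lambda>y. \<sigma> * E x y" "K x" y "\<sigma> * D" "\<sigma> * D"] by simp
    moreover have "\<bar>D\<bar> \<le> C"
    proof (rule tendsto_upperbound)
      show "((\<lambda>h. \<bar>(E x (y + h) - E x y) / h\<bar>) \<longlongrightarrow> \<bar>D\<bar>) (at 0)"
        using D unfolding DERIV_def by (rule tendsto_rabs)
      have "\<bar>(E x (y + h) - E x y) / h\<bar> \<le> C" if "h \<noteq> 0" for h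
        using lipschitz_onD[OF E_lip, of "y + h" y x] that by (auto simp: dist_real_def field_simps)
      then show "\<forall>\<^sub>F h in at 0. \<bar>(E x (y + h) - E x y) / h\<bar> \<le> C"
        by (auto simp: eventually_at_filter)
    qed simp
    ultimately show ?thesis using D \<sigma> by (auto simp: DERIV_imp_deriv)
  qed
  let ?S = "{0..R} \<times> {0..R}"
  have S: "?S \<in> sets borel" by (simp add: borel_prod[symmetric])
  have lebesgue_on_iff: "(AE z in lebesgue_on ?S. P z) \<longleftrightarrow> (AE z in lborel. z \<in> ?S \<longrightarrow> P z)" for P
    using S by (subst AE_restrict_space_iff) (auto simp: AE_completion_iff)
  have "AE z in lebesgue_on ?S. \<bar>case z of (x, y) \<Rightarrow> deriv (K x) y\<bar> \<le> C"
    unfolding lebesgue_on_iff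
    using diff AE_lborel_off_lines[of 0 0] AE_lborel_off_lines[of R R]
  proof eventually_elim
    case (elim z)
    show ?case
    proof
      assume "z \<in> ?S"
      then have "fst z \<in> {0<..<R}" "snd z \<in> {0<..<R}" using elim(2,3) by (auto simp: mem_Times_iff)
      from deriv_E[OF this elim(1)] show "\<bar>case z of (x, y) \<Rightarrow> deriv (K x) y\<bar> \<le> C"
        by (simp add: case_prod_beta)
    qed
  qed
  from AE_abs_le_Linf_norm[OF C this]
  have L: "0 \<le> L" "AE z in lebesgue_on ?S. \<bar>case z of (x, y) \<Rightarrow> deriv (K x) y\<bar> \<le> L"
    unfolding L_def by blast+
  show "0 \<le> L" by fact
  have "AE z in lborel. fst z \<in> {0<..<R} \<and> snd z \<in> {0<..<R} \<longrightarrow> deriv (E (fst z)) (snd z) \<le> L"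
    using L(2)[unfolded lebesgue_on_iff] diff
  proof eventually_elim
    case (elim z)
    show ?case
    proof
      assume z: "fst z \<in> {0<..<R} \<and> snd z \<in> {0<..<R}"
      then have "\<bar>deriv (K (fst z)) (snd z)\<bar> \<le> L" using elim(1) by (auto simp: mem_Times_iff case_prod_beta)
      then show "deriv (E (fst z)) (snd z) \<le> L"
        using deriv_E[OF _ _ elim(2)] z \<sigma> by auto
    qed
  qed
  then have "AE z in lborel \<Otimes>\<^sub>M lborel. fst z \<in> {0<..<R} \<and> snd z \<in> {0<..<R} \<longrightarrow> deriv (E (fst z)) (snd z) \<le> L"
    by (subst lborel_prod)
  from lborel_pair.AE_pair[OF this]
  have ae: "AE x in lborel. AE y in lborel. x \<in> {0<..<R} \<and> y \<in> {0<..<R} \<longrightarrow> deriv (E x) y \<le> L" by simp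
  show "\<sigma> * (K x y' - K x y) \<le> L * (y' - y)"
    if "x \<in> {0..R}" "0 \<le> y" "y \<le> y'" "y' \<le> R" for x y y'
  proof -
    have "E x y' - E x y \<le> L * (y' - y)"
    proof (rule continuous_le_of_AE_le[where h="\<lambda>x. E x y' - E x y"])
      have "continuous_on UNIV ((\<lambda>(x, y). E x y) \<circ> (\<lambda>x. (x, y)))" for y
        by (intro continuous_on_compose continuous_intros continuous_on_subset[OF E_cont]) auto
      then show "continuous_on UNIV (\<lambda>x. E x y' - E x y)"
        by (intro continuous_on_diff) (auto simp: o_def)
      have "AE x in lborel. x \<in> {0<..<R} \<longrightarrow> E x y' - E x y \<le> L * (y' - y)"
        using ae
      proof eventually_elim
        case (elim x)
        show ?case
        proof
          assume "x \<in> {0<..<R}"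
          then have "AE w in lebesgue. w \<in> {y<..<y'} \<longrightarrow> deriv (E x) w \<le> L"
            using elim that unfolding AE_completion_iff by (auto elim!: eventually_mono)
          from monotone_lipschitz_increment_le[OF E_mono E_lip this that(3)]
          show "E x y' - E x y \<le> L * (y' - y)" .
        qed
      qed
      then show "AE x in lebesgue. x \<in> {0<..<R} \<longrightarrow> E x y' - E x y \<le> L * (y' - y)"
        by (simp add: AE_completion_iff)
    qed (use that R in auto)
    then show ?thesis using that c(2) by (simp add: E_def right_diff_distrib)
  qed
qed

text \<open>The form in which a CFL condition is used: \<open>flux_slope\<close> splits into Lipschitz constants for the two
variables.  The first variable is treated by exchanging the two.\<close>

lemma numerical_flux_increments:
  assumes "R > 0" and H: "numerical_flux R g H"
  obtains L1 L2 where "0 \<le> L1" "0 \<le> L2" "flux_slope R H = L1 + L2"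
    "\<And>a a' b. \<lbrakk>0 \<le> a; a \<le> a'; a' \<le> R; 0 \<le> b; b \<le> R\<rbrakk> \<Longrightarrow> H a' b - H a b \<le> L1 * (a' - a)"
    "\<And>a b b'. \<lbrakk>0 \<le> b; b \<le> b'; b' \<le> R; 0 \<le> a; a \<le> R\<rbrakk> \<Longrightarrow> H a b - H a b' \<le> L2 * (b' - b)"
proof -
  from H obtain C where C: "C-lipschitz_on ({0..R} \<times> {0..R}) (\<lambda>(a, b). H a b)"
    and mono: "\<forall>b\<in>{0..R}. mono_on {0..R} (\<lambda>a. H a b)" "\<forall>a\<in>{0..R}. antimono_on {0..R} (\<lambda>b. H a b)"
    by (auto simp: numerical_flux_def)
  have C': "C-lipschitz_on ({0..R} \<times> {0..R}) (\<lambda>(x, y). H y x)"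
  proof (rule lipschitz_onI)
    fix z w assume "z \<in> {0..R} \<times> {0..R}" "w \<in> {0..R} \<times> {0..R}"
    then have "dist (H (snd z) (fst z)) (H (snd w) (fst w)) \<le> C * dist (snd z, fst z) (snd w, fst w)"
      using lipschitz_onD[OF C, of "(snd z, fst z)" "(snd w, fst w)"] by auto
    also have "dist (snd z, fst z) (snd w, fst w) = dist z w"
      by (cases z; cases w) (simp add: dist_Pair_Pair add.commute)
    finally show "dist (case z of (x, y) \<Rightarrow> H y x) (case w of (x, y) \<Rightarrow> H y x) \<le> C * dist z w"
      by (simp add: case_prod_beta)
  qed (use C lipschitz_on_nonneg in blast)
  define L1 where "L1 = Linf_norm ({0..R} \<times> {0..R}) (\<lambda>(x, y). deriv (\<lambda>a'. H a' x) y)"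
  define L2 where "L2 = Linf_norm ({0..R} \<times> {0..R}) (\<lambda>(x, y). deriv (\<lambda>b'. H x b') y)"
  note 1 = partial_increment_le_Linf_norm[OF \<open>R > 0\<close> C', of 1, folded L1_def]
  note 2 = partial_increment_le_Linf_norm[OF \<open>R > 0\<close> C, of "-1", folded L2_def]
  have anti: "mono_on {0..R} (\<lambda>y. - 1 * H x y)" if "x \<in> {0..R}" for x
    using mono(2)[rule_format, OF that] by (auto simp: monotone_on_def)
  show ?thesis
  proof (rule that[of L1 L2])
    show "0 \<le> L1" "0 \<le> L2" using 1(1) 2(1) mono(1) anti by auto
    have "L1 = Linf_norm ({0..R} \<times> {0..R}) (\<lambda>(a, b). deriv (\<lambda>a'. H a' b) a)"
      unfolding L1_def by (rule Linf_norm_swap) simp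
    then show "flux_slope R H = L1 + L2" by (simp add: flux_slope_def L2_def)
  qed (use 1(2) 2(2) mono(1) anti in auto)
qed

section \<open>Strongly concave fluxes and the spreading of rarefactions\<close>

text \<open>A flux \<open>F\<close> with derivative \<open>g\<close> that decreases at rate at least \<open>\<alpha>\<close>, and with its maximum at the
interior point \<open>p\<close>.\<close>

locale strongly_concave_flux =
  fixes F g :: "real \<Rightarrow> real" and R \<alpha> p :: real
  assumes R: "R > 0" and \<alpha>: "\<alpha> > 0" and p: "0 < p" "p < R"
    and deriv: "\<And>r. r \<in> {0..R} \<Longrightarrow> (F has_real_derivative g r) (at r within {0..R})"
    and slope: "\<And>x y. 0 \<le> x \<Longrightarrow> x \<le> y \<Longrightarrow> y \<le> R \<Longrightarrow> g y \<le> g x - \<alpha> * (y - x)"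
    and critical: "g p = 0"
begin

text \<open>Compare with the parabola touching at \<open>a\<close>: the difference has a derivative that changes sign at \<open>a\<close>
from nonnegative to nonpositive.\<close>

lemma below_parabola:
  assumes "x \<in> {0..R}" "a \<in> {0..R}"
  shows "F x \<le> F a + g a * (x - a) - \<alpha> / 2 * (x - a)\<^sup>2"
proof -
  define h where "h x = F x - F a - g a * (x - a) + \<alpha> / 2 * (x - a)\<^sup>2" for x
  define h' where "h' x = g x - g a + \<alpha> * (x - a)" for x
  have h': "(h has_real_derivative h' r) (at r within S)" if "r \<in> S" "S \<subseteq> {0..R}" for r S
    unfolding h_def h'_def
    by (rule derivative_eq_intros DERIV_subset[OF deriv] refl | use that in force)+
  have "h x \<le> h a"
  proof (cases x a rule: linorder_cases)
    case less
    have "\<exists>z\<in>{x<..<a}. h a - h x = h' z * (a - x)"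
      by (rule mvt_simple[OF less]) (use h'[of _ "{x..a}"] assms in \<open>auto simp: has_field_derivative_def\<close>)
    then obtain z where z: "z \<in> {x<..<a}" "h a - h x = h' z * (a - x)" by blast
    have "h' z \<ge> 0" using slope[of z a] z(1) assms by (auto simp: h'_def algebra_simps)
    then have "h' z * (a - x) \<ge> 0" using less by simp
    then show ?thesis using z(2) by simp
  next
    case greater
    have "\<exists>z\<in>{a<..<x}. h x - h a = h' z * (x - a)"
      by (rule mvt_simple[OF greater]) (use h'[of _ "{a..x}"] assms in \<open>auto simp: has_field_derivative_def\<close>)
    then obtain z where z: "z \<in> {a<..<x}" "h x - h a = h' z * (x - a)" by blast
    have "h' z \<le> 0" using slope[of a z] z(1) assms by (auto simp: h'_def algebra_simps)
    then have "h' z * (x - a) \<le> 0" using greater by (simp add: mult_nonpos_nonneg)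
    then show ?thesis using z(2) by simp
  qed simp
  then show ?thesis by (simp add: h_def)
qed

lemma tangent: "x \<in> {0..R} \<Longrightarrow> a \<in> {0..R} \<Longrightarrow> F x \<le> F a + g a * (x - a)"
  using below_parabola[of x a] \<alpha> by (smt (verit) zero_le_power2 mult_nonneg_nonneg divide_nonneg_nonneg)

lemma g_antimono: "0 \<le> x \<Longrightarrow> x \<le> y \<Longrightarrow> y \<le> R \<Longrightarrow> g y \<le> g x"
  using slope[of x y] \<alpha> by (smt (verit) mult_nonneg_nonneg)

lemma g_below: "0 \<le> x \<Longrightarrow> x \<le> p \<Longrightarrow> g x \<ge> \<alpha> * (p - x)"
  using slope[of x p] critical p by simp

lemma g_above: "p \<le> x \<Longrightarrow> x \<le> R \<Longrightarrow> g x \<le> - \<alpha> * (x - p)"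
  using slope[of p x] critical p by simp

lemma g_total: "\<alpha> * R \<le> g 0 - g R"
  using slope[of 0 R] R by simp

text \<open>The flux as a sum of a nondecreasing and a nonincreasing part.  Information in the first travels to
the right, in the second to the left.\<close>

definition rising :: "real \<Rightarrow> real" where "rising a = F (min a p)"
definition falling :: "real \<Rightarrow> real" where "falling b = F (max b p) - F p"

lemma g_nonneg: "0 \<le> x \<Longrightarrow> x \<le> p \<Longrightarrow> 0 \<le> g x"
  using g_antimono[of x p] critical p by simp

lemma g_nonpos: "p \<le> x \<Longrightarrow> x \<le> R \<Longrightarrow> g x \<le> 0"
  using g_antimono[of p x] critical p by simp

lemma F_increasing: "0 \<le> x \<Longrightarrow> x \<le> y \<Longrightarrow> y \<le> p \<Longrightarrow> F x \<le> F y"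
  using tangent[of x y] g_nonneg[of y] p mult_nonneg_nonneg[of "g y" "y - x"]
  by (simp add: algebra_simps)

lemma F_decreasing: "p \<le> x \<Longrightarrow> x \<le> y \<Longrightarrow> y \<le> R \<Longrightarrow> F y \<le> F x"
  using tangent[of y x] g_nonpos[of x] p mult_nonneg_nonneg[of "- g x" "y - x"]
  by (simp add: algebra_simps)

lemma F_le_max: "0 \<le> x \<Longrightarrow> x \<le> R \<Longrightarrow> F x \<le> F p"
  using tangent[of x p] critical p by simp

lemma split: "rising a + falling a = F a"
  by (simp add: rising_def falling_def min_def max_def)

lemma rising_increment:
  assumes "0 \<le> x" "x \<le> y" "y \<le> R"
  shows "0 \<le> rising y - rising x" "rising y - rising x \<le> g 0 * (y - x)"
proof -
  show "0 \<le> rising y - rising x"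
    unfolding rising_def using F_increasing[of "min x p" "min y p"] assms p by auto
  have "rising y - rising x \<le> g (min x p) * (min y p - min x p)"
    unfolding rising_def using tangent[of "min y p" "min x p"] assms p by (simp add: min_le_iff_disj)
  also have "\<dots> \<le> g 0 * (y - x)"
    by (rule mult_mono) (use g_antimono[of 0 "min x p"] g_nonneg[of 0] assms p in auto)
  finally show "rising y - rising x \<le> g 0 * (y - x)" .
qed

lemma falling_increment:
  assumes "0 \<le> x" "x \<le> y" "y \<le> R"
  shows "0 \<le> falling x - falling y" "falling x - falling y \<le> - g R * (y - x)"
proof -
  show "0 \<le> falling x - falling y"
    unfolding falling_def using F_decreasing[of "max x p" "max y p"] assms p by auto
  have "falling x - falling y \<le> - g (max y p) * (max y p - max x p)"
    unfolding falling_def using tangent[of "max x p" "max y p"] assms p by (simp add: le_max_iff_disj algebra_simps)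
  also have "\<dots> \<le> - g R * (y - x)"
    by (rule mult_mono) (use g_antimono[of "max y p" R] g_nonpos[of R] assms p in auto)
  finally show "falling x - falling y \<le> - g R * (y - x)" .
qed

text \<open>The rising part can gain only up to the maximum point \<open>p\<close>; \<open>m\<close> is the part of the
increment \<open>x - a\<close> that lies below \<open>p\<close>.\<close>

lemma rising_gain:
  assumes "0 \<le> a" "a \<le> p" "0 \<le> x" "x \<le> R" "x \<le> a + M" "0 \<le> M"
  obtains m where "0 \<le> m" "m \<le> M" "m \<le> p - a" "rising x - rising a \<le> g a * m - \<alpha> / 2 * m\<^sup>2"
proof (cases "x \<le> a")
  case True
  show ?thesis
    by (rule that[of 0]) (use True assms rising_increment(1)[of x a] p in auto)
next
  case False
  show ?thesis
    using below_parabola[of "min x p" a] assms p False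
    by (intro that[of "min x p - a"]) (auto simp: rising_def min_absorb1 min_le_iff_disj)
qed

lemma falling_gain:
  assumes "p \<le> b" "b \<le> R" "0 \<le> y" "y \<le> R" "b - M \<le> y" "0 \<le> M"
  obtains m where "0 \<le> m" "m \<le> M" "m \<le> b - p" "falling y - falling b \<le> - g b * m - \<alpha> / 2 * m\<^sup>2"
proof (cases "b \<le> y")
  case True
  show ?thesis
    by (rule that[of 0]) (use True assms falling_increment(1)[of b y] p in auto)
next
  case False
  show ?thesis
    using below_parabola[of "max y p" b] assms p False
    by (intro that[of "b - max y p"])
      (auto simp: falling_def max_absorb1 power2_commute le_max_iff_disj right_diff_distrib)
qed

lemma falling_nonpos: "0 \<le> y \<Longrightarrow> y \<le> R \<Longrightarrow> falling y \<le> 0"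
  unfolding falling_def using F_le_max[of "max y p"] p by simp

lemma rising_le_max: "0 \<le> y \<Longrightarrow> y \<le> R \<Longrightarrow> rising y \<le> F p"
  unfolding rising_def using F_le_max[of "min y p"] p by simp

text \<open>The estimate behind \<open>rarefaction_decay\<close> on a monotone branch of the flux, in dimensionless form:
\<open>A\<close> is \<open>\<lambda>\<alpha>\<close>, \<open>w\<close> the Courant number at the slower of the two states, \<open>d\<close> the present drop and \<open>m\<close>
the drop at the upwind neighbour.  The terms in \<open>w\<close> are \<open>w (m - d)\<close>: for \<open>m > d\<close> the CFL condition
bounds \<open>w\<close> above by \<open>1 - A d\<close>, for \<open>m \<le> d\<close> concavity bounds it below by \<open>A m\<close>.\<close>

lemma gain_polynomial:
  fixes A w d m M :: real
  assumes "0 \<le> A" "A * m \<le> w" "w + A * d \<le> 1" "A * M \<le> 1" "0 \<le> d" "d \<le> M" "0 \<le> m" "m \<le> M"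
  shows "d - w * d - A * d\<^sup>2 / 2 + w * m - A * m\<^sup>2 / 2 \<le> M - A * M\<^sup>2 / 2"
proof (cases "m \<le> d")
  case True
  have "A * m * (d - m) \<le> w * (d - m)" using assms True by (intro mult_right_mono) auto
  moreover have "A * M * (M - d) \<le> 1 * (M - d)" using assms by (intro mult_right_mono) auto
  moreover have "0 \<le> A * (2 * (m * (d - m)) + m\<^sup>2 + (M - d)\<^sup>2)" using assms True by auto
  ultimately show ?thesis by (simp add: power2_eq_square algebra_simps)
next
  case False
  have "w * (m - d) \<le> (1 - A * d) * (m - d)" using assms False by (intro mult_right_mono) auto
  moreover have "A * M * (M - m) \<le> 1 * (M - m)" using assms by (intro mult_right_mono) auto
  moreover have "0 \<le> A * (2 * (d * (m - d)) + d\<^sup>2 + (M - m)\<^sup>2)" using assms False by auto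
  ultimately show ?thesis by (simp add: power2_eq_square algebra_simps)
qed

lemma loss_polynomial:
  fixes q m M :: real
  assumes "0 \<le> m" "m \<le> M" "m \<le> q"
  shows "M * min q M / 2 \<le> q * (M - m) + m\<^sup>2 / 2"
proof (cases "q \<le> M")
  case True
  have "q * (M - q) \<ge> 0" using assms True by auto
  moreover have "(q - m)\<^sup>2 \<ge> 0" by simp
  ultimately show ?thesis using True by (simp add: power2_eq_square algebra_simps)
next
  case False
  have "M * (M - m) \<le> q * (M - m)" using assms False by (intro mult_right_mono) auto
  moreover have "(M - m)\<^sup>2 \<ge> 0" by simp
  ultimately show ?thesis using False by (simp add: power2_eq_square algebra_simps)
qed

text \<open>The left side is the drop between two neighbouring cells with values \<open>a\<close>, \<open>b\<close> after one
Engquist-Osher step, where \<open>x\<close> and \<open>y\<close> are the values left of \<open>a\<close> and right of \<open>b\<close>.  There are four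
cases.  If \<open>a \<le> b\<close>, there is no drop yet and the CFL condition limits what can flow in; since \<open>M \<le> R\<close>,
the distances of \<open>p\<close> from \<open>0\<close> and \<open>R\<close> add up to at least \<open>M\<close>, and strong concavity loses a square
over them (\<open>loss_polynomial\<close>).  If \<open>b < a\<close> on one branch of the flux, the drop is spread by the difference of
the speeds and fed by one neighbour only (\<open>gain_polynomial\<close>).  If \<open>b < p < a\<close>, the drop straddles the
maximum: neither neighbour can contribute more than the maximal flux \<open>F(p)\<close>, and \<open>F(a)\<close> and \<open>F(b)\<close>
lie below it by the squares of \<open>a - p\<close> and \<open>p - b\<close>.  This last case is the worst and gives the factor \<open>1/4\<close>.\<close>

lemma rarefaction_decay:
  assumes box: "{x, a, b, y} \<subseteq> {0..R}"
    and M: "x - a \<le> M" "a - b \<le> M" "b - y \<le> M" "0 \<le> M" "M \<le> R"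
    and lam: "lam > 0" and CFL: "lam * (g 0 - g R) \<le> 1"
  shows "(a - b) + lam * (rising x - 2 * rising a + rising b)
     + lam * (falling a - 2 * falling b + falling y) \<le> M - lam * \<alpha> / 4 * M\<^sup>2" (is "?E \<le> _")
proof -
  define A where "A = lam * \<alpha>"
  have A: "A > 0" using lam \<alpha> by (simp add: A_def)
  have "lam * (\<alpha> * R) \<le> lam * (g 0 - g R)" using lam by (intro mult_left_mono g_total) auto
  then have "A * R \<le> 1" using CFL by (simp add: A_def mult.assoc)
  then have AM: "A * M \<le> 1" using mult_left_mono[OF M(5), of A] A by linarith
  have AM2: "A * M\<^sup>2 \<ge> 0" using A by simp
  have box': "0 \<le> x" "x \<le> R" "0 \<le> a" "a \<le> R" "0 \<le> b" "b \<le> R" "0 \<le> y" "y \<le> R" using box by auto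
  consider "a \<le> b" | "b < a" "a \<le> p" | "b < a" "p \<le> b" | "b < p" "p < a" by linarith
  then have "?E \<le> M - A * M\<^sup>2 / 4"
  proof cases
    case 1
    have "(rising b - rising a) + (falling a - falling b) \<le> (g 0 - g R) * (b - a)"
      using rising_increment(2)[of a b] falling_increment(2)[of a b] 1 box' by (simp add: algebra_simps)
    then have "lam * ((rising b - rising a) + (falling a - falling b)) \<le> lam * ((g 0 - g R) * (b - a))"
      using lam by (intro mult_left_mono) auto
    also have "\<dots> \<le> 1 * (b - a)"
      using CFL 1 unfolding mult.assoc[symmetric] by (intro mult_right_mono) auto
    finally have E: "?E \<le> lam * ((rising x - rising a) + (falling y - falling b))"
      by (simp add: algebra_simps)
    obtain m where m: "0 \<le> m" "m \<le> M" "m \<le> p" "rising x - rising a \<le> g 0 * m - \<alpha> / 2 * m\<^sup>2"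
    proof (cases "a \<le> p")
      case True
      obtain m where "0 \<le> m" "m \<le> M" "m \<le> p - a" "rising x - rising a \<le> g a * m - \<alpha> / 2 * m\<^sup>2"
        using rising_gain[of a x M] True box' M by auto
      moreover have "g a * m \<le> g 0 * m"
        using g_antimono[of 0 a] box' \<open>0 \<le> m\<close> by (intro mult_right_mono) auto
      ultimately show ?thesis using box' by (intro that[of m]) auto
    next
      case False
      then have "rising x \<le> rising a" using rising_le_max[of x] box' by (simp add: rising_def[of a])
      then show ?thesis using p M by (intro that[of 0]) auto
    qed
    obtain n where n: "0 \<le> n" "n \<le> M" "n \<le> R - p" "falling y - falling b \<le> - g R * n - \<alpha> / 2 * n\<^sup>2"
    proof (cases "p \<le> b")
      case True
      obtain n where "0 \<le> n" "n \<le> M" "n \<le> b - p" "falling y - falling b \<le> - g b * n - \<alpha> / 2 * n\<^sup>2"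
        using falling_gain[of b y M] True box' M by auto
      moreover have "- g b * n \<le> - g R * n"
        using g_antimono[of b R] box' \<open>0 \<le> n\<close> by (intro mult_right_mono) auto
      ultimately show ?thesis using box' by (intro that[of n]) auto
    next
      case False
      then have "falling y \<le> falling b" using falling_nonpos[of y] box' by (simp add: falling_def[of b])
      then show ?thesis using p M by (intro that[of 0]) auto
    qed
    have "\<alpha> * p * (M - m) \<le> g 0 * (M - m)"
      using g_below[of 0] p m by (intro mult_right_mono) auto
    moreover have "\<alpha> * (R - p) * (M - n) \<le> - g R * (M - n)"
      using g_above[of R] p n by (intro mult_right_mono) auto
    moreover have "\<alpha> * (M * min p M / 2) \<le> \<alpha> * (p * (M - m) + m\<^sup>2 / 2)"
      using loss_polynomial[of m M p] m \<alpha> by (intro mult_left_mono) auto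
    moreover have "\<alpha> * (M * min (R - p) M / 2) \<le> \<alpha> * ((R - p) * (M - n) + n\<^sup>2 / 2)"
      using loss_polynomial[of n M "R - p"] n \<alpha> by (intro mult_left_mono) auto
    moreover have "\<alpha> * (M * M / 2) \<le> \<alpha> * (M * min p M / 2) + \<alpha> * (M * min (R - p) M / 2)"
    proof -
      have "M * M \<le> M * (min p M + min (R - p) M)" using M p by (intro mult_left_mono) auto
      then have "\<alpha> * (M * M) \<le> \<alpha> * (M * (min p M + min (R - p) M))" by (rule mult_left_mono) (use \<alpha> in simp)
      then show ?thesis by (simp add: algebra_simps)
    qed
    ultimately have "(rising x - rising a) + (falling y - falling b) \<le> (g 0 - g R) * M - \<alpha> * (M * M / 2)"
      using m(4) n(4) by (simp add: algebra_simps)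
    then have "lam * ((rising x - rising a) + (falling y - falling b)) \<le> lam * ((g 0 - g R) * M - \<alpha> * (M * M / 2))"
      using lam by (intro mult_left_mono) auto
    also have "\<dots> \<le> M - A * M\<^sup>2 / 2"
      using mult_right_mono[OF CFL M(4)] by (simp add: A_def power2_eq_square algebra_simps)
    finally show ?thesis using E AM2 by linarith
  next
    case 2
    obtain m where m: "0 \<le> m" "m \<le> M" "m \<le> p - a" "rising x - rising a \<le> g a * m - \<alpha> / 2 * m\<^sup>2"
      using rising_gain[of a x M] 2 box' M by auto
    define d where "d = a - b"
    have "rising b - rising a = F b - F a" using 2 by (simp add: rising_def)
    also have "\<dots> \<le> - g a * d - \<alpha> / 2 * d\<^sup>2"
      using below_parabola[of b a] box' by (simp add: d_def power2_commute algebra_simps)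
    finally have "rising x - 2 * rising a + rising b \<le> g a * m - \<alpha> / 2 * m\<^sup>2 - g a * d - \<alpha> / 2 * d\<^sup>2"
      using m(4) by simp
    then have "lam * (rising x - 2 * rising a + rising b) \<le> lam * (g a * m - \<alpha> / 2 * m\<^sup>2 - g a * d - \<alpha> / 2 * d\<^sup>2)"
      using lam by (intro mult_left_mono) auto
    moreover have "lam * (falling a - 2 * falling b + falling y) \<le> 0"
      using 2 falling_nonpos[of y] box' lam by (intro mult_nonneg_nonpos) (auto simp: falling_def)
    ultimately have "?E \<le> d - (lam * g a) * d - A * d\<^sup>2 / 2 + (lam * g a) * m - A * m\<^sup>2 / 2"
      by (simp add: A_def d_def algebra_simps)
    also have "\<dots> \<le> M - A * M\<^sup>2 / 2"
    proof (rule gain_polynomial)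
      have "\<alpha> * m \<le> \<alpha> * (p - a)" using m \<alpha> by (intro mult_left_mono) auto
      then have "\<alpha> * m \<le> g a" using g_below[of a] 2 box' by linarith
      then show "A * m \<le> lam * g a" using lam by (simp add: A_def)
      have "g a + \<alpha> * d \<le> g 0 - g R"
        using slope[of b a] g_antimono[of 0 b] g_nonpos[of R] 2 p box' by (simp add: d_def)
      then have "lam * (g a + \<alpha> * d) \<le> lam * (g 0 - g R)" using lam by (intro mult_left_mono) auto
      then show "lam * g a + A * d \<le> 1" using CFL by (simp add: A_def algebra_simps)
    qed (use A AM 2 m M in \<open>auto simp: d_def\<close>)
    finally show ?thesis using AM2 by linarith
  next
    case 3
    obtain m where m: "0 \<le> m" "m \<le> M" "m \<le> b - p" "falling y - falling b \<le> - g b * m - \<alpha> / 2 * m\<^sup>2"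
      using falling_gain[of b y M] 3 box' M by auto
    define d where "d = a - b"
    have "falling a - falling b = F a - F b" using 3 by (simp add: falling_def)
    also have "\<dots> \<le> g b * d - \<alpha> / 2 * d\<^sup>2"
      using below_parabola[of a b] box' by (simp add: d_def)
    finally have "falling a - 2 * falling b + falling y \<le> - g b * m - \<alpha> / 2 * m\<^sup>2 + g b * d - \<alpha> / 2 * d\<^sup>2"
      using m(4) by simp
    then have "lam * (falling a - 2 * falling b + falling y) \<le> lam * (- g b * m - \<alpha> / 2 * m\<^sup>2 + g b * d - \<alpha> / 2 * d\<^sup>2)"
      using lam by (intro mult_left_mono) auto
    moreover have "lam * (rising x - 2 * rising a + rising b) \<le> 0"
      using 3 rising_le_max[of x] box' lam by (intro mult_nonneg_nonpos) (auto simp: rising_def)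
    ultimately have "?E \<le> d - (lam * (- g b)) * d - A * d\<^sup>2 / 2 + (lam * (- g b)) * m - A * m\<^sup>2 / 2"
      by (simp add: A_def d_def algebra_simps)
    also have "\<dots> \<le> M - A * M\<^sup>2 / 2"
    proof (rule gain_polynomial)
      have "\<alpha> * m \<le> \<alpha> * (b - p)" using m \<alpha> by (intro mult_left_mono) auto
      then have "\<alpha> * m \<le> - g b" using g_above[of b] 3 box' by linarith
      then have "lam * (\<alpha> * m) \<le> lam * (- g b)" using lam by (intro mult_left_mono) auto
      then show "A * m \<le> lam * (- g b)" by (simp add: A_def)
      have "- g b + \<alpha> * d \<le> g 0 - g R"
        using slope[of b a] g_antimono[of a R] g_nonneg[of 0] 3 p box' by (simp add: d_def)
      then have "lam * (- g b + \<alpha> * d) \<le> lam * (g 0 - g R)" using lam by (intro mult_left_mono) auto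
      then show "lam * (- g b) + A * d \<le> 1" using CFL by (simp add: A_def algebra_simps)
    qed (use A AM 3 m M in \<open>auto simp: d_def\<close>)
    finally show ?thesis using AM2 by linarith
  next
    case 4
    define d where "d = a - b"
    have "rising x - 2 * rising a + rising b \<le> F b - F p"
      using 4 rising_le_max[of x] box' by (simp add: rising_def)
    moreover have "falling a - 2 * falling b + falling y \<le> F a - F p"
      using 4 falling_nonpos[of y] box' by (simp add: falling_def)
    moreover have "F b - F p \<le> - \<alpha> / 2 * (p - b)\<^sup>2" "F a - F p \<le> - \<alpha> / 2 * (a - p)\<^sup>2"
      using below_parabola[of b p] below_parabola[of a p] critical p box' by (auto simp: power2_commute)
    moreover have "\<alpha> / 4 * d\<^sup>2 \<le> \<alpha> / 2 * (p - b)\<^sup>2 + \<alpha> / 2 * (a - p)\<^sup>2"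
    proof -
      have "0 \<le> \<alpha> / 4 * ((p - b) - (a - p))\<^sup>2" using \<alpha> by simp
      then show ?thesis by (simp add: d_def power2_eq_square algebra_simps)
    qed
    ultimately have "(rising x - 2 * rising a + rising b) + (falling a - 2 * falling b + falling y) \<le> - \<alpha> / 4 * d\<^sup>2"
      by simp
    then have "lam * ((rising x - 2 * rising a + rising b) + (falling a - 2 * falling b + falling y)) \<le> lam * (- \<alpha> / 4 * d\<^sup>2)"
      using lam by (intro mult_left_mono) auto
    then have "?E \<le> d - A * d\<^sup>2 / 4"
      by (simp add: A_def d_def algebra_simps)
    also have "\<dots> \<le> M - A * M\<^sup>2 / 4"
    proof -
      have "d \<le> M" "0 \<le> d" using M 4 by (auto simp: d_def)
      have "A * (M + d) \<le> 4" using AM mult_left_mono[OF \<open>d \<le> M\<close>, of A] A unfolding distrib_left by linarith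
      then have "A * (M + d) * (M - d) \<le> 4 * (M - d)" using \<open>d \<le> M\<close> by (intro mult_right_mono) auto
      then show ?thesis by (simp add: power2_eq_square algebra_simps)
    qed
    finally show ?thesis .
  qed
  then show ?thesis by (simp add: A_def)
qed

text \<open>What the Engquist-Osher and Godunov fluxes have in common.  They agree with the split flux
\<open>rising a + falling b\<close> when \<open>b \<le> a\<close>, that is in rarefactions, and can exceed it only in compressions;
their slopes are bounded by the largest characteristic speeds \<open>F'(0)\<close> and \<open>- F'(R)\<close>.\<close>

definition upwind_flux :: "(real \<Rightarrow> real \<Rightarrow> real) \<Rightarrow> bool" where
  "upwind_flux H \<longleftrightarrow> (\<forall>a\<in>{0..R}. \<forall>b\<in>{0..R}.
      H a a = F a \<and> rising a + falling b \<le> H a b \<and> (b \<le> a \<longrightarrow> H a b = rising a + falling b)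
      \<and> (\<forall>c\<in>{a..R}. 0 \<le> H c b - H a b \<and> H c b - H a b \<le> g 0 * (c - a))
      \<and> (\<forall>c\<in>{b..R}. 0 \<le> H a b - H a c \<and> H a b - H a c \<le> - g R * (c - b)))"

lemma upwind_flux_rising_plus_falling:
  "(\<And>a b. a \<in> {0..R} \<Longrightarrow> b \<in> {0..R} \<Longrightarrow> H a b = rising a + falling b) \<Longrightarrow> upwind_flux H"
  unfolding upwind_flux_def using split rising_increment falling_increment by auto

lemma upwind_flux_demand_supply:
  assumes "\<And>a b. a \<in> {0..R} \<Longrightarrow> b \<in> {0..R} \<Longrightarrow> H a b = min (rising a) (F p + falling b)"
  shows "upwind_flux H"
  unfolding upwind_flux_def
proof (intro ballI conjI impI)
  fix a b assume ab: "a \<in> {0..R}" "b \<in> {0..R}"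
  have max: "rising a \<le> F p" "falling b \<le> 0" using rising_le_max falling_nonpos ab by auto
  show "H a a = F a"
    using assms[OF ab(1) ab(1)] F_le_max[of a] ab by (auto simp: rising_def falling_def min_def max_def)
  show "rising a + falling b \<le> H a b" using assms[OF ab] max by simp
  show "H a b = rising a + falling b" if "b \<le> a"
    using assms[OF ab] that F_le_max[of a] F_le_max[of b] ab
    by (auto simp: rising_def falling_def min_def max_def)
  fix c
  show "0 \<le> H c b - H a b" "H c b - H a b \<le> g 0 * (c - a)" if "c \<in> {a..R}"
    using rising_increment[of a c] assms[of c b] assms[of a b] ab that by auto
  show "0 \<le> H a b - H a c" "H a b - H a c \<le> - g R * (c - b)" if "c \<in> {b..R}"
    using falling_increment[of b c] assms[of a c] assms[of a b] ab that by auto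
qed

text \<open>On a bell-shaped flux the Godunov flux is the minimum of what the left cell can send (its demand
\<open>rising a\<close>) and what the right cell can take (its supply \<open>F p + falling b\<close>).\<close>

lemma godunov_demand_supply:
  assumes "a \<in> {0..R}" "b \<in> {0..R}"
  shows "godunov F a b = min (rising a) (F p + falling b)"
proof (cases "a \<le> b")
  case True
  define z where "z = (if F a \<le> F b then a else b)"
  have "(INF r\<in>{a..b}. F r) = F z"
  proof (rule cInf_eq_minimum)
    show "F z \<in> F ` {a..b}" using True by (auto simp: z_def)
    fix w assume "w \<in> F ` {a..b}"
    then obtain r where r: "r \<in> {a..b}" "w = F r" by auto
    have "F a \<le> F r \<or> F b \<le> F r"
      using F_increasing[of a r] F_decreasing[of r b] r assms by (cases "r \<le> p") auto
    then show "F z \<le> w" using r by (auto simp: z_def)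
  qed
  then show ?thesis
    using True assms F_increasing[of a b] F_decreasing[of a b] F_le_max[of a] F_le_max[of b]
    by (auto simp: godunov_def z_def rising_def falling_def min_def max_def)
next
  case False
  define z where "z = (if p \<le> b then b else if a \<le> p then a else p)"
  have "(SUP r\<in>{b..a}. F r) = F z"
  proof (rule cSup_eq_maximum)
    show "F z \<in> F ` {b..a}" using False by (auto simp: z_def)
    fix w assume "w \<in> F ` {b..a}"
    then obtain r where r: "r \<in> {b..a}" "w = F r" by auto
    then show "w \<le> F z"
      using F_increasing[of r a] F_decreasing[of b r] F_le_max[of r] assms by (auto simp: z_def)
  qed
  then show ?thesis
    using False assms F_le_max[of a] F_le_max[of b]
    by (auto simp: godunov_def z_def rising_def falling_def min_def max_def)
qed

lemma deriv_interior:
  assumes "0 < r" "r < R"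
  shows "(F has_real_derivative g r) (at r)"
proof -
  have "(F has_real_derivative g r) (at r within {0<..<R})"
    by (rule DERIV_subset[OF deriv]) (use assms in auto)
  then show ?thesis using at_within_open[of r "{0<..<R}"] assms by simp
qed

lemma F_continuous: "continuous_on {0..R} F"
  using deriv by (meson DERIV_continuous continuous_on_eq_continuous_within)

text \<open>The positive part of \<open>F'\<close> is \<open>F'\<close> left of \<open>p\<close> and \<open>0\<close> right of \<open>p\<close>, which is the derivative of
\<open>rising\<close> except at \<open>p\<close>.\<close>

lemma integral_positive_slope:
  assumes a: "a \<in> {0..R}"
  shows "(LINT r:{0..a}|lebesgue. max (deriv F r) 0) = rising a - rising 0"
proof -
  have "((\<lambda>r. max (deriv F r) 0) has_integral (rising a - rising 0)) {0..a}"
  proof (rule fundamental_theorem_of_calculus_interior_strong[of "{p}"])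
    show "continuous_on {0..a} rising"
      unfolding rising_def
      by (rule continuous_on_compose2[OF F_continuous]) (use a p in \<open>auto intro!: continuous_intros\<close>)
    fix x assume x: "x \<in> {0<..<a} - {p}"
    have d: "deriv F x = g x" using deriv_interior[of x] x a by (auto intro: DERIV_imp_deriv)
    show "(rising has_vector_derivative max (deriv F x) 0) (at x)"
    proof (cases "x < p")
      case True
      have "\<forall>\<^sub>F r in nhds x. r \<in> {..<p}" using True by (intro eventually_nhds_in_open) auto
      then have "\<forall>\<^sub>F r in nhds x. F r = rising r" by eventually_elim (auto simp: rising_def)
      then have "(rising has_real_derivative g x) (at x)"
        using deriv_interior[of x] x a DERIV_cong_ev[OF refl, of F rising x "g x" "g x"] by auto
      then show ?thesis using d g_nonneg[of x] x True
        by (simp add: has_real_derivative_iff_has_vector_derivative)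
    next
      case False
      have "\<forall>\<^sub>F r in nhds x. r \<in> {p<..}" using False x by (intro eventually_nhds_in_open) auto
      then have "\<forall>\<^sub>F r in nhds x. F p = rising r" by eventually_elim (auto simp: rising_def)
      then have "(rising has_real_derivative 0) (at x)"
        using DERIV_cong_ev[OF refl, of "\<lambda>_. F p" rising x 0 0] by auto
      then show ?thesis using d g_nonpos[of x] x a False
        by (simp add: has_real_derivative_iff_has_vector_derivative)
    qed
  qed (use a in auto)
  moreover from this have "(\<lambda>r. max (deriv F r) 0) absolutely_integrable_on {0..a}"
    by (intro nonnegative_absolutely_integrable_1) auto
  ultimately show ?thesis
    by (simp add: set_lebesgue_integral_eq_integral(2) integral_unique)
qed

lemma integral_negative_slope:
  assumes b: "b \<in> {0..R}"
  shows "(LINT r:{0..b}|lebesgue. min (deriv F r) 0) = falling b - falling 0"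
proof -
  have "((\<lambda>r. min (deriv F r) 0) has_integral (falling b - falling 0)) {0..b}"
  proof (rule fundamental_theorem_of_calculus_interior_strong[of "{p}"])
    show "continuous_on {0..b} falling"
      unfolding falling_def
      by (intro continuous_intros continuous_on_compose2[OF F_continuous]) (use b p in auto)
    fix x assume x: "x \<in> {0<..<b} - {p}"
    have d: "deriv F x = g x" using deriv_interior[of x] x b by (auto intro: DERIV_imp_deriv)
    show "(falling has_vector_derivative min (deriv F x) 0) (at x)"
    proof (cases "x < p")
      case True
      have "\<forall>\<^sub>F r in nhds x. r \<in> {..<p}" using True by (intro eventually_nhds_in_open) auto
      then have "\<forall>\<^sub>F r in nhds x. 0 = falling r" by eventually_elim (auto simp: falling_def)
      then have "(falling has_real_derivative 0) (at x)"
        using DERIV_cong_ev[OF refl, of "\<lambda>_. 0" falling x 0 0] by auto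
      then show ?thesis using d g_nonneg[of x] x True
        by (simp add: has_real_derivative_iff_has_vector_derivative)
    next
      case False
      have "\<forall>\<^sub>F r in nhds x. r \<in> {p<..}" using False x by (intro eventually_nhds_in_open) auto
      then have ev: "\<forall>\<^sub>F r in nhds x. F r - F p = falling r" by eventually_elim (auto simp: falling_def)
      have "((\<lambda>r. F r - F p) has_real_derivative g x) (at x)"
        using deriv_interior[of x] x b by (auto intro!: derivative_eq_intros)
      then have "(falling has_real_derivative g x) (at x)"
        using DERIV_cong_ev[OF refl ev, of "g x" "g x"] by auto
      then show ?thesis using d g_nonpos[of x] x b False
        by (simp add: has_real_derivative_iff_has_vector_derivative)
    qed
  qed (use b in auto)
  note J = this
  then have I: "((\<lambda>r. - min (deriv F r) 0) has_integral - (falling b - falling 0)) {0..b}"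
    by (rule has_integral_neg)
  then have A: "(\<lambda>r. - min (deriv F r) 0) absolutely_integrable_on {0..b}"
    by (intro nonnegative_absolutely_integrable_1) auto
  show ?thesis
    using set_integral_uminus[OF A] integral_unique[OF J] A by (simp add: set_lebesgue_integral_eq_integral(2))
qed

lemma engquist_osher_rising_plus_falling:
  assumes "a \<in> {0..R}" "b \<in> {0..R}"
  shows "engquist_osher F a b = rising a + falling b"
  using split[of 0] integral_positive_slope[OF assms(1)] integral_negative_slope[OF assms(2)]
  by (simp add: engquist_osher_def)

text \<open>Raising \<open>x\<close> to at least \<open>a\<close> and lowering \<open>y\<close> to at most \<open>b\<close> increases the drop and turns the outer
pairs into rarefactions, where the flux splits.  The inner flux \<open>H a b\<close> enters with a negative sign,
so its lower bound by the split flux suffices.\<close>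

lemma upwind_flux_decay:
  assumes H: "upwind_flux H"
    and box: "{x, a, b, y} \<subseteq> {0..R}"
    and M: "x - a \<le> M" "a - b \<le> M" "b - y \<le> M" "0 \<le> M" "M \<le> R"
    and lam: "lam > 0" and CFL: "lam * (g 0 - g R) \<le> 1"
  shows "(a - lam * (H a b - H x a)) - (b - lam * (H b y - H a b)) \<le> M - lam * \<alpha> / 4 * M\<^sup>2"
proof -
  define x' where "x' = max x a"
  define y' where "y' = min y b"
  have H1: "\<And>a b. a \<in> {0..R} \<Longrightarrow> b \<in> {0..R} \<Longrightarrow> rising a + falling b \<le> H a b"
    "\<And>a b. a \<in> {0..R} \<Longrightarrow> b \<in> {0..R} \<Longrightarrow> b \<le> a \<Longrightarrow> H a b = rising a + falling b"
    "\<And>a b c. a \<in> {0..R} \<Longrightarrow> b \<in> {0..R} \<Longrightarrow> c \<in> {a..R} \<Longrightarrow> H a b \<le> H c b"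
    "\<And>a b c. a \<in> {0..R} \<Longrightarrow> b \<in> {0..R} \<Longrightarrow> c \<in> {b..R} \<Longrightarrow> H a c \<le> H a b"
    using H unfolding upwind_flux_def by fastforce+
  have "H x a \<le> H x' a" using H1(3)[of x a x'] box by (auto simp: x'_def)
  also have "\<dots> = rising x' + falling a" using box by (intro H1(2)) (auto simp: x'_def)
  finally have 1: "H x a \<le> rising x' + falling a" .
  have "H b y \<le> H b y'" using H1(4)[of b y' y] box by (auto simp: y'_def)
  also have "\<dots> = rising b + falling y'" using box by (intro H1(2)) (auto simp: y'_def)
  finally have 2: "H b y \<le> rising b + falling y'" .
  have 3: "rising a + falling b \<le> H a b" using box by (intro H1(1)) auto
  have "lam * (H x a - 2 * H a b + H b y)
      \<le> lam * ((rising x' - 2 * rising a + rising b) + (falling a - 2 * falling b + falling y'))"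
    using 1 2 3 lam by (intro mult_left_mono) auto
  then have "(a - lam * (H a b - H x a)) - (b - lam * (H b y - H a b)) \<le>
     (a - b) + lam * (rising x' - 2 * rising a + rising b) + lam * (falling a - 2 * falling b + falling y')"
    by (simp add: algebra_simps)
  also have "\<dots> \<le> M - lam * \<alpha> / 4 * M\<^sup>2"
    by (rule rarefaction_decay[OF _ _ M(2) _ M(4,5) lam CFL]) (use box M in \<open>auto simp: x'_def y'_def\<close>)
  finally show ?thesis .
qed

end

section \<open>Monotonicity of the scheme and the discrete entropy inequality\<close>

lemma floor_measurable_fun [measurable]:
  fixes c :: "int \<Rightarrow> real"
  shows "(\<lambda>x::real. c \<lfloor>x / d\<rfloor>) \<in> borel_measurable borel"
  by (rule measurable_compose[of _ _ "count_space UNIV"]) measurable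

lemma mem_cell_iff_floor:
  assumes "dx > 0"
  shows "x \<in> cell dx j \<longleftrightarrow> \<lfloor>x / dx\<rfloor> = j \<and> x \<noteq> of_int j * dx"
proof -
  have "\<lfloor>x / dx\<rfloor> = j \<longleftrightarrow> of_int j * dx \<le> x \<and> x < of_int (j + 1) * dx"
    using assms by (auto simp: floor_eq_iff le_divide_eq divide_less_eq)
  then show ?thesis by (auto simp: cell_def)
qed

text \<open>The discrete weighted mean is an integral of the piecewise constant density against \<open>\<mu>\<close> itself, with
no discretisation error: the cell means of \<open>\<mu>\<close> are exact for functions that are constant on cells.\<close>

lemma infsum_cells_eq_integral:
  fixes c :: "int \<Rightarrow> real" and \<mu> :: "real \<Rightarrow> real"
  assumes dx: "dx > 0" and c: "\<And>j. 0 \<le> c j" "\<And>j. c j \<le> C"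
    and \<mu>: "integrable lebesgue \<mu>" "AE x in lebesgue. 0 \<le> \<mu> x"
  shows "integrable lebesgue (\<lambda>x. c \<lfloor>x / dx\<rfloor> * \<mu> x)"
    and "(\<Sum>\<^sub>\<infinity>j\<in>UNIV. c j * cell_mean dx \<mu> j * dx) = (LINT x|lebesgue. c \<lfloor>x / dx\<rfloor> * \<mu> x)"
proof -
  have m: "(\<lambda>x. c \<lfloor>x / dx\<rfloor>) \<in> borel_measurable lebesgue"
    by (rule measurable_completion) measurable
  show I: "integrable lebesgue (\<lambda>x. c \<lfloor>x / dx\<rfloor> * \<mu> x)"
  proof (rule Bochner_Integration.integrable_bound)
    show "integrable lebesgue (\<lambda>x. C * \<mu> x)" using \<mu> by simp
    show "AE x in lebesgue. norm (c \<lfloor>x / dx\<rfloor> * \<mu> x) \<le> norm (C * \<mu> x)"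
      using c by (intro always_eventually allI) (auto simp: abs_mult intro!: mult_right_mono order_trans[OF c(2)])
  qed (use m \<mu> in measurable)
  have cell: "x \<in> cell dx j \<Longrightarrow> \<lfloor>x / dx\<rfloor> = j" for x j
    using mem_cell_iff_floor[OF dx] by blast
  have cell': "x \<in> cell dx j" if "\<lfloor>x / dx\<rfloor> = j" "x \<noteq> of_int j * dx" for x j
    using mem_cell_iff_floor[OF dx] that by blast
  define F where "F j x = indicator (cell dx j) x * (c \<lfloor>x / dx\<rfloor> * \<mu> x)" for j x
  have Fint: "integrable lebesgue (F j)" for j
    unfolding F_def using integrable_mult_indicator[OF _ I, of "cell dx j"] by (simp add: cell_def)
  have Fval: "(LINT x|lebesgue. F j x) = c j * cell_mean dx \<mu> j * dx" for j
  proof -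
    have "(LINT x|lebesgue. F j x) = (LINT x|lebesgue. c j * (indicator (cell dx j) x * \<mu> x))"
      by (rule Bochner_Integration.integral_cong) (auto simp: F_def indicator_def dest: cell)
    then show ?thesis using dx by (simp add: cell_mean_def set_lebesgue_integral_def)
  qed
  define f where "f i = F (int_decode i)" for i
  have at_most_one: "finite {i. f i x \<noteq> 0}" for x
  proof -
    have "{i. f i x \<noteq> 0} \<subseteq> {int_encode \<lfloor>x / dx\<rfloor>}"
      using cell by (auto simp: f_def F_def indicator_def split: if_splits)
    then show ?thesis by (rule finite_subset) simp
  qed
  have sum_le: "(\<Sum>i<n. norm (f i x)) \<le> norm (c \<lfloor>x / dx\<rfloor> * \<mu> x)" for n x
  proof -
    let ?i = "int_encode \<lfloor>x / dx\<rfloor>"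
    have "(\<Sum>i<n. norm (f i x)) = (\<Sum>i\<in>{..<n} \<inter> {?i}. norm (f i x))"
      using cell by (intro sum.mono_neutral_right) (auto simp: f_def F_def indicator_def split: if_splits)
    also have "\<dots> \<le> norm (c \<lfloor>x / dx\<rfloor> * \<mu> x)"
      by (cases "?i < n") (auto simp: f_def F_def indicator_def)
    finally show ?thesis .
  qed
  have "(\<lambda>i. LINT x|lebesgue. f i x) sums (LINT x|lebesgue. (\<Sum>i. f i x))"
  proof (rule sums_integral)
    show "integrable lebesgue (f i)" for i using Fint by (simp add: f_def)
    show "AE x in lebesgue. summable (\<lambda>i. norm (f i x))"
      by (intro always_eventually allI summable_finite[OF at_most_one]) simp
    show "summable (\<lambda>i. LINT x|lebesgue. norm (f i x))"
    proof (rule summableI_nonneg_bounded)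
      fix n
      have "(\<Sum>i<n. LINT x|lebesgue. norm (f i x)) = (LINT x|lebesgue. (\<Sum>i<n. norm (f i x)))"
        using Fint by (simp add: f_def)
      also have "\<dots> \<le> (LINT x|lebesgue. norm (c \<lfloor>x / dx\<rfloor> * \<mu> x))"
        using sum_le I Fint by (intro integral_mono) (auto simp: f_def)
      finally show "(\<Sum>i<n. LINT x|lebesgue. norm (f i x)) \<le> (LINT x|lebesgue. norm (c \<lfloor>x / dx\<rfloor> * \<mu> x))" .
    qed simp
  qed
  also have "(LINT x|lebesgue. (\<Sum>i. f i x)) = (LINT x|lebesgue. c \<lfloor>x / dx\<rfloor> * \<mu> x)"
  proof (rule integral_cong_AE)
    have "countable (range (\<lambda>j::int. of_int j * dx))" by simp
    then have "AE x in lebesgue. x \<notin> range (\<lambda>j::int. of_int j * dx)"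
      by (intro AE_not_in) (simp add: countable_imp_null_set_lborel null_sets_completionI)
    then show "AE x in lebesgue. (\<Sum>i. f i x) = c \<lfloor>x / dx\<rfloor> * \<mu> x"
    proof eventually_elim
      case (elim x)
      let ?i = "int_encode \<lfloor>x / dx\<rfloor>"
      have "(\<Sum>i. f i x) = (\<Sum>i\<in>{?i}. f i x)"
        using cell by (intro suminf_finite) (auto simp: f_def F_def indicator_def split: if_splits)
      also have "\<dots> = c \<lfloor>x / dx\<rfloor> * \<mu> x"
      proof -
        have "x \<in> cell dx \<lfloor>x / dx\<rfloor>" using elim by (intro cell'[OF refl]) blast
        then show ?thesis by (simp add: f_def F_def)
      qed
      finally show ?case .
    qed
    show "(\<lambda>x. \<Sum>i. f i x) \<in> borel_measurable lebesgue"
      by (intro borel_measurable_suminf borel_measurable_integrable) (simp add: f_def Fint)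
  qed (use I in auto)
  finally have s: "(\<lambda>i. LINT x|lebesgue. f i x) sums (LINT x|lebesgue. c \<lfloor>x / dx\<rfloor> * \<mu> x)" .
  have nonneg: "0 \<le> (LINT x|lebesgue. f i x)" for i
    using \<mu>(2) by (intro integral_nonneg_AE, eventually_elim) (auto simp: f_def F_def indicator_def c)
  have "((\<lambda>i. LINT x|lebesgue. f i x) has_sum (LINT x|lebesgue. c \<lfloor>x / dx\<rfloor> * \<mu> x)) UNIV"
    using s nonneg sums_summable[OF s] by (intro norm_summable_imp_has_sum) auto
  then have "((\<lambda>j. c j * cell_mean dx \<mu> j * dx) has_sum (LINT x|lebesgue. c \<lfloor>x / dx\<rfloor> * \<mu> x)) UNIV"
    using has_sum_reindex_bij_betw[OF bij_int_decode, of "\<lambda>j. c j * cell_mean dx \<mu> j * dx"]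
    by (simp add: f_def Fval)
  then show "(\<Sum>\<^sub>\<infinity>j\<in>UNIV. c j * cell_mean dx \<mu> j * dx) = (LINT x|lebesgue. c \<lfloor>x / dx\<rfloor> * \<mu> x)"
    by (rule infsumI)
qed

text \<open>The data in the form in which the scheme uses them: concavity of the flux in the moving frame for
every admissible speed \<open>s\<close>, an upwind flux off the constraint, and a monotone consistent flux at
the constraint whose increments satisfy the CFL condition.\<close>

locale moving_constraint =
  fixes R \<alpha> lam smax y\<^sub>o :: real and f f' \<omega> Q \<mu> \<rho>\<^sub>o p :: "real \<Rightarrow> real"
    and FF GG :: "real \<Rightarrow> real \<Rightarrow> real \<Rightarrow> real" and C\<omega> CQ :: real
  assumes R: "R > 0" and \<alpha>: "\<alpha> > 0" and lam: "lam > 0"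
    and concave: "\<And>s. s \<in> {0..smax} \<Longrightarrow> strongly_concave_flux (flux f s) (\<lambda>r. f' r - s) R \<alpha> (p s)"
    and f0: "f 0 = 0" and fR: "f R \<le> 0"
    and FF: "\<And>s. s \<in> {0..smax} \<Longrightarrow>
      strongly_concave_flux.upwind_flux (flux f s) (\<lambda>r. f' r - s) R (p s) (FF s)"
    and GG: "\<And>s. s \<in> {0..smax} \<Longrightarrow> \<exists>L1 L2. 0 \<le> L1 \<and> 0 \<le> L2 \<and> lam * (L1 + L2) \<le> 1
      \<and> (\<forall>a\<in>{0..R}. GG s a a = flux f s a)
      \<and> (\<forall>a\<in>{0..R}. \<forall>b\<in>{0..R}. \<forall>c\<in>{a..R}. 0 \<le> GG s c b - GG s a b \<and> GG s c b - GG s a b \<le> L1 * (c - a))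
      \<and> (\<forall>a\<in>{0..R}. \<forall>b\<in>{0..R}. \<forall>c\<in>{b..R}. 0 \<le> GG s a b - GG s a c \<and> GG s a b - GG s a c \<le> L2 * (c - b))"
    and \<omega>: "\<And>r. r \<in> {0..R} \<Longrightarrow> \<omega> r \<in> {0..smax}" and \<omega>_lip: "C\<omega>-lipschitz_on {0..R} \<omega>"
    and Q: "\<And>s. s \<in> {0..smax} \<Longrightarrow> 0 \<le> Q s" and Q_lip: "CQ-lipschitz_on {0..smax} Q"
    and \<mu>: "integrable lebesgue \<mu>" "AE x in lebesgue. 0 \<le> \<mu> x" "(LINT x|lebesgue. \<mu> x) = 1"
    and \<rho>\<^sub>o: "integrable lebesgue \<rho>\<^sub>o" "AE x in lebesgue. \<rho>\<^sub>o x \<in> {0..R}"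
begin

abbreviation E :: "real \<Rightarrow> int \<Rightarrow> real \<Rightarrow> real \<Rightarrow> real" where
  "E \<equiv> edge_flux Q FF GG"

text \<open>By consistency and monotonicity, \<open>F(c) - F(a) = G(c,c) - G(a,a) \<le> G(c,a) - G(a,a) \<le> L1 (c - a)\<close> for
\<open>a \<le> c\<close>, and similarly for decrements.  So any monotone consistent flux is at least as steep as the
fastest characteristic speeds.\<close>

lemma GG_slopes_dominate:
  assumes s: "s \<in> {0..smax}" and L:
    "\<forall>a\<in>{0..R}. GG s a a = flux f s a"
    "\<forall>a\<in>{0..R}. \<forall>b\<in>{0..R}. \<forall>c\<in>{a..R}. 0 \<le> GG s c b - GG s a b \<and> GG s c b - GG s a b \<le> L1 * (c - a)"
    "\<forall>a\<in>{0..R}. \<forall>b\<in>{0..R}. \<forall>c\<in>{b..R}. 0 \<le> GG s a b - GG s a c \<and> GG s a b - GG s a c \<le> L2 * (c - b)"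
  shows "f' 0 - s \<le> L1" "- (f' R - s) \<le> L2"
proof -
  interpret strongly_concave_flux "flux f s" "\<lambda>r. f' r - s" R \<alpha> "p s" by (rule concave[OF s])
  have up: "flux f s c - flux f s a \<le> L1 * (c - a)" if "0 \<le> a" "a \<le> c" "c \<le> R" for a c
  proof -
    have "GG s c c \<le> GG s c a" using L(3)[rule_format, of c a c] that by auto
    moreover have "GG s c a - GG s a a \<le> L1 * (c - a)" using L(2)[rule_format, of a a c] that by auto
    ultimately show ?thesis using L(1)[rule_format, of a] L(1)[rule_format, of c] that by auto
  qed
  have down: "flux f s a - flux f s c \<le> L2 * (c - a)" if "0 \<le> a" "a \<le> c" "c \<le> R" for a c
  proof -
    have "GG s a a \<le> GG s c a" using L(2)[rule_format, of a a c] that by auto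
    moreover have "GG s c a - GG s c c \<le> L2 * (c - a)" using L(3)[rule_format, of c a c] that by auto
    ultimately show ?thesis using L(1)[rule_format, of a] L(1)[rule_format, of c] that by auto
  qed
  show "f' 0 - s \<le> L1"
  proof (rule tendsto_upperbound)
    show "((\<lambda>x. (flux f s x - flux f s 0) / (x - 0)) \<longlongrightarrow> f' 0 - s) (at 0 within {0..R})"
      using deriv[of 0] R by (simp add: has_field_derivative_iff)
    show "\<forall>\<^sub>F x in at 0 within {0..R}. (flux f s x - flux f s 0) / (x - 0) \<le> L1"
      unfolding eventually_at_filter using up[of 0] by (intro always_eventually) (auto simp: divide_le_eq)
    show "at 0 within {0..R} \<noteq> bot"
      using R by (simp add: at_within_Icc_at_right)
  qed
  show "- (f' R - s) \<le> L2"
  proof (rule tendsto_upperbound)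
    have "((\<lambda>x. (flux f s x - flux f s R) / (x - R)) \<longlongrightarrow> f' R - s) (at R within {0..R})"
      using deriv[of R] R by (simp add: has_field_derivative_iff)
    then show "((\<lambda>x. - ((flux f s x - flux f s R) / (x - R))) \<longlongrightarrow> - (f' R - s)) (at R within {0..R})"
      by (rule tendsto_minus)
    have "- ((flux f s x - flux f s R) / (x - R)) \<le> L2" if "x \<in> {0..R}" "x \<noteq> R" for x
    proof -
      have "- ((flux f s x - flux f s R) / (x - R)) = (flux f s x - flux f s R) / (R - x)"
        using that by (simp add: field_simps)
      then show ?thesis using down[of x R] that by (simp add: divide_le_eq)
    qed
    then show "\<forall>\<^sub>F x in at R within {0..R}. - ((flux f s x - flux f s R) / (x - R)) \<le> L2"
      unfolding eventually_at_filter by (intro always_eventually) auto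
    show "at R within {0..R} \<noteq> bot"
      using R by (simp add: at_within_Icc_at_left)
  qed
qed

text \<open>The constants do not depend on the edge.  Hence the CFL condition holds also in the two cells next to
the constraint, which have different fluxes on their two sides.\<close>

lemma edge_flux_slopes:
  assumes s: "s \<in> {0..smax}"
  obtains L1 L2 where "0 \<le> L1" "0 \<le> L2" "lam * (L1 + L2) \<le> 1"
    "f' 0 - s \<le> L1" "- (f' R - s) \<le> L2"
    "\<And>a. a \<in> {0..R} \<Longrightarrow> GG s a a = flux f s a \<and> FF s a a = flux f s a"
    "\<And>j a b c. \<lbrakk>a \<in> {0..R}; b \<in> {0..R}; c \<in> {a..R}\<rbrakk> \<Longrightarrow> 0 \<le> E s j c b - E s j a b \<and> E s j c b - E s j a b \<le> L1 * (c - a)"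
    "\<And>j a b c. \<lbrakk>a \<in> {0..R}; b \<in> {0..R}; c \<in> {b..R}\<rbrakk> \<Longrightarrow> 0 \<le> E s j a b - E s j a c \<and> E s j a b - E s j a c \<le> L2 * (c - b)"
proof -
  interpret strongly_concave_flux "flux f s" "\<lambda>r. f' r - s" R \<alpha> "p s" by (rule concave[OF s])
  from GG[OF s] obtain L1 L2 where L: "0 \<le> L1" "0 \<le> L2" "lam * (L1 + L2) \<le> 1"
    "\<forall>a\<in>{0..R}. GG s a a = flux f s a"
    "\<forall>a\<in>{0..R}. \<forall>b\<in>{0..R}. \<forall>c\<in>{a..R}. 0 \<le> GG s c b - GG s a b \<and> GG s c b - GG s a b \<le> L1 * (c - a)"
    "\<forall>a\<in>{0..R}. \<forall>b\<in>{0..R}. \<forall>c\<in>{b..R}. 0 \<le> GG s a b - GG s a c \<and> GG s a b - GG s a c \<le> L2 * (c - b)"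
    by blast
  note dom = GG_slopes_dominate[OF s L(4,5,6)]
  note up = FF[OF s, unfolded upwind_flux_def]
  have F1: "0 \<le> FF s c b - FF s a b \<and> FF s c b - FF s a b \<le> L1 * (c - a)"
    if "a \<in> {0..R}" "b \<in> {0..R}" "c \<in> {a..R}" for a b c
  proof -
    have "0 \<le> FF s c b - FF s a b \<and> FF s c b - FF s a b \<le> (f' 0 - s) * (c - a)" using up that by blast
    then show ?thesis using that mult_right_mono[OF dom(1), of "c - a"] by auto
  qed
  have F2: "0 \<le> FF s a b - FF s a c \<and> FF s a b - FF s a c \<le> L2 * (c - b)"
    if "a \<in> {0..R}" "b \<in> {0..R}" "c \<in> {b..R}" for a b c
  proof -
    have "0 \<le> FF s a b - FF s a c \<and> FF s a b - FF s a c \<le> - (f' R - s) * (c - b)" using up that by blast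
    then show ?thesis using that mult_right_mono[OF dom(2), of "c - b"] by auto
  qed
  show ?thesis
  proof (rule that[OF L(1-3) dom])
    show "GG s a a = flux f s a \<and> FF s a a = flux f s a" if "a \<in> {0..R}" for a
      using that L(4) up by auto
    show "0 \<le> E s j c b - E s j a b \<and> E s j c b - E s j a b \<le> L1 * (c - a)"
      if "a \<in> {0..R}" "b \<in> {0..R}" "c \<in> {a..R}" for j a b c
      using F1[OF that] L(5)[rule_format, OF that] by (auto simp: edge_flux_def min_def)
    show "0 \<le> E s j a b - E s j a c \<and> E s j a b - E s j a c \<le> L2 * (c - b)"
      if "a \<in> {0..R}" "b \<in> {0..R}" "c \<in> {b..R}" for j a b c
      using F2[OF that] L(6)[rule_format, OF that] by (auto simp: edge_flux_def min_def)
  qed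
qed

definition U :: "real \<Rightarrow> nat \<Rightarrow> int \<Rightarrow> real" where
  "U dx n = scheme \<omega> Q \<mu> FF GG \<rho>\<^sub>o y\<^sub>o lam dx n"

definition S :: "real \<Rightarrow> nat \<Rightarrow> real" where
  "S dx n = speed_of \<omega> \<mu> dx (U dx n)"

lemma U_0: "U dx 0 = cell_mean dx (\<lambda>x. \<rho>\<^sub>o (x + y\<^sub>o))"
  by (simp add: U_def)

lemma U_Suc: "U dx (Suc n) = step Q FF GG lam (S dx n) (U dx n)"
  by (simp add: U_def S_def Let_def)

lemma edge_flux_bound:
  assumes s: "s \<in> {0..smax}" and ab: "a \<in> {0..R}" "b \<in> {0..R}"
  shows "\<bar>E s j a b\<bar> \<le> 2 * R / lam" and "\<bar>FF s a b - flux f s b\<bar> \<le> \<bar>a - b\<bar> / lam"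
    and "\<bar>flux f s a\<bar> \<le> R / lam"
proof -
  obtain L1 L2 where L: "0 \<le> L1" "0 \<le> L2" "lam * (L1 + L2) \<le> 1"
    "\<And>a. a \<in> {0..R} \<Longrightarrow> GG s a a = flux f s a \<and> FF s a a = flux f s a"
    "\<And>j a b c. \<lbrakk>a \<in> {0..R}; b \<in> {0..R}; c \<in> {a..R}\<rbrakk> \<Longrightarrow> 0 \<le> E s j c b - E s j a b \<and> E s j c b - E s j a b \<le> L1 * (c - a)"
    "\<And>j a b c. \<lbrakk>a \<in> {0..R}; b \<in> {0..R}; c \<in> {b..R}\<rbrakk> \<Longrightarrow> 0 \<le> E s j a b - E s j a c \<and> E s j a b - E s j a c \<le> L2 * (c - b)"
    using edge_flux_slopes[OF s] by metis
  have L': "L1 + L2 \<le> 1 / lam" using L(3) lam by (simp add: field_simps)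
  have Ls: "L1 * r \<le> r / lam" "L2 * r \<le> r / lam" "L1 * r + L2 * r \<le> r / lam" if "r \<ge> 0" for r
    using mult_right_mono[of L1 "1 / lam" r] mult_right_mono[of L2 "1 / lam" r]
      mult_right_mono[OF L' that] L' L(1,2) that by (auto simp: distrib_right)
  have E1: "E s 1 = FF s" by (intro ext) (simp add: edge_flux_def)
  have F0: "flux f s 0 = 0" using f0 by (simp add: flux_def)
  have F: "\<bar>flux f s a\<bar> \<le> R / lam" if a: "a \<in> {0..R}" for a
  proof -
    have "0 \<le> FF s a 0 - FF s 0 0" "FF s a 0 - FF s 0 0 \<le> L1 * a"
      "0 \<le> FF s a 0 - FF s a a" "FF s a 0 - FF s a a \<le> L2 * a"
      using L(5)[of 0 0 a 1] L(6)[of a 0 a 1] a R by (auto simp: E1)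
    moreover have "FF s 0 0 = 0" "FF s a a = flux f s a" using L(4)[of 0] L(4)[OF a] F0 R by auto
    moreover have "0 \<le> L1 * a" "0 \<le> L2 * a" using L(1,2) a by auto
    ultimately have "\<bar>flux f s a\<bar> \<le> L1 * a + L2 * a" by linarith
    also have "\<dots> \<le> a / lam" using a by (intro Ls) auto
    also have "\<dots> \<le> R / lam" using a lam by (intro divide_right_mono) auto
    finally show ?thesis .
  qed
  show "\<bar>flux f s a\<bar> \<le> R / lam" using F ab by blast
  have diff: "\<bar>E s j a b - E s j b b\<bar> \<le> \<bar>a - b\<bar> / lam" if "a \<in> {0..R}" "b \<in> {0..R}" for a b j
  proof (cases "a \<le> b")
    case True
    then show ?thesis using L(5)[of a b b j] that Ls(1)[of "b - a"] by auto
  next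
    case False
    then show ?thesis using L(5)[of b b a j] that Ls(1)[of "a - b"] by auto
  qed
  show "\<bar>FF s a b - flux f s b\<bar> \<le> \<bar>a - b\<bar> / lam"
    using diff[OF ab, of 1] L(4)[OF ab(2)] by (simp add: E1)
  have Ebb: "\<bar>E s j b b\<bar> \<le> R / lam"
    using F[OF ab(2)] L(4)[OF ab(2)] Q[OF s] by (auto simp: edge_flux_def min_def abs_le_iff)
  have "\<bar>a - b\<bar> / lam \<le> R / lam" using ab lam by (intro divide_right_mono) auto
  then have "\<bar>E s j a b\<bar> \<le> R / lam + R / lam" using diff[OF ab, of j] Ebb by linarith
  then show "\<bar>E s j a b\<bar> \<le> 2 * R / lam" by simp
qed

text \<open>A cell value enters its own update through both edges; the CFL condition \<open>lam (L1 + L2) \<le> 1\<close>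
makes this dependence nondecreasing.\<close>

lemma step_mono:
  assumes s: "s \<in> {0..smax}" and u: "\<And>i. u i \<in> {0..R}" and v: "\<And>i. v i \<in> {0..R}"
    and le: "\<And>i. u i \<le> v i"
  shows "step Q FF GG lam s u j \<le> step Q FF GG lam s v j"
proof -
  obtain L1 L2 where L: "0 \<le> L1" "0 \<le> L2" "lam * (L1 + L2) \<le> 1"
    "\<And>j a b c. \<lbrakk>a \<in> {0..R}; b \<in> {0..R}; c \<in> {a..R}\<rbrakk> \<Longrightarrow> 0 \<le> E s j c b - E s j a b \<and> E s j c b - E s j a b \<le> L1 * (c - a)"
    "\<And>j a b c. \<lbrakk>a \<in> {0..R}; b \<in> {0..R}; c \<in> {b..R}\<rbrakk> \<Longrightarrow> 0 \<le> E s j a b - E s j a c \<and> E s j a b - E s j a c \<le> L2 * (c - b)"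
    using edge_flux_slopes[OF s] by metis
  have mem: "v i \<in> {u i..R}" for i using le v by auto
  have "E s (j+1) (v j) (v (j+1)) \<le> E s (j+1) (v j) (u (j+1))"
    using L(5)[OF v u mem, of "j+1" j "j+1"] by linarith
  moreover have "E s (j+1) (v j) (u (j+1)) \<le> E s (j+1) (u j) (u (j+1)) + L1 * (v j - u j)"
    using L(4)[OF u u mem, of "j+1" j "j+1"] by linarith
  moreover have "E s j (u (j-1)) (v j) \<le> E s j (v (j-1)) (v j)"
    using L(4)[OF u v mem, of j "j-1" j] by linarith
  moreover have "E s j (u (j-1)) (u j) - L2 * (v j - u j) \<le> E s j (u (j-1)) (v j)"
    using L(5)[OF u u mem, of j "j-1" j] by linarith
  ultimately have "(E s (j+1) (v j) (v (j+1)) - E s j (v (j-1)) (v j))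
      - (E s (j+1) (u j) (u (j+1)) - E s j (u (j-1)) (u j)) \<le> (L1 + L2) * (v j - u j)"
    by (simp add: algebra_simps)
  then have "lam * ((E s (j+1) (v j) (v (j+1)) - E s j (v (j-1)) (v j))
      - (E s (j+1) (u j) (u (j+1)) - E s j (u (j-1)) (u j))) \<le> lam * ((L1 + L2) * (v j - u j))"
    using lam by (intro mult_left_mono) auto
  also have "\<dots> = lam * (L1 + L2) * (v j - u j)" by simp
  also have "\<dots> \<le> 1 * (v j - u j)" using L(3) le by (intro mult_right_mono) auto
  finally show ?thesis by (simp add: step_def algebra_simps)
qed

text \<open>A constant state is steady except next to the constraint, where mass that the constraint holds back
is stored in the cell \<open>-1\<close> and missing in the cell \<open>0\<close>.\<close>

lemma step_const:
  assumes s: "s \<in> {0..smax}" and k: "k \<in> {0..R}"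
  shows "step Q FF GG lam s (\<lambda>_. k) j
    = k + lam * constraint_excess f s k (Q s) * (if j = -1 then 1 else if j = 0 then -1 else 0)"
proof -
  have "\<And>a. a \<in> {0..R} \<Longrightarrow> GG s a a = flux f s a \<and> FF s a a = flux f s a"
    using edge_flux_slopes[OF s] by metis
  then show ?thesis using k
    by (auto simp: step_def edge_flux_def constraint_excess_def algebra_simps)
qed

text \<open>The constants \<open>0\<close> and \<open>R\<close> satisfy the constraint and are steady, so they are barriers.\<close>

lemma step_range:
  assumes s: "s \<in> {0..smax}" and u: "\<And>i. u i \<in> {0..R}"
  shows "step Q FF GG lam s u j \<in> {0..R}"
proof -
  have sR: "0 \<le> s * R" using s R by simp
  have "constraint_excess f s 0 (Q s) = 0" "constraint_excess f s R (Q s) = 0"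
    using Q[OF s] f0 fR sR by (auto simp: constraint_excess_def flux_def min_def)
  then have "step Q FF GG lam s (\<lambda>_. 0) j = 0" "step Q FF GG lam s (\<lambda>_. R) j = R"
    using step_const[OF s, of 0 j] step_const[OF s, of R j] R by auto
  moreover have "step Q FF GG lam s (\<lambda>_. 0) j \<le> step Q FF GG lam s u j"
    by (rule step_mono[OF s]) (use u R in auto)
  moreover have "step Q FF GG lam s u j \<le> step Q FF GG lam s (\<lambda>_. R) j"
    by (rule step_mono[OF s]) (use u R in auto)
  ultimately show ?thesis by simp
qed

lemma constraint_excess_nonneg: "0 \<le> constraint_excess f s k q"
  by (simp add: constraint_excess_def)

text \<open>The numerical flux of the Kruzhkov entropy \<open>|u - k|\<close>.\<close>

definition EF :: "real \<Rightarrow> int \<Rightarrow> real \<Rightarrow> real \<Rightarrow> real \<Rightarrow> real" where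
  "EF s j k a b = E s j (max a k) (max b k) - E s j (min a k) (min b k)"

text \<open>The Crandall-Majda argument: monotonicity compares the update of \<open>u\<close> with those of \<open>max u k\<close> and
\<open>min u k\<close> and of the constant \<open>k\<close>.  Since \<open>k\<close> is not steady in the two cells next to the constraint,
these contribute the constraint excess once each.\<close>

lemma step_entropy:
  assumes s: "s \<in> {0..smax}" and u: "\<And>i. u i \<in> {0..R}" and k: "k \<in> {0..R}"
  shows "\<bar>step Q FF GG lam s u j - k\<bar> \<le> \<bar>u j - k\<bar>
     - lam * (EF s (j + 1) k (u j) (u (j + 1)) - EF s j k (u (j - 1)) (u j))
     + lam * constraint_excess f s k (Q s) * (if j \<in> {-1, 0} then 1 else 0)"
proof -
  let ?st = "\<lambda>u. step Q FF GG lam s u j"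
  have "max (u i) k \<in> {0..R}" "min (u i) k \<in> {0..R}" for i using u[of i] k by auto
  then have "?st u \<le> ?st (\<lambda>i. max (u i) k)" "?st (\<lambda>i. min (u i) k) \<le> ?st u"
    "?st (\<lambda>i. k) \<le> ?st (\<lambda>i. max (u i) k)" "?st (\<lambda>i. min (u i) k) \<le> ?st (\<lambda>i. k)"
    by (intro step_mono[OF s]; use u k in simp)+
  then have "\<bar>?st u - ?st (\<lambda>i. k)\<bar> \<le> ?st (\<lambda>i. max (u i) k) - ?st (\<lambda>i. min (u i) k)"
    by linarith
  also have "\<dots> = (max (u j) k - min (u j) k)
      - lam * (EF s (j + 1) k (u j) (u (j + 1)) - EF s j k (u (j - 1)) (u j))"
    by (simp add: step_def EF_def algebra_simps)
  also have "max (u j) k - min (u j) k = \<bar>u j - k\<bar>" by auto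
  finally have "\<bar>?st u - ?st (\<lambda>i. k)\<bar> \<le> \<bar>u j - k\<bar>
      - lam * (EF s (j + 1) k (u j) (u (j + 1)) - EF s j k (u (j - 1)) (u j))" .
  moreover have "\<bar>?st (\<lambda>i. k) - k\<bar> \<le> lam * constraint_excess f s k (Q s) * (if j \<in> {-1, 0} then 1 else 0)"
    using step_const[OF s k, of j] constraint_excess_nonneg[of s k "Q s"] lam by auto
  ultimately show ?thesis by linarith
qed

end

section \<open>The one-sided Lipschitz estimate\<close>

lemma AE_lebesgue_shift:
  fixes P :: "real \<Rightarrow> bool"
  assumes "AE x in lebesgue. P x"
  shows "AE x in lebesgue. P (x + c)"
proof -
  have "AE x in distr lborel borel ((+) c). P x"
    using assms by (simp only: AE_completion_iff lborel_distr_plus)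
  then have "AE x in lborel. P (c + x)" by (rule AE_distrD[rotated]) simp
  then show ?thesis by (simp add: AE_completion_iff add.commute)
qed

lemma integrable_lebesgue_shift:
  fixes h :: "real \<Rightarrow> real"
  assumes h: "integrable lebesgue h"
  shows "integrable lebesgue (\<lambda>x. h (x + c))"
proof -
  obtain g where g: "g \<in> borel_measurable lborel" "AE x in lborel. h x = g x"
    using completion_ex_borel_measurable_real[OF borel_measurable_integrable[OF h]] by blast
  have "integrable lebesgue g"
    using h g by (subst integrable_cong_AE[of _ _ h]) (auto simp: AE_completion_iff intro: measurable_completion)
  then have "integrable lborel g" using g(1) by (simp add: integrable_completion)
  from lborel_integrable_real_affine[OF this, of 1 c]
  have "integrable lborel (\<lambda>x. g (x + c))" by (simp add: add.commute)
  then have gi: "integrable lebesgue (\<lambda>x. g (x + c))"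
    by (subst integrable_completion) auto
  have ae: "AE x in lebesgue. g (x + c) = h (x + c)"
    using AE_lebesgue_shift[of "\<lambda>x. g x = h x" c] g(2) by (simp add: AE_completion_iff eq_commute)
  have "(\<lambda>x. h (x + c)) \<in> borel_measurable lebesgue"
    by (rule borel_measurable_AE[OF borel_measurable_integrable[OF gi] ae])
  then show ?thesis by (rule integrable_cong_AE_imp[OF gi _ ae])
qed

context moving_constraint begin

lemma integrable_shifted: "integrable lebesgue (\<lambda>x. \<rho>\<^sub>o (x + y\<^sub>o))"
  by (rule integrable_lebesgue_shift[OF \<rho>\<^sub>o(1)])

lemma AE_shifted: "AE x in lebesgue. \<rho>\<^sub>o (x + y\<^sub>o) \<in> {0..R}"
  by (rule AE_lebesgue_shift[OF \<rho>\<^sub>o(2)])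

lemma cell_mean_range:
  assumes dx: "dx > 0" and h: "integrable lebesgue h" "AE x in lebesgue. h x \<in> {0..R}"
  shows "cell_mean dx h j \<in> {0..R}"
proof -
  have [measurable]: "cell dx j \<in> sets lebesgue" by (simp add: cell_def)
  have I: "set_integrable lebesgue (cell dx j) h"
    unfolding set_integrable_def using integrable_mult_indicator[OF _ h(1), of "cell dx j"] by simp
  have c: "set_integrable lebesgue (cell dx j) (\<lambda>_. R)" "(LINT x:cell dx j|lebesgue. R) = dx * R"
    using dx by (auto simp: cell_def set_integrable_def set_lebesgue_integral_def algebra_simps)
  have "0 \<le> (LINT x:cell dx j|lebesgue. h x)"
    unfolding set_lebesgue_integral_def using h(2)
    by (intro integral_nonneg_AE, eventually_elim) (auto simp: indicator_def)
  moreover have "(LINT x:cell dx j|lebesgue. h x) \<le> (LINT x:cell dx j|lebesgue. R)"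
    unfolding set_lebesgue_integral_def
  proof (rule integral_mono_AE)
    show "AE x in lebesgue. indicator (cell dx j) x *\<^sub>R h x \<le> indicator (cell dx j) x *\<^sub>R R"
      using h(2) by eventually_elim (auto simp: indicator_def)
  qed (use I c(1) in \<open>simp_all only: set_integrable_def\<close>)
  ultimately show ?thesis using dx c(2) by (simp add: cell_mean_def field_simps)
qed

lemma speed_of_eq:
  assumes dx: "dx > 0" and u: "\<And>j. u j \<in> {0..R}"
  shows "speed_of \<omega> \<mu> dx u = \<omega> (LINT x|lebesgue. u \<lfloor>x / dx\<rfloor> * \<mu> x)"
    and "integrable lebesgue (\<lambda>x. u \<lfloor>x / dx\<rfloor> * \<mu> x)"
  using infsum_cells_eq_integral[OF dx, of u R \<mu>] u \<mu> by (auto simp: speed_of_def)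

lemma weighted_mean_range:
  assumes "integrable lebesgue (\<lambda>x. h x * \<mu> x)" and "AE x in lebesgue. h x \<in> {0..R}"
  shows "(LINT x|lebesgue. h x * \<mu> x) \<in> {0..R}"
proof -
  have "0 \<le> (LINT x|lebesgue. h x * \<mu> x)"
    using assms(2) \<mu>(2) by (intro integral_nonneg_AE, eventually_elim) auto
  moreover have "(LINT x|lebesgue. h x * \<mu> x) \<le> (LINT x|lebesgue. R * \<mu> x)"
  proof (rule integral_mono_AE)
    show "AE x in lebesgue. h x * \<mu> x \<le> R * \<mu> x"
      using assms(2) \<mu>(2) by eventually_elim (auto intro: mult_right_mono)
  qed (use assms \<mu> in auto)
  ultimately show ?thesis using \<mu>(3) by simp
qed

lemma speed_of_range:
  assumes dx: "dx > 0" and u: "\<And>j. u j \<in> {0..R}"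
  shows "speed_of \<omega> \<mu> dx u \<in> {0..smax}"
  unfolding speed_of_eq(1)[OF dx u]
  by (rule \<omega>, rule weighted_mean_range[OF speed_of_eq(2)[OF dx u]]) (use u in auto)

lemma U_range:
  assumes dx: "dx > 0"
  shows "U dx n j \<in> {0..R}"
proof (induction n arbitrary: j)
  case 0
  show ?case unfolding U_0 by (rule cell_mean_range[OF dx integrable_shifted AE_shifted])
next
  case (Suc n)
  have "S dx n \<in> {0..smax}" unfolding S_def using Suc by (intro speed_of_range[OF dx])
  then show ?case unfolding U_Suc using Suc by (rule step_range)
qed

lemma S_range: "dx > 0 \<Longrightarrow> S dx n \<in> {0..smax}"
  unfolding S_def using U_range by (intro speed_of_range)

lemma U_Suc_eq:
  "U dx (Suc n) j = U dx n j - lam * (E (S dx n) (j + 1) (U dx n j) (U dx n (j + 1))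
     - E (S dx n) j (U dx n (j - 1)) (U dx n j))"
  by (simp add: U_Suc step_def)

lemma lam_concave:
  assumes s: "s \<in> {0..smax}"
  shows "lam * ((f' 0 - s) - (f' R - s)) \<le> 1" and "lam * \<alpha> * R \<le> 1"
proof -
  interpret strongly_concave_flux "flux f s" "\<lambda>r. f' r - s" R \<alpha> "p s" by (rule concave[OF s])
  obtain L1 L2 where L: "0 \<le> L1" "0 \<le> L2" "lam * (L1 + L2) \<le> 1" "f' 0 - s \<le> L1" "- (f' R - s) \<le> L2"
    using edge_flux_slopes[OF s] by metis
  have "lam * ((f' 0 - s) - (f' R - s)) \<le> lam * (L1 + L2)"
    using L lam by (intro mult_left_mono) auto
  then show 1: "lam * ((f' 0 - s) - (f' R - s)) \<le> 1" using L(3) by linarith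
  have "lam * (\<alpha> * R) \<le> lam * ((f' 0 - s) - (f' R - s))"
    using lam by (intro mult_left_mono g_total) auto
  then show "lam * \<alpha> * R \<le> 1" using 1 by (simp add: mult.assoc)
qed

text \<open>The drops obey \<open>D \<mapsto> D - D\<^sup>2/\<beta>\<close>.\<close>

definition \<beta> :: real where "\<beta> = 4 / (lam * \<alpha>)"

lemma \<beta>: "\<beta> > 0" "smax \<ge> 0 \<Longrightarrow> R \<le> \<beta> / 2"
proof -
  show "\<beta> > 0" using lam \<alpha> by (simp add: \<beta>_def)
  assume "smax \<ge> 0"
  then have "lam * \<alpha> * R \<le> 1" using lam_concave(2)[of 0] by simp
  then show "R \<le> \<beta> / 2" using lam \<alpha> R by (simp add: \<beta>_def field_simps)
qed

text \<open>The condition on \<open>j\<close> keeps the three edges \<open>j\<close>, \<open>j + 1\<close>, \<open>j + 2\<close> off the constraint.  The map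
\<open>D \<mapsto> D - D\<^sup>2/\<beta>\<close> increases on \<open>[0, \<beta>/2]\<close> and sends \<open>\<beta>/K\<close> to \<open>\<beta>(K - 1)/K\<^sup>2 \<le> \<beta>/(K + 1)\<close>.\<close>

lemma drop_decay_step:
  assumes dx: "dx > 0" and j: "j \<notin> {0, -1, -2}"
    and D: "\<And>i. i \<in> {j - 1, j, j + 1} \<Longrightarrow> U dx n i - U dx n (i + 1) \<le> \<beta> / (real k + 2)"
  shows "U dx (Suc n) j - U dx (Suc n) (j + 1) \<le> \<beta> / (real (Suc k) + 2)"
proof -
  note s = S_range[OF dx, of n]
  have smax: "smax \<ge> 0" using s by simp
  interpret strongly_concave_flux "flux f (S dx n)" "\<lambda>r. f' r - S dx n" R \<alpha> "p (S dx n)"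
    by (rule concave[OF s])
  \<comment> \<open>Truncation at \<open>R\<close> costs nothing, since drops never exceed \<open>R\<close>.\<close>
  define M where "M = min R (\<beta> / (real k + 2))"
  have M: "0 \<le> M" "M \<le> R" "M \<le> \<beta> / (real k + 2)" using R \<beta>(1) by (auto simp: M_def)
  have D': "U dx n i - U dx n (i + 1) \<le> M" if "i \<in> {j - 1, j, j + 1}" for i
    using D[OF that] U_range[OF dx, of n i] U_range[OF dx, of n "i + 1"] by (auto simp: M_def)
  have E: "E (S dx n) i = FF (S dx n)" if "i \<in> {j, j + 1, j + 2}" for i
    using that j by (intro ext) (auto simp: edge_flux_def)
  have "U dx (Suc n) j - U dx (Suc n) (j + 1) =
      (U dx n j - lam * (FF (S dx n) (U dx n j) (U dx n (j + 1)) - FF (S dx n) (U dx n (j - 1)) (U dx n j)))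
    - (U dx n (j + 1) - lam * (FF (S dx n) (U dx n (j + 1)) (U dx n (j + 2)) - FF (S dx n) (U dx n j) (U dx n (j + 1))))"
    unfolding U_Suc_eq using E[of j] E[of "j + 1"] E[of "j + 2"] by (simp add: add.assoc)
  also have "\<dots> \<le> M - lam * \<alpha> / 4 * M\<^sup>2"
    by (rule upwind_flux_decay[OF FF[OF s] _ _ _ _ M(1,2) lam lam_concave(1)[OF s]])
      (use D'[of "j-1"] D'[of j] D'[of "j+1"] U_range[OF dx] in \<open>auto simp: add.assoc\<close>)
  also have "\<dots> = M - M\<^sup>2 / \<beta>" using lam \<alpha> by (simp add: \<beta>_def)
  also have "\<dots> \<le> \<beta> / (real k + 2) - (\<beta> / (real k + 2))\<^sup>2 / \<beta>"
  proof -
    let ?N = "\<beta> / (real k + 2)"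
    have "?N \<le> \<beta> / 2" using \<beta>(1) by (intro divide_left_mono) auto
    then have "M + ?N \<le> \<beta>" using M by linarith
    then have "(M + ?N) * (?N - M) \<le> \<beta> * (?N - M)" using M by (intro mult_right_mono) auto
    then have "((M + ?N) * (?N - M)) / \<beta> \<le> ?N - M" using \<beta>(1) by (simp add: divide_le_eq mult.commute)
    moreover have "((M + ?N) * (?N - M)) / \<beta> = ?N\<^sup>2 / \<beta> - M\<^sup>2 / \<beta>"
      by (simp add: power2_eq_square algebra_simps diff_divide_distrib)
    ultimately show ?thesis by linarith
  qed
  also have "\<dots> = \<beta> * ((real k + 1) / (real k + 2)\<^sup>2)"
  proof -
    have "\<beta> / K - (\<beta> / K)\<^sup>2 / \<beta> = \<beta> * ((K - 1) / K\<^sup>2)" if "K > 0" for K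
      using that \<beta>(1) by (simp add: divide_simps power2_eq_square) (simp add: algebra_simps)
    from this[of "real k + 2"] show ?thesis by simp
  qed
  also have "\<dots> \<le> \<beta> * (1 / (real (Suc k) + 2))"
  proof (rule mult_left_mono)
    have "(real k + 1) * (real k + 3) \<le> (real k + 2)\<^sup>2" by (simp add: power2_eq_square algebra_simps)
    then show "(real k + 1) / (real k + 2)\<^sup>2 \<le> 1 / (real (Suc k) + 2)"
      by (simp add: divide_le_eq le_divide_eq field_simps)
  qed (use \<beta>(1) in simp)
  finally show ?thesis by simp
qed

text \<open>The estimate at a pair of cells uses the neighbouring pairs one step earlier, so the unknown behaviour
at the constraint spreads by one cell per step: the bound is governed by the smaller of the number of
steps and the distance from the constraint.  The induction starts from the bound \<open>R \<le> \<beta>/2\<close>.\<close>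

lemma drop_decay:
  assumes dx: "dx > 0"
  shows "0 \<le> j \<Longrightarrow> U dx n j - U dx n (j + 1) \<le> \<beta> / (real (min n (nat j)) + 2)"
    and "j \<le> -2 \<Longrightarrow> U dx n j - U dx n (j + 1) \<le> \<beta> / (real (min n (nat (-2 - j))) + 2)"
proof -
  have triv: "U dx n j - U dx n (j + 1) \<le> \<beta> / 2" for n j
    using U_range[OF dx, of n j] U_range[OF dx, of n "j + 1"] \<beta>(2) S_range[OF dx, of 0] by auto
  have weaken: "\<beta> / (real m + 2) \<le> \<beta> / (real k + 2)" if "k \<le> m" for k m
    using that \<beta>(1) by (intro divide_left_mono) auto
  show "0 \<le> j \<Longrightarrow> U dx n j - U dx n (j + 1) \<le> \<beta> / (real (min n (nat j)) + 2)"
  proof (induction n arbitrary: j)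
    case 0 then show ?case using triv[of 0 j] by simp
  next
    case (Suc n)
    show ?case
    proof (cases "j = 0")
      case True then show ?thesis using triv[of "Suc n" j] by simp
    next
      case False
      define k where "k = min n (nat (j - 1))"
      have "U dx (Suc n) j - U dx (Suc n) (j + 1) \<le> \<beta> / (real (Suc k) + 2)"
      proof (rule drop_decay_step[OF dx])
        fix i assume "i \<in> {j - 1, j, j + 1}"
        then have i: "0 \<le> i" "k \<le> min n (nat i)" using Suc.prems False by (auto simp: k_def)
        show "U dx n i - U dx n (i + 1) \<le> \<beta> / (real k + 2)"
          by (rule order_trans[OF Suc.IH[OF i(1)] weaken[OF i(2)]])
      qed (use Suc.prems False in auto)
      moreover have "min (Suc n) (nat j) = Suc k" using Suc.prems False by (auto simp: k_def min_def)
      ultimately show ?thesis by simp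
    qed
  qed
  show "j \<le> -2 \<Longrightarrow> U dx n j - U dx n (j + 1) \<le> \<beta> / (real (min n (nat (-2 - j))) + 2)"
  proof (induction n arbitrary: j)
    case 0 then show ?case using triv[of 0 j] by simp
  next
    case (Suc n)
    show ?case
    proof (cases "j = -2")
      case True then show ?thesis using triv[of "Suc n" j] by simp
    next
      case False
      define k where "k = min n (nat (-3 - j))"
      have "U dx (Suc n) j - U dx (Suc n) (j + 1) \<le> \<beta> / (real (Suc k) + 2)"
      proof (rule drop_decay_step[OF dx])
        fix i assume "i \<in> {j - 1, j, j + 1}"
        then have i: "i \<le> -2" "k \<le> min n (nat (-2 - i))" using Suc.prems False by (auto simp: k_def)
        show "U dx n i - U dx n (i + 1) \<le> \<beta> / (real k + 2)"
          by (rule order_trans[OF Suc.IH[OF i(1)] weaken[OF i(2)]])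
      qed (use Suc.prems False in auto)
      moreover have "min (Suc n) (nat (-2 - j)) = Suc k" using Suc.prems False by (auto simp: k_def min_def)
      ultimately show ?thesis by simp
    qed
  qed
qed

text \<open>Sum of the drops between \<open>i\<close> and \<open>j\<close>, both on the same side of the constraint and at least \<open>J\<close> cells
away from it.\<close>

lemma one_sided_Lipschitz:
  assumes dx: "dx > 0" and ij: "i \<le> j" and J: "int J \<le> i \<or> j \<le> -1 - int J"
  shows "U dx n i - U dx n j \<le> of_int (j - i) * (\<beta> / (real (min n J) + 2))"
proof -
  have D: "U dx n l - U dx n (l + 1) \<le> \<beta> / (real (min n J) + 2)" if l: "i \<le> l" "l < j" for l
  proof -
    have weaken: "\<beta> / (real (min n m) + 2) \<le> \<beta> / (real (min n J) + 2)" if "J \<le> m" for m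
      using that \<beta>(1) by (intro divide_left_mono) auto
    show ?thesis
    proof (cases "int J \<le> i")
      case True
      then have "0 \<le> l" "J \<le> nat l" using l by auto
      then show ?thesis by (rule order_trans[OF drop_decay(1)[OF dx] weaken])
    next
      case False
      then have "l \<le> -2" "J \<le> nat (-2 - l)" using l J by auto
      then show ?thesis by (rule order_trans[OF drop_decay(2)[OF dx] weaken])
    qed
  qed
  have "m \<ge> i \<Longrightarrow> m \<le> j \<longrightarrow> U dx n i - U dx n m \<le> of_int (m - i) * (\<beta> / (real (min n J) + 2))" for m
  proof (induction m rule: int_ge_induct)
    case (step m)
    show ?case
    proof
      assume "m + 1 \<le> j"
      then show "U dx n i - U dx n (m + 1) \<le> of_int (m + 1 - i) * (\<beta> / (real (min n J) + 2))"
        using step D[of m] by (simp add: distrib_right left_diff_distrib add_divide_distrib diff_divide_distrib)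
    qed
  qed simp
  then show ?thesis using ij by blast
qed

end

section \<open>Convergence of primitives and of their slopes\<close>

lemma tendsto_floor_mult:
  fixes h :: "'p \<Rightarrow> real"
  assumes "(h \<longlongrightarrow> 0) F" and pos: "\<forall>\<^sub>F p in F. h p > 0"
  shows "((\<lambda>p. of_int \<lfloor>z / h p\<rfloor> * h p) \<longlongrightarrow> z) F"
proof (rule real_tendsto_sandwich)
  show "\<forall>\<^sub>F p in F. z - h p \<le> of_int \<lfloor>z / h p\<rfloor> * h p"
    using pos
  proof eventually_elim
    case (elim p)
    have "z / h p - 1 \<le> of_int \<lfloor>z / h p\<rfloor>" by linarith
    then have "(z / h p - 1) * h p \<le> of_int \<lfloor>z / h p\<rfloor> * h p" using elim by (intro mult_right_mono) auto
    then show ?case using elim by (simp add: left_diff_distrib)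
  qed
  show "\<forall>\<^sub>F p in F. of_int \<lfloor>z / h p\<rfloor> * h p \<le> z"
    using pos
  proof eventually_elim
    case (elim p)
    have "of_int \<lfloor>z / h p\<rfloor> * h p \<le> z / h p * h p" using elim by (intro mult_right_mono) auto
    then show ?case using elim by simp
  qed
  show "((\<lambda>p. z - h p) \<longlongrightarrow> z) F" using tendsto_diff[OF tendsto_const assms(1), of z] by simp
qed simp

lemma sum_of_increments:
  fixes V U :: "int \<Rightarrow> real"
  assumes "\<And>i. V (i + 1) - V i = h * U i"
  shows "V (j + int m) - V j = h * (\<Sum>i<m. U (j + int i))"
  using assms by (induction m) (auto simp: algebra_simps, smt (verit))

text \<open>The one-sided bound makes \<open>U\<close> almost nondecreasing: its value at \<open>j\<close> is at most its mean over a
window of length \<open>\<delta>\<close> to the right, and at least its mean over a window to the left, up to \<open>C \<delta>\<close>.  These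
means are difference quotients of \<open>V\<close>, which converge to those of \<open>P\<close>, and these in turn are close
to \<open>D\<close> for small \<open>\<delta>\<close>.  An arbitrary filter is allowed since the lemma is used along sequences of
meshes and also along pairs of a mesh and a time.\<close>

lemma one_sided_Lipschitz_slopes_converge:
  fixes F :: "'p filter" and h :: "'p \<Rightarrow> real" and V U :: "'p \<Rightarrow> int \<Rightarrow> real" and j :: "'p \<Rightarrow> int"
    and P :: "real \<Rightarrow> real"
  assumes h: "(h \<longlongrightarrow> 0) F" and pos: "\<forall>\<^sub>F p in F. h p > 0"
    and slope: "\<And>p i. V p (i + 1) - V p i = h p * U p i"
    and conv: "\<And>z i. \<bar>z - x\<bar> < d \<Longrightarrow> ((\<lambda>p. of_int (i p) * h p) \<longlongrightarrow> z) F \<Longrightarrow> ((\<lambda>p. V p (i p)) \<longlongrightarrow> P z) F"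
    and osl: "\<forall>\<^sub>F p in F. \<forall>i i'. i \<le> i' \<and> \<bar>of_int i * h p - x\<bar> < d \<and> \<bar>of_int i' * h p - x\<bar> < d
        \<longrightarrow> U p i - U p i' \<le> C * of_int (i' - i) * h p"
    and C: "C \<ge> 0" and d: "d > 0"
    and D: "(P has_real_derivative D) (at x)"
    and j: "((\<lambda>p. of_int (j p) * h p) \<longlongrightarrow> x) F"
  shows "((\<lambda>p. U p (j p)) \<longlongrightarrow> D) F"
proof -
  define q where "q \<delta> = (P (x + \<delta>) - P x) / \<delta>" for \<delta>
  have q: "(q \<longlongrightarrow> D) (at 0)" using D unfolding DERIV_def q_def .
  \<comment> \<open>An increment over a window of length about \<open>\<delta>\<close> compared with the slope at one of its ends.\<close>
  have window: "((\<lambda>p. (V p (j p + int (m p)) - V p (j p)) / (real (m p) * h p) + C * (real (m p) * h p)) \<longlongrightarrow> q \<delta> + C * \<delta>) F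
    \<and> ((\<lambda>p. (V p (j p) - V p (j p - int (m p))) / (real (m p) * h p) - C * (real (m p) * h p)) \<longlongrightarrow> q (-\<delta>) - C * \<delta>) F
    \<and> (\<forall>\<^sub>F p in F. U p (j p) \<le> (V p (j p + int (m p)) - V p (j p)) / (real (m p) * h p) + C * (real (m p) * h p))
    \<and> (\<forall>\<^sub>F p in F. (V p (j p) - V p (j p - int (m p))) / (real (m p) * h p) - C * (real (m p) * h p) \<le> U p (j p))"
    if \<delta>: "0 < \<delta>" "\<delta> < d / 2" and m: "m = (\<lambda>p. nat \<lfloor>\<delta> / h p\<rfloor>)" for \<delta> m
  proof -
    have m': "\<forall>\<^sub>F p in F. real (m p) = of_int \<lfloor>\<delta> / h p\<rfloor>"
      using pos by eventually_elim (use \<delta> in \<open>simp add: m\<close>)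
    have mh: "((\<lambda>p. real (m p) * h p) \<longlongrightarrow> \<delta>) F"
      using tendsto_floor_mult[OF h pos, of \<delta>]
      by (rule Lim_transform_eventually) (use m' in eventually_elim, simp)
    have up: "((\<lambda>p. of_int (j p + int (m p)) * h p) \<longlongrightarrow> x + \<delta>) F"
      using tendsto_add[OF j mh] by (simp add: distrib_right)
    have down: "((\<lambda>p. of_int (j p - int (m p)) * h p) \<longlongrightarrow> x - \<delta>) F"
      using tendsto_diff[OF j mh] by (simp add: left_diff_distrib)
    have Vj: "((\<lambda>p. V p (j p)) \<longlongrightarrow> P x) F" using conv[OF _ j] d by simp
    have 1: "((\<lambda>p. (V p (j p + int (m p)) - V p (j p)) / (real (m p) * h p) + C * (real (m p) * h p)) \<longlongrightarrow> q \<delta> + C * \<delta>) F"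
      unfolding q_def by (intro tendsto_intros conv[OF _ up] Vj mh) (use \<delta> in auto)
    have 2: "((\<lambda>p. (V p (j p) - V p (j p - int (m p))) / (real (m p) * h p) - C * (real (m p) * h p)) \<longlongrightarrow> (P x - P (x - \<delta>)) / \<delta> - C * \<delta>) F"
      by (intro tendsto_intros conv[OF _ down] Vj mh) (use \<delta> in auto)
    have "(P x - P (x - \<delta>)) / \<delta> = q (-\<delta>)" using \<delta> by (simp add: q_def field_simps)
    have mpos: "\<forall>\<^sub>F p in F. 0 < real (m p) * h p" by (rule order_tendstoD(1)[OF mh \<delta>(1)])
    have "\<forall>\<^sub>F p in F. real (m p) * h p < d / 2" by (rule order_tendstoD(2)[OF mh \<delta>(2)])
    moreover have "\<forall>\<^sub>F p in F. \<bar>of_int (j p) * h p - x\<bar> < d / 2"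
      using tendstoD[OF j, of "d / 2"] d by (simp add: dist_real_def)
    ultimately have near: "\<forall>\<^sub>F p in F. \<forall>i. \<bar>i\<bar> \<le> int (m p) \<longrightarrow> \<bar>of_int (j p + i) * h p - x\<bar> < d"
      using pos
    proof eventually_elim
      case (elim p)
      show ?case
      proof (intro allI impI)
        fix i assume "\<bar>i\<bar> \<le> int (m p)"
        then have "\<bar>of_int i :: real\<bar> \<le> real (m p)" by linarith
        then have "\<bar>of_int i\<bar> * h p \<le> real (m p) * h p" using elim(3) by (intro mult_right_mono) auto
        moreover have "\<bar>of_int i * h p\<bar> = \<bar>of_int i\<bar> * h p" using elim(3) by (simp add: abs_mult)
        ultimately have "\<bar>of_int i * h p\<bar> < d / 2" using elim(1) by linarith
        moreover have "of_int (j p + i) * h p - x = (of_int (j p) * h p - x) + of_int i * h p"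
          by (simp add: distrib_right)
        ultimately show "\<bar>of_int (j p + i) * h p - x\<bar> < d" using elim(2) by linarith
      qed
    qed
    have 3: "\<forall>\<^sub>F p in F. U p (j p) \<le> (V p (j p + int (m p)) - V p (j p)) / (real (m p) * h p) + C * (real (m p) * h p)"
      using near osl pos mpos
    proof eventually_elim
      case (elim p)
      have le: "U p (j p) - C * (real (m p) * h p) \<le> U p (j p + int i)" if "i < m p" for i
      proof -
        have "U p (j p) - U p (j p + int i) \<le> C * of_int (j p + int i - j p) * h p"
          using elim(1)[rule_format, of 0] elim(1)[rule_format, of "int i"] that
          by (intro elim(2)[rule_format]) auto
        also have "\<dots> \<le> C * real (m p) * h p"
          using C elim(3) that by (intro mult_right_mono mult_left_mono) auto
        finally show ?thesis by (simp add: mult.assoc)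
      qed
      have "real (m p) * (U p (j p) - C * (real (m p) * h p)) \<le> (\<Sum>i<m p. U p (j p + int i))"
        using sum_mono[of "{..<m p}" "\<lambda>_. U p (j p) - C * (real (m p) * h p)" "\<lambda>i. U p (j p + int i)"] le by simp
      then have "h p * (real (m p) * (U p (j p) - C * (real (m p) * h p))) \<le> V p (j p + int (m p)) - V p (j p)"
        unfolding sum_of_increments[where V = "V p" and U = "U p" and h = "h p", OF slope] using elim(3) by (intro mult_left_mono) auto
      then have "(real (m p) * h p) * (U p (j p) - C * (real (m p) * h p)) \<le> V p (j p + int (m p)) - V p (j p)"
        by (simp only: mult.assoc mult.left_commute)
      then have "U p (j p) - C * (real (m p) * h p) \<le> (V p (j p + int (m p)) - V p (j p)) / (real (m p) * h p)"
        using elim(4) by (simp only: pos_le_divide_eq mult.commute)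
      then show ?case by linarith
    qed
    have 4: "\<forall>\<^sub>F p in F. (V p (j p) - V p (j p - int (m p))) / (real (m p) * h p) - C * (real (m p) * h p) \<le> U p (j p)"
      using near osl pos mpos
    proof eventually_elim
      case (elim p)
      let ?a = "j p - int (m p)"
      have le: "U p (?a + int i) \<le> U p (j p) + C * (real (m p) * h p)" if "i < m p" for i
      proof -
        have "U p (?a + int i) - U p (j p) \<le> C * of_int (j p - (?a + int i)) * h p"
          using elim(1)[rule_format, of 0] elim(1)[rule_format, of "int i - int (m p)"] that
          by (intro elim(2)[rule_format]) (auto simp: algebra_simps)
        also have "\<dots> \<le> C * real (m p) * h p"
          using C elim(3) that by (intro mult_right_mono mult_left_mono) auto
        finally show ?thesis by (simp add: mult.assoc)
      qed
      have "(\<Sum>i<m p. U p (?a + int i)) \<le> real (m p) * (U p (j p) + C * (real (m p) * h p))"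
        using sum_mono[of "{..<m p}" "\<lambda>i. U p (?a + int i)" "\<lambda>_. U p (j p) + C * (real (m p) * h p)"] le by simp
      then have "V p (?a + int (m p)) - V p ?a \<le> h p * (real (m p) * (U p (j p) + C * (real (m p) * h p)))"
        unfolding sum_of_increments[where V = "V p" and U = "U p" and h = "h p", OF slope] using elim(3) by (intro mult_left_mono) auto
      then have "V p (j p) - V p ?a \<le> (real (m p) * h p) * (U p (j p) + C * (real (m p) * h p))"
        by (simp add: mult.assoc mult.left_commute)
      then have "(V p (j p) - V p ?a) / (real (m p) * h p) \<le> U p (j p) + C * (real (m p) * h p)"
        using elim(4) by (simp only: pos_divide_le_eq mult.commute)
      then show ?case by linarith
    qed
    show ?thesis using 1 2 3 4 unfolding \<open>(P x - P (x - \<delta>)) / \<delta> = q (-\<delta>)\<close> by blast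
  qed
  show ?thesis
  proof (rule order_tendstoI)
    fix a assume "D < a"
    have "((\<lambda>\<delta>. q \<delta> + C * \<delta>) \<longlongrightarrow> D + C * 0) (at_right 0)"
      by (intro tendsto_intros filterlim_mono[OF q]) (auto simp: at_le)
    then have "\<forall>\<^sub>F \<delta> in at_right 0. q \<delta> + C * \<delta> < a" by (rule order_tendstoD) (use \<open>D < a\<close> in simp)
    moreover have "\<forall>\<^sub>F \<delta> in at_right (0::real). \<delta> \<in> {0<..<d / 2}"
      using d by (intro eventually_at_rightI[of 0 "d / 2"]) auto
    ultimately have "\<forall>\<^sub>F \<delta> in at_right (0::real). q \<delta> + C * \<delta> < a \<and> \<delta> \<in> {0<..<d / 2}" by eventually_elim blast
    then obtain \<delta> where \<delta>: "q \<delta> + C * \<delta> < a" "0 < \<delta>" "\<delta> < d / 2"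
      using eventually_happens'[OF trivial_limit_at_right_real] by fastforce
    note w = window[OF \<delta>(2,3) refl]
    show "\<forall>\<^sub>F p in F. U p (j p) < a"
      using order_tendstoD(2)[OF conjunct1[OF w] \<delta>(1)] w[THEN conjunct2, THEN conjunct2, THEN conjunct1]
      by eventually_elim (erule (1) le_less_trans[rotated])
  next
    fix a assume "a < D"
    have q': "((\<lambda>\<delta>. q (-\<delta>)) \<longlongrightarrow> D) (at_right 0)"
    proof (rule filterlim_compose[OF q])
      have "((\<lambda>x::real. - x) \<longlongrightarrow> - 0) (at_right 0)" by (intro tendsto_intros)
      then show "filterlim uminus (at (0::real)) (at_right 0)"
        by (auto simp: filterlim_at eventually_at_filter)
    qed
    have "((\<lambda>\<delta>. q (-\<delta>) - C * \<delta>) \<longlongrightarrow> D - C * 0) (at_right 0)"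
      by (intro tendsto_intros q')
    then have "\<forall>\<^sub>F \<delta> in at_right 0. a < q (-\<delta>) - C * \<delta>" by (rule order_tendstoD) (use \<open>a < D\<close> in simp)
    moreover have "\<forall>\<^sub>F \<delta> in at_right (0::real). \<delta> \<in> {0<..<d / 2}"
      using d by (intro eventually_at_rightI[of 0 "d / 2"]) auto
    ultimately have "\<forall>\<^sub>F \<delta> in at_right (0::real). a < q (-\<delta>) - C * \<delta> \<and> \<delta> \<in> {0<..<d / 2}" by eventually_elim blast
    then obtain \<delta> where \<delta>: "a < q (-\<delta>) - C * \<delta>" "0 < \<delta>" "\<delta> < d / 2"
      using eventually_happens'[OF trivial_limit_at_right_real] by fastforce
    note w = window[OF \<delta>(2,3) refl]
    show "\<forall>\<^sub>F p in F. a < U p (j p)"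
      using order_tendstoD(1)[OF w[THEN conjunct2, THEN conjunct1] \<delta>(1)] w[THEN conjunct2, THEN conjunct2, THEN conjunct2]
      by eventually_elim (erule (1) less_le_trans)
  qed
qed

text \<open>Arzela-Ascoli for functions on shrinking grids.  A diagonal subsequence converges at the rational
points; the Lipschitz bound, with an error of the order of the mesh, carries convergence to all
points.\<close>

lemma equi_Lipschitz_grid_functions_subsequence:
  fixes G :: "nat \<Rightarrow> nat \<Rightarrow> int \<Rightarrow> real" and dx :: "nat \<Rightarrow> real"
  assumes dx: "\<And>k. dx k > 0" "dx \<longlonglongrightarrow> 0" and lam: "lam > 0"
    and lip: "\<And>k n m i j. \<bar>G k n i - G k m j\<bar> \<le> C * (dx k * (\<bar>real n - real m\<bar> + \<bar>of_int i - of_int j\<bar>))"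
    and bound: "\<And>k i. \<bar>G k 0 i\<bar> \<le> M"
  obtains r P where "strict_mono (r :: nat \<Rightarrow> nat)"
    "\<And>x t. 0 \<le> t \<Longrightarrow> (\<lambda>k. G (r k) (nat \<lfloor>t / (lam * dx (r k))\<rfloor>) \<lfloor>x / dx (r k)\<rfloor>) \<longlonglongrightarrow> P x t"
proof -
  define g where "g k x t = G k (nat \<lfloor>t / (lam * dx k)\<rfloor>) \<lfloor>x / dx k\<rfloor>" for k x t
  have C: "0 \<le> C"
  proof (rule ccontr)
    assume "\<not> 0 \<le> C"
    then have "C * (dx 0 * (\<bar>real 0 - real 0\<bar> + \<bar>of_int 1 - of_int 0\<bar>)) < 0"
      using dx(1)[of 0] by (simp add: mult_neg_pos)
    then show False using lip[of 0 0 1 0 0] by linarith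
  qed
  have nat_floor: "\<bar>real (nat \<lfloor>a\<rfloor>) - a\<bar> \<le> 1" if "0 \<le> a" for a :: real using that by linarith
  have g_lip: "\<bar>g k x t - g k x' t'\<bar> \<le> C * (\<bar>t - t'\<bar> / lam + \<bar>x - x'\<bar> + 4 * dx k)"
    if "0 \<le> t" "0 \<le> t'" for k x t x' t'
  proof -
    let ?n = "nat \<lfloor>t / (lam * dx k)\<rfloor>" and ?n' = "nat \<lfloor>t' / (lam * dx k)\<rfloor>"
    have l: "lam * dx k > 0" using lam dx(1)[of k] by simp
    have n: "\<bar>real ?n - real ?n'\<bar> \<le> \<bar>t - t'\<bar> / (lam * dx k) + 2"
    proof -
      have "\<bar>real ?n - t / (lam * dx k)\<bar> \<le> 1" "\<bar>real ?n' - t' / (lam * dx k)\<bar> \<le> 1"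
        using that l by (intro nat_floor divide_nonneg_nonneg; simp)+
      moreover have "\<bar>t / (lam * dx k) - t' / (lam * dx k)\<bar> = \<bar>t - t'\<bar> / (lam * dx k)"
        using l by (simp flip: diff_divide_distrib)
      moreover have "\<bar>u - v\<bar> \<le> e + 2" if "\<bar>u - u'\<bar> \<le> 1" "\<bar>v - v'\<bar> \<le> 1" "\<bar>u' - v'\<bar> = e" for u v u' v' e :: real
        using that by linarith
      ultimately show ?thesis by blast
    qed
    have i: "\<bar>of_int \<lfloor>x / dx k\<rfloor> - of_int \<lfloor>x' / dx k\<rfloor>\<bar> \<le> \<bar>x - x'\<bar> / dx k + 2"
    proof -
      have "\<bar>x / dx k - x' / dx k\<bar> = \<bar>x - x'\<bar> / dx k"
        using dx(1)[of k] by (simp flip: diff_divide_distrib)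
      then show ?thesis by linarith
    qed
    have "\<bar>g k x t - g k x' t'\<bar> \<le> C * (dx k * (\<bar>real ?n - real ?n'\<bar> + \<bar>of_int \<lfloor>x / dx k\<rfloor> - of_int \<lfloor>x' / dx k\<rfloor>\<bar>))"
      unfolding g_def by (rule lip)
    also have "\<dots> \<le> C * (dx k * (\<bar>t - t'\<bar> / (lam * dx k) + 2 + (\<bar>x - x'\<bar> / dx k + 2)))"
      using C dx(1)[of k] n i by (intro mult_left_mono) auto
    also have "dx k * (\<bar>t - t'\<bar> / (lam * dx k) + 2 + (\<bar>x - x'\<bar> / dx k + 2)) = \<bar>t - t'\<bar> / lam + \<bar>x - x'\<bar> + 4 * dx k"
      using dx(1)[of k] lam by (simp add: field_simps)
    finally show ?thesis .
  qed
  \<comment> \<open>The bound of \<open>g\<close> grows with time; the factor \<open>1/(1 + t)\<close> in \<open>w\<close> below makes it uniform.\<close>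
  obtain B where B: "\<And>k. dx k \<le> B"
    using convergent_imp_Bseq[OF convergentI[OF dx(2)]] by (auto simp: Bseq_def abs_le_iff)
  have g_bound: "\<bar>g k x t\<bar> \<le> M + C * (t / lam + 4 * B)" if "0 \<le> t" for k x t
  proof -
    have "\<bar>g k x 0\<bar> \<le> M" using bound by (simp add: g_def)
    moreover have "\<bar>g k x t - g k x 0\<bar> \<le> C * (t / lam + 4 * dx k)" using g_lip[of t 0 k x x] that by simp
    moreover have "C * (t / lam + 4 * dx k) \<le> C * (t / lam + 4 * B)"
      using B C by (intro mult_left_mono) auto
    ultimately show ?thesis by linarith
  qed
  define Rpos where "Rpos = (\<rat> \<times> (\<rat> \<inter> {0..}) :: (real \<times> real) set)"
  define w where "w k z = g k (fst z) (snd z) / (1 + snd z)" for k z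
  have "countable Rpos" unfolding Rpos_def using countable_rat by (intro countable_SIGMA) auto
  moreover have "norm (w k z) \<le> \<bar>M\<bar> + C * (1 / lam + 4 * \<bar>B\<bar>)" if "z \<in> Rpos" for k z
  proof -
    have t: "0 \<le> snd z" using that by (auto simp: Rpos_def)
    have "\<bar>g k (fst z) (snd z)\<bar> \<le> M + C * (snd z / lam + 4 * B)" by (rule g_bound[OF t])
    also have "\<dots> \<le> (\<bar>M\<bar> + C * (1 / lam + 4 * \<bar>B\<bar>)) * (1 + snd z)"
    proof -
      have "snd z / lam + 4 * B \<le> (1 / lam + 4 * \<bar>B\<bar>) * (1 + snd z)"
        using t lam by (simp add: algebra_simps) (smt (verit) divide_nonneg_pos mult_nonneg_nonneg)
      then have "C * (snd z / lam + 4 * B) \<le> C * ((1 / lam + 4 * \<bar>B\<bar>) * (1 + snd z))"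
        by (rule mult_left_mono[OF _ C])
      moreover have "M \<le> \<bar>M\<bar> * (1 + snd z)" using t by (simp add: distrib_left) (smt (verit) mult_nonneg_nonneg)
      ultimately show ?thesis by (simp only: distrib_right mult.assoc)
    qed
    finally show ?thesis using t by (simp add: w_def pos_divide_le_eq)
  qed
  ultimately obtain r where r: "strict_mono (r :: nat \<Rightarrow> nat)" "\<And>z. z \<in> Rpos \<Longrightarrow> \<exists>l. (\<lambda>k. w (r k) z) \<longlonglongrightarrow> l"
    using function_convergent_subsequence[of Rpos w] by metis
  have dxr: "(\<lambda>k. dx (r k)) \<longlonglongrightarrow> 0" using LIMSEQ_subseq_LIMSEQ[OF dx(2) r(1)] by (simp add: o_def)
  have rat: "Cauchy (\<lambda>k. g (r k) x t)" if xt: "x \<in> \<rat>" "t \<in> \<rat>" "0 \<le> t" for x t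
  proof -
    obtain l where "(\<lambda>k. w (r k) (x, t)) \<longlonglongrightarrow> l" using r(2)[of "(x, t)"] xt by (auto simp: Rpos_def)
    then have "(\<lambda>k. w (r k) (x, t) * (1 + t)) \<longlonglongrightarrow> l * (1 + t)" by (intro tendsto_intros)
    moreover have "(\<lambda>k. w (r k) (x, t) * (1 + t)) = (\<lambda>k. g (r k) x t)" using xt by (simp add: w_def)
    ultimately show ?thesis using LIMSEQ_imp_Cauchy by metis
  qed
  have "Cauchy (\<lambda>k. g (r k) x t)" if t: "0 \<le> t" for x t
  proof (rule metric_CauchyI)
    fix e :: real assume "e > 0"
    define d where "d = e / (8 * (C + 1) * (1 / lam + 5))"
    have dpos: "d > 0" using \<open>e > 0\<close> C lam unfolding d_def
      by (intro divide_pos_pos mult_pos_pos add_nonneg_pos) auto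
    obtain x' where x': "x' \<in> \<rat>" "x < x'" "x' < x + d" using Rats_dense_in_real[of x "x + d"] dpos by auto
    obtain t' where t': "t' \<in> \<rat>" "t < t'" "t' < t + d" using Rats_dense_in_real[of t "t + d"] dpos by auto
    have "Cauchy (\<lambda>k. g (r k) x' t')" using rat x' t' t by auto
    then obtain N1 where N1: "\<And>m n. m \<ge> N1 \<Longrightarrow> n \<ge> N1 \<Longrightarrow> dist (g (r m) x' t') (g (r n) x' t') < e / 2"
      using metric_CauchyD[of _ "e / 2"] \<open>e > 0\<close> by (metis half_gt_zero)
    have "\<forall>\<^sub>F k in sequentially. dx (r k) < d" by (rule order_tendstoD(2)[OF dxr dpos])
    then obtain N2 where N2: "\<And>k. k \<ge> N2 \<Longrightarrow> dx (r k) < d" by (auto simp: eventually_sequentially)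
    have close: "\<bar>g (r k) x t - g (r k) x' t'\<bar> \<le> e / 8" if "k \<ge> N2" for k
    proof -
      have "\<bar>g (r k) x t - g (r k) x' t'\<bar> \<le> C * (\<bar>t - t'\<bar> / lam + \<bar>x - x'\<bar> + 4 * dx (r k))"
        by (rule g_lip) (use t t' in auto)
      also have "\<dots> \<le> C * (d / lam + d + 4 * d)"
        using C x' t' N2[OF that] lam by (intro mult_left_mono add_mono divide_right_mono) auto
      also have "\<dots> = C * (d * (1 / lam + 5))" by (simp add: algebra_simps)
      also have "\<dots> \<le> (C + 1) * (d * (1 / lam + 5))" using dpos lam by (intro mult_right_mono) auto
      also have "\<dots> = e / 8"
      proof -
        have "C + 1 \<noteq> 0" "1 / lam + 5 \<noteq> 0" using C lam by (auto simp: add_nonneg_eq_0_iff)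
        moreover have "A * (e / (8 * A * K) * K) = e / 8" if "A \<noteq> 0" "K \<noteq> 0" for A K :: real
          using that by (simp add: field_simps)
        ultimately show ?thesis unfolding d_def by blast
      qed
      finally show ?thesis .
    qed
    have "dist (g (r m) x t) (g (r n) x t) < e" if "m \<ge> max N1 N2" "n \<ge> max N1 N2" for m n
    proof -
      have "\<bar>g (r m) x t - g (r m) x' t'\<bar> \<le> e / 8" "\<bar>g (r n) x t - g (r n) x' t'\<bar> \<le> e / 8"
        "\<bar>g (r m) x' t' - g (r n) x' t'\<bar> < e / 2"
        using close N1 that unfolding dist_real_def by auto
      then show ?thesis using \<open>e > 0\<close> unfolding dist_real_def by linarith
    qed
    then show "\<exists>N. \<forall>m\<ge>N. \<forall>n\<ge>N. dist (g (r m) x t) (g (r n) x t) < e" by blast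
  qed
  then have "(\<lambda>k. g (r k) x t) \<longlonglongrightarrow> lim (\<lambda>k. g (r k) x t)" if "0 \<le> t" for x t
    using that by (simp add: Cauchy_convergent_iff convergent_LIMSEQ_iff)
  then show ?thesis by (intro that[OF r(1), of "\<lambda>x t. lim (\<lambda>k. g (r k) x t)"]) (simp add: g_def)
qed

lemma cumulative_has_integral:
  fixes h :: "real \<Rightarrow> real"
  assumes h: "integrable lebesgue h" and "a \<le> b"
  shows "(h has_integral ((LINT z:{..b}|lebesgue. h z) - (LINT z:{..a}|lebesgue. h z))) {a..b}"
    and "(LINT z:{..b}|lebesgue. h z) - (LINT z:{..a}|lebesgue. h z) = (LINT z:{a<..<b}|lebesgue. h z)"
proof -
  have I: "set_integrable lebesgue A h" if "A \<in> sets lebesgue" for A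
    unfolding set_integrable_def using integrable_mult_indicator[OF that h] by simp
  have "{..b} = {..a} \<union> {a<..b}" using \<open>a \<le> b\<close> by auto
  then have "(LINT z:{..b}|lebesgue. h z) = (LINT z:{..a}|lebesgue. h z) + (LINT z:{a<..b}|lebesgue. h z)"
    by (simp only:) (rule set_integral_Un; use I in auto)
  moreover have "(LINT z:{a<..b}|lebesgue. h z) = (LINT z:{a<..<b}|lebesgue. h z)"
    "(LINT z:{a..b}|lebesgue. h z) = (LINT z:{a<..<b}|lebesgue. h z)"
  proof -
    have ae: "AE z in lebesgue. z \<noteq> a \<and> z \<noteq> b"
      using AE_lborel_singleton[of a] AE_lborel_singleton[of b] by (simp add: AE_completion_iff)
    have ae1: "AE z in lebesgue. z \<in> {a<..<b} \<longleftrightarrow> z \<in> {a<..b}" using ae by eventually_elim auto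
    have ae2: "AE z in lebesgue. z \<in> {a<..<b} \<longleftrightarrow> z \<in> {a..b}" using ae by eventually_elim auto
    have meas: "set_borel_measurable lebesgue A h" if "A \<in> sets lebesgue" for A
      using I[OF that] by (simp add: set_integrable_def set_borel_measurable_def borel_measurable_integrable)
    show "(LINT z:{a<..b}|lebesgue. h z) = (LINT z:{a<..<b}|lebesgue. h z)"
      by (rule set_integral_cong_set[OF meas meas ae1]) auto
    show "(LINT z:{a..b}|lebesgue. h z) = (LINT z:{a<..<b}|lebesgue. h z)"
      by (rule set_integral_cong_set[OF meas meas ae2]) auto
  qed
  moreover have "(h has_integral (LINT z:{a..b}|lebesgue. h z)) {a..b}"
    by (rule has_integral_set_lebesgue) (use I in auto)
  ultimately show "(h has_integral ((LINT z:{..b}|lebesgue. h z) - (LINT z:{..a}|lebesgue. h z))) {a..b}"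
    and "(LINT z:{..b}|lebesgue. h z) - (LINT z:{..a}|lebesgue. h z) = (LINT z:{a<..<b}|lebesgue. h z)"
    by simp_all
qed

lemma floor_mult_close:
  fixes h :: real
  assumes "h > 0"
  shows "\<bar>of_int \<lfloor>z / h\<rfloor> * h - z\<bar> \<le> h" and "0 \<le> z \<Longrightarrow> \<bar>real (nat \<lfloor>z / h\<rfloor>) * h - z\<bar> \<le> h"
proof -
  have "of_int \<lfloor>z / h\<rfloor> * h \<le> z / h * h" using assms by (intro mult_right_mono) auto
  moreover have "(z / h - 1) * h \<le> of_int \<lfloor>z / h\<rfloor> * h"
    using assms by (intro mult_right_mono) linarith+
  ultimately show 1: "\<bar>of_int \<lfloor>z / h\<rfloor> * h - z\<bar> \<le> h"
    using assms by (simp add: left_diff_distrib abs_le_iff)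
  assume "0 \<le> z"
  then have "0 \<le> \<lfloor>z / h\<rfloor>" using assms by simp
  then show "\<bar>real (nat \<lfloor>z / h\<rfloor>) * h - z\<bar> \<le> h" using 1 by simp
qed

context moving_constraint begin

text \<open>The discrete primitive of the density, at edge \<open>j\<close>: the mass left of the edge.  It changes in time by
the flux through that edge.\<close>

primrec H :: "real \<Rightarrow> nat \<Rightarrow> int \<Rightarrow> real" where
  "H dx 0 j = (LINT z:{..of_int j * dx}|lebesgue. \<rho>\<^sub>o (z + y\<^sub>o))"
| "H dx (Suc n) j = H dx n j - lam * dx * E (S dx n) j (U dx n (j - 1)) (U dx n j)"

lemma H_slope:
  assumes dx: "dx > 0"
  shows "H dx n (j + 1) - H dx n j = dx * U dx n j"
proof (induction n)
  case 0
  have "of_int j * dx \<le> of_int (j + 1) * dx" using dx by (intro mult_right_mono) auto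
  from cumulative_has_integral(2)[OF integrable_shifted this] show ?case
    using dx by (simp add: U_0 cell_mean_def cell_def)
next
  case (Suc n)
  have "H dx (Suc n) (j + 1) - H dx (Suc n) j = (H dx n (j + 1) - H dx n j)
     - lam * dx * (E (S dx n) (j + 1) (U dx n j) (U dx n (j + 1)) - E (S dx n) j (U dx n (j - 1)) (U dx n j))"
    by (simp add: algebra_simps)
  then show ?case unfolding Suc U_Suc_eq by (simp add: algebra_simps)
qed

lemma H_space:
  assumes dx: "dx > 0" and "i \<le> j"
  shows "0 \<le> H dx n j - H dx n i" "H dx n j - H dx n i \<le> R * (dx * of_int (j - i))"
proof -
  define m where "m = nat (j - i)"
  have j: "j = i + int m" using \<open>i \<le> j\<close> by (simp add: m_def)
  have eq: "H dx n j - H dx n i = dx * (\<Sum>l<m. U dx n (i + int l))"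
    unfolding j by (rule sum_of_increments[where V = "H dx n" and U = "U dx n"]) (rule H_slope[OF dx])
  show "0 \<le> H dx n j - H dx n i"
    unfolding eq using dx U_range[OF dx] by (intro mult_nonneg_nonneg sum_nonneg) auto
  have "(\<Sum>l<m. U dx n (i + int l)) \<le> real m * R"
    using sum_mono[of "{..<m}" "\<lambda>l. U dx n (i + int l)" "\<lambda>_. R"] U_range[OF dx] by simp
  then have "dx * (\<Sum>l<m. U dx n (i + int l)) \<le> dx * (real m * R)" using dx by (intro mult_left_mono) auto
  then show "H dx n j - H dx n i \<le> R * (dx * of_int (j - i))"
    unfolding eq by (simp add: j mult_ac)
qed

lemma H_time:
  assumes dx: "dx > 0"
  shows "\<bar>H dx (n + m) j - H dx n j\<bar> \<le> 2 * R * (dx * real m)"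
proof (induction m)
  case (Suc m)
  have "\<bar>E (S dx (n + m)) j (U dx (n + m) (j - 1)) (U dx (n + m) j)\<bar> \<le> 2 * R / lam"
    using edge_flux_bound(1)[OF S_range[OF dx] U_range[OF dx] U_range[OF dx]] .
  then have "lam * dx * \<bar>E (S dx (n + m)) j (U dx (n + m) (j - 1)) (U dx (n + m) j)\<bar> \<le> lam * dx * (2 * R / lam)"
    using lam dx by (intro mult_left_mono) auto
  then have "\<bar>H dx (n + Suc m) j - H dx (n + m) j\<bar> \<le> 2 * R * dx"
    using lam dx by (simp add: abs_mult mult_ac)
  then show ?case using Suc by (simp add: algebra_simps)
qed simp

lemma H_lipschitz:
  assumes dx: "dx > 0"
  shows "\<bar>H dx n i - H dx m j\<bar> \<le> 2 * R * (dx * (\<bar>real n - real m\<bar> + \<bar>of_int i - of_int j\<bar>))"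
proof -
  have "\<bar>H dx n i - H dx m i\<bar> \<le> 2 * R * (dx * \<bar>real n - real m\<bar>)"
  proof (cases "n \<le> m")
    case True
    then show ?thesis using H_time[OF dx, of n "m - n" i] by (simp add: of_nat_diff abs_minus_commute)
  next
    case False
    then show ?thesis using H_time[OF dx, of m "n - m" i] by (simp add: of_nat_diff)
  qed
  moreover have "\<bar>H dx m i - H dx m j\<bar> \<le> R * (dx * \<bar>of_int i - of_int j\<bar>)"
  proof (cases "i \<le> j")
    case True
    then show ?thesis using H_space[OF dx True, of m] by (simp add: abs_minus_commute)
  next
    case False
    then show ?thesis using H_space[OF dx, of j i m] by simp
  qed
  moreover have "R * (dx * \<bar>of_int i - of_int j\<bar>) \<le> 2 * R * (dx * \<bar>of_int i - of_int j\<bar>)"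
    using R dx by simp
  ultimately show ?thesis unfolding distrib_left by linarith
qed

lemma H_bound: "dx > 0 \<Longrightarrow> \<bar>H dx 0 i\<bar> \<le> (LINT z|lebesgue. \<bar>\<rho>\<^sub>o (z + y\<^sub>o)\<bar>)"
proof -
  have "set_integrable lebesgue {..of_int i * dx} (\<lambda>z. \<rho>\<^sub>o (z + y\<^sub>o))"
    unfolding set_integrable_def using integrable_mult_indicator[OF _ integrable_shifted] by simp
  then have "\<bar>H dx 0 i\<bar> \<le> (LINT z:{..of_int i * dx}|lebesgue. \<bar>\<rho>\<^sub>o (z + y\<^sub>o)\<bar>)"
    using set_integral_norm_bound by fastforce
  also have "\<dots> \<le> (LINT z|lebesgue. \<bar>\<rho>\<^sub>o (z + y\<^sub>o)\<bar>)"
    unfolding set_lebesgue_integral_def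
    using integrable_shifted by (intro integral_mono integrable_mult_indicator) (auto simp: indicator_def)
  finally show ?thesis .
qed

end

text \<open>A sequence of meshes along which the discrete primitives converge everywhere, to \<open>P\<close>.\<close>

locale scheme_limit = moving_constraint +
  fixes dx :: "nat \<Rightarrow> real" and P :: "real \<Rightarrow> real \<Rightarrow> real"
  assumes dx: "\<And>k. dx k > 0" and dx0: "dx \<longlonglongrightarrow> 0"
    and H_pointwise: "\<And>x t. 0 \<le> t \<Longrightarrow> (\<lambda>k. H (dx k) (nat \<lfloor>t / (lam * dx k)\<rfloor>) \<lfloor>x / dx k\<rfloor>) \<longlonglongrightarrow> P x t"

lemma (in moving_constraint) scheme_limit_exists:
  assumes "\<And>k. dx k > 0" and "dx \<longlonglongrightarrow> 0"
  obtains r P where "strict_mono r"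
    "scheme_limit R \<alpha> lam smax y\<^sub>o f f' \<omega> Q \<mu> \<rho>\<^sub>o p FF GG C\<omega> CQ (\<lambda>k. dx (r k)) P"
proof -
  obtain r P where r: "strict_mono (r :: nat \<Rightarrow> nat)"
    "\<And>x t. 0 \<le> t \<Longrightarrow> (\<lambda>k. H (dx (r k)) (nat \<lfloor>t / (lam * dx (r k))\<rfloor>) \<lfloor>x / dx (r k)\<rfloor>) \<longlonglongrightarrow> P x t"
    using equi_Lipschitz_grid_functions_subsequence[of dx lam "\<lambda>k. H (dx k)", OF assms lam H_lipschitz H_bound] assms(1)
    by blast
  have "(\<lambda>k. dx (r k)) \<longlonglongrightarrow> 0" using LIMSEQ_subseq_LIMSEQ[OF assms(2) r(1)] by (simp add: o_def)
  then have "scheme_limit R \<alpha> lam smax y\<^sub>o f f' \<omega> Q \<mu> \<rho>\<^sub>o p FF GG C\<omega> CQ (\<lambda>k. dx (r k)) P"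
    using assms(1) r(2) by unfold_locales auto
  then show ?thesis using that r(1) by blast
qed

context scheme_limit begin

definition dt :: "nat \<Rightarrow> real" where "dt k = lam * dx k"

lemma dt: "dt k > 0" "dt \<longlonglongrightarrow> 0"
  using lam dx tendsto_mult_right[OF dx0, of lam] by (auto simp: dt_def[abs_def])

text \<open>By equicontinuity the primitives converge along arbitrary grid points that approach \<open>(x, t)\<close>, also
when the mesh and the point vary together.\<close>

lemma H_tendsto:
  assumes k: "filterlim k sequentially F" and t: "0 \<le> t"
    and n: "((\<lambda>p. real (n p) * dt (k p)) \<longlongrightarrow> t) F" and i: "((\<lambda>p. of_int (i p) * dx (k p)) \<longlongrightarrow> x) F"
  shows "((\<lambda>p. H (dx (k p)) (n p) (i p)) \<longlongrightarrow> P x t) F"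
proof -
  let ?H0 = "\<lambda>k. H (dx k) (nat \<lfloor>t / dt k\<rfloor>) \<lfloor>x / dx k\<rfloor>"
  have "((\<lambda>p. ?H0 (k p)) \<longlongrightarrow> P x t) F"
    by (rule filterlim_compose[OF _ k]) (use H_pointwise[OF t, of x] in \<open>simp add: dt_def\<close>)
  moreover have "((\<lambda>p. H (dx (k p)) (n p) (i p) - ?H0 (k p)) \<longlongrightarrow> 0) F"
  proof (rule Lim_null_comparison)
    have dxk: "((\<lambda>p. dx (k p)) \<longlongrightarrow> 0) F" by (rule filterlim_compose[OF dx0 k])
    have "((\<lambda>p. 2 * R * (\<bar>real (n p) * dt (k p) - t\<bar> / lam + dx (k p) + (\<bar>of_int (i p) * dx (k p) - x\<bar> + dx (k p))))
        \<longlongrightarrow> 2 * R * (\<bar>t - t\<bar> / lam + 0 + (\<bar>x - x\<bar> + 0))) F"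
      using lam by (intro tendsto_intros n i dxk) auto
    then show "((\<lambda>p. 2 * R * (\<bar>real (n p) * dt (k p) - t\<bar> / lam + dx (k p) + (\<bar>of_int (i p) * dx (k p) - x\<bar> + dx (k p)))) \<longlongrightarrow> 0) F"
      by simp
    have "norm (H (dx K) N I - ?H0 K) \<le> 2 * R * (\<bar>real N * dt K - t\<bar> / lam + dx K + (\<bar>of_int I * dx K - x\<bar> + dx K))" for K N I
    proof -
      have "dx K * \<bar>real N - real (nat \<lfloor>t / dt K\<rfloor>)\<bar> = \<bar>real N * dt K - real (nat \<lfloor>t / dt K\<rfloor>) * dt K\<bar> / lam"
        using lam dx[of K] by (simp add: dt_def abs_mult flip: left_diff_distrib)
      also have "\<dots> \<le> (\<bar>real N * dt K - t\<bar> + dt K) / lam"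
        using floor_mult_close(2)[OF dt(1) t, of K] lam by (intro divide_right_mono) linarith+
      also have "\<dots> = \<bar>real N * dt K - t\<bar> / lam + dx K" using lam by (simp add: add_divide_distrib dt_def)
      finally have 1: "dx K * \<bar>real N - real (nat \<lfloor>t / dt K\<rfloor>)\<bar> \<le> \<bar>real N * dt K - t\<bar> / lam + dx K" .
      have "dx K * \<bar>of_int I - of_int \<lfloor>x / dx K\<rfloor>\<bar> = \<bar>of_int I * dx K - of_int \<lfloor>x / dx K\<rfloor> * dx K\<bar>"
        using dx[of K] by (simp add: abs_mult flip: left_diff_distrib)
      also have "\<dots> \<le> \<bar>of_int I * dx K - x\<bar> + dx K"
        using floor_mult_close(1)[OF dx, of x K] by linarith
      finally have 2: "dx K * \<bar>of_int I - of_int \<lfloor>x / dx K\<rfloor>\<bar> \<le> \<bar>of_int I * dx K - x\<bar> + dx K" .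
      have "norm (H (dx K) N I - ?H0 K) \<le> 2 * R * (dx K * (\<bar>real N - real (nat \<lfloor>t / dt K\<rfloor>)\<bar> + \<bar>of_int I - of_int \<lfloor>x / dx K\<rfloor>\<bar>))"
        unfolding real_norm_def by (rule H_lipschitz[OF dx])
      also have "\<dots> \<le> 2 * R * (\<bar>real N * dt K - t\<bar> / lam + dx K + (\<bar>of_int I * dx K - x\<bar> + dx K))"
        unfolding distrib_left[of "dx K"] using R 1 2 by (intro mult_left_mono add_mono) auto
      finally show ?thesis .
    qed
    then show "\<forall>\<^sub>F p in F. norm (H (dx (k p)) (n p) (i p) - ?H0 (k p))
        \<le> 2 * R * (\<bar>real (n p) * dt (k p) - t\<bar> / lam + dx (k p) + (\<bar>of_int (i p) * dx (k p) - x\<bar> + dx (k p)))"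
      by (intro always_eventually allI)
  qed
  ultimately show ?thesis using tendsto_add by fastforce
qed

lemma P_increment:
  assumes t: "0 \<le> t" and "x \<le> y"
  shows "0 \<le> P y t - P x t" "P y t - P x t \<le> R * (y - x)"
proof -
  let ?n = "\<lambda>k. nat \<lfloor>t / dt k\<rfloor>"
  have lim: "(\<lambda>k. H (dx k) (?n k) \<lfloor>y / dx k\<rfloor> - H (dx k) (?n k) \<lfloor>x / dx k\<rfloor>) \<longlonglongrightarrow> P y t - P x t"
    using H_pointwise[OF t] by (intro tendsto_diff) (auto simp: dt_def)
  have le: "\<lfloor>x / dx k\<rfloor> \<le> \<lfloor>y / dx k\<rfloor>" for k
    using \<open>x \<le> y\<close> dx[of k] by (intro floor_mono divide_right_mono) auto
  show "0 \<le> P y t - P x t"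
    by (rule LIMSEQ_le_const[OF lim]) (use H_space(1)[OF dx le] in auto)
  have fl: "(\<lambda>k. of_int \<lfloor>z / dx k\<rfloor> * dx k) \<longlonglongrightarrow> z" for z
    by (rule tendsto_floor_mult[OF dx0]) (use dx in auto)
  have "(\<lambda>k. R * (of_int \<lfloor>y / dx k\<rfloor> * dx k - of_int \<lfloor>x / dx k\<rfloor> * dx k)) \<longlonglongrightarrow> R * (y - x)"
    by (intro tendsto_intros fl)
  then show "P y t - P x t \<le> R * (y - x)"
    by (rule LIMSEQ_le[OF lim]) (use H_space(2)[OF dx le] in \<open>auto simp: algebra_simps\<close>)
qed

lemma AE_P_differentiable: "0 \<le> t \<Longrightarrow> AE x in lebesgue. \<exists>D. ((\<lambda>x. P x t) has_real_derivative D) (at x)"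
proof -
  assume t: "0 \<le> t"
  have "mono (\<lambda>x. P x t)" using P_increment(1)[OF t] by (intro monoI) simp
  moreover have "R-lipschitz_on UNIV (\<lambda>x. P x t)"
  proof (rule lipschitz_onI)
    fix x y :: real
    show "dist (P x t) (P y t) \<le> R * dist x y"
    proof (cases "x \<le> y")
      case True then show ?thesis using P_increment[OF t True] by (simp add: dist_real_def)
    next
      case False then show ?thesis using P_increment[OF t, of y x] by (simp add: dist_real_def)
    qed
  qed (use R in simp)
  ultimately show ?thesis
    using AE_differentiable_monotone_lipschitz[of "\<lambda>x. P x t" R] by (simp add: real_differentiable_def)
qed

text \<open>Away from \<open>t = 0\<close> and \<open>x = 0\<close> both the number of steps and the distance from the constraint in cells
are at least of the order \<open>1/\<Delta>x\<close>, so the drop estimate is a one-sided Lipschitz bound with the constant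
\<open>\<beta>/c\<close>, where \<open>c\<close> is a lower bound for \<open>\<Delta>x\<close> times either number.\<close>

lemma U_tendsto:
  assumes k: "filterlim k sequentially F" and t: "0 < t" and x: "x \<noteq> 0"
    and n: "((\<lambda>p. real (n p) * dt (k p)) \<longlongrightarrow> t) F" and j: "((\<lambda>p. of_int (j p) * dx (k p)) \<longlongrightarrow> x) F"
    and D: "((\<lambda>x. P x t) has_real_derivative D) (at x)"
  shows "((\<lambda>p. U (dx (k p)) (n p) (j p)) \<longlongrightarrow> D) F"
proof (rule one_sided_Lipschitz_slopes_converge[where V = "\<lambda>p. H (dx (k p)) (n p)" and d = "\<bar>x\<bar> / 2"])
  define c where "c = min (t / (2 * lam)) (\<bar>x\<bar> / 2)"
  have c: "c > 0" using t x lam by (simp add: c_def)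
  show dxk: "((\<lambda>p. dx (k p)) \<longlongrightarrow> 0) F" by (rule filterlim_compose[OF dx0 k])
  show "\<forall>\<^sub>F p in F. dx (k p) > 0" using dx by simp
  show "H (dx (k p)) (n p) (i + 1) - H (dx (k p)) (n p) i = dx (k p) * U (dx (k p)) (n p) i" for p i
    by (rule H_slope[OF dx])
  show "((\<lambda>p. H (dx (k p)) (n p) (i p)) \<longlongrightarrow> P z t) F"
    if "((\<lambda>p. of_int (i p) * dx (k p)) \<longlongrightarrow> z) F" for z i
    by (rule H_tendsto[OF k _ n that]) (use t in simp)
  show "\<beta> / c \<ge> 0" "\<bar>x\<bar> / 2 > 0" using c \<beta>(1) x by auto
  show "((\<lambda>x. P x t) has_real_derivative D) (at x)" by (rule D)
  show "((\<lambda>p. of_int (j p) * dx (k p)) \<longlongrightarrow> x) F" by (rule j)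
  have "\<forall>\<^sub>F p in F. t / 2 < real (n p) * dt (k p)"
    by (rule order_tendstoD(1)[OF n]) (use t in simp)
  then show "\<forall>\<^sub>F p in F. \<forall>i i'. i \<le> i' \<and> \<bar>of_int i * dx (k p) - x\<bar> < \<bar>x\<bar> / 2 \<and> \<bar>of_int i' * dx (k p) - x\<bar> < \<bar>x\<bar> / 2
      \<longrightarrow> U (dx (k p)) (n p) i - U (dx (k p)) (n p) i' \<le> \<beta> / c * of_int (i' - i) * dx (k p)"
  proof eventually_elim
    case (elim p)
    let ?h = "dx (k p)" and ?n = "n p"
    note h = dx[of "k p"]
    have cn: "c \<le> (real ?n + 2) * ?h"
    proof -
      have "t / (2 * lam) < real ?n * ?h" using elim lam by (simp add: dt_def field_simps)
      then show ?thesis using h by (simp add: c_def distrib_right)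
    qed
    show ?case
    proof (intro allI impI, elim conjE)
      fix i i' assume i: "i \<le> i'" "\<bar>of_int i * ?h - x\<bar> < \<bar>x\<bar> / 2" "\<bar>of_int i' * ?h - x\<bar> < \<bar>x\<bar> / 2"
      obtain J where J: "int J \<le> i \<or> i' \<le> -1 - int J" "\<bar>x\<bar> / 2 \<le> (real J + 1) * ?h"
      proof (cases "x > 0")
        case True
        define J where "J = nat \<lfloor>x / 2 / ?h\<rfloor>"
        have "x / 2 < of_int i * ?h" using i(2) True by linarith
        then have "x / 2 / ?h < of_int i" using h by (simp add: divide_less_eq)
        then have "\<lfloor>x / 2 / ?h\<rfloor> \<le> i" by linarith
        moreover have "0 \<le> \<lfloor>x / 2 / ?h\<rfloor>" using True h by simp
        ultimately have "int J \<le> i" by (simp add: J_def)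
        moreover have "x / 2 / ?h \<le> real J + 1" using True h by (simp add: J_def)
        ultimately show ?thesis using that[of J] True h by (simp add: divide_le_eq)
      next
        case False
        then have x0: "x < 0" using x by simp
        define J where "J = nat (-1 - \<lfloor>x / 2 / ?h\<rfloor>)"
        have "of_int i' * ?h < x / 2" using i(3) x0 by linarith
        then have "of_int i' < x / 2 / ?h" using h by (simp add: less_divide_eq)
        then have 1: "i' \<le> \<lfloor>x / 2 / ?h\<rfloor>" by linarith
        have "x / 2 / ?h < 0" using x0 h by (simp add: divide_neg_pos)
        then have 2: "\<lfloor>x / 2 / ?h\<rfloor> \<le> -1" by linarith
        have "int J = -1 - \<lfloor>x / 2 / ?h\<rfloor>" using 2 by (simp add: J_def)
        then have "i' \<le> -1 - int J" "real J + 1 = - of_int \<lfloor>x / 2 / ?h\<rfloor>" using 1 by linarith+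
        moreover have "of_int \<lfloor>x / 2 / ?h\<rfloor> \<le> x / 2 / ?h" by simp
        ultimately have "- (x / 2 / ?h) \<le> real J + 1" by linarith
        then have "- (x / 2 / ?h) * ?h \<le> (real J + 1) * ?h" using h by (intro mult_right_mono) auto
        then have "\<bar>x\<bar> / 2 \<le> (real J + 1) * ?h" using x0 h by simp
        then show ?thesis using that[of J] \<open>i' \<le> -1 - int J\<close> by blast
      qed
      have "c \<le> (real J + 2) * ?h" using J(2) h by (simp add: c_def distrib_right)
      then have "c \<le> (real (min ?n J) + 2) * ?h" using cn by (simp add: min_def)
      then have "\<beta> / (real (min ?n J) + 2) \<le> \<beta> / c * ?h"
        using c \<beta>(1) h by (simp add: divide_le_eq le_divide_eq mult.commute mult.left_commute)
      then have "of_int (i' - i) * (\<beta> / (real (min ?n J) + 2)) \<le> of_int (i' - i) * (\<beta> / c * ?h)"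
        using i(1) by (intro mult_left_mono) auto
      moreover have "U ?h ?n i - U ?h ?n i' \<le> of_int (i' - i) * (\<beta> / (real (min ?n J) + 2))"
        by (rule one_sided_Lipschitz[OF h i(1) J(1)])
      ultimately show "U ?h ?n i - U ?h ?n i' \<le> \<beta> / c * of_int (i' - i) * ?h" by (simp only: mult_ac)
    qed
  qed
qed

end

section \<open>Limits of discrete weak inequalities\<close>

lemma AE_limit_measurable:
  fixes f :: "nat \<Rightarrow> real \<Rightarrow> real"
  assumes "\<And>k. f k \<in> borel_measurable lebesgue" and "AE x in lebesgue. (\<lambda>k. f k x) \<longlonglongrightarrow> F x"
  shows "F \<in> borel_measurable lebesgue"
proof (rule borel_measurable_AE)
  show "(\<lambda>x. lim (\<lambda>k. f k x)) \<in> borel_measurable lebesgue"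
    using assms(1) by (intro borel_measurable_lim_metric)
  show "AE x in lebesgue. lim (\<lambda>k. f k x) = F x"
    using assms(2) by eventually_elim (rule limI)
qed

lemma grid_sum_tendsto_integral:
  fixes f :: "nat \<Rightarrow> int \<Rightarrow> real" and h :: "nat \<Rightarrow> real"
  assumes h: "\<And>k. h k > 0" "\<And>k. h k \<le> B"
    and S: "\<And>k. finite (S k)" "\<And>k j. j \<notin> S k \<Longrightarrow> f k j = 0"
    and bound: "\<And>k j. \<bar>f k j\<bar> \<le> M" and supp: "\<And>k j. f k j \<noteq> 0 \<Longrightarrow> \<bar>of_int j * h k\<bar> \<le> X"
    and lim: "AE x in lebesgue. (\<lambda>k. f k \<lfloor>x / h k\<rfloor>) \<longlonglongrightarrow> F x"
  shows "(\<lambda>k. h k * (\<Sum>j\<in>S k. f k j)) \<longlonglongrightarrow> (LINT x|lebesgue. F x)"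
proof -
  have meas: "(\<lambda>x. f k \<lfloor>x / h k\<rfloor>) \<in> borel_measurable lebesgue" for k
    by (rule measurable_completion) measurable
  have "(\<lambda>k. LINT x|lebesgue. f k \<lfloor>x / h k\<rfloor>) \<longlonglongrightarrow> (LINT x|lebesgue. F x)"
  proof (rule integral_dominated_convergence[where w = "\<lambda>x. M * indicator {-X - B..X + B} x"])
    show "F \<in> borel_measurable lebesgue" by (rule AE_limit_measurable[OF meas lim])
    show "integrable lebesgue (\<lambda>x. M * indicator {-X - B..X + B} x)"
      by (intro integrable_mult_right integrable_real_indicator) (auto simp: emeasure_lborel_Icc_eq)
    show "AE x in lebesgue. norm (f k \<lfloor>x / h k\<rfloor>) \<le> M * indicator {-X - B..X + B} x" for k
    proof (intro always_eventually allI)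
      fix x
      show "norm (f k \<lfloor>x / h k\<rfloor>) \<le> M * indicator {-X - B..X + B} x"
      proof (cases "f k \<lfloor>x / h k\<rfloor> = 0")
        case True
        then show ?thesis using bound[of k 0] by (simp add: indicator_def)
      next
        case False
        then have "\<bar>of_int \<lfloor>x / h k\<rfloor> * h k\<bar> \<le> X" by (rule supp)
        then have "x \<in> {-X - B..X + B}" using floor_mult_close(1)[OF h(1), of x k] h(2)[of k] by auto
        then show ?thesis using bound by simp
      qed
    qed
  qed (use lim meas in auto)
  moreover have "(LINT x|lebesgue. f k \<lfloor>x / h k\<rfloor>) = h k * (\<Sum>j\<in>S k. f k j)" for k
  proof -
    let ?I = "\<lambda>j::int. {of_int j * h k..<of_int (j + 1) * h k}"
    have in_iff: "x \<in> ?I j \<longleftrightarrow> \<lfloor>x / h k\<rfloor> = j" for x j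
      using h(1)[of k] by (auto simp: floor_eq_iff field_simps)
    have "f k \<lfloor>x / h k\<rfloor> = (\<Sum>j\<in>S k. f k j * indicator (?I j) x)" for x
    proof -
      have "(\<Sum>j\<in>S k. f k j * indicator (?I j) x) = (\<Sum>j\<in>S k. if j = \<lfloor>x / h k\<rfloor> then f k j else 0)"
        by (intro sum.cong refl) (simp only: indicator_def in_iff, auto)
      also have "\<dots> = f k \<lfloor>x / h k\<rfloor>" using S by simp
      finally show ?thesis by simp
    qed
    then have "(LINT x|lebesgue. f k \<lfloor>x / h k\<rfloor>) = (LINT x|lebesgue. (\<Sum>j\<in>S k. f k j * indicator (?I j) x))"
      by simp
    also have "\<dots> = (\<Sum>j\<in>S k. LINT x|lebesgue. f k j * indicator (?I j) x)"
      by (rule Bochner_Integration.integral_sum, intro integrable_mult_right integrable_real_indicator) (use h(1)[of k] in \<open>auto simp: distrib_right\<close>)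
    also have "\<dots> = (\<Sum>j\<in>S k. f k j * h k)"
      using h(1)[of k] by (intro sum.cong refl) (simp add: algebra_simps)
    finally show ?thesis by (simp add: sum_distrib_left mult.commute)
  qed
  ultimately show ?thesis by simp
qed

text \<open>The cells counted differ from the cells meeting \<open>[c, d]\<close> by a bounded number, whose share vanishes in
the limit.\<close>

lemma interval_sum_tendsto_integral:
  fixes g :: "nat \<Rightarrow> int \<Rightarrow> real" and h :: "nat \<Rightarrow> real"
  assumes h: "\<And>k. h k > 0" "h \<longlonglongrightarrow> 0"
    and bound: "\<And>k j. \<lfloor>c / h k\<rfloor> \<le> j \<Longrightarrow> j < \<lfloor>d / h k\<rfloor> \<Longrightarrow> \<bar>g k j\<bar> \<le> M"
    and lim: "AE x in lebesgue. c < x \<and> x < d \<longrightarrow> (\<lambda>k. g k \<lfloor>x / h k\<rfloor>) \<longlonglongrightarrow> G x"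
  shows "(\<lambda>k. h k * (\<Sum>j\<in>{\<lfloor>c / h k\<rfloor>..<\<lfloor>d / h k\<rfloor>}. g k j)) \<longlonglongrightarrow> (LINT x:{c..d}|lebesgue. G x)"
proof -
  define f where "f k j = (if \<lfloor>c / h k\<rfloor> \<le> j \<and> j < \<lfloor>d / h k\<rfloor> then g k j else 0)" for k j
  obtain B where B: "\<And>k. h k \<le> B"
    using convergent_imp_Bseq[OF convergentI[OF h(2)]] by (auto simp: Bseq_def abs_le_iff)
  have "(\<lambda>k. h k * (\<Sum>j\<in>{\<lfloor>c / h k\<rfloor>..<\<lfloor>d / h k\<rfloor>}. f k j)) \<longlonglongrightarrow> (LINT x|lebesgue. indicator {c..d} x *\<^sub>R G x)"
  proof (rule grid_sum_tendsto_integral[where B = B and M = "\<bar>M\<bar>" and X = "\<bar>c\<bar> + \<bar>d\<bar> + B"])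
    show "\<bar>f k j\<bar> \<le> \<bar>M\<bar>" for k j using bound[of k j] by (auto simp: f_def)
    show "\<bar>of_int j * h k\<bar> \<le> \<bar>c\<bar> + \<bar>d\<bar> + B" if "f k j \<noteq> 0" for k j
    proof -
      have j: "\<lfloor>c / h k\<rfloor> \<le> j" "j \<le> \<lfloor>d / h k\<rfloor>" using that by (auto simp: f_def split: if_splits)
      have "of_int \<lfloor>c / h k\<rfloor> * h k \<le> of_int j * h k" "of_int j * h k \<le> of_int \<lfloor>d / h k\<rfloor> * h k"
        using j h(1)[of k] by (auto intro!: mult_right_mono)
      then show ?thesis
        using floor_mult_close(1)[OF h(1), of c k] floor_mult_close(1)[OF h(1), of d k] B[of k] by linarith
    qed
    have ae: "AE x in lebesgue. x \<noteq> c \<and> x \<noteq> d"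
      using AE_lborel_singleton[of c] AE_lborel_singleton[of d] by (simp add: AE_completion_iff)
    show "AE x in lebesgue. (\<lambda>k. f k \<lfloor>x / h k\<rfloor>) \<longlonglongrightarrow> indicator {c..d} x *\<^sub>R G x"
      using ae lim
    proof eventually_elim
      case (elim x)
      have eq_off: "\<forall>\<^sub>F k in sequentially. \<lfloor>u / h k\<rfloor> < \<lfloor>v / h k\<rfloor>" if "u < v" for u v
      proof -
        have "\<forall>\<^sub>F k in sequentially. h k < v - u" by (rule order_tendstoD(2)[OF h(2)]) (use that in simp)
        then show ?thesis
        proof eventually_elim
          case (elim k)
          then have "(u + h k) / h k < v / h k" using h(1)[of k] by (intro divide_strict_right_mono) auto
          then have "u / h k + 1 < v / h k" using h(1)[of k] by (simp add: add_divide_distrib)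
          then show ?case by linarith
        qed
      qed
      consider "x < c" | "d < x" | "c < x" "x < d" using elim by linarith
      then show ?case
      proof cases
        case 1
        have "\<forall>\<^sub>F k in sequentially. f k \<lfloor>x / h k\<rfloor> = 0"
          using eq_off[OF 1] by eventually_elim (simp add: f_def)
        then show ?thesis using 1 by (simp add: tendsto_eventually)
      next
        case 2
        have "\<forall>\<^sub>F k in sequentially. f k \<lfloor>x / h k\<rfloor> = 0"
          using eq_off[OF 2] by eventually_elim (simp add: f_def)
        then show ?thesis using 2 by (simp add: tendsto_eventually)
      next
        case 3
        then have G: "(\<lambda>k. g k \<lfloor>x / h k\<rfloor>) \<longlonglongrightarrow> G x" using elim by blast
        have "\<forall>\<^sub>F k in sequentially. g k \<lfloor>x / h k\<rfloor> = f k \<lfloor>x / h k\<rfloor>"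
          using eq_off[OF 3(1)] eq_off[OF 3(2)] by eventually_elim (simp add: f_def)
        from Lim_transform_eventually[OF G this] show ?thesis using 3 by simp
      qed
    qed
  qed (use B h(1) in \<open>auto simp: f_def\<close>)
  moreover have "(\<Sum>j\<in>{\<lfloor>c / h k\<rfloor>..<\<lfloor>d / h k\<rfloor>}. f k j) = (\<Sum>j\<in>{\<lfloor>c / h k\<rfloor>..<\<lfloor>d / h k\<rfloor>}. g k j)" for k
    by (rule sum.cong) (auto simp: f_def)
  ultimately show ?thesis by (simp add: set_lebesgue_integral_def)
qed

text \<open>Boundedness is asked only for steps ending before \<open>\<tau>'\<close>, because test functions are controlled only
on the given time interval.\<close>

lemma time_sum_tendsto_integral:
  fixes g :: "nat \<Rightarrow> nat \<Rightarrow> real" and h :: "nat \<Rightarrow> real"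
  assumes h: "\<And>k. h k > 0" "h \<longlonglongrightarrow> 0" and \<tau>: "0 \<le> \<tau>" "\<tau> < \<tau>'"
    and bound: "\<And>k n. real (Suc n) * h k \<le> \<tau>' \<Longrightarrow> \<bar>g k n\<bar> \<le> M"
    and lim: "\<And>t. \<tau> < t \<Longrightarrow> t < \<tau>' \<Longrightarrow> (\<lambda>k. g k (nat \<lfloor>t / h k\<rfloor>)) \<longlonglongrightarrow> G t"
  shows "(\<lambda>k. h k * (\<Sum>n\<in>{nat \<lfloor>\<tau> / h k\<rfloor>..<nat \<lfloor>\<tau>' / h k\<rfloor>}. g k n)) \<longlonglongrightarrow> (LINT t:{\<tau>..\<tau>'}|lebesgue. G t)"
proof -
  have a0: "0 \<le> \<lfloor>\<tau> / h k\<rfloor>" "0 \<le> \<lfloor>\<tau>' / h k\<rfloor>" for k using \<tau> h(1)[of k] by auto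
  have "(\<lambda>k. h k * (\<Sum>j\<in>{\<lfloor>\<tau> / h k\<rfloor>..<\<lfloor>\<tau>' / h k\<rfloor>}. g k (nat j))) \<longlonglongrightarrow> (LINT t:{\<tau>..\<tau>'}|lebesgue. G t)"
  proof (rule interval_sum_tendsto_integral[OF h])
    fix k j assume j: "\<lfloor>\<tau> / h k\<rfloor> \<le> j" "j < \<lfloor>\<tau>' / h k\<rfloor>"
    have "of_int (j + 1) \<le> \<tau>' / h k" using j(2) by linarith
    then have "of_int (j + 1) * h k \<le> \<tau>'" using h(1)[of k] by (simp add: le_divide_eq)
    moreover have "0 \<le> j" by (rule order_trans[OF a0(1) j(1)])
    then have "real (Suc (nat j)) = of_int (j + 1)" by simp
    ultimately show "\<bar>g k (nat j)\<bar> \<le> M" by (intro bound) (simp only:)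
  qed (use lim in auto)
  moreover have "(\<Sum>j\<in>{\<lfloor>\<tau> / h k\<rfloor>..<\<lfloor>\<tau>' / h k\<rfloor>}. g k (nat j)) = (\<Sum>n\<in>{nat \<lfloor>\<tau> / h k\<rfloor>..<nat \<lfloor>\<tau>' / h k\<rfloor>}. g k n)" for k
  proof -
    have "(\<Sum>j\<in>{a..<b}. g k (nat j)) = (\<Sum>n\<in>{nat a..<nat b}. g k n)" if "0 \<le> a" "0 \<le> b" for a b
      by (rule sum.reindex_bij_witness[of _ int nat]) (use that in auto)
    then show ?thesis using a0 by blast
  qed
  ultimately show ?thesis by simp
qed

lemma sum_int_shift:
  fixes \<phi> b :: "int \<Rightarrow> real"
  assumes "\<And>j. int J \<le> \<bar>j\<bar> \<Longrightarrow> \<phi> j = 0"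
  shows "(\<Sum>j\<in>{-int J..int J}. \<phi> j * (b (j + 1) - b j)) = - (\<Sum>j\<in>{-int J..int J}. b j * (\<phi> j - \<phi> (j - 1)))"
proof -
  have "(\<Sum>j\<in>{-int J..int J}. \<phi> j * b (j + 1)) = (\<Sum>j\<in>{-int J + 1..int J + 1}. \<phi> (j - 1) * b j)"
    by (rule sum.reindex_bij_witness[of _ "\<lambda>j. j - 1" "\<lambda>j. j + 1"]) auto
  also have "\<dots> = (\<Sum>j\<in>{-int J..int J + 1}. \<phi> (j - 1) * b j)"
    by (rule sum.mono_neutral_left) (use assms in auto)
  also have "\<dots> = (\<Sum>j\<in>{-int J..int J}. \<phi> (j - 1) * b j)"
    by (rule sum.mono_neutral_right) (use assms in auto)
  finally show ?thesis by (simp add: right_diff_distrib sum_subtractf mult.commute)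
qed

text \<open>A discrete balance law with defect \<open>c\<close> in the cells \<open>-1\<close> and \<open>0\<close>, multiplied by the values of a test
function at the grid points and summed by parts, is a weak inequality with difference quotients of
the test function; all terms are Riemann sums.  The weights \<open>m\<close> distinguish the two uses: the
entropy inequality has a defect in both cells, the mass balance on the right half line in the cell
\<open>0\<close> only.\<close>

lemma weak_inequality_limit:
  fixes a b :: "nat \<Rightarrow> nat \<Rightarrow> int \<Rightarrow> real" and c :: "nat \<Rightarrow> nat \<Rightarrow> real" and m :: "int \<Rightarrow> real"
    and A B \<phi> \<phi>t \<phi>x :: "real \<Rightarrow> real \<Rightarrow> real" and dx :: "nat \<Rightarrow> real"
  assumes dx: "\<And>k. dx k > 0" "dx \<longlonglongrightarrow> 0" and lam: "lam > 0"
    and bounds: "\<And>k n j. \<bar>a k n j\<bar> \<le> C" "\<And>k n j. \<bar>b k n j\<bar> \<le> C" "\<And>k n. \<bar>c k n\<bar> \<le> C"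
    and ineq: "\<And>k n j. a k (Suc n) j - a k n j \<le> - lam * (b k n (j + 1) - b k n j) + lam * c k n * m j"
    and m: "\<And>j. j \<notin> {-1, 0} \<Longrightarrow> m j = 0"
    and A: "\<And>t. 0 \<le> t \<Longrightarrow> AE x in lebesgue. (\<lambda>k. a k (nat \<lfloor>t / (lam * dx k)\<rfloor>) \<lfloor>x / dx k\<rfloor>) \<longlonglongrightarrow> A x t"
    and B: "\<And>t. 0 < t \<Longrightarrow> AE x in lebesgue. (\<lambda>k. b k (nat \<lfloor>t / (lam * dx k)\<rfloor>) \<lfloor>x / dx k\<rfloor>) \<longlonglongrightarrow> B x t"
    and \<gamma>: "\<And>t. 0 < t \<Longrightarrow> (\<lambda>k. c k (nat \<lfloor>t / (lam * dx k)\<rfloor>)) \<longlonglongrightarrow> \<gamma> t"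
    and \<phi>t: "\<And>x t. ((\<lambda>u. \<phi> x u) has_real_derivative \<phi>t x t) (at t)"
    and \<phi>x: "\<And>x t. ((\<lambda>w. \<phi> w t) has_real_derivative \<phi>x x t) (at x)"
    and cont: "continuous_on UNIV (\<lambda>z. \<phi> (fst z) (snd z))" "continuous_on UNIV (\<lambda>z. \<phi>t (fst z) (snd z))"
      "continuous_on UNIV (\<lambda>z. \<phi>x (fst z) (snd z))"
    and supp: "\<And>x t. 0 \<le> t \<Longrightarrow> X < \<bar>x\<bar> \<Longrightarrow> \<phi> x t = 0" and X: "0 \<le> X"
    and nonneg: "\<And>x t. 0 \<le> t \<Longrightarrow> t \<le> T \<Longrightarrow> 0 \<le> \<phi> x t"
    and \<tau>: "0 \<le> \<tau>" "\<tau> < \<tau>'" "\<tau>' \<le> T"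
  shows "0 \<le> (LINT t:{\<tau>..\<tau>'}|lebesgue. LINT x|lebesgue. (A x t * \<phi>t x t + B x t * \<phi>x x t))
     + (LINT x|lebesgue. A x \<tau> * \<phi> x \<tau>) - (LINT x|lebesgue. A x \<tau>' * \<phi> x \<tau>')
     + (m (-1) + m 0) * (LINT t:{\<tau>..\<tau>'}|lebesgue. \<gamma> t * \<phi> 0 t)"
proof -
  define dt where "dt k = lam * dx k" for k
  have dt: "dt k > 0" "dt \<longlonglongrightarrow> 0" for k
    using lam dx tendsto_mult_right[OF dx(2), of lam] by (auto simp: dt_def[abs_def])
  obtain D where D: "\<And>k. dx k \<le> D"
    using convergent_imp_Bseq[OF convergentI[OF dx(2)]] by (auto simp: Bseq_def abs_le_iff)
  have D0: "0 < D" using dx(1)[of 0] D[of 0] by linarith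
  have C0: "0 \<le> C" using bounds(1)[of 0 0 0] by linarith
  let ?K = "cbox (-X - 2 * D, 0) (X + 2 * D, T)"
  have "\<exists>M. \<forall>z\<in>?K. \<bar>\<psi> (fst z) (snd z)\<bar> \<le> M" if "continuous_on UNIV (\<lambda>z. \<psi> (fst z) (snd z))" for \<psi> :: "real \<Rightarrow> real \<Rightarrow> real"
  proof -
    have "compact ((\<lambda>z. \<psi> (fst z) (snd z)) ` ?K)"
      by (intro compact_continuous_image continuous_on_subset[OF that] compact_cbox) simp
    then show ?thesis using bounded_iff[of "(\<lambda>z. \<psi> (fst z) (snd z)) ` ?K"] compact_imp_bounded by auto
  qed
  note bounded_on_K = this
  obtain M1 where M1: "\<forall>z\<in>?K. \<bar>\<phi> (fst z) (snd z)\<bar> \<le> M1" using bounded_on_K[OF cont(1)] by blast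
  obtain M2 where M2: "\<forall>z\<in>?K. \<bar>\<phi>t (fst z) (snd z)\<bar> \<le> M2" using bounded_on_K[OF cont(2)] by blast
  obtain M3 where M3: "\<forall>z\<in>?K. \<bar>\<phi>x (fst z) (snd z)\<bar> \<le> M3" using bounded_on_K[OF cont(3)] by blast
  define M where "M = max 0 (max M1 (max M2 M3))"
  have M0: "0 \<le> M" by (simp add: M_def)
  have MK: "\<bar>\<phi> x t\<bar> \<le> M \<and> \<bar>\<phi>t x t\<bar> \<le> M \<and> \<bar>\<phi>x x t\<bar> \<le> M" if "(x, t) \<in> ?K" for x t
    using bspec[OF M1 that] bspec[OF M2 that] bspec[OF M3 that]
    unfolding M_def by (simp_all only: fst_conv snd_conv le_max_iff_disj order_refl simp_thms)
  have inK: "(x, t) \<in> ?K \<longleftrightarrow> \<bar>x\<bar> \<le> X + 2 * D \<and> 0 \<le> t \<and> t \<le> T" for x t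
    by (auto simp: cbox_Pair_eq abs_le_iff)
  have \<phi>_bound: "\<bar>\<phi> x t\<bar> \<le> M" if "0 \<le> t" "t \<le> T" for x t
  proof (cases "\<bar>x\<bar> \<le> X")
    case True
    then have "(x, t) \<in> ?K" using that D0 unfolding inK by linarith
    then show ?thesis using MK by blast
  next
    case False
    then show ?thesis using supp[of t x] that M0 by simp
  qed
  \<comment> \<open>Difference quotients of the test function at grid points.\<close>
  define qt where "qt k n j = (\<phi> (of_int j * dx k) (real (Suc n) * dt k) - \<phi> (of_int j * dx k) (real n * dt k)) / dt k" for k n j
  define qx where "qx k n j = (\<phi> (of_int j * dx k) (real (Suc n) * dt k) - \<phi> (of_int (j - 1) * dx k) (real (Suc n) * dt k)) / dx k" for k n j
  have qt: "\<exists>\<xi>. real n * dt k < \<xi> \<and> \<xi> < real (Suc n) * dt k \<and> qt k n j = \<phi>t (of_int j * dx k) \<xi>" for k n j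
  proof -
    have lt: "real n * dt k < real (Suc n) * dt k" using dt(1)[of k] by simp
    from MVT2[OF lt, of "\<phi> (of_int j * dx k)" "\<phi>t (of_int j * dx k)"] \<phi>t
    obtain \<xi> where "real n * dt k < \<xi>" "\<xi> < real (Suc n) * dt k"
      "\<phi> (of_int j * dx k) (real (Suc n) * dt k) - \<phi> (of_int j * dx k) (real n * dt k) = (real (Suc n) * dt k - real n * dt k) * \<phi>t (of_int j * dx k) \<xi>"
      by blast
    moreover have "real (Suc n) * dt k - real n * dt k = dt k" by (simp add: algebra_simps)
    ultimately show ?thesis using dt(1)[of k] unfolding qt_def by (intro exI[of _ \<xi>]) simp
  qed
  have qx: "\<exists>\<xi>. of_int (j - 1) * dx k < \<xi> \<and> \<xi> < of_int j * dx k \<and> qx k n j = \<phi>x \<xi> (real (Suc n) * dt k)" for k n j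
  proof -
    have lt: "of_int (j - 1) * dx k < of_int j * dx k" using dx(1)[of k] by simp
    from MVT2[OF lt, of "\<lambda>w. \<phi> w (real (Suc n) * dt k)" "\<lambda>w. \<phi>x w (real (Suc n) * dt k)"] \<phi>x
    obtain \<xi> where "of_int (j - 1) * dx k < \<xi>" "\<xi> < of_int j * dx k"
      "\<phi> (of_int j * dx k) (real (Suc n) * dt k) - \<phi> (of_int (j - 1) * dx k) (real (Suc n) * dt k) = (of_int j * dx k - of_int (j - 1) * dx k) * \<phi>x \<xi> (real (Suc n) * dt k)"
      by blast
    moreover have "of_int j * dx k - of_int (j - 1) * dx k = dx k" by (simp add: algebra_simps)
    ultimately show ?thesis using dx(1)[of k] unfolding qx_def by (intro exI[of _ \<xi>]) simp
  qed
  have abs_shift: "\<bar>of_int (j - 1) * dx k\<bar> \<ge> \<bar>of_int j * dx k\<bar> - D" for j k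
    using dx(1)[of k] D[of k] by (simp add: left_diff_distrib)
  have qt_zero: "qt k n j = 0" and qx_zero: "qx k n j = 0" if "X + D < \<bar>of_int j * dx k\<bar>" for k n j
    using that abs_shift[of j k] supp[of "real (Suc n) * dt k"] supp[of "real n * dt k"] dt(1)[of k] D0
    by (simp_all add: qt_def qx_def)
  have qt_bound: "\<bar>qt k n j\<bar> \<le> M" and qx_bound: "\<bar>qx k n j\<bar> \<le> M" if n: "real (Suc n) * dt k \<le> T" for k n j
  proof -
    have n0: "0 \<le> real n * dt k" "0 \<le> real (Suc n) * dt k" using dt(1)[of k] by auto
    show "\<bar>qt k n j\<bar> \<le> M"
    proof (cases "X + D < \<bar>of_int j * dx k\<bar>")
      case True then show ?thesis using qt_zero M0 by simp
    next
      case False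
      obtain \<xi> where "real n * dt k < \<xi>" "\<xi> < real (Suc n) * dt k" "qt k n j = \<phi>t (of_int j * dx k) \<xi>" using qt by blast
      moreover from this have "(of_int j * dx k, \<xi>) \<in> ?K"
        unfolding inK using False n n0 D0 by linarith
      ultimately show ?thesis using MK by metis
    qed
    show "\<bar>qx k n j\<bar> \<le> M"
    proof (cases "X + D < \<bar>of_int j * dx k\<bar>")
      case True then show ?thesis using qx_zero M0 by simp
    next
      case False
      obtain \<xi> where \<xi>: "of_int (j - 1) * dx k < \<xi>" "\<xi> < of_int j * dx k" "qx k n j = \<phi>x \<xi> (real (Suc n) * dt k)" using qx by blast
      have "of_int (j - 1) * dx k = of_int j * dx k - dx k" by (simp add: left_diff_distrib)
      then have "\<bar>\<xi>\<bar> \<le> X + 2 * D" using \<xi>(1,2) False D[of k] by linarith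
      then have "(\<xi>, real (Suc n) * dt k) \<in> ?K" unfolding inK using n n0 by linarith
      then show ?thesis using MK \<xi>(3) by metis
    qed
  qed
  have gx: "(\<lambda>k. of_int \<lfloor>x / dx k\<rfloor> * dx k) \<longlonglongrightarrow> x" for x
    by (rule tendsto_floor_mult[OF dx(2)]) (use dx(1) in auto)
  have gt: "(\<lambda>k. real (nat \<lfloor>t / dt k\<rfloor>) * dt k) \<longlonglongrightarrow> t" if "0 \<le> t" for t
  proof -
    have "(\<lambda>k. of_int \<lfloor>t / dt k\<rfloor> * dt k) \<longlonglongrightarrow> t"
      by (rule tendsto_floor_mult[OF dt(2)]) (use dt(1) in auto)
    moreover have "real (nat \<lfloor>t / dt k\<rfloor>) = of_int \<lfloor>t / dt k\<rfloor>" for k using that dt(1)[of k] by simp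
    ultimately show ?thesis by simp
  qed
  have gt': "(\<lambda>k. real (Suc (nat \<lfloor>t / dt k\<rfloor>)) * dt k) \<longlonglongrightarrow> t" if "0 \<le> t" for t
    using tendsto_add[OF gt[OF that] dt(2)] by (simp add: algebra_simps)
  have comp: "(\<lambda>k. \<psi> (u k) (w k)) \<longlonglongrightarrow> \<psi> x t"
    if "continuous_on UNIV (\<lambda>z. \<psi> (fst z) (snd z))" "u \<longlonglongrightarrow> x" "w \<longlonglongrightarrow> t" for \<psi> :: "real \<Rightarrow> real \<Rightarrow> real" and u w x t
  proof -
    have "isCont (\<lambda>z. \<psi> (fst z) (snd z)) (x, t)" using that(1) by (simp add: continuous_on_eq_continuous_at)
    from isCont_tendsto_compose[OF this tendsto_Pair[OF that(2,3)]] show ?thesis by simp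
  qed
  have qt_lim: "(\<lambda>k. qt k (nat \<lfloor>t / dt k\<rfloor>) \<lfloor>x / dx k\<rfloor>) \<longlonglongrightarrow> \<phi>t x t" if "0 \<le> t" for x t
  proof -
    have "\<forall>k. \<exists>\<xi>. real (nat \<lfloor>t / dt k\<rfloor>) * dt k < \<xi> \<and> \<xi> < real (Suc (nat \<lfloor>t / dt k\<rfloor>)) * dt k
      \<and> qt k (nat \<lfloor>t / dt k\<rfloor>) \<lfloor>x / dx k\<rfloor> = \<phi>t (of_int \<lfloor>x / dx k\<rfloor> * dx k) \<xi>" using qt by blast
    from choice[OF this] obtain \<xi> where \<xi>: "\<And>k. real (nat \<lfloor>t / dt k\<rfloor>) * dt k < \<xi> k" "\<And>k. \<xi> k < real (Suc (nat \<lfloor>t / dt k\<rfloor>)) * dt k"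
      "\<And>k. qt k (nat \<lfloor>t / dt k\<rfloor>) \<lfloor>x / dx k\<rfloor> = \<phi>t (of_int \<lfloor>x / dx k\<rfloor> * dx k) (\<xi> k)" by blast
    have "\<xi> \<longlonglongrightarrow> t"
      by (rule real_tendsto_sandwich[OF _ _ gt[OF that] gt'[OF that]]) (use \<xi>(1,2) in \<open>auto intro!: always_eventually less_imp_le\<close>)
    then show ?thesis unfolding \<xi>(3) by (rule comp[OF cont(2) gx])
  qed
  have qx_lim: "(\<lambda>k. qx k (nat \<lfloor>t / dt k\<rfloor>) \<lfloor>x / dx k\<rfloor>) \<longlonglongrightarrow> \<phi>x x t" if "0 \<le> t" for x t
  proof -
    have "\<forall>k. \<exists>\<xi>. of_int (\<lfloor>x / dx k\<rfloor> - 1) * dx k < \<xi> \<and> \<xi> < of_int \<lfloor>x / dx k\<rfloor> * dx k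
      \<and> qx k (nat \<lfloor>t / dt k\<rfloor>) \<lfloor>x / dx k\<rfloor> = \<phi>x \<xi> (real (Suc (nat \<lfloor>t / dt k\<rfloor>)) * dt k)" using qx by blast
    from choice[OF this] obtain \<xi> where \<xi>: "\<And>k. of_int (\<lfloor>x / dx k\<rfloor> - 1) * dx k < \<xi> k" "\<And>k. \<xi> k < of_int \<lfloor>x / dx k\<rfloor> * dx k"
      "\<And>k. qx k (nat \<lfloor>t / dt k\<rfloor>) \<lfloor>x / dx k\<rfloor> = \<phi>x (\<xi> k) (real (Suc (nat \<lfloor>t / dt k\<rfloor>)) * dt k)" by blast
    have low: "(\<lambda>k. of_int (\<lfloor>x / dx k\<rfloor> - 1) * dx k) \<longlonglongrightarrow> x"
      using tendsto_diff[OF gx dx(2), of x] by (simp add: algebra_simps)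
    have "\<xi> \<longlonglongrightarrow> x"
      by (rule real_tendsto_sandwich[OF _ _ low gx]) (use \<xi>(1,2) in \<open>auto intro!: always_eventually less_imp_le\<close>)
    then show ?thesis unfolding \<xi>(3) by (rule comp[OF cont(3) _ gt'[OF that]])
  qed
  \<comment> \<open>Beyond \<open>J\<close> cells the test function and its difference quotients vanish; the 2 keeps the cells \<open>-1\<close> and \<open>0\<close> inside.\<close>
  define J where "J k = nat \<lceil>(X + D) / dx k\<rceil> + 2" for k
  have J2: "2 \<le> J k" for k by (simp add: J_def)
  define S where "S k = {-int (J k)..int (J k)}" for k
  have far: "X + D < \<bar>of_int j * dx k\<bar>" if "int (J k) \<le> \<bar>j\<bar> + 1" for j k
  proof -
    have "(X + D) / dx k < real (J k) - 1" using X D0 by (simp add: J_def) linarith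
    also have "real (J k) - 1 \<le> \<bar>of_int j\<bar>" using that by linarith
    finally show ?thesis using dx(1)[of k] by (simp add: divide_less_eq abs_mult)
  qed
  define \<Phi> where "\<Phi> k n j = \<phi> (of_int j * dx k) (real n * dt k)" for k n j
  have \<Phi>_zero: "\<Phi> k n j = 0" if "int (J k) \<le> \<bar>j\<bar> + 1" for k n j
    unfolding \<Phi>_def using far[OF that] D0 dt(1)[of k] by (intro supp) auto
  define e where "e k n = dx k * (\<Sum>j\<in>S k. a k n j * \<Phi> k n j)" for k n
  define I where "I k n = dx k * (\<Sum>j\<in>S k. a k n j * qt k n j + b k n j * qx k n j)" for k n
  define s where "s k n = c k n * (m (-1) * \<Phi> k (Suc n) (-1) + m 0 * \<Phi> k (Suc n) 0)" for k n
  have one_step: "e k (Suc n) - e k n \<le> dt k * (I k n + s k n)" if n: "real (Suc n) * dt k \<le> T" for k n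
  proof -
    have pos: "0 \<le> \<Phi> k (Suc n) j" for j unfolding \<Phi>_def using n dt(1)[of k] by (intro nonneg) auto
    have "(\<Sum>j\<in>S k. \<Phi> k (Suc n) j * (a k (Suc n) j - a k n j))
        \<le> (\<Sum>j\<in>S k. \<Phi> k (Suc n) j * (- lam * (b k n (j + 1) - b k n j) + lam * c k n * m j))"
      by (intro sum_mono mult_left_mono ineq pos)
    also have "\<dots> = - lam * (\<Sum>j\<in>S k. \<Phi> k (Suc n) j * (b k n (j + 1) - b k n j)) + lam * c k n * (\<Sum>j\<in>S k. \<Phi> k (Suc n) j * m j)"
    proof -
      have "\<Phi> k (Suc n) j * (- lam * (b k n (j + 1) - b k n j) + lam * c k n * m j)
         = - lam * (\<Phi> k (Suc n) j * (b k n (j + 1) - b k n j)) + lam * c k n * (\<Phi> k (Suc n) j * m j)" for j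
        by (simp add: algebra_simps)
      then show ?thesis by (simp only: sum.distrib sum_distrib_left)
    qed
    also have "(\<Sum>j\<in>S k. \<Phi> k (Suc n) j * (b k n (j + 1) - b k n j)) = - (\<Sum>j\<in>S k. b k n j * (\<Phi> k (Suc n) j - \<Phi> k (Suc n) (j - 1)))"
      unfolding S_def by (rule sum_int_shift) (rule \<Phi>_zero, simp)
    also have "(\<Sum>j\<in>S k. \<Phi> k (Suc n) j * m j) = (\<Sum>j\<in>{-1,0}. \<Phi> k (Suc n) j * m j)"
      by (rule sum.mono_neutral_right) (use m J2[of k] in \<open>auto simp: S_def\<close>)
    finally have step: "(\<Sum>j\<in>S k. \<Phi> k (Suc n) j * (a k (Suc n) j - a k n j))
       \<le> lam * (\<Sum>j\<in>S k. b k n j * (\<Phi> k (Suc n) j - \<Phi> k (Suc n) (j - 1))) + lam * s k n"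
      by (simp add: s_def algebra_simps)
    have "e k (Suc n) - e k n = dx k * ((\<Sum>j\<in>S k. \<Phi> k (Suc n) j * (a k (Suc n) j - a k n j)) + (\<Sum>j\<in>S k. a k n j * (\<Phi> k (Suc n) j - \<Phi> k n j)))"
      by (simp add: e_def algebra_simps sum.distrib sum_subtractf)
    also have "\<dots> \<le> dx k * (lam * (\<Sum>j\<in>S k. b k n j * (\<Phi> k (Suc n) j - \<Phi> k (Suc n) (j - 1))) + lam * s k n + (\<Sum>j\<in>S k. a k n j * (\<Phi> k (Suc n) j - \<Phi> k n j)))"
      using step dx(1)[of k] by (intro mult_left_mono) auto
    also have "(\<Sum>j\<in>S k. b k n j * (\<Phi> k (Suc n) j - \<Phi> k (Suc n) (j - 1))) = dx k * (\<Sum>j\<in>S k. b k n j * qx k n j)"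
      using dx(1)[of k] by (simp add: qx_def \<Phi>_def sum_distrib_left)
    also have "(\<Sum>j\<in>S k. a k n j * (\<Phi> k (Suc n) j - \<Phi> k n j)) = dt k * (\<Sum>j\<in>S k. a k n j * qt k n j)"
      using dt(1)[of k] by (simp add: qt_def \<Phi>_def sum_distrib_left)
    also have "dx k * (lam * (dx k * (\<Sum>j\<in>S k. b k n j * qx k n j)) + lam * s k n + dt k * (\<Sum>j\<in>S k. a k n j * qt k n j)) = dt k * (I k n + s k n)"
      by (simp add: I_def dt_def sum.distrib algebra_simps)
    finally show ?thesis .
  qed
  define n0 where "n0 k = nat \<lfloor>\<tau> / dt k\<rfloor>" for k
  define n1 where "n1 k = nat \<lfloor>\<tau>' / dt k\<rfloor>" for k
  have n01: "n0 k \<le> n1 k" for k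
    using \<tau> dt(1)[of k] by (auto simp: n0_def n1_def intro!: nat_mono floor_mono divide_right_mono)
  have n1T: "real (Suc n) * dt k \<le> T" if "n < n1 k" for n k
  proof -
    have "real (Suc n) \<le> real (n1 k)" using that by simp
    also have "\<dots> \<le> \<tau>' / dt k" using \<tau> dt(1)[of k] by (simp add: n1_def)
    finally show ?thesis using dt(1)[of k] \<tau> by (simp add: le_divide_eq)
  qed
  have total: "e k (n1 k) - e k (n0 k) \<le> dt k * (\<Sum>n\<in>{n0 k..<n1 k}. I k n) + dt k * (\<Sum>n\<in>{n0 k..<n1 k}. s k n)" for k
  proof -
    have "e k (n1 k) - e k (n0 k) = (\<Sum>n\<in>{n0 k..<n1 k}. e k (Suc n) - e k n)"
      using sum_Suc_diff'[OF n01] by metis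
    also have "\<dots> \<le> (\<Sum>n\<in>{n0 k..<n1 k}. dt k * (I k n + s k n))"
      using n1T by (intro sum_mono one_step) auto
    finally show ?thesis by (simp add: sum.distrib sum_distrib_left distrib_left)
  qed
  have e_lim: "(\<lambda>k. e k (nat \<lfloor>t / dt k\<rfloor>)) \<longlonglongrightarrow> (LINT x|lebesgue. A x t * \<phi> x t)" if t: "0 \<le> t" "t \<le> T" for t
    unfolding e_def
  proof (rule grid_sum_tendsto_integral[where B = D and M = "C * M" and X = "X + D"])
    fix k j
    have tk: "0 \<le> real (nat \<lfloor>t / dt k\<rfloor>) * dt k" "real (nat \<lfloor>t / dt k\<rfloor>) * dt k \<le> T"
    proof -
      have "real (nat \<lfloor>t / dt k\<rfloor>) \<le> t / dt k" using t dt(1)[of k] by simp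
      then show "real (nat \<lfloor>t / dt k\<rfloor>) * dt k \<le> T" using dt(1)[of k] t by (simp add: le_divide_eq)
    qed (use dt(1)[of k] in simp)
    show "\<bar>a k (nat \<lfloor>t / dt k\<rfloor>) j * \<Phi> k (nat \<lfloor>t / dt k\<rfloor>) j\<bar> \<le> C * M"
      unfolding abs_mult \<Phi>_def using bounds(1) \<phi>_bound[OF tk] C0 by (intro mult_mono) auto
    show "\<bar>of_int j * dx k\<bar> \<le> X + D" if "a k (nat \<lfloor>t / dt k\<rfloor>) j * \<Phi> k (nat \<lfloor>t / dt k\<rfloor>) j \<noteq> 0"
      using that supp[OF tk(1), of "of_int j * dx k"] D0 by (force simp: \<Phi>_def)
    show "a k (nat \<lfloor>t / dt k\<rfloor>) j * \<Phi> k (nat \<lfloor>t / dt k\<rfloor>) j = 0" if "j \<notin> S k"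
    proof -
      have "int (J k) \<le> \<bar>j\<bar> + 1" using that by (auto simp: S_def)
      then show ?thesis using \<Phi>_zero by simp
    qed
  next
    show "AE x in lebesgue. (\<lambda>k. a k (nat \<lfloor>t / dt k\<rfloor>) \<lfloor>x / dx k\<rfloor> * \<Phi> k (nat \<lfloor>t / dt k\<rfloor>) \<lfloor>x / dx k\<rfloor>) \<longlonglongrightarrow> A x t * \<phi> x t"
      using A[OF t(1)]
    proof eventually_elim
      case (elim x)
      show ?case unfolding \<Phi>_def
        by (intro tendsto_mult comp[OF cont(1)] gx gt t) (use elim in \<open>simp add: dt_def\<close>)
    qed
  qed (use dx D in \<open>auto simp: S_def\<close>)
  have summand: "\<bar>a k n j * qt k n j + b k n j * qx k n j\<bar> \<le> 2 * C * M" if n: "real (Suc n) * dt k \<le> T" for k n j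
  proof -
    have "\<bar>a k n j * qt k n j\<bar> \<le> C * M" "\<bar>b k n j * qx k n j\<bar> \<le> C * M"
      unfolding abs_mult using bounds qt_bound[OF n] qx_bound[OF n] C0 by (auto intro!: mult_mono)
    then show ?thesis by linarith
  qed
  have I_bound: "\<bar>I k n\<bar> \<le> (2 * (X + D) + 3 * D) * (2 * C * M)" if n: "real (Suc n) * dt k \<le> T" for k n
  proof -
    define S' where "S' = {j \<in> S k. \<bar>of_int j * dx k\<bar> \<le> X + D}"
    have card: "real (card S') * dx k \<le> 2 * (X + D) + 3 * D"
    proof -
      let ?L = "\<lfloor>(X + D) / dx k\<rfloor>"
      have "S' \<subseteq> {-?L..?L}"
      proof
        fix j assume "j \<in> S'"
        then have "\<bar>of_int j\<bar> \<le> (X + D) / dx k" using dx(1)[of k] by (simp add: S'_def abs_mult le_divide_eq)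
        then show "j \<in> {-?L..?L}" by (simp add: abs_le_iff le_floor_iff) linarith
      qed
      then have "card S' \<le> card {-?L..?L}" by (intro card_mono) auto
      moreover have "0 \<le> ?L" using X D0 dx(1)[of k] by simp
      ultimately have "card S' \<le> nat (2 * ?L + 1)" "0 \<le> 2 * ?L + 1" by simp_all
      then have "int (card S') \<le> 2 * ?L + 1" by linarith
      then have "real (card S') \<le> 2 * of_int ?L + 1" by linarith
      also have "\<dots> \<le> 2 * ((X + D) / dx k) + 1" using of_int_floor_le[of "(X + D) / dx k"] by linarith
      finally have "real (card S') * dx k \<le> (2 * ((X + D) / dx k) + 1) * dx k"
        using dx(1)[of k] by (intro mult_right_mono) auto
      also have "\<dots> = 2 * (X + D) + dx k" using dx(1)[of k] by (simp add: field_simps)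
      finally show ?thesis using D[of k] D0 by linarith
    qed
    have zero: "a k n j * qt k n j + b k n j * qx k n j = 0" if "j \<in> S k - S'" for j
    proof -
      have "X + D < \<bar>of_int j * dx k\<bar>" using that by (auto simp: S'_def)
      then show ?thesis using qt_zero qx_zero by simp
    qed
    have "(\<Sum>j\<in>S k. a k n j * qt k n j + b k n j * qx k n j) = (\<Sum>j\<in>S'. a k n j * qt k n j + b k n j * qx k n j)"
      by (rule sum.mono_neutral_right) (use zero in \<open>auto simp: S_def S'_def\<close>)
    then have "I k n = dx k * (\<Sum>j\<in>S'. a k n j * qt k n j + b k n j * qx k n j)"
      by (simp add: I_def)
    also have "\<bar>\<dots>\<bar> \<le> dx k * (\<Sum>j\<in>S'. 2 * C * M)"
      unfolding abs_mult using dx(1)[of k] summand[OF n] by (intro mult_mono order_trans[OF sum_abs] sum_mono) auto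
    also have "\<dots> = (real (card S') * dx k) * (2 * C * M)" by simp
    also have "\<dots> \<le> (2 * (X + D) + 3 * D) * (2 * C * M)" using card C0 M0 by (intro mult_right_mono) auto
    finally show ?thesis .
  qed
  have I_lim: "(\<lambda>k. I k (nat \<lfloor>t / dt k\<rfloor>)) \<longlonglongrightarrow> (LINT x|lebesgue. (A x t * \<phi>t x t + B x t * \<phi>x x t))"
    if t: "\<tau> < t" "t < \<tau>'" for t
  proof -
    \<comment> \<open>The grid time after \<open>t\<close> may exceed \<open>T\<close> for finitely many \<open>k\<close>; there the summand is replaced by 0.\<close>
    have t0: "0 \<le> t" "0 < t" using t \<tau>(1) by auto
    define ok where "ok k = (if real (Suc (nat \<lfloor>t / dt k\<rfloor>)) * dt k \<le> T then 1 else 0 :: real)" for k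
    have "\<forall>\<^sub>F k in sequentially. real (Suc (nat \<lfloor>t / dt k\<rfloor>)) * dt k < \<tau>'"
      by (rule order_tendstoD(2)[OF gt']) (use t \<tau> in auto)
    then have ok: "\<forall>\<^sub>F k in sequentially. ok k = 1" by eventually_elim (use \<tau> in \<open>simp add: ok_def\<close>)
    have "(\<lambda>k. dx k * (\<Sum>j\<in>S k. ok k * (a k (nat \<lfloor>t / dt k\<rfloor>) j * qt k (nat \<lfloor>t / dt k\<rfloor>) j + b k (nat \<lfloor>t / dt k\<rfloor>) j * qx k (nat \<lfloor>t / dt k\<rfloor>) j)))
       \<longlonglongrightarrow> (LINT x|lebesgue. (A x t * \<phi>t x t + B x t * \<phi>x x t))"
    proof (rule grid_sum_tendsto_integral[where B = D and M = "2 * C * M" and X = "X + D"])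
      fix k j
      let ?n = "nat \<lfloor>t / dt k\<rfloor>"
      show "\<bar>ok k * (a k ?n j * qt k ?n j + b k ?n j * qx k ?n j)\<bar> \<le> 2 * C * M"
      proof (cases "real (Suc ?n) * dt k \<le> T")
        case True
        then have "ok k = 1" by (simp add: ok_def)
        then show ?thesis using summand[OF True, of j] by (simp only: mult_1)
      next
        case False
        then show ?thesis using C0 M0 by (simp add: ok_def)
      qed
      show "\<bar>of_int j * dx k\<bar> \<le> X + D" if "ok k * (a k ?n j * qt k ?n j + b k ?n j * qx k ?n j) \<noteq> 0"
      proof (rule ccontr)
        assume "\<not> \<bar>of_int j * dx k\<bar> \<le> X + D"
        then have "qt k ?n j = 0" "qx k ?n j = 0" by (auto intro!: qt_zero qx_zero)
        then show False using that by simp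
      qed
      show "ok k * (a k ?n j * qt k ?n j + b k ?n j * qx k ?n j) = 0" if "j \<notin> S k"
      proof -
        have "int (J k) \<le> \<bar>j\<bar> + 1" using that by (auto simp: S_def)
        from far[OF this] show ?thesis using qt_zero qx_zero by simp
      qed
    next
      show "AE x in lebesgue. (\<lambda>k. ok k * (a k (nat \<lfloor>t / dt k\<rfloor>) \<lfloor>x / dx k\<rfloor> * qt k (nat \<lfloor>t / dt k\<rfloor>) \<lfloor>x / dx k\<rfloor> + b k (nat \<lfloor>t / dt k\<rfloor>) \<lfloor>x / dx k\<rfloor> * qx k (nat \<lfloor>t / dt k\<rfloor>) \<lfloor>x / dx k\<rfloor>))
         \<longlonglongrightarrow> A x t * \<phi>t x t + B x t * \<phi>x x t"
        using A[OF t0(1), folded dt_def] B[OF t0(2), folded dt_def]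
      proof eventually_elim
        case (elim x)
        have "(\<lambda>k. ok k * (a k (nat \<lfloor>t / dt k\<rfloor>) \<lfloor>x / dx k\<rfloor> * qt k (nat \<lfloor>t / dt k\<rfloor>) \<lfloor>x / dx k\<rfloor> + b k (nat \<lfloor>t / dt k\<rfloor>) \<lfloor>x / dx k\<rfloor> * qx k (nat \<lfloor>t / dt k\<rfloor>) \<lfloor>x / dx k\<rfloor>))
           \<longlonglongrightarrow> 1 * (A x t * \<phi>t x t + B x t * \<phi>x x t)"
          by (intro tendsto_mult tendsto_add elim qt_lim qx_lim tendsto_eventually[OF ok]) (use t \<tau> in auto)
        then show ?case by simp
      qed
    qed (use dx D in \<open>auto simp: S_def\<close>)
    then show ?thesis
      by (rule Lim_transform_eventually) (use ok in eventually_elim, simp add: I_def)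
  qed
  have "(\<lambda>k. dt k * (\<Sum>n\<in>{n0 k..<n1 k}. I k n)) \<longlonglongrightarrow> (LINT t:{\<tau>..\<tau>'}|lebesgue. LINT x|lebesgue. (A x t * \<phi>t x t + B x t * \<phi>x x t))"
    unfolding n0_def n1_def
  proof (rule time_sum_tendsto_integral[OF dt \<tau>(1,2)])
    show "\<bar>I k n\<bar> \<le> (2 * (X + D) + 3 * D) * (2 * C * M)" if "real (Suc n) * dt k \<le> \<tau>'" for k n
      by (rule I_bound) (use that \<tau>(3) in linarith)
  qed (rule I_lim)
  moreover have "(\<lambda>k. dt k * (\<Sum>n\<in>{n0 k..<n1 k}. s k n)) \<longlonglongrightarrow> (LINT t:{\<tau>..\<tau>'}|lebesgue. (m (-1) + m 0) * (\<gamma> t * \<phi> 0 t))"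
    unfolding n0_def n1_def
  proof (rule time_sum_tendsto_integral[OF dt \<tau>(1,2)])
    show "\<bar>s k n\<bar> \<le> C * (\<bar>m (-1)\<bar> * M + \<bar>m 0\<bar> * M)" if "real (Suc n) * dt k \<le> \<tau>'" for k n
    proof -
      have "0 \<le> real (Suc n) * dt k" "real (Suc n) * dt k \<le> T" using that \<tau> dt(1)[of k] by auto
      from \<phi>_bound[OF this] have "\<bar>\<Phi> k (Suc n) j\<bar> \<le> M" for j by (simp add: \<Phi>_def)
      then show ?thesis unfolding s_def abs_mult using bounds(3) C0 M0
        by (intro mult_mono order_trans[OF abs_triangle_ineq] add_mono) (auto simp: abs_mult intro: mult_left_mono)
    qed
    fix t assume t: "\<tau> < t" "t < \<tau>'"
    have t0: "0 \<le> t" "0 < t" using t \<tau> by auto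
    have z: "(\<lambda>k. of_int j * dx k) \<longlonglongrightarrow> 0" for j using tendsto_mult_left[OF dx(2), of "of_int j"] by simp
    have "(\<lambda>k. s k (nat \<lfloor>t / dt k\<rfloor>)) \<longlonglongrightarrow> \<gamma> t * (m (-1) * \<phi> 0 t + m 0 * \<phi> 0 t)"
      unfolding s_def \<Phi>_def
      by (intro tendsto_mult tendsto_add tendsto_const comp[OF cont(1)] z gt'[OF t0(1)])
        (use \<gamma>[OF t0(2)] in \<open>simp add: dt_def\<close>)
    then show "(\<lambda>k. s k (nat \<lfloor>t / dt k\<rfloor>)) \<longlonglongrightarrow> (m (-1) + m 0) * (\<gamma> t * \<phi> 0 t)"
      by (simp add: algebra_simps)
  qed
  ultimately have "(LINT x|lebesgue. A x \<tau>' * \<phi> x \<tau>') - (LINT x|lebesgue. A x \<tau> * \<phi> x \<tau>)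
     \<le> (LINT t:{\<tau>..\<tau>'}|lebesgue. LINT x|lebesgue. (A x t * \<phi>t x t + B x t * \<phi>x x t))
     + (LINT t:{\<tau>..\<tau>'}|lebesgue. (m (-1) + m 0) * (\<gamma> t * \<phi> 0 t))"
    using total e_lim[of \<tau>] e_lim[of \<tau>'] \<tau> unfolding n0_def n1_def
    by (intro LIMSEQ_le[OF tendsto_diff tendsto_add]) auto
  then show ?thesis by (simp add: set_integral_mult_right)
qed

section \<open>Smooth functions\<close>

lemma smooth_partial_derivatives:
  fixes \<phi> :: "real \<times> real \<Rightarrow> real"
  assumes "smooth \<phi>"
  shows "((\<lambda>u. \<phi> (x, u)) has_real_derivative deriv (\<lambda>u. \<phi> (x, u)) t) (at t)"
    and "((\<lambda>w. \<phi> (w, t)) has_real_derivative deriv (\<lambda>w. \<phi> (w, t)) x) (at x)"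
    and "continuous_on UNIV \<phi>"
    and "continuous_on UNIV (\<lambda>z. deriv (\<lambda>u. \<phi> (fst z, u)) (snd z))"
    and "continuous_on UNIV (\<lambda>z. deriv (\<lambda>w. \<phi> (w, snd z)) (fst z))"
proof -
  have C: "C_diff 0 \<phi>" "C_diff (Suc 0) \<phi>" using assms unfolding smooth_def by blast+
  let ?D = "\<lambda>z. frechet_derivative \<phi> (at z)"
  have d: "(\<phi> has_derivative ?D z) (at z)" for z
    using C(2) unfolding C_diff.simps frechet_derivative_works[symmetric] by blast
  have c: "continuous_on UNIV (\<lambda>z. ?D z v)" for v using C(2) unfolding C_diff.simps by blast
  have scale: "?D z (h *\<^sub>R v) = h * ?D z v" for z h v
    using linear_scale[OF has_derivative_linear[OF d[of z]], of h v] by simp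
  have t: "((\<lambda>u. \<phi> (x, u)) has_real_derivative ?D (x, t) (0, 1)) (at t)" for x t
  proof -
    have "((\<lambda>u. (x, u)) has_derivative (\<lambda>h. (0, h))) (at t)" by (auto intro!: derivative_eq_intros)
    from has_derivative_compose[OF this d]
    have "((\<lambda>u. \<phi> (x, u)) has_derivative (\<lambda>h. ?D (x, t) (0, h))) (at t)" by simp
    moreover have "(\<lambda>h. ?D (x, t) (0, h)) = (*) (?D (x, t) (0, 1))"
    proof (rule ext)
      fix h
      show "?D (x, t) (0, h) = ?D (x, t) (0, 1) * h" using scale[of "(x, t)" h "(0, 1)"] by (simp add: mult.commute)
    qed
    ultimately show ?thesis unfolding has_field_derivative_def by (simp only:)
  qed
  have x: "((\<lambda>w. \<phi> (w, t)) has_real_derivative ?D (x, t) (1, 0)) (at x)" for x t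
  proof -
    have "((\<lambda>w. (w, t)) has_derivative (\<lambda>h. (h, 0))) (at x)" by (auto intro!: derivative_eq_intros)
    from has_derivative_compose[OF this d]
    have "((\<lambda>w. \<phi> (w, t)) has_derivative (\<lambda>h. ?D (x, t) (h, 0))) (at x)" by simp
    moreover have "(\<lambda>h. ?D (x, t) (h, 0)) = (*) (?D (x, t) (1, 0))"
    proof (rule ext)
      fix h
      show "?D (x, t) (h, 0) = ?D (x, t) (1, 0) * h" using scale[of "(x, t)" h "(1, 0)"] by (simp add: mult.commute)
    qed
    ultimately show ?thesis unfolding has_field_derivative_def by (simp only:)
  qed
  have dt: "deriv (\<lambda>u. \<phi> (x, u)) t = ?D (x, t) (0, 1)" and dx: "deriv (\<lambda>w. \<phi> (w, t)) x = ?D (x, t) (1, 0)" for x t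
    using t x by (auto intro: DERIV_imp_deriv)
  show "((\<lambda>u. \<phi> (x, u)) has_real_derivative deriv (\<lambda>u. \<phi> (x, u)) t) (at t)"
    "((\<lambda>w. \<phi> (w, t)) has_real_derivative deriv (\<lambda>w. \<phi> (w, t)) x) (at x)"
    unfolding dt dx by (rule t x)+
  show "continuous_on UNIV \<phi>" using C(1) by simp
  show "continuous_on UNIV (\<lambda>z. deriv (\<lambda>u. \<phi> (fst z, u)) (snd z))"
    "continuous_on UNIV (\<lambda>z. deriv (\<lambda>w. \<phi> (w, snd z)) (fst z))"
    using c by (simp_all add: dt dx)
qed

lemma smooth_real_derivative:
  fixes \<psi> :: "real \<Rightarrow> real"
  assumes "smooth \<psi>"
  shows "(\<psi> has_real_derivative deriv \<psi> t) (at t)" and "continuous_on UNIV \<psi>"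
    and "continuous_on UNIV (deriv \<psi>)"
proof -
  have C: "C_diff 0 \<psi>" "C_diff (Suc 0) \<psi>" using assms unfolding smooth_def by blast+
  show d: "(\<psi> has_real_derivative deriv \<psi> t) (at t)" for t
    using C(2) DERIV_deriv_iff_real_differentiable by simp
  have "frechet_derivative \<psi> (at t) 1 = deriv \<psi> t" for t
    using frechet_derivative_at[OF d[of t, unfolded has_field_derivative_def]] by (metis mult.right_neutral)
  moreover have "continuous_on UNIV (\<lambda>t. frechet_derivative \<psi> (at t) 1)"
    using C(2) unfolding C_diff.simps by blast
  ultimately show "continuous_on UNIV (deriv \<psi>)" by simp
  show "continuous_on UNIV \<psi>" using C(1) by simp
qed

lemma frechet_derivative_real:
  fixes g :: "real \<Rightarrow> real"
  assumes "(g has_real_derivative D) (at x)"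
  shows "frechet_derivative g (at x) v = v * D"
  using frechet_derivative_at[OF assms[unfolded has_field_derivative_def]] by (metis mult.commute)

lemma C_diff_Suc_real:
  fixes g g' :: "real \<Rightarrow> real"
  assumes "\<And>x. (g has_real_derivative g' x) (at x)"
  shows "C_diff (Suc n) g \<longleftrightarrow> (\<forall>v. C_diff n (\<lambda>x. v * g' x))"
  using assms frechet_derivative_real[OF assms] by (auto simp: real_differentiable_def)

text \<open>Needed for products: the derivative of \<open>g h\<close> contains \<open>g\<close> itself, with one order less of
differentiability to show.\<close>

lemma C_diff_antimono: "C_diff (Suc n) g \<Longrightarrow> C_diff n g"
proof (induction n arbitrary: g)
  case 0
  then show ?case by (auto intro!: continuous_at_imp_continuous_on differentiable_imp_continuous_within)
next
  case (Suc n)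
  then show ?case by (metis C_diff.simps(2))
qed

lemma C_diff_add:
  fixes g h :: "real \<Rightarrow> real"
  shows "C_diff n g \<Longrightarrow> C_diff n h \<Longrightarrow> C_diff n (\<lambda>x. g x + h x)"
proof (induction n arbitrary: g h)
  case 0 then show ?case by (auto intro: continuous_intros)
next
  case (Suc n)
  have d: "g differentiable (at x)" "h differentiable (at x)" for x using Suc.prems by auto
  have "frechet_derivative (\<lambda>x. g x + h x) (at x) v = frechet_derivative g (at x) v + frechet_derivative h (at x) v" for x v
  proof -
    have "((\<lambda>x. g x + h x) has_derivative (\<lambda>v. frechet_derivative g (at x) v + frechet_derivative h (at x) v)) (at x)"
      using d by (intro has_derivative_add) (simp_all flip: frechet_derivative_works)
    then show ?thesis by (metis frechet_derivative_at)
  qed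
  then have "C_diff n (\<lambda>x. frechet_derivative (\<lambda>x. g x + h x) (at x) v)" for v
    by (simp only:) (intro Suc.IH; use Suc.prems in \<open>simp only: C_diff.simps\<close>)
  moreover have "(\<lambda>x. g x + h x) differentiable (at x)" for x
    by (intro differentiable_add d)
  ultimately show ?case by (simp only: C_diff.simps) blast
qed

lemma C_diff_mult:
  fixes g h :: "real \<Rightarrow> real"
  shows "C_diff n g \<Longrightarrow> C_diff n h \<Longrightarrow> C_diff n (\<lambda>x. g x * h x)"
proof (induction n arbitrary: g h)
  case 0 then show ?case by (auto intro: continuous_intros)
next
  case (Suc n)
  have d: "g differentiable (at x)" "h differentiable (at x)" for x using Suc.prems by auto
  have "frechet_derivative (\<lambda>x. g x * h x) (at x) v = g x * frechet_derivative h (at x) v + frechet_derivative g (at x) v * h x" for x v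
  proof -
    have "((\<lambda>x. g x * h x) has_derivative (\<lambda>v. g x * frechet_derivative h (at x) v + frechet_derivative g (at x) v * h x)) (at x)"
      using d by (intro has_derivative_mult) (simp_all flip: frechet_derivative_works)
    then show ?thesis by (metis frechet_derivative_at)
  qed
  then have "C_diff n (\<lambda>x. frechet_derivative (\<lambda>x. g x * h x) (at x) v)" for v
    by (simp only:) (intro C_diff_add Suc.IH C_diff_antimono[OF Suc.prems(1)] C_diff_antimono[OF Suc.prems(2)];
      use Suc.prems in \<open>simp only: C_diff.simps\<close>)
  moreover have "(\<lambda>x. g x * h x) differentiable (at x)" for x
    by (intro differentiable_mult d)
  ultimately show ?case by (simp only: C_diff.simps) blast
qed

text \<open>The functions \<open>P(1/y) exp(-1/y)\<close> of \<open>y = 1 + \<sigma> x\<close>, extended by \<open>0\<close> to \<open>y \<le> 0\<close>.  With an arbitrary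
polynomial \<open>P\<close> they are closed under differentiation, which makes smoothness a plain induction.\<close>

definition flat :: "real \<Rightarrow> real poly \<Rightarrow> real \<Rightarrow> real" where
  "flat \<sigma> P x = (if 0 < 1 + \<sigma> * x then poly P (1 / (1 + \<sigma> * x)) * exp (- (1 / (1 + \<sigma> * x))) else 0)"

lemma poly_times_exp_tendsto_0: "((\<lambda>y. poly P y * exp (- y)) \<longlongrightarrow> (0::real)) at_top"
proof -
  have "((\<lambda>y::real. y ^ i * exp (- y)) \<longlongrightarrow> 0) at_top" for i
    using tendsto_power_div_exp_0[of i] by (simp add: exp_minus divide_inverse)
  then have "((\<lambda>y. \<Sum>i\<le>degree P. coeff P i * (y ^ i * exp (- y))) \<longlongrightarrow> (\<Sum>i\<le>degree P. coeff P i * 0)) at_top"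
    by (intro tendsto_intros)
  then show ?thesis by (simp add: poly_altdef sum_distrib_right mult.assoc)
qed

definition flat_deriv :: "real \<Rightarrow> real poly \<Rightarrow> real poly" where
  "flat_deriv \<sigma> P = smult \<sigma> (monom 1 2 * (P - pderiv P))"

lemma flat_has_derivative:
  assumes \<sigma>: "\<sigma> \<noteq> 0"
  shows "(flat \<sigma> P has_real_derivative flat \<sigma> (flat_deriv \<sigma> P) x) (at x)"
proof (cases "1 + \<sigma> * x" "0 :: real" rule: linorder_cases)
  case less
  have "open {w. 1 + \<sigma> * w < 0}" by (intro open_Collect_less continuous_intros)
  then have "\<forall>\<^sub>F w in nhds x. w \<in> {w. 1 + \<sigma> * w < 0}" using less by (intro eventually_nhds_in_open) auto
  then have ev: "\<forall>\<^sub>F w in nhds x. 0 = flat \<sigma> P w" by eventually_elim (auto simp: flat_def)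
  have "flat \<sigma> (flat_deriv \<sigma> P) x = 0" using less by (simp add: flat_def)
  then show ?thesis using DERIV_cong_ev[OF refl ev, of 0 0] by simp
next
  case greater
  have "open {w. 0 < 1 + \<sigma> * w}" by (intro open_Collect_less continuous_intros)
  then have "\<forall>\<^sub>F w in nhds x. w \<in> {w. 0 < 1 + \<sigma> * w}" using greater by (intro eventually_nhds_in_open) auto
  then have ev: "\<forall>\<^sub>F w in nhds x. poly P (1 / (1 + \<sigma> * w)) * exp (- (1 / (1 + \<sigma> * w))) = flat \<sigma> P w"
    by eventually_elim (auto simp: flat_def)
  let ?y = "1 / (1 + \<sigma> * x)"
  have y: "((\<lambda>w. 1 / (1 + \<sigma> * w)) has_real_derivative (- \<sigma> * ?y\<^sup>2)) (at x)"
    using greater by (auto intro!: derivative_eq_intros simp: power2_eq_square)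
  have "((\<lambda>w. poly P (1 / (1 + \<sigma> * w)) * exp (- (1 / (1 + \<sigma> * w)))) has_real_derivative
      (poly (pderiv P) ?y * (- \<sigma> * ?y\<^sup>2)) * exp (- ?y) + (exp (- ?y) * - (- \<sigma> * ?y\<^sup>2)) * poly P ?y) (at x)"
    by (intro DERIV_mult DERIV_chain2[OF poly_DERIV y] DERIV_chain2[OF DERIV_exp] DERIV_minus y)
  also have "(poly (pderiv P) ?y * (- \<sigma> * ?y\<^sup>2)) * exp (- ?y) + (exp (- ?y) * - (- \<sigma> * ?y\<^sup>2)) * poly P ?y
      = flat \<sigma> (flat_deriv \<sigma> P) x"
    using greater by (simp add: flat_def flat_deriv_def poly_monom algebra_simps)
  finally show ?thesis using DERIV_cong_ev[OF refl ev refl] by blast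
next
  case equal
  have val: "flat \<sigma> P x = 0" "flat \<sigma> (flat_deriv \<sigma> P) x = 0" using equal by (auto simp: flat_def)
  have lim: "((\<lambda>y. \<bar>\<sigma>\<bar> * \<bar>poly (pCons 0 P) y * exp (- y)\<bar>) \<longlongrightarrow> \<bar>\<sigma>\<bar> * \<bar>0\<bar>) at_top"
    by (intro tendsto_intros poly_times_exp_tendsto_0)
  have "((\<lambda>h. flat \<sigma> P (x + h) / h) \<longlongrightarrow> 0) (at 0)"
  proof (rule tendstoI)
    fix e :: real assume "e > 0"
    have "\<forall>\<^sub>F y in at_top. \<bar>\<sigma>\<bar> * \<bar>poly (pCons 0 P) y * exp (- y)\<bar> < e"
      by (rule order_tendstoD(2)[OF lim]) (use \<open>e > 0\<close> in simp)
    then obtain N where N: "\<And>y. y \<ge> N \<Longrightarrow> \<bar>\<sigma>\<bar> * \<bar>poly (pCons 0 P) y * exp (- y)\<bar> < e"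
      by (auto simp: eventually_at_top_linorder)
    define d where "d = 1 / ((\<bar>N\<bar> + 1) * \<bar>\<sigma>\<bar>)"
    have d: "d > 0" using \<sigma> by (simp add: d_def)
    have "dist (flat \<sigma> P (x + h) / h) 0 < e" if h: "h \<noteq> 0" "\<bar>h\<bar> < d" for h
    proof (cases "0 < \<sigma> * h")
      case False
      then show ?thesis using equal \<open>e > 0\<close> by (simp add: flat_def distrib_left add.assoc[symmetric])
    next
      case True
      define y where "y = 1 / (\<sigma> * h)"
      have w: "1 + \<sigma> * (x + h) = \<sigma> * h" using equal by (simp add: distrib_left)
      have "\<sigma> * h \<le> \<bar>\<sigma>\<bar> * \<bar>h\<bar>" by (metis abs_ge_self abs_mult)
      also have "\<dots> \<le> \<bar>\<sigma>\<bar> * d" using h by (intro mult_left_mono) auto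
      also have "\<dots> = 1 / (\<bar>N\<bar> + 1)" using \<sigma> by (simp add: d_def)
      finally have "\<bar>N\<bar> + 1 \<le> y" using True unfolding y_def by (simp add: field_simps)
      then have "\<bar>\<sigma>\<bar> * \<bar>poly (pCons 0 P) y * exp (- y)\<bar> < e" by (intro N) simp
      moreover have "flat \<sigma> P (x + h) / h = \<sigma> * (poly (pCons 0 P) y * exp (- y))"
        using True h \<sigma> unfolding flat_def w by (simp add: y_def field_simps)
      ultimately show ?thesis by (simp add: abs_mult)
    qed
    then show "\<forall>\<^sub>F h in at 0. dist (flat \<sigma> P (x + h) / h) 0 < e"
      unfolding eventually_at using d by (intro exI[of _ d]) (auto simp: dist_real_def)
  qed
  then show ?thesis unfolding DERIV_def val by simp
qed

lemma C_diff_flat: "\<sigma> \<noteq> 0 \<Longrightarrow> C_diff n (flat \<sigma> P)"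
proof (induction n arbitrary: P)
  case 0
  then show ?case using flat_has_derivative[OF 0]
    by (auto intro!: continuous_at_imp_continuous_on DERIV_isCont)
next
  case (Suc n)
  have "(\<lambda>x. v * flat \<sigma> (flat_deriv \<sigma> P) x) = flat \<sigma> (smult v (flat_deriv \<sigma> P))" for v
    by (auto simp: flat_def)
  then show ?case
    unfolding C_diff_Suc_real[of "flat \<sigma> P" "flat \<sigma> (flat_deriv \<sigma> P)", OF flat_has_derivative[OF Suc.prems]]
    using Suc by simp
qed

text \<open>The product of a function that vanishes left of \<open>-1\<close> and one that vanishes right of \<open>1\<close>.\<close>

lemma bump_function_exists:
  obtains \<phi> :: "real \<Rightarrow> real" where "smooth \<phi>" "\<phi> 0 = 1" "\<And>x. 0 \<le> \<phi> x" "\<And>x. 1 \<le> \<bar>x\<bar> \<Longrightarrow> \<phi> x = 0"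
proof
  define \<phi> where "\<phi> x = flat 1 [:exp 2:] x * flat (-1) 1 x" for x
  show "smooth \<phi>" unfolding smooth_def \<phi>_def by (intro allI C_diff_mult C_diff_flat) auto
  have "\<phi> 0 = exp 2 * (exp (-1) * exp (-1))" by (simp add: \<phi>_def flat_def)
  also have "\<dots> = 1" by (simp flip: exp_add)
  finally show "\<phi> 0 = 1" .
  show "0 \<le> \<phi> x" for x by (simp add: \<phi>_def flat_def)
  show "\<phi> x = 0" if "1 \<le> \<bar>x\<bar>" for x using that by (auto simp: \<phi>_def flat_def)
qed

section \<open>The limit density\<close>

text \<open>The cell means of the initial density are difference quotients of its primitive with \<open>x\<close> between the
two points, not at one of them.\<close>

lemma straddling_difference_quotient:
  fixes G :: "real \<Rightarrow> real"
  assumes D: "(G has_real_derivative D) (at x)"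
    and ab: "\<And>k. a k \<le> x" "\<And>k. x \<le> b k" "\<And>k. a k < b k" and lim: "a \<longlonglongrightarrow> x" "b \<longlonglongrightarrow> x"
  shows "(\<lambda>k. (G (b k) - G (a k)) / (b k - a k)) \<longlonglongrightarrow> D"
proof (rule tendstoI)
  fix e :: real assume "e > 0"
  then have "e / 2 > 0" by simp
  have "(G has_derivative (*) D) (at x)" using D by (simp add: has_field_derivative_def)
  then obtain d where d: "d > 0" "\<And>y. norm (y - x) < d \<Longrightarrow> norm (G y - G x - D * (y - x)) \<le> e / 2 * norm (y - x)"
    using \<open>e / 2 > 0\<close> unfolding has_derivative_at_alt by meson
  have "\<forall>\<^sub>F k in sequentially. dist (a k) x < d" "\<forall>\<^sub>F k in sequentially. dist (b k) x < d"
    using tendstoD[OF lim(1) d(1)] tendstoD[OF lim(2) d(1)] by auto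
  then show "\<forall>\<^sub>F k in sequentially. dist ((G (b k) - G (a k)) / (b k - a k)) D < e"
  proof eventually_elim
    case (elim k)
    have "\<bar>G (b k) - G x - D * (b k - x)\<bar> \<le> e / 2 * (b k - x)" "\<bar>G (a k) - G x - D * (a k - x)\<bar> \<le> e / 2 * (x - a k)"
      using d(2)[of "b k"] d(2)[of "a k"] elim ab[of k] by (auto simp: dist_real_def)
    moreover have "G (b k) - G (a k) - D * (b k - a k) = (G (b k) - G x - D * (b k - x)) - (G (a k) - G x - D * (a k - x))"
      by (simp add: algebra_simps)
    moreover have "e / 2 * (b k - x) + e / 2 * (x - a k) = e / 2 * (b k - a k)"
      by (simp only: distrib_left[symmetric]) simp
    ultimately have "\<bar>G (b k) - G (a k) - D * (b k - a k)\<bar> \<le> e / 2 * (b k - a k)" by linarith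
    moreover have "(G (b k) - G (a k)) / (b k - a k) - D = (G (b k) - G (a k) - D * (b k - a k)) / (b k - a k)"
      using ab(3)[of k] by (simp add: diff_divide_distrib)
    ultimately have "\<bar>(G (b k) - G (a k)) / (b k - a k) - D\<bar> \<le> e / 2"
      using ab(3)[of k] by (simp add: divide_le_eq)
    then show ?case using \<open>e > 0\<close> unfolding dist_real_def by linarith
  qed
qed

context scheme_limit begin

definition u :: "nat \<Rightarrow> real \<Rightarrow> real \<Rightarrow> real" where
  "u k x t = U (dx k) (nat \<lfloor>t / dt k\<rfloor>) \<lfloor>x / dx k\<rfloor>"

text \<open>The limit is fixed at every point, with the value \<open>0\<close> where the densities do not converge.  So it is
jointly Borel measurable and has values in \<open>[0, R]\<close> without exceptional sets.\<close>

definition \<rho> :: "real \<Rightarrow> real \<Rightarrow> real" where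
  "\<rho> x t = (if convergent (\<lambda>k. u k x t) then lim (\<lambda>k. u k x t) else 0)"

lemma \<rho>_eq: "(\<lambda>k. u k x t) \<longlonglongrightarrow> l \<Longrightarrow> \<rho> x t = l"
  by (auto simp: \<rho>_def convergent_def limI)

lemma u_range: "u k x t \<in> {0..R}"
  unfolding u_def by (rule U_range[OF dx])

lemma \<rho>_range: "\<rho> x t \<in> {0..R}"
proof (cases "convergent (\<lambda>k. u k x t)")
  case True
  then have l: "(\<lambda>k. u k x t) \<longlonglongrightarrow> \<rho> x t" by (simp add: \<rho>_def convergent_LIMSEQ_iff)
  have "0 \<le> u k x t" "u k x t \<le> R" for k using u_range[of k x t] by auto
  then show ?thesis using LIMSEQ_le_const[OF l, of 0] LIMSEQ_le_const2[OF l, of R] by auto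
qed (use R in \<open>simp add: \<rho>_def\<close>)

lemma grid_point: "(\<lambda>k. of_int (\<lfloor>x / dx k\<rfloor> + i) * dx k) \<longlonglongrightarrow> x"
proof -
  have "(\<lambda>k. of_int \<lfloor>x / dx k\<rfloor> * dx k) \<longlonglongrightarrow> x"
    by (rule tendsto_floor_mult[OF dx0]) (use dx in auto)
  then have "(\<lambda>k. of_int \<lfloor>x / dx k\<rfloor> * dx k + of_int i * dx k) \<longlonglongrightarrow> x + of_int i * 0"
    by (intro tendsto_intros dx0)
  then show ?thesis by (simp add: distrib_right)
qed

lemma grid_time: "0 \<le> t \<Longrightarrow> (\<lambda>k. real (nat \<lfloor>t / dt k\<rfloor>) * dt k) \<longlonglongrightarrow> t"
proof -
  assume t: "0 \<le> t"
  have "(\<lambda>k. of_int \<lfloor>t / dt k\<rfloor> * dt k) \<longlonglongrightarrow> t"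
    by (rule tendsto_floor_mult[OF dt(2)]) (use dt(1) in auto)
  moreover have "real (nat \<lfloor>t / dt k\<rfloor>) = of_int \<lfloor>t / dt k\<rfloor>" for k using t dt(1)[of k] by simp
  ultimately show ?thesis by simp
qed

lemma neighbours_tendsto:
  assumes "0 < t" "x \<noteq> 0" "((\<lambda>x. P x t) has_real_derivative D) (at x)"
  shows "(\<lambda>k. U (dx k) (nat \<lfloor>t / dt k\<rfloor>) (\<lfloor>x / dx k\<rfloor> + i)) \<longlonglongrightarrow> D"
  using U_tendsto[OF filterlim_ident assms(1,2) grid_time grid_point assms(3)] assms(1) by simp

text \<open>Neighbouring cells have the same limit, which makes the numerical fluxes consistent in the limit.\<close>

lemma AE_neighbours_tendsto:
  assumes "0 < t"
  shows "AE x in lebesgue. (\<lambda>k. U (dx k) (nat \<lfloor>t / dt k\<rfloor>) (\<lfloor>x / dx k\<rfloor> + i)) \<longlonglongrightarrow> \<rho> x t"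
proof -
  have "AE x in lebesgue. x \<noteq> (0::real)" using AE_lborel_singleton[of 0] by (simp add: AE_completion_iff)
  then show ?thesis using AE_P_differentiable[OF less_imp_le[OF assms]]
  proof eventually_elim
    case (elim x)
    then obtain D where D: "((\<lambda>x. P x t) has_real_derivative D) (at x)" by blast
    note lim = neighbours_tendsto[OF assms _ D, where i = i] neighbours_tendsto[OF assms _ D, where i = 0]
    have "\<rho> x t = D" using lim(2) elim by (intro \<rho>_eq) (simp add: u_def)
    then show ?case using lim(1) elim by simp
  qed
qed

text \<open>At \<open>t = 0\<close> there is no one-sided bound; convergence of the cell means is Lebesgue's differentiation
theorem.\<close>

lemma AE_initial: "AE x in lebesgue. (\<lambda>k. u k x 0) \<longlonglongrightarrow> \<rho>\<^sub>o (x + y\<^sub>o)"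
proof -
  define G where "G x = (LINT z:{..x}|lebesgue. \<rho>\<^sub>o (z + y\<^sub>o))" for x
  have "AE x in lebesgue. (G has_real_derivative \<rho>\<^sub>o (x + y\<^sub>o)) (at x)"
    by (rule AE_has_derivative_of_indefinite_integral)
      (use cumulative_has_integral(1)[OF integrable_shifted] in \<open>simp add: G_def\<close>)
  then show ?thesis
  proof eventually_elim
    case (elim x)
    have "(\<lambda>k. (G (of_int (\<lfloor>x / dx k\<rfloor> + 1) * dx k) - G (of_int (\<lfloor>x / dx k\<rfloor> + 0) * dx k))
        / (of_int (\<lfloor>x / dx k\<rfloor> + 1) * dx k - of_int (\<lfloor>x / dx k\<rfloor> + 0) * dx k)) \<longlonglongrightarrow> \<rho>\<^sub>o (x + y\<^sub>o)"
    proof (rule straddling_difference_quotient[OF elim _ _ _ grid_point grid_point])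
      fix k
      have "of_int (\<lfloor>x / dx k\<rfloor> + 0) \<le> x / dx k" "x / dx k \<le> of_int (\<lfloor>x / dx k\<rfloor> + 1)" by linarith+
      then have "of_int (\<lfloor>x / dx k\<rfloor> + 0) * dx k \<le> x / dx k * dx k" "x / dx k * dx k \<le> of_int (\<lfloor>x / dx k\<rfloor> + 1) * dx k"
        using dx[of k] by (auto intro!: mult_right_mono simp del: times_divide_eq_left)
      moreover have "x / dx k * dx k = x" using dx[of k] by simp
      ultimately show "of_int (\<lfloor>x / dx k\<rfloor> + 0) * dx k \<le> x" "x \<le> of_int (\<lfloor>x / dx k\<rfloor> + 1) * dx k"
        by (simp_all only:)
      show "of_int (\<lfloor>x / dx k\<rfloor> + 0) * dx k < of_int (\<lfloor>x / dx k\<rfloor> + 1) * dx k"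
        using dx[of k] by (intro mult_strict_right_mono) auto
    qed
    moreover have "(G (of_int (j + 1) * dx k) - G (of_int (j + 0) * dx k)) / (of_int (j + 1) * dx k - of_int (j + 0) * dx k)
        = U (dx k) 0 j" for j k
      using H_slope[OF dx, of k 0 j] dx[of k] by (simp add: G_def algebra_simps)
    ultimately show ?case by (simp add: u_def)
  qed
qed

lemma AE_u_tendsto: "0 \<le> t \<Longrightarrow> AE x in lebesgue. (\<lambda>k. u k x t) \<longlonglongrightarrow> \<rho> x t"
proof (cases "t = 0")
  case True
  show ?thesis using AE_initial unfolding True by eventually_elim (use \<rho>_eq in auto)
next
  case False
  assume "0 \<le> t"
  then show ?thesis using AE_neighbours_tendsto[of t 0] False by (simp add: u_def)
qed

lemma \<rho>_initial: "AE x in lebesgue. \<rho> x 0 = \<rho>\<^sub>o (x + y\<^sub>o)"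
  using AE_initial by eventually_elim (rule \<rho>_eq)

lemma u_measurable [measurable]: "(\<lambda>z. u k (fst z) (snd z)) \<in> borel_measurable (borel \<Otimes>\<^sub>M borel)"
  unfolding u_def
proof (rule measurable_compose_countable[where f = "\<lambda>j z. U (dx k) (nat \<lfloor>snd z / dt k\<rfloor>) j" and g = "\<lambda>z. \<lfloor>fst z / dx k\<rfloor>"])
  show "(\<lambda>z. U (dx k) (nat \<lfloor>snd z / dt k\<rfloor>) j) \<in> borel_measurable (borel \<Otimes>\<^sub>M borel)" for j
    by (rule measurable_compose[of _ _ "count_space UNIV" "\<lambda>i. U (dx k) (nat i) j"]) measurable
qed measurable

lemma \<rho>_measurable [measurable]: "(\<lambda>z. \<rho> (fst z) (snd z)) \<in> borel_measurable (borel \<Otimes>\<^sub>M borel)"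
proof -
  have "Measurable.pred (borel \<Otimes>\<^sub>M borel) (\<lambda>z. Cauchy (\<lambda>k. u k (fst z) (snd z)))"
    unfolding pred_def by (rule sets_Collect_Cauchy) measurable
  moreover have "(\<lambda>z. lim (\<lambda>k. u k (fst z) (snd z))) \<in> borel_measurable (borel \<Otimes>\<^sub>M borel)"
    by (rule borel_measurable_lim_metric) measurable
  ultimately show ?thesis unfolding \<rho>_def Cauchy_convergent_iff[symmetric] by measurable
qed

lemma \<rho>_slice_measurable: "(\<lambda>x. \<rho> x t) \<in> borel_measurable lebesgue"
proof -
  have "(\<lambda>x. \<rho> x t) \<in> borel_measurable borel"
    using measurable_compose[OF _ \<rho>_measurable, of "\<lambda>x. (x, t)" borel] by simp
  then show ?thesis by (intro measurable_completion) simp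
qed

text \<open>\<open>U_tendsto\<close> along pairs of a mesh index \<open>k\<close> and a time index \<open>m\<close> gives
\<open>u k x (w m) \<longlongrightarrow> \<rho> x t\<close> as both tend to infinity; letting first \<open>k\<close> tend to infinity gives the claim.\<close>

lemma \<rho>_continuous_in_time:
  assumes t: "0 < t" and w: "w \<longlonglongrightarrow> t" "\<And>m. 0 < w m"
  shows "AE x in lebesgue. (\<lambda>m. \<rho> x (w m)) \<longlonglongrightarrow> \<rho> x t"
proof -
  have "AE x in lebesgue. \<forall>m. (\<lambda>k. u k x (w m)) \<longlonglongrightarrow> \<rho> x (w m)"
    unfolding AE_all_countable using AE_u_tendsto w(2) less_imp_le by blast
  moreover have "AE x in lebesgue. x \<noteq> (0::real)" using AE_lborel_singleton[of 0] by (simp add: AE_completion_iff)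
  moreover have "AE x in lebesgue. \<exists>D. ((\<lambda>x. P x t) has_real_derivative D) (at x)"
    using AE_P_differentiable t by simp
  ultimately show ?thesis
  proof eventually_elim
    case (elim x)
    then obtain D where D: "((\<lambda>x. P x t) has_real_derivative D) (at x)" by blast
    have "(\<lambda>k. u k x t) \<longlonglongrightarrow> D"
      using neighbours_tendsto[OF t _ D, where i = 0] elim(2) by (simp add: u_def)
    then have \<rho>: "\<rho> x t = D" by (rule \<rho>_eq)
    let ?F = "sequentially \<times>\<^sub>F sequentially :: (nat \<times> nat) filter"
    have k: "filterlim fst sequentially ?F" and m: "filterlim snd sequentially ?F"
      by (auto simp: filterlim_fst filterlim_snd)
    have wm: "((\<lambda>p. w (snd p)) \<longlongrightarrow> t) ?F" by (rule filterlim_compose[OF w(1) m])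
    have "((\<lambda>p. U (dx (fst p)) (nat \<lfloor>w (snd p) / dt (fst p)\<rfloor>) \<lfloor>x / dx (fst p)\<rfloor>) \<longlongrightarrow> D) ?F"
    proof (rule U_tendsto[OF k t elim(2) _ _ D])
      have "((\<lambda>p. real (nat \<lfloor>w (snd p) / dt (fst p)\<rfloor>) * dt (fst p) - w (snd p)) \<longlongrightarrow> 0) ?F"
        by (rule Lim_null_comparison[OF _ filterlim_compose[OF dt(2) k]])
          (use floor_mult_close(2)[OF dt(1) less_imp_le[OF w(2)]] in \<open>auto intro!: always_eventually\<close>)
      from tendsto_add[OF this wm] show "((\<lambda>p. real (nat \<lfloor>w (snd p) / dt (fst p)\<rfloor>) * dt (fst p)) \<longlongrightarrow> t) ?F" by simp
      show "((\<lambda>p. of_int \<lfloor>x / dx (fst p)\<rfloor> * dx (fst p)) \<longlongrightarrow> x) ?F"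
        using filterlim_compose[OF grid_point[of x 0] k] by simp
    qed
    then have lim: "((\<lambda>p. u (fst p) x (w (snd p))) \<longlongrightarrow> D) ?F" by (simp add: u_def)
    show "(\<lambda>m. \<rho> x (w m)) \<longlonglongrightarrow> \<rho> x t"
      unfolding \<rho>
    proof (rule tendstoI)
      fix e :: real assume "e > 0"
      then have "\<forall>\<^sub>F p in ?F. dist (u (fst p) x (w (snd p))) D < e / 2" by (intro tendstoD[OF lim]) simp
      then obtain A B where AB: "eventually A sequentially" "eventually B sequentially"
        "\<And>k m. A k \<Longrightarrow> B m \<Longrightarrow> dist (u k x (w m)) D < e / 2"
        unfolding eventually_prod_filter by auto
      show "\<forall>\<^sub>F m in sequentially. dist (\<rho> x (w m)) D < e"
        using AB(2)
      proof eventually_elim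
        case (elim m)
        have "dist (\<rho> x (w m)) D \<le> e / 2"
        proof (rule tendsto_upperbound)
          show "(\<lambda>k. dist (u k x (w m)) D) \<longlonglongrightarrow> dist (\<rho> x (w m)) D"
            using \<open>\<forall>m. (\<lambda>k. u k x (w m)) \<longlonglongrightarrow> \<rho> x (w m)\<close> by (intro tendsto_dist tendsto_const) blast
          show "\<forall>\<^sub>F k in sequentially. dist (u k x (w m)) D \<le> e / 2"
            using AB(1) by eventually_elim (use AB(3) elim less_imp_le in blast)
        qed simp
        then show ?case using \<open>e > 0\<close> by linarith
      qed
    qed
  qed
qed

end

section \<open>Continuity in time and convergence of the speed\<close>

lemma bounded_set_integrable:
  fixes g :: "real \<Rightarrow> real"
  assumes "g \<in> borel_measurable lebesgue" "\<And>x. \<bar>g x\<bar> \<le> C" "A \<in> sets lebesgue" "bounded A"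
  shows "set_integrable lebesgue A g"
  unfolding set_integrable_def
proof (rule Bochner_Integration.integrable_bound)
  obtain M where "A \<subseteq> {-M..M}" using \<open>bounded A\<close> by (auto simp: bounded_iff abs_le_iff subset_eq) (metis minus_le_iff)
  then have "emeasure lebesgue A \<le> emeasure lebesgue {-M..M}" by (intro emeasure_mono) auto
  also have "\<dots> < \<infinity>" by (simp add: emeasure_lborel_Icc_eq)
  finally show "integrable lebesgue (\<lambda>x. C * indicator A x)"
    using assms(3) by (intro integrable_mult_right integrable_real_indicator) auto
  show "AE x in lebesgue. norm (indicator A x *\<^sub>R g x) \<le> norm (C * indicator A x)"
    using assms(2) by (intro always_eventually allI) (auto simp: indicator_def intro: order_trans[OF _ abs_ge_self])
qed (use assms in \<open>auto intro: borel_measurable_indicator\<close>)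

lemma set_integral_subset_mono:
  fixes g :: "real \<Rightarrow> real"
  assumes "set_integrable lebesgue A g" "set_integrable lebesgue B g" "A \<subseteq> B" "\<And>x. 0 \<le> g x"
  shows "(LINT x:A|lebesgue. g x) \<le> (LINT x:B|lebesgue. g x)"
  unfolding set_lebesgue_integral_def
proof (rule integral_mono)
  show "indicator A x *\<^sub>R g x \<le> indicator B x *\<^sub>R g x" for x
  proof (cases "x \<in> A")
    case True
    then have "x \<in> B" using assms(3) by (rule rev_subsetD)
    then show ?thesis using True by simp
  qed (use assms(4) in simp)
qed (use assms(1,2) in \<open>simp_all only: set_integrable_def\<close>)

context scheme_limit begin

abbreviation Sk :: "nat \<Rightarrow> real \<Rightarrow> real" where "Sk k t \<equiv> S (dx k) (nat \<lfloor>t / dt k\<rfloor>)"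

definition v :: "real \<Rightarrow> real" where "v t = \<omega> (LINT x|lebesgue. \<rho> x t * \<mu> x)"

lemma \<rho>_\<mu>_integrable: "integrable lebesgue (\<lambda>x. \<rho> x t * \<mu> x)"
proof (rule Bochner_Integration.integrable_bound)
  show "integrable lebesgue (\<lambda>x. R * \<mu> x)" using \<mu> by simp
  show "(\<lambda>x. \<rho> x t * \<mu> x) \<in> borel_measurable lebesgue"
    by (intro borel_measurable_times \<rho>_slice_measurable borel_measurable_integrable \<mu>)
  show "AE x in lebesgue. norm (\<rho> x t * \<mu> x) \<le> norm (R * \<mu> x)"
    using \<rho>_range R by (intro always_eventually allI) (auto simp: abs_mult intro!: mult_right_mono)
qed

lemma weighted_range: "(LINT x|lebesgue. \<rho> x t * \<mu> x) \<in> {0..R}"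
  by (rule weighted_mean_range[OF \<rho>_\<mu>_integrable]) (use \<rho>_range in auto)

lemma v_range: "v t \<in> {0..smax}"
  unfolding v_def by (rule \<omega>[OF weighted_range])

lemma weighted_tendsto:
  assumes "\<And>m x. w m x \<in> {0..R}" "\<And>m. w m \<in> borel_measurable lebesgue"
    and "AE x in lebesgue. (\<lambda>m. w m x) \<longlonglongrightarrow> \<rho> x t"
  shows "(\<lambda>m. LINT x|lebesgue. w m x * \<mu> x) \<longlonglongrightarrow> (LINT x|lebesgue. \<rho> x t * \<mu> x)"
proof (rule integral_dominated_convergence[where w = "\<lambda>x. \<bar>R * \<mu> x\<bar>"])
  show "(\<lambda>x. \<rho> x t * \<mu> x) \<in> borel_measurable lebesgue" using \<rho>_\<mu>_integrable by (rule borel_measurable_integrable)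
  show "(\<lambda>x. w m x * \<mu> x) \<in> borel_measurable lebesgue" for m
    by (intro borel_measurable_times assms borel_measurable_integrable \<mu>)
  show "integrable lebesgue (\<lambda>x. \<bar>R * \<mu> x\<bar>)" using \<mu> by simp
  show "AE x in lebesgue. (\<lambda>m. w m x * \<mu> x) \<longlonglongrightarrow> \<rho> x t * \<mu> x"
    using assms(3) by eventually_elim (intro tendsto_intros)
  show "AE x in lebesgue. norm (w m x * \<mu> x) \<le> \<bar>R * \<mu> x\<bar>" for m
    using assms(1)[of m] R by (intro always_eventually allI) (auto simp: abs_mult intro!: mult_right_mono)
qed

lemma \<omega>_tendsto:
  assumes "a \<longlonglongrightarrow> l" "\<And>m. a m \<in> {0..R}" "l \<in> {0..R}"
  shows "(\<lambda>m. \<omega> (a m)) \<longlonglongrightarrow> \<omega> l"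
  using continuous_on_tendsto_compose[OF lipschitz_on_continuous_on[OF \<omega>_lip] assms(1,3)] assms(2) by simp

lemma u_slice_measurable: "(\<lambda>x. u k x t) \<in> borel_measurable lebesgue"
  unfolding u_def by (rule measurable_completion) measurable

lemma S_eq: "Sk k t = \<omega> (LINT x|lebesgue. u k x t * \<mu> x)"
  unfolding S_def u_def by (rule speed_of_eq(1)[OF dx U_range[OF dx]])

lemma S_tendsto: "0 \<le> t \<Longrightarrow> (\<lambda>k. Sk k t) \<longlonglongrightarrow> v t"
  unfolding S_eq v_def
proof (rule \<omega>_tendsto)
  assume t: "0 \<le> t"
  show "(\<lambda>k. LINT x|lebesgue. u k x t * \<mu> x) \<longlonglongrightarrow> (LINT x|lebesgue. \<rho> x t * \<mu> x)"
    by (rule weighted_tendsto[OF u_range u_slice_measurable AE_u_tendsto[OF t]])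
  show "(LINT x|lebesgue. u k x t * \<mu> x) \<in> {0..R}" for k
    by (rule weighted_mean_range) (use speed_of_eq(2)[OF dx U_range[OF dx]] u_range in \<open>auto simp: u_def\<close>)
qed (rule weighted_range)

lemma v_continuous: "continuous_on {0<..} v"
proof (rule continuous_on_sequentiallyI)
  fix w :: "nat \<Rightarrow> real" and t assume w: "\<forall>n. w n \<in> {0<..}" "t \<in> {0<..}" "w \<longlonglongrightarrow> t"
  show "(\<lambda>n. v (w n)) \<longlonglongrightarrow> v t"
    unfolding v_def
    by (intro \<omega>_tendsto weighted_tendsto \<rho>_range \<rho>_slice_measurable weighted_range \<rho>_continuous_in_time)
      (use w in auto)
qed

lemma EF_bound:
  assumes "s \<in> {0..smax}" "a \<in> {0..R}" "b \<in> {0..R}" "k \<in> {0..R}"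
  shows "\<bar>EF s j k a b\<bar> \<le> 4 * R / lam"
proof -
  have m: "max a k \<in> {0..R}" "max b k \<in> {0..R}" "min a k \<in> {0..R}" "min b k \<in> {0..R}" using assms(2-4) by (simp_all add: max_def min_def)
  have "\<bar>EF s j k a b\<bar> \<le> 2 * R / lam + 2 * R / lam" unfolding EF_def
    by (intro order_trans[OF abs_triangle_ineq4] add_mono edge_flux_bound(1) assms(1) m)
  then show ?thesis by simp
qed

lemma constraint_excess_bound:
  assumes "s \<in> {0..smax}" "k \<in> {0..R}"
  shows "constraint_excess f s k (Q s) \<le> 2 * R / lam"
proof -
  have "\<bar>flux f s k\<bar> \<le> R / lam" by (rule edge_flux_bound(3)[OF assms assms(2)])
  moreover have "0 \<le> R / lam" using R lam by simp
  ultimately have "constraint_excess f s k (Q s) \<le> R / lam + R / lam"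
    using Q[OF assms(1)] by (auto simp: constraint_excess_def min_def)
  then show ?thesis by simp
qed

text \<open>The Kruzhkov inequality summed over an interval: in one step the two end edges contribute at most
\<open>4R\<close> each and the two cells next to the constraint at most \<open>2R\<close> each, which adds up to \<open>12R\<close>.\<close>

lemma interval_step:
  assumes \<kappa>: "\<kappa> \<in> {0..R}"
  shows "(\<Sum>j\<in>{i..<i'}. \<bar>U (dx k) n j - \<kappa>\<bar>) \<le> (\<Sum>j\<in>{i..<i'}. \<bar>U (dx k) 0 j - \<kappa>\<bar>) + 12 * R * real n"
proof (cases "i \<le> i'")
  case le: True
  show ?thesis
  proof (induction n)
    case (Suc n)
    define s where "s = S (dx k) n"
    have s: "s \<in> {0..smax}" unfolding s_def by (rule S_range[OF dx])
    define X where "X = constraint_excess f s \<kappa> (Q s)"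
    define \<Phi> where "\<Phi> j = EF s j \<kappa> (U (dx k) n (j - 1)) (U (dx k) n j)" for j
    have X: "0 \<le> lam * X" "lam * X \<le> 2 * R"
      using mult_left_mono[OF constraint_excess_bound[OF s \<kappa>], of lam] constraint_excess_nonneg[of s \<kappa> "Q s"] lam
      by (auto simp: X_def)
    have \<Phi>: "lam * \<bar>\<Phi> j\<bar> \<le> 4 * R" for j
      using mult_left_mono[OF EF_bound[OF s U_range[OF dx] U_range[OF dx] \<kappa>], of lam j k n "j - 1" k n j] lam
      by (simp add: \<Phi>_def)
    have "(\<Sum>j\<in>{i..<i'}. \<bar>U (dx k) (Suc n) j - \<kappa>\<bar>)
        \<le> (\<Sum>j\<in>{i..<i'}. \<bar>U (dx k) n j - \<kappa>\<bar> - lam * (\<Phi> (j + 1) - \<Phi> j) + lam * X * (if j \<in> {-1, 0} then 1 else 0))"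
      unfolding U_Suc \<Phi>_def X_def s_def
      using step_entropy[where u = "U (dx k) n" and s = "S (dx k) n", OF S_range[OF dx] U_range[OF dx] \<kappa>]
      by (intro sum_mono) (simp only: add_diff_cancel_right')
    also have "\<dots> = (\<Sum>j\<in>{i..<i'}. \<bar>U (dx k) n j - \<kappa>\<bar>) - lam * (\<Sum>j\<in>{i..<i'}. \<Phi> (j + 1) - \<Phi> j)
        + lam * X * (\<Sum>j\<in>{i..<i'}. if j \<in> {-1, 0} then 1 else 0)"
      by (simp only: sum.distrib sum_subtractf sum_distrib_left[symmetric])
    also have "(\<Sum>j\<in>{i..<i'}. \<Phi> (j + 1) - \<Phi> j) = \<Phi> i' - \<Phi> i"
    proof -
      have "m \<ge> i \<Longrightarrow> (\<Sum>j\<in>{i..<m}. \<Phi> (j + 1) - \<Phi> j) = \<Phi> m - \<Phi> i" for m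
      proof (induction m rule: int_ge_induct)
        case (step m)
        have "{i..<m + 1} = insert m {i..<m}" using step.hyps by auto
        then show ?case using step.IH by simp
      qed simp
      then show ?thesis using le by simp
    qed
    also have "(\<Sum>j\<in>{i..<i'}. if j \<in> {-1, 0} then 1 else 0 :: real) \<le> 2"
    proof -
      have "(\<Sum>j\<in>{i..<i'}. if j \<in> {-1, 0} then 1 else 0 :: real) = real (card ({i..<i'} \<inter> {-1, 0}))"
        by (subst sum.inter_restrict[symmetric]) simp_all
      also have "card ({i..<i'} \<inter> {-1, 0}) \<le> card {-1, 0 :: int}" by (intro card_mono) auto
      finally show ?thesis by simp
    qed
    finally have "(\<Sum>j\<in>{i..<i'}. \<bar>U (dx k) (Suc n) j - \<kappa>\<bar>)
        \<le> (\<Sum>j\<in>{i..<i'}. \<bar>U (dx k) n j - \<kappa>\<bar>) - lam * (\<Phi> i' - \<Phi> i) + lam * X * 2"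
      using X(1) by (simp add: mult_left_mono)
    moreover have "- (lam * (\<Phi> i' - \<Phi> i)) \<le> 8 * R"
    proof -
      have "- (lam * (\<Phi> i' - \<Phi> i)) \<le> lam * \<bar>\<Phi> i'\<bar> + lam * \<bar>\<Phi> i\<bar>"
        unfolding distrib_left[symmetric] minus_mult_right using lam by (intro mult_left_mono) auto
      then show ?thesis using \<Phi>[of i'] \<Phi>[of i] by linarith
    qed
    moreover have "12 * R * real (Suc n) = 12 * R * real n + 12 * R" by (simp add: algebra_simps)
    ultimately show ?case using Suc.IH X(2) by linarith
  qed simp
qed (use R in simp)

lemma interval_estimate:
  assumes \<kappa>: "\<kappa> \<in> {0..R}" and t: "0 \<le> t"
  shows "(LINT x:{c..d}|lebesgue. \<bar>\<rho> x t - \<kappa>\<bar>) \<le> (LINT x:{c..d}|lebesgue. \<bar>\<rho> x 0 - \<kappa>\<bar>) + 12 * R / lam * t"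
proof -
  have lim: "(\<lambda>k. dx k * (\<Sum>j\<in>{\<lfloor>c / dx k\<rfloor>..<\<lfloor>d / dx k\<rfloor>}. \<bar>U (dx k) (nat \<lfloor>t / dt k\<rfloor>) j - \<kappa>\<bar>))
      \<longlonglongrightarrow> (LINT x:{c..d}|lebesgue. \<bar>\<rho> x t - \<kappa>\<bar>)" if t: "0 \<le> t" for t
  proof (rule interval_sum_tendsto_integral[OF dx dx0])
    show "\<bar>\<bar>U (dx k) (nat \<lfloor>t / dt k\<rfloor>) j - \<kappa>\<bar>\<bar> \<le> R" for k j
      using U_range[OF dx, of k "nat \<lfloor>t / dt k\<rfloor>" j] \<kappa> by auto
    show "AE x in lebesgue. c < x \<and> x < d \<longrightarrow> (\<lambda>k. \<bar>U (dx k) (nat \<lfloor>t / dt k\<rfloor>) \<lfloor>x / dx k\<rfloor> - \<kappa>\<bar>) \<longlonglongrightarrow> \<bar>\<rho> x t - \<kappa>\<bar>"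
      using AE_u_tendsto[OF t] by eventually_elim (auto simp: u_def intro!: tendsto_intros)
  qed
  have "(\<lambda>k. dx k * (\<Sum>j\<in>{\<lfloor>c / dx k\<rfloor>..<\<lfloor>d / dx k\<rfloor>}. \<bar>U (dx k) 0 j - \<kappa>\<bar>) + 12 * R / lam * (real (nat \<lfloor>t / dt k\<rfloor>) * dt k))
      \<longlonglongrightarrow> (LINT x:{c..d}|lebesgue. \<bar>\<rho> x 0 - \<kappa>\<bar>) + 12 * R / lam * t"
    using lim[of 0] by (intro tendsto_add tendsto_mult_left grid_time[OF t]) simp
  then show ?thesis
  proof (rule LIMSEQ_le[OF lim[OF t]], intro exI allI impI)
    fix k :: nat
    show "dx k * (\<Sum>j\<in>{\<lfloor>c / dx k\<rfloor>..<\<lfloor>d / dx k\<rfloor>}. \<bar>U (dx k) (nat \<lfloor>t / dt k\<rfloor>) j - \<kappa>\<bar>)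
      \<le> dx k * (\<Sum>j\<in>{\<lfloor>c / dx k\<rfloor>..<\<lfloor>d / dx k\<rfloor>}. \<bar>U (dx k) 0 j - \<kappa>\<bar>) + 12 * R / lam * (real (nat \<lfloor>t / dt k\<rfloor>) * dt k)"
      using mult_left_mono[OF interval_step[OF \<kappa>, where i = "\<lfloor>c / dx k\<rfloor>" and i' = "\<lfloor>d / dx k\<rfloor>" and k = k and n = "nat \<lfloor>t / dt k\<rfloor>"], of "dx k"] dx[of k] lam
      by (simp add: dt_def distrib_left mult_ac)
  qed
qed

text \<open>The Kruzhkov inequality compares with constants only, so the initial density is replaced by a
function \<open>\<sigma>\<close> that is constant on the cells of one fixed fine mesh.  On each of these finitely many
cells \<open>interval_estimate\<close> applies.\<close>

lemma local_continuity_at_0: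
  assumes "e > 0"
  shows "\<exists>\<delta>>0. \<forall>t. 0 \<le> t \<and> t < \<delta> \<longrightarrow> (LINT x:{-X..X}|lebesgue. \<bar>\<rho> x t - \<rho> x 0\<bar>) < e"
proof -
  let ?X = "\<bar>X\<bar> + 1"
  \<comment> \<open>Approximate the initial density by a function that is constant on the cells of one mesh.\<close>
  have "(\<lambda>m. LINT x:{-?X..?X}|lebesgue. \<bar>u m x 0 - \<rho> x 0\<bar>) \<longlonglongrightarrow> (LINT x:{-?X..?X}|lebesgue. 0)"
    unfolding set_lebesgue_integral_def
  proof (rule integral_dominated_convergence[where w = "\<lambda>x. indicator {-?X..?X} x *\<^sub>R R"])
    show "integrable lebesgue (\<lambda>x. indicator {-?X..?X} x *\<^sub>R R)"
      using bounded_set_integrable[of "\<lambda>_. R" R "{-?X..?X}"] R by (simp add: set_integrable_def)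
    show "(\<lambda>x. indicator {-?X..?X} x *\<^sub>R \<bar>u m x 0 - \<rho> x 0\<bar>) \<in> borel_measurable lebesgue" for m
      by (intro borel_measurable_scaleR borel_measurable_indicator borel_measurable_abs borel_measurable_diff
          u_slice_measurable \<rho>_slice_measurable) simp
    show "AE x in lebesgue. (\<lambda>m. indicator {-?X..?X} x *\<^sub>R \<bar>u m x 0 - \<rho> x 0\<bar>) \<longlonglongrightarrow> indicator {-?X..?X} x *\<^sub>R 0"
      using AE_u_tendsto[OF order_refl]
    proof eventually_elim
      case (elim x)
      have "(\<lambda>m. indicator {-?X..?X} x *\<^sub>R \<bar>u m x 0 - \<rho> x 0\<bar>) \<longlonglongrightarrow> indicator {-?X..?X} x *\<^sub>R \<bar>\<rho> x 0 - \<rho> x 0\<bar>"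
        by (intro tendsto_intros elim)
      then show ?case by simp
    qed
    have "\<bar>u m x 0 - \<rho> x 0\<bar> \<le> R" for m x using u_range[of m x 0] \<rho>_range[of x 0] by auto
    then show "AE x in lebesgue. norm (indicator {-?X..?X} x *\<^sub>R \<bar>u m x 0 - \<rho> x 0\<bar>) \<le> indicator {-?X..?X} x *\<^sub>R R" for m
      by (intro always_eventually allI) (auto simp: indicator_def)
  qed auto
  then have "(\<lambda>m. LINT x:{-?X..?X}|lebesgue. \<bar>u m x 0 - \<rho> x 0\<bar>) \<longlonglongrightarrow> 0" by (simp add: set_lebesgue_integral_def)
  then have "\<forall>\<^sub>F m in sequentially. (LINT x:{-?X..?X}|lebesgue. \<bar>u m x 0 - \<rho> x 0\<bar>) < e / 4"
    by (rule order_tendstoD) (use \<open>e > 0\<close> in simp)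
  moreover have "\<forall>\<^sub>F m in sequentially. dx m < 1" by (rule order_tendstoD(2)[OF dx0]) simp
  ultimately have "\<forall>\<^sub>F m in sequentially. (LINT x:{-?X..?X}|lebesgue. \<bar>u m x 0 - \<rho> x 0\<bar>) < e / 4 \<and> dx m < 1"
    by eventually_elim blast
  then obtain m where m: "(LINT x:{-?X..?X}|lebesgue. \<bar>u m x 0 - \<rho> x 0\<bar>) < e / 4" "dx m < 1"
    using eventually_happens'[OF sequentially_bot] by blast
  define h where "h = dx m"
  have h: "h > 0" "h < 1" using dx m(2) by (auto simp: h_def)
  define \<sigma> where "\<sigma> x = u m x 0" for x
  define N where "N = nat \<lceil>\<bar>X\<bar> / h\<rceil>"
  have N: "\<bar>X\<bar> \<le> real N * h" "real N * h \<le> ?X"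
  proof -
    have "\<bar>X\<bar> / h \<le> real N" "real N \<le> \<bar>X\<bar> / h + 1" using h by (auto simp: N_def)
    note Nb = this
    show "\<bar>X\<bar> \<le> real N * h" using Nb(1) h(1) by (simp only: pos_divide_le_eq)
    have "real N * h \<le> (\<bar>X\<bar> / h + 1) * h" using Nb(2) h(1) by (rule mult_right_mono[OF _ less_imp_le])
    also have "\<dots> = \<bar>X\<bar> + h" using h(1) by (simp add: distrib_right)
    finally show "real N * h \<le> ?X" using h(2) by linarith
  qed
  define I where "I A t = (LINT x:A|lebesgue. \<bar>\<rho> x t - \<sigma> x\<bar>)" for A t
  have \<sigma>_meas: "\<sigma> \<in> borel_measurable lebesgue" using u_slice_measurable[of m 0] by (simp add: \<sigma>_def[abs_def])
  have int: "set_integrable lebesgue A (\<lambda>x. \<bar>\<rho> x t - g x\<bar>)"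
    if "A \<in> sets lebesgue" "bounded A" "g \<in> borel_measurable lebesgue" "\<And>x. g x \<in> {0..R}" for A t g
  proof (rule bounded_set_integrable[OF _ _ that(1,2)])
    show "\<bar>\<bar>\<rho> x t - g x\<bar>\<bar> \<le> R" for x using \<rho>_range[of x t] that(4)[of x] by auto
    show "(\<lambda>x. \<bar>\<rho> x t - g x\<bar>) \<in> borel_measurable lebesgue"
      by (intro borel_measurable_abs borel_measurable_diff \<rho>_slice_measurable that)
  qed
  have \<sigma>_range: "\<sigma> x \<in> {0..R}" for x unfolding \<sigma>_def by (rule u_range)
  note int\<sigma> = int[OF _ _ \<sigma>_meas \<sigma>_range]
  have cell: "I {of_int i * h..<of_int (i + 1) * h} t \<le> I {of_int i * h..<of_int (i + 1) * h} 0 + 12 * R / lam * t"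
    if t: "0 \<le> t" for i t
  proof -
    define \<kappa> where "\<kappa> = U (dx m) 0 i"
    have \<kappa>: "\<kappa> \<in> {0..R}" unfolding \<kappa>_def by (rule U_range[OF dx])
    have "I {of_int i * h..<of_int (i + 1) * h} t = (LINT x:{of_int i * h..of_int (i + 1) * h}|lebesgue. \<bar>\<rho> x t - \<kappa>\<bar>)" for t
      unfolding I_def set_lebesgue_integral_def
    proof (rule integral_cong_AE)
      have "AE x in lebesgue. x \<noteq> of_int (i + 1) * h"
        using AE_lborel_singleton by (simp only: AE_completion_iff)
      then show "AE x in lebesgue. indicator {of_int i * h..<of_int (i + 1) * h} x *\<^sub>R \<bar>\<rho> x t - \<sigma> x\<bar>
          = indicator {of_int i * h..of_int (i + 1) * h} x *\<^sub>R \<bar>\<rho> x t - \<kappa>\<bar>"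
      proof eventually_elim
        case (elim x)
        show ?case
        proof (cases "x \<in> {of_int i * h..<of_int (i + 1) * h}")
          case True
          then have "\<lfloor>x / h\<rfloor> = i" using h by (auto simp: floor_eq_iff le_divide_eq divide_less_eq)
          then show ?thesis using True by (simp add: \<sigma>_def u_def \<kappa>_def h_def)
        next
          case False
          then show ?thesis using elim by (auto simp: indicator_def)
        qed
      qed
    qed (intro borel_measurable_scaleR borel_measurable_indicator borel_measurable_abs borel_measurable_diff
          borel_measurable_const \<rho>_slice_measurable \<sigma>_meas; simp)+
    then show ?thesis using interval_estimate[OF \<kappa> t] by simp
  qed
  have grow: "I {- real N * h..<(- real N + real n) * h} t \<le> I {- real N * h..<(- real N + real n) * h} 0 + real n * (12 * R / lam * t)"
    if t: "0 \<le> t" for n t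
  proof (induction n)
    case 0 then show ?case by (simp add: I_def set_lebesgue_integral_def)
  next
    case (Suc n)
    let ?a = "- real N * h" and ?b = "(- real N + real n) * h" and ?c = "(- real N + real (Suc n)) * h"
    have "?a \<le> ?b" by (rule mult_right_mono) (use h in auto)
    moreover have "?b \<le> ?c" by (rule mult_right_mono) (use h in auto)
    ultimately have "{?a..<?c} = {?a..<?b} \<union> {?b..<?c}" by (simp add: ivl_disj_un_two(3))
    then have split: "I {?a..<?c} t = I {?a..<?b} t + I {?b..<?c} t" for t
      unfolding I_def by (simp only:) (rule set_integral_Un; (rule int\<sigma>)?; auto)
    have "?b = of_int (- int N + int n) * h" "?c = of_int (- int N + int n + 1) * h" by simp_all
    then have "I {?b..<?c} t \<le> I {?b..<?c} 0 + 12 * R / lam * t" using cell[OF t] by (simp only:)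
    moreover have "real (Suc n) * (12 * R / lam * t) = real n * (12 * R / lam * t) + 12 * R / lam * t"
      by (simp only: of_nat_Suc distrib_right mult_1 add.commute)
    ultimately show ?case using Suc.IH unfolding split by linarith
  qed
  let ?Y = "{- real N * h..<(- real N + real (2 * N)) * h}"
  have Y: "{-X..X} - {real N * h} \<subseteq> ?Y" "?Y \<subseteq> {-?X..?X}" using N by auto
  \<comment> \<open>There are \<open>2 N\<close> cells, each contributing \<open>12 R t / lam\<close>.\<close>
  define \<delta> where "\<delta> = e / (4 * (real (2 * N) + 1) * (12 * R / lam))"
  have CR: "12 * R / lam > 0" using R lam by simp
  have \<delta>: "\<delta> > 0" unfolding \<delta>_def by (intro divide_pos_pos[OF \<open>e > 0\<close>] mult_pos_pos[OF _ CR]) auto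
  have "(LINT x:{-X..X}|lebesgue. \<bar>\<rho> x t - \<rho> x 0\<bar>) < e" if t: "0 \<le> t" "t < \<delta>" for t
  proof -
    have Y0: "I ?Y 0 < e / 4"
    proof -
      have "I ?Y 0 \<le> (LINT x:{-?X..?X}|lebesgue. \<bar>\<rho> x 0 - \<sigma> x\<bar>)"
        unfolding I_def by (rule set_integral_subset_mono[OF int\<sigma> int\<sigma> Y(2)]) auto
      then show ?thesis using m(1) by (simp add: \<sigma>_def abs_minus_commute)
    qed
    have "real (2 * N) * (12 * R / lam * t) \<le> e / 4"
    proof -
      have "real (2 * N) * (12 * R / lam * t) \<le> (real (2 * N) + 1) * (12 * R / lam * \<delta>)"
        by (intro mult_mono mult_nonneg_nonneg less_imp_le[OF CR] mult_left_mono) (use t \<delta> CR in auto)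
      also have "\<dots> = e / 4"
      proof -
        have "A * (B * (e / (4 * A * B))) = e / 4" if "A > 0" "B > 0" for A B :: real using that by (simp add: field_simps)
        then show ?thesis unfolding \<delta>_def by this (use CR in auto)
      qed
      finally show ?thesis .
    qed
    then have Yt: "I ?Y t < e / 2" using grow[OF t(1), of "2 * N"] Y0 by linarith
    have "(LINT x:{-X..X}|lebesgue. \<bar>\<rho> x t - \<rho> x 0\<bar>) \<le> (LINT x:?Y|lebesgue. \<bar>\<rho> x t - \<sigma> x\<bar> + \<bar>\<rho> x 0 - \<sigma> x\<bar>)"
      unfolding set_lebesgue_integral_def
    proof (rule integral_mono_AE)
      show "integrable lebesgue (\<lambda>x. indicator {-X..X} x *\<^sub>R \<bar>\<rho> x t - \<rho> x 0\<bar>)"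
        using int[of "{-X..X}" "\<lambda>x. \<rho> x 0" t] \<rho>_slice_measurable \<rho>_range by (simp add: set_integrable_def)
      show "integrable lebesgue (\<lambda>x. indicator ?Y x *\<^sub>R (\<bar>\<rho> x t - \<sigma> x\<bar> + \<bar>\<rho> x 0 - \<sigma> x\<bar>))"
        unfolding set_integrable_def[symmetric] by (intro set_integral_add int\<sigma>) auto
      have "AE x in lebesgue. x \<noteq> real N * h" using AE_lborel_singleton by (simp only: AE_completion_iff)
      then show "AE x in lebesgue. indicator {-X..X} x *\<^sub>R \<bar>\<rho> x t - \<rho> x 0\<bar> \<le> indicator ?Y x *\<^sub>R (\<bar>\<rho> x t - \<sigma> x\<bar> + \<bar>\<rho> x 0 - \<sigma> x\<bar>)"
      proof eventually_elim
        case (elim x)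
        have "\<bar>\<rho> x t - \<rho> x 0\<bar> \<le> \<bar>\<rho> x t - \<sigma> x\<bar> + \<bar>\<rho> x 0 - \<sigma> x\<bar>" by linarith
        moreover have "x \<in> {-X..X} \<Longrightarrow> x \<in> ?Y" using Y(1) elim by blast
        ultimately show ?case by (cases "x \<in> {-X..X}") auto
      qed
    qed
    also have "\<dots> = I ?Y t + I ?Y 0"
      unfolding I_def by (rule set_integral_add(2); (rule int\<sigma>); auto)
    finally show ?thesis using Yt Y0 \<open>e > 0\<close> by linarith
  qed
  then show ?thesis using \<delta> by blast
qed


text \<open>For positive times pointwise convergence in time and dominated convergence suffice.\<close>

lemma continuous_L1loc_limit: "continuous_L1loc T \<rho>"
  unfolding continuous_L1loc_def
proof (intro allI impI conjI ballI)
  fix K :: "real set" assume K: "compact K"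
  have K': "K \<in> sets lebesgue" "bounded K"
    using fmeasurableD[OF lmeasurable_compact[OF K]] compact_imp_bounded[OF K] by auto
  show "set_integrable lebesgue K (\<lambda>x. \<rho> x t)" for t
    by (rule bounded_set_integrable[OF \<rho>_slice_measurable _ K', of _ R]) (use \<rho>_range R in auto)
  have diff_int: "set_integrable lebesgue A (\<lambda>x. \<bar>\<rho> x t - \<rho> x t'\<bar>)" if "A \<in> sets lebesgue" "bounded A" for A t t'
  proof (rule bounded_set_integrable[OF _ _ that])
    show "\<bar>\<bar>\<rho> x t - \<rho> x t'\<bar>\<bar> \<le> R" for x using \<rho>_range[of x t] \<rho>_range[of x t'] by auto
    show "(\<lambda>x. \<bar>\<rho> x t - \<rho> x t'\<bar>) \<in> borel_measurable lebesgue"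
      by (intro borel_measurable_abs borel_measurable_diff \<rho>_slice_measurable)
  qed
  fix t\<^sub>0 assume t0: "t\<^sub>0 \<in> {0..T}"
  show "((\<lambda>t. LINT x:K|lebesgue. \<bar>\<rho> x t - \<rho> x t\<^sub>0\<bar>) \<longlongrightarrow> 0) (at t\<^sub>0 within {0..T})"
  proof (cases "t\<^sub>0 = 0")
    case True
    obtain X where X: "K \<subseteq> {-X..X}" using K'(2) by (auto simp: bounded_iff abs_le_iff subset_eq) (metis minus_le_iff)
    have le: "0 \<le> (LINT x:K|lebesgue. \<bar>\<rho> x t - \<rho> x 0\<bar>) \<and>
      (LINT x:K|lebesgue. \<bar>\<rho> x t - \<rho> x 0\<bar>) \<le> (LINT x:{-X..X}|lebesgue. \<bar>\<rho> x t - \<rho> x 0\<bar>)" for t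
    proof
      show "0 \<le> (LINT x:K|lebesgue. \<bar>\<rho> x t - \<rho> x 0\<bar>)"
        unfolding set_lebesgue_integral_def by (rule Bochner_Integration.integral_nonneg) (simp add: indicator_def)
      show "(LINT x:K|lebesgue. \<bar>\<rho> x t - \<rho> x 0\<bar>) \<le> (LINT x:{-X..X}|lebesgue. \<bar>\<rho> x t - \<rho> x 0\<bar>)"
        by (rule set_integral_subset_mono[OF diff_int[OF K'] diff_int X]) auto
    qed
    show ?thesis unfolding True
    proof (rule tendstoI)
      fix e :: real assume "e > 0"
      from local_continuity_at_0[OF this] obtain \<delta> where \<delta>: "\<delta> > 0"
        "\<And>t. 0 \<le> t \<Longrightarrow> t < \<delta> \<Longrightarrow> (LINT x:{-X..X}|lebesgue. \<bar>\<rho> x t - \<rho> x 0\<bar>) < e" by blast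
      have "dist (LINT x:K|lebesgue. \<bar>\<rho> x t - \<rho> x 0\<bar>) 0 < e" if "t \<in> {0..T}" "dist t 0 < \<delta>" for t
        using le[of t] \<delta>(2)[of t] that by (auto simp: dist_real_def)
      then show "\<forall>\<^sub>F t in at 0 within {0..T}. dist (LINT x:K|lebesgue. \<bar>\<rho> x t - \<rho> x 0\<bar>) 0 < e"
        unfolding eventually_at using \<delta>(1) by blast
    qed
  next
    case False
    then have pos: "0 < t\<^sub>0" using t0 by simp
    show ?thesis
      unfolding tendsto_at_iff_sequentially comp_def
    proof (intro allI impI)
      fix w assume w: "\<forall>i. w i \<in> {0..T} - {t\<^sub>0}" "w \<longlonglongrightarrow> t\<^sub>0"
      define w' where "w' i = (if 0 < w i then w i else t\<^sub>0)" for i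
      have ev: "\<forall>\<^sub>F i in sequentially. w' i = w i"
        using order_tendstoD(1)[OF w(2) pos] by eventually_elim (simp add: w'_def)
      have w'_lim: "w' \<longlonglongrightarrow> t\<^sub>0" by (rule Lim_transform_eventually[OF w(2)]) (use ev in eventually_elim, simp)
      have w'_pos: "0 < w' i" for i using pos by (simp add: w'_def)
      have "(\<lambda>i. LINT x:K|lebesgue. \<bar>\<rho> x (w' i) - \<rho> x t\<^sub>0\<bar>) \<longlonglongrightarrow> (LINT x:K|lebesgue. 0)"
        unfolding set_lebesgue_integral_def
      proof (rule integral_dominated_convergence[where w = "\<lambda>x. indicator K x *\<^sub>R R"])
        show "integrable lebesgue (\<lambda>x. indicator K x *\<^sub>R R)"
          using bounded_set_integrable[of "\<lambda>_. R" R, OF _ _ K'] R by (simp add: set_integrable_def)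
        show "(\<lambda>x. indicator K x *\<^sub>R \<bar>\<rho> x (w' i) - \<rho> x t\<^sub>0\<bar>) \<in> borel_measurable lebesgue" for i
          using diff_int[OF K'] by (simp add: set_integrable_def borel_measurable_integrable)
        show "AE x in lebesgue. (\<lambda>i. indicator K x *\<^sub>R \<bar>\<rho> x (w' i) - \<rho> x t\<^sub>0\<bar>) \<longlonglongrightarrow> indicator K x *\<^sub>R 0"
          using \<rho>_continuous_in_time[OF pos w'_lim w'_pos]
        proof eventually_elim
          case (elim x)
          have "(\<lambda>i. indicator K x *\<^sub>R \<bar>\<rho> x (w' i) - \<rho> x t\<^sub>0\<bar>) \<longlonglongrightarrow> indicator K x *\<^sub>R \<bar>\<rho> x t\<^sub>0 - \<rho> x t\<^sub>0\<bar>"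
            by (intro tendsto_intros elim)
          then show ?case by simp
        qed
        have "\<bar>\<rho> x t - \<rho> x t\<^sub>0\<bar> \<le> R" for x t using \<rho>_range[of x t] \<rho>_range[of x t\<^sub>0] by auto
        then show "AE x in lebesgue. norm (indicator K x *\<^sub>R \<bar>\<rho> x (w' i) - \<rho> x t\<^sub>0\<bar>) \<le> indicator K x *\<^sub>R R" for i
          by (intro always_eventually allI) (auto simp: indicator_def)
      qed simp
      then have "(\<lambda>i. LINT x:K|lebesgue. \<bar>\<rho> x (w' i) - \<rho> x t\<^sub>0\<bar>) \<longlonglongrightarrow> 0" by (simp add: set_lebesgue_integral_def)
      then show "(\<lambda>i. LINT x:K|lebesgue. \<bar>\<rho> x (w i) - \<rho> x t\<^sub>0\<bar>) \<longlonglongrightarrow> 0"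
        by (rule Lim_transform_eventually) (use ev in eventually_elim, simp)
    qed
  qed
qed

section \<open>Entropy inequality and constraint in the limit\<close>

lemma smax_nonneg: "0 \<le> smax" using S_range[OF dx, of 0 0] by simp

lemma f_continuous: "continuous_on {0..R} f"
proof -
  interpret strongly_concave_flux "flux f 0" "\<lambda>r. f' r - 0" R \<alpha> "p 0" by (rule concave) (use smax_nonneg in simp)
  show ?thesis using F_continuous by (simp add: flux_def)
qed

lemma flux_tendsto:
  assumes "s \<longlonglongrightarrow> s\<^sub>0" "a \<longlonglongrightarrow> r" "\<And>k. a k \<in> {0..R}" "r \<in> {0..R}"
  shows "(\<lambda>k. flux f (s k) (a k)) \<longlonglongrightarrow> flux f s\<^sub>0 r"
proof -
  have "(\<lambda>k. f (a k)) \<longlonglongrightarrow> f r"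
    using continuous_on_tendsto_compose[OF f_continuous assms(2,4)] assms(3) by simp
  then show ?thesis unfolding flux_def by (intro tendsto_intros assms)
qed

lemma FF_tendsto:
  assumes s: "s \<longlonglongrightarrow> s\<^sub>0" "\<And>k. s k \<in> {0..smax}"
    and ab: "a \<longlonglongrightarrow> r" "b \<longlonglongrightarrow> r" "\<And>k. a k \<in> {0..R}" "\<And>k. b k \<in> {0..R}" "r \<in> {0..R}"
  shows "(\<lambda>k. FF (s k) (a k) (b k)) \<longlonglongrightarrow> flux f s\<^sub>0 r"
proof -
  have "(\<lambda>k. FF (s k) (a k) (b k) - flux f (s k) (b k)) \<longlonglongrightarrow> 0"
  proof (rule Lim_null_comparison)
    show "\<forall>\<^sub>F k in sequentially. norm (FF (s k) (a k) (b k) - flux f (s k) (b k)) \<le> \<bar>a k - b k\<bar> / lam"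
      using edge_flux_bound(2)[OF s(2) ab(3,4)] by simp
    have "(\<lambda>k. \<bar>a k - b k\<bar> / lam) \<longlonglongrightarrow> \<bar>r - r\<bar> / lam" using lam by (intro tendsto_intros ab) simp
    then show "(\<lambda>k. \<bar>a k - b k\<bar> / lam) \<longlonglongrightarrow> 0" by simp
  qed
  from tendsto_add[OF this flux_tendsto[OF s(1) ab(2,4,5)]] show ?thesis by simp
qed

lemma Q_tendsto: "0 \<le> t \<Longrightarrow> (\<lambda>k. Q (Sk k t)) \<longlonglongrightarrow> Q (v t)"
  using continuous_on_tendsto_compose[OF lipschitz_on_continuous_on[OF Q_lip] S_tendsto v_range] S_range[OF dx] by simp

lemma off_constraint:
  assumes "x \<noteq> 0"
  shows "\<forall>\<^sub>F k in sequentially. \<lfloor>x / dx k\<rfloor> \<noteq> 0"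
proof -
  have "\<forall>\<^sub>F k in sequentially. dx k < \<bar>x\<bar>" by (rule order_tendstoD(2)[OF dx0]) (use assms in simp)
  then show ?thesis
  proof eventually_elim
    case (elim k)
    show ?case
    proof
      assume "\<lfloor>x / dx k\<rfloor> = 0"
      then have "0 \<le> x" "x < dx k" using dx[of k] by (auto simp: floor_eq_iff zero_le_divide_iff divide_less_eq)
      then show False using elim by simp
    qed
  qed
qed

text \<open>The edges near \<open>x \<noteq> 0\<close> eventually carry the unconstrained flux, and both its arguments have the same
limit.  The function \<open>g\<close> is \<open>max k\<close>, \<open>min k\<close> or the identity in the uses below.\<close>

lemma edge_flux_tendsto:
  assumes t: "0 < t" and x: "x \<noteq> 0"
    and u: "(\<lambda>k. U (dx k) (nat \<lfloor>t / dt k\<rfloor>) (\<lfloor>x / dx k\<rfloor> + -1)) \<longlonglongrightarrow> \<rho> x t"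
      "(\<lambda>k. U (dx k) (nat \<lfloor>t / dt k\<rfloor>) (\<lfloor>x / dx k\<rfloor> + 0)) \<longlonglongrightarrow> \<rho> x t"
    and g: "continuous_on {0..R} g" "\<And>r. r \<in> {0..R} \<Longrightarrow> g r \<in> {0..R}"
  shows "(\<lambda>k. E (Sk k t) \<lfloor>x / dx k\<rfloor> (g (U (dx k) (nat \<lfloor>t / dt k\<rfloor>) (\<lfloor>x / dx k\<rfloor> - 1))) (g (U (dx k) (nat \<lfloor>t / dt k\<rfloor>) \<lfloor>x / dx k\<rfloor>)))
    \<longlonglongrightarrow> flux f (v t) (g (\<rho> x t))"
proof -
  have "(\<lambda>k. FF (Sk k t) (g (U (dx k) (nat \<lfloor>t / dt k\<rfloor>) (\<lfloor>x / dx k\<rfloor> - 1))) (g (U (dx k) (nat \<lfloor>t / dt k\<rfloor>) \<lfloor>x / dx k\<rfloor>)))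
    \<longlonglongrightarrow> flux f (v t) (g (\<rho> x t))"
  proof (rule FF_tendsto)
    show "(\<lambda>k. Sk k t) \<longlonglongrightarrow> v t" using S_tendsto t by simp
    show "(\<lambda>k. g (U (dx k) (nat \<lfloor>t / dt k\<rfloor>) (\<lfloor>x / dx k\<rfloor> - 1))) \<longlonglongrightarrow> g (\<rho> x t)"
      "(\<lambda>k. g (U (dx k) (nat \<lfloor>t / dt k\<rfloor>) \<lfloor>x / dx k\<rfloor>)) \<longlonglongrightarrow> g (\<rho> x t)"
      using u U_range[OF dx]
      by (auto intro!: continuous_on_tendsto_compose[OF g(1) _ \<rho>_range] always_eventually simp del: atLeastAtMost_iff)
  qed (use S_range[OF dx] U_range[OF dx] \<rho>_range g(2) in auto)
  then show ?thesis
    by (rule Lim_transform_eventually) (use off_constraint[OF x] in eventually_elim, simp add: edge_flux_def)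
qed

lemma entropy_flux_eq:
  "flux f s (max r k) - flux f s (min r k) = entropy_flux f s r k"
  by (auto simp: entropy_flux_def max_def min_def sgn_if)

lemma entropy_inequality_limit: "entropy_inequality T R f Q \<rho> v"
  unfolding entropy_inequality_def
proof (intro allI impI, elim conjE)
  fix \<phi> :: "real \<times> real \<Rightarrow> real" and \<kappa> \<tau> \<tau>'
  assume \<phi>: "test_function_on (UNIV \<times> {0..}) \<phi>" "\<forall>z\<in>UNIV \<times> {0..}. 0 \<le> \<phi> z"
    and \<kappa>: "\<kappa> \<in> {0..R}" and \<tau>: "0 \<le> \<tau>" "\<tau> < \<tau>'" "\<tau>' \<le> T"
  from \<phi>(1) have sm: "smooth \<phi>" by (simp add: test_function_on_def)
  from \<phi>(1) obtain K where K: "compact K" "\<And>z. z \<in> UNIV \<times> {0..} - K \<Longrightarrow> \<phi> z = 0"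
    by (auto simp: test_function_on_def)
  obtain X0 where X0: "\<And>z. z \<in> K \<Longrightarrow> norm z \<le> X0" using compact_imp_bounded[OF K(1)] by (auto simp: bounded_iff)
  define X where "X = max 0 X0"
  have supp: "\<phi> (x, t) = 0" if "0 \<le> t" "X < \<bar>x\<bar>" for x t
  proof -
    have "(x, t) \<notin> K" using X0[of "(x, t)"] norm_fst_le[of x t] that(2) by (auto simp: X_def)
    then show ?thesis using K(2)[of "(x, t)"] that(1) by auto
  qed
  define C where "C = R + 4 * R / lam"
  have C: "R \<le> C" "4 * R / lam \<le> C" "2 * R / lam \<le> C" using R lam by (auto simp: C_def field_simps)
  define m where "m j = (if j \<in> {-1, 0 :: int} then 1 else 0 :: real)" for j
  have "0 \<le> (LINT t:{\<tau>..\<tau>'}|lebesgue. LINT x|lebesgue.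
        (\<bar>\<rho> x t - \<kappa>\<bar> * deriv (\<lambda>u. \<phi> (x, u)) t + entropy_flux f (v t) (\<rho> x t) \<kappa> * deriv (\<lambda>w. \<phi> (w, t)) x))
     + (LINT x|lebesgue. \<bar>\<rho> x \<tau> - \<kappa>\<bar> * \<phi> (x, \<tau>)) - (LINT x|lebesgue. \<bar>\<rho> x \<tau>' - \<kappa>\<bar> * \<phi> (x, \<tau>'))
     + (m (-1) + m 0) * (LINT t:{\<tau>..\<tau>'}|lebesgue. constraint_excess f (v t) \<kappa> (Q (v t)) * \<phi> (0, t))"
  proof (rule weak_inequality_limit[where a = "\<lambda>k n j. \<bar>U (dx k) n j - \<kappa>\<bar>" and C = C and X = X and T = T
        and b = "\<lambda>k n j. EF (S (dx k) n) j \<kappa> (U (dx k) n (j - 1)) (U (dx k) n j)"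
        and c = "\<lambda>k n. constraint_excess f (S (dx k) n) \<kappa> (Q (S (dx k) n))"])
    show "\<bar>\<bar>U (dx k) n j - \<kappa>\<bar>\<bar> \<le> C" for k n j using U_range[OF dx, of k n j] \<kappa> C(1) by auto
    show "\<bar>EF (S (dx k) n) j \<kappa> (U (dx k) n (j - 1)) (U (dx k) n j)\<bar> \<le> C" for k n j
      by (rule order_trans[OF EF_bound C(2)]) (use S_range[OF dx] U_range[OF dx] \<kappa> in auto)
    show "\<bar>constraint_excess f (S (dx k) n) \<kappa> (Q (S (dx k) n))\<bar> \<le> C" for k n
      using constraint_excess_bound[OF S_range[OF dx] \<kappa>, of k n] constraint_excess_nonneg[of "S (dx k) n" \<kappa> "Q (S (dx k) n)"] C(3)
      by linarith
    show "\<bar>U (dx k) (Suc n) j - \<kappa>\<bar> - \<bar>U (dx k) n j - \<kappa>\<bar>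
      \<le> - lam * (EF (S (dx k) n) (j + 1) \<kappa> (U (dx k) n (j + 1 - 1)) (U (dx k) n (j + 1)) - EF (S (dx k) n) j \<kappa> (U (dx k) n (j - 1)) (U (dx k) n j))
        + lam * constraint_excess f (S (dx k) n) \<kappa> (Q (S (dx k) n)) * m j" for k n j
      using step_entropy[where u = "U (dx k) n" and s = "S (dx k) n" and j = j, OF S_range[OF dx] U_range[OF dx] \<kappa>]
      unfolding U_Suc m_def by (simp only: add_diff_cancel_right')
    show "AE x in lebesgue. (\<lambda>k. \<bar>U (dx k) (nat \<lfloor>t / (lam * dx k)\<rfloor>) \<lfloor>x / dx k\<rfloor> - \<kappa>\<bar>) \<longlonglongrightarrow> \<bar>\<rho> x t - \<kappa>\<bar>" if "0 \<le> t" for t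
      using AE_u_tendsto[OF that] by eventually_elim (auto simp: u_def dt_def intro!: tendsto_intros)
    show "AE x in lebesgue. (\<lambda>k. EF (S (dx k) (nat \<lfloor>t / (lam * dx k)\<rfloor>)) \<lfloor>x / dx k\<rfloor> \<kappa>
        (U (dx k) (nat \<lfloor>t / (lam * dx k)\<rfloor>) (\<lfloor>x / dx k\<rfloor> - 1)) (U (dx k) (nat \<lfloor>t / (lam * dx k)\<rfloor>) \<lfloor>x / dx k\<rfloor>))
        \<longlonglongrightarrow> entropy_flux f (v t) (\<rho> x t) \<kappa>" if t: "0 < t" for t
    proof -
      have "AE x in lebesgue. x \<noteq> (0::real)" using AE_lborel_singleton[of 0] by (simp add: AE_completion_iff)
      then show ?thesis
        using AE_neighbours_tendsto[OF t, of "-1"] AE_neighbours_tendsto[OF t, of 0]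
      proof eventually_elim
        case (elim x)
        have "continuous_on {0..R} (\<lambda>r. max r \<kappa>)" "continuous_on {0..R} (\<lambda>r. min r \<kappa>)"
          by (intro continuous_intros)+
        moreover have "r \<in> {0..R} \<Longrightarrow> max r \<kappa> \<in> {0..R}" "r \<in> {0..R} \<Longrightarrow> min r \<kappa> \<in> {0..R}" for r using \<kappa> by auto
        ultimately show ?case
          unfolding EF_def entropy_flux_eq[symmetric] dt_def[symmetric]
          by (intro tendsto_diff edge_flux_tendsto[OF t elim])
      qed
    qed
    show "(\<lambda>k. constraint_excess f (S (dx k) (nat \<lfloor>t / (lam * dx k)\<rfloor>)) \<kappa> (Q (S (dx k) (nat \<lfloor>t / (lam * dx k)\<rfloor>))))
      \<longlonglongrightarrow> constraint_excess f (v t) \<kappa> (Q (v t))" if t: "0 < t" for t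
      unfolding constraint_excess_def dt_def[symmetric]
      by (intro tendsto_diff tendsto_min flux_tendsto[OF S_tendsto tendsto_const] Q_tendsto) (use t \<kappa> in auto)
    show "continuous_on UNIV (\<lambda>z. \<phi> (fst z, snd z))" using smooth_partial_derivatives(3)[OF sm] by simp
    show "continuous_on UNIV (\<lambda>z. deriv (\<lambda>u. \<phi> (fst z, u)) (snd z))" "continuous_on UNIV (\<lambda>z. deriv (\<lambda>w. \<phi> (w, snd z)) (fst z))"
      by (rule smooth_partial_derivatives(4,5)[OF sm])+
    show "((\<lambda>u. \<phi> (x, u)) has_real_derivative deriv (\<lambda>u. \<phi> (x, u)) t) (at t)" for x t
      by (rule smooth_partial_derivatives(1)[OF sm])
    show "((\<lambda>w. \<phi> (w, t)) has_real_derivative deriv (\<lambda>w. \<phi> (w, t)) x) (at x)" for x t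
      by (rule smooth_partial_derivatives(2)[OF sm])
  qed (use dx dx0 lam supp \<phi>(2) \<tau> in \<open>auto simp: m_def X_def\<close>)
  then show "0 \<le> (LINT t:{\<tau>..\<tau>'}|lebesgue. LINT x|lebesgue.
        (\<bar>\<rho> x t - \<kappa>\<bar> * deriv (\<lambda>u. \<phi> (x, u)) t + entropy_flux f (v t) (\<rho> x t) \<kappa> * deriv (\<lambda>w. \<phi> (w, t)) x))
     + (LINT x|lebesgue. \<bar>\<rho> x \<tau> - \<kappa>\<bar> * \<phi> (x, \<tau>)) - (LINT x|lebesgue. \<bar>\<rho> x \<tau>' - \<kappa>\<bar> * \<phi> (x, \<tau>'))
     + 2 * (LINT t:{\<tau>..\<tau>'}|lebesgue. constraint_excess f (v t) \<kappa> (Q (v t)) * \<phi> (0, t))"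
    by (simp add: m_def)
qed

lemma Q_bounded: "s \<in> {0..smax} \<Longrightarrow> \<bar>Q s\<bar> \<le> \<bar>Q 0\<bar> + CQ * smax"
proof -
  assume s: "s \<in> {0..smax}"
  have "\<bar>Q s - Q 0\<bar> \<le> CQ * \<bar>s - 0\<bar>"
    using lipschitz_onD[OF Q_lip s, of 0] smax_nonneg by (simp add: dist_real_def)
  also have "\<dots> \<le> CQ * smax" using s lipschitz_on_nonneg[OF Q_lip] by (intro mult_left_mono) auto
  finally show ?thesis by linarith
qed

text \<open>The mass balance restricted to the cells \<open>j \<ge> 0\<close>: the flux through edge \<open>0\<close> is moved from the flux
term to the defect, where it is bounded by \<open>Q\<close>.\<close>

lemma weak_constraint_limit: "weak_constraint T f Q \<rho> v"
proof -
  obtain \<phi> :: "real \<Rightarrow> real" where \<phi>: "smooth \<phi>" "\<phi> 0 = 1" "\<And>x. 0 \<le> \<phi> x" "\<And>x. 1 \<le> \<bar>x\<bar> \<Longrightarrow> \<phi> x = 0"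
    using bump_function_exists by blast
  have test: "test_function_on UNIV \<phi>"
    unfolding test_function_on_def using \<phi>(1,4) by (intro conjI exI[of _ "{-1..1}"]) auto
  note d\<phi> = smooth_real_derivative[OF \<phi>(1)]
  show ?thesis
    unfolding weak_constraint_def
  proof (intro exI[of _ \<phi>] conjI test \<phi>(2) allI impI, elim conjE)
    fix \<psi> :: "real \<Rightarrow> real" and \<tau> \<tau>'
    assume \<psi>: "smooth \<psi>" "\<forall>t\<in>{0..T}. 0 \<le> \<psi> t" and \<tau>: "0 \<le> \<tau>" "\<tau> < \<tau>'" "\<tau>' \<le> T"
    note d\<psi> = smooth_real_derivative[OF \<psi>(1)]
    define C where "C = R + 2 * R / lam + (\<bar>Q 0\<bar> + CQ * smax)"
    have "0 \<le> CQ * smax" using smax_nonneg lipschitz_on_nonneg[OF Q_lip] by simp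
    then have C: "R \<le> C" "2 * R / lam \<le> C" "\<bar>Q 0\<bar> + CQ * smax \<le> C" "0 \<le> C" using R lam by (auto simp: C_def)
    define m where "m j = (if j = (0 :: int) then 1 else 0 :: real)" for j
    \<comment> \<open>The weak form is on the half line; the scheme limit is stated on the line, with densities cut off by \<open>\<theta>\<close>.\<close>
    define \<theta> where "\<theta> x = (indicator {0..} x :: real)" for x :: real
    have "0 \<le> (LINT t:{\<tau>..\<tau>'}|lebesgue. LINT x|lebesgue.
        (\<theta> x * \<rho> x t * (\<phi> x * deriv \<psi> t) + \<theta> x * flux f (v t) (\<rho> x t) * (deriv \<phi> x * \<psi> t)))
     + (LINT x|lebesgue. \<theta> x * \<rho> x \<tau> * (\<phi> x * \<psi> \<tau>)) - (LINT x|lebesgue. \<theta> x * \<rho> x \<tau>' * (\<phi> x * \<psi> \<tau>'))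
     + (m (-1) + m 0) * (LINT t:{\<tau>..\<tau>'}|lebesgue. Q (v t) * (\<phi> 0 * \<psi> t))"
    proof (rule weak_inequality_limit[where a = "\<lambda>k n j. if 0 \<le> j then U (dx k) n j else 0" and C = C and X = 1 and T = T
        and b = "\<lambda>k n j. if 1 \<le> j then E (S (dx k) n) j (U (dx k) n (j - 1)) (U (dx k) n j) else 0"
        and c = "\<lambda>k n. Q (S (dx k) n)"])
      show "\<bar>if 0 \<le> j then U (dx k) n j else 0\<bar> \<le> C" for k n j using U_range[OF dx, of k n j] C by auto
      show "\<bar>if 1 \<le> j then E (S (dx k) n) j (U (dx k) n (j - 1)) (U (dx k) n j) else 0\<bar> \<le> C" for k n j
        using edge_flux_bound(1)[OF S_range[OF dx] U_range[OF dx] U_range[OF dx], of k n j k n "j - 1" k n j] C by auto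
      show "\<bar>Q (S (dx k) n)\<bar> \<le> C" for k n using Q_bounded[OF S_range[OF dx], of k n] C by linarith
      show "(if 0 \<le> j then U (dx k) (Suc n) j else 0) - (if 0 \<le> j then U (dx k) n j else 0)
        \<le> - lam * ((if 1 \<le> j + 1 then E (S (dx k) n) (j + 1) (U (dx k) n (j + 1 - 1)) (U (dx k) n (j + 1)) else 0)
             - (if 1 \<le> j then E (S (dx k) n) j (U (dx k) n (j - 1)) (U (dx k) n j) else 0))
          + lam * Q (S (dx k) n) * m j" for k n j
      proof -
        consider "j < 0" | "j = 0" | "1 \<le> j" by linarith
        then show ?thesis
        proof cases
          case 2
          have "E (S (dx k) n) 0 (U (dx k) n (-1)) (U (dx k) n 0) \<le> Q (S (dx k) n)" by (simp add: edge_flux_def)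
          then have "lam * E (S (dx k) n) 0 (U (dx k) n (-1)) (U (dx k) n 0) \<le> lam * Q (S (dx k) n)"
            using lam by (intro mult_left_mono) auto
          then show ?thesis using 2 by (simp add: U_Suc_eq m_def right_diff_distrib)
        qed (simp_all add: U_Suc_eq m_def)
      qed
      have sign: "0 \<le> \<lfloor>x / dx k\<rfloor> \<longleftrightarrow> 0 \<le> x" for x k using dx[of k] by (simp add: zero_le_divide_iff)
      show "AE x in lebesgue. (\<lambda>k. if 0 \<le> \<lfloor>x / dx k\<rfloor> then U (dx k) (nat \<lfloor>t / (lam * dx k)\<rfloor>) \<lfloor>x / dx k\<rfloor> else 0) \<longlonglongrightarrow> \<theta> x * \<rho> x t"
        if "0 \<le> t" for t
        using AE_u_tendsto[OF that]
      proof eventually_elim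
        case (elim x)
        then show ?case unfolding sign by (cases "0 \<le> x") (auto simp: u_def dt_def \<theta>_def)
      qed
      show "AE x in lebesgue. (\<lambda>k. if 1 \<le> \<lfloor>x / dx k\<rfloor> then E (S (dx k) (nat \<lfloor>t / (lam * dx k)\<rfloor>)) \<lfloor>x / dx k\<rfloor>
          (U (dx k) (nat \<lfloor>t / (lam * dx k)\<rfloor>) (\<lfloor>x / dx k\<rfloor> - 1)) (U (dx k) (nat \<lfloor>t / (lam * dx k)\<rfloor>) \<lfloor>x / dx k\<rfloor>) else 0)
        \<longlonglongrightarrow> \<theta> x * flux f (v t) (\<rho> x t)" if t: "0 < t" for t
      proof -
        have "AE x in lebesgue. x \<noteq> (0::real)" using AE_lborel_singleton[of 0] by (simp add: AE_completion_iff)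
        then show ?thesis
          using AE_neighbours_tendsto[OF t, of "-1"] AE_neighbours_tendsto[OF t, of 0]
        proof eventually_elim
          case (elim x)
          have lim: "(\<lambda>k. E (Sk k t) \<lfloor>x / dx k\<rfloor> (U (dx k) (nat \<lfloor>t / dt k\<rfloor>) (\<lfloor>x / dx k\<rfloor> - 1)) (U (dx k) (nat \<lfloor>t / dt k\<rfloor>) \<lfloor>x / dx k\<rfloor>))
            \<longlonglongrightarrow> flux f (v t) (\<rho> x t)"
            by (rule edge_flux_tendsto[OF t elim, where g = "\<lambda>r. r"]) auto
          show ?case
          proof (cases "0 \<le> x")
            case True
            have "\<forall>\<^sub>F k in sequentially. 1 \<le> \<lfloor>x / dx k\<rfloor>"
              using off_constraint[OF elim(1)]
            proof eventually_elim
              case (elim k)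
              have "0 \<le> \<lfloor>x / dx k\<rfloor>" using sign True by blast
              then show ?case using elim by linarith
            qed
            then have "\<forall>\<^sub>F k in sequentially. E (Sk k t) \<lfloor>x / dx k\<rfloor> (U (dx k) (nat \<lfloor>t / dt k\<rfloor>) (\<lfloor>x / dx k\<rfloor> - 1)) (U (dx k) (nat \<lfloor>t / dt k\<rfloor>) \<lfloor>x / dx k\<rfloor>)
              = (if 1 \<le> \<lfloor>x / dx k\<rfloor> then E (Sk k t) \<lfloor>x / dx k\<rfloor> (U (dx k) (nat \<lfloor>t / dt k\<rfloor>) (\<lfloor>x / dx k\<rfloor> - 1)) (U (dx k) (nat \<lfloor>t / dt k\<rfloor>) \<lfloor>x / dx k\<rfloor>) else 0)"
              by eventually_elim simp
            from Lim_transform_eventually[OF lim this] show ?thesis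
              unfolding dt_def[symmetric] using True by (simp add: \<theta>_def)
          next
            case False
            have "\<not> 1 \<le> \<lfloor>x / dx k\<rfloor>" for k using sign[of x k] False by linarith
            then show ?thesis using False by (simp add: \<theta>_def)
          qed
        qed
      qed
      show "(\<lambda>k. Q (S (dx k) (nat \<lfloor>t / (lam * dx k)\<rfloor>))) \<longlonglongrightarrow> Q (v t)" if "0 < t" for t
        using Q_tendsto[of t] that by (simp add: dt_def)
      show "((\<lambda>u. \<phi> x * \<psi> u) has_real_derivative \<phi> x * deriv \<psi> t) (at t)" for x t by (rule DERIV_cmult[OF d\<psi>(1)])
      show "((\<lambda>w. \<phi> w * \<psi> t) has_real_derivative deriv \<phi> x * \<psi> t) (at x)" for x t by (rule DERIV_cmult_right[OF d\<phi>(1)])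
      have c: "continuous_on UNIV (\<lambda>z. g (fst z))" "continuous_on UNIV (\<lambda>z. g (snd z))"
        if "continuous_on UNIV g" for g :: "real \<Rightarrow> real"
        by (rule continuous_on_compose2[OF that]; auto intro: continuous_intros)+
      show "continuous_on UNIV (\<lambda>z. \<phi> (fst z) * \<psi> (snd z))" "continuous_on UNIV (\<lambda>z. \<phi> (fst z) * deriv \<psi> (snd z))"
        "continuous_on UNIV (\<lambda>z. deriv \<phi> (fst z) * \<psi> (snd z))"
        by (intro continuous_on_mult c d\<phi> d\<psi>)+
    qed (use dx dx0 lam \<phi> \<psi>(2) \<tau> in \<open>auto simp: m_def\<close>)
    moreover have "deriv (\<lambda>u. \<phi> x * \<psi> u) t = \<phi> x * deriv \<psi> t" for x t by (rule DERIV_imp_deriv[OF DERIV_cmult[OF d\<psi>(1)]])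
    moreover have "deriv (\<lambda>w. \<phi> w * \<psi> t) x = deriv \<phi> x * \<psi> t" for x t by (rule DERIV_imp_deriv[OF DERIV_cmult_right[OF d\<phi>(1)]])
    ultimately show "- (LINT t:{\<tau>..\<tau>'}|lebesgue. LINT x:{0..}|lebesgue.
             (\<rho> x t * deriv (\<lambda>u. \<phi> x * \<psi> u) t + flux f (v t) (\<rho> x t) * deriv (\<lambda>w. \<phi> w * \<psi> t) x))
        - (LINT x:{0..}|lebesgue. \<rho> x \<tau> * \<phi> x * \<psi> \<tau>)
        + (LINT x:{0..}|lebesgue. \<rho> x \<tau>' * \<phi> x * \<psi> \<tau>')
        \<le> (LINT t:{\<tau>..\<tau>'}|lebesgue. Q (v t) * \<psi> t)"
      by (simp add: set_lebesgue_integral_def[of lebesgue "{0..}"] \<theta>_def m_def \<phi>(2) algebra_simps)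
  qed
qed


section \<open>Position and admissibility\<close>

lemma S_measurable: "(\<lambda>t. Sk k t) \<in> borel_measurable lebesgue"
  by (rule measurable_completion) (use floor_measurable_fun[of "\<lambda>i. S (dx k) (nat i)" "dt k"] in simp)

lemma v_set_integrable: "set_integrable lebesgue {0..t} v"
proof -
  have "(\<lambda>s. indicator {0..t} s * v s) \<in> borel_measurable lebesgue"
  proof (rule borel_measurable_LIMSEQ_real)
    show "(\<lambda>k. indicator {0..t} s * Sk k s) \<longlonglongrightarrow> indicator {0..t} s * v s" for s
      using S_tendsto[of s] by (cases "s \<in> {0..t}") (auto intro!: tendsto_intros)
    show "(\<lambda>s. indicator {0..t} s * Sk k s) \<in> borel_measurable lebesgue" for k
      by (intro borel_measurable_times borel_measurable_indicator S_measurable) simp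
  qed
  moreover have "\<bar>indicator {0..t} s * v s\<bar> \<le> smax" for s
    using v_range[of s] smax_nonneg by (cases "s \<in> {0..t}") auto
  ultimately have "set_integrable lebesgue {0..t} (\<lambda>s. indicator {0..t} s * v s)"
    by (rule bounded_set_integrable) auto
  moreover have "indicator {0..t} s *\<^sub>R (indicator {0..t} s * v s) = indicator {0..t} s *\<^sub>R v s" for s
    by (cases "s \<in> {0..t}") auto
  ultimately show ?thesis unfolding set_integrable_def by (simp only:)
qed

definition y :: "real \<Rightarrow> real" where "y t = y\<^sub>o + (LINT s:{0..t}|lebesgue. v s)"

lemma approx_position_uniform:
  "uniform_limit {0..T} (\<lambda>k. approx_position \<omega> Q \<mu> FF GG \<rho>\<^sub>o y\<^sub>o lam (dx k)) y sequentially"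
proof -
  have Sint: "set_integrable lebesgue {0..t} (\<lambda>s. Sk k s)" for k t
    using S_range[OF dx] smax_nonneg by (intro bounded_set_integrable[where C = smax] S_measurable) auto
  have dint: "set_integrable lebesgue {0..t} (\<lambda>s. \<bar>Sk k s - v s\<bar>)" for k t
    by (intro set_integrable_abs set_integral_diff Sint v_set_integrable)
  have "(\<lambda>k. LINT s:{0..T}|lebesgue. \<bar>Sk k s - v s\<bar>) \<longlonglongrightarrow> (LINT s:{0..T}|lebesgue. 0)"
    unfolding set_lebesgue_integral_def
  proof (rule integral_dominated_convergence[where w = "\<lambda>s. indicator {0..T} s *\<^sub>R smax"])
    show "integrable lebesgue (\<lambda>s. indicator {0..T} s *\<^sub>R smax)"
      using bounded_set_integrable[of "\<lambda>_. smax" smax "{0..T}"] smax_nonneg by (simp add: set_integrable_def)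
    show "(\<lambda>s. indicator {0..T} s *\<^sub>R \<bar>Sk k s - v s\<bar>) \<in> borel_measurable lebesgue" for k
      using dint by (simp add: set_integrable_def borel_measurable_integrable)
    have "(\<lambda>k. indicator {0..T} s *\<^sub>R \<bar>Sk k s - v s\<bar>) \<longlonglongrightarrow> indicator {0..T} s *\<^sub>R 0" for s
    proof (cases "s \<in> {0..T}")
      case True
      then have "(\<lambda>k. \<bar>Sk k s - v s\<bar>) \<longlonglongrightarrow> \<bar>v s - v s\<bar>" by (intro tendsto_intros S_tendsto) simp
      then show ?thesis using True by simp
    qed simp
    then show "AE s in lebesgue. (\<lambda>k. indicator {0..T} s *\<^sub>R \<bar>Sk k s - v s\<bar>) \<longlonglongrightarrow> indicator {0..T} s *\<^sub>R 0" by simp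
    have "\<bar>Sk k s - v s\<bar> \<le> smax" for k s using S_range[OF dx, of k "nat \<lfloor>s / dt k\<rfloor>"] v_range[of s] by auto
    then show "AE s in lebesgue. norm (indicator {0..T} s *\<^sub>R \<bar>Sk k s - v s\<bar>) \<le> indicator {0..T} s *\<^sub>R smax" for k
      by (intro always_eventually allI) (auto simp: indicator_def)
  qed simp
  then have lim: "(\<lambda>k. LINT s:{0..T}|lebesgue. \<bar>Sk k s - v s\<bar>) \<longlonglongrightarrow> 0" by (simp add: set_lebesgue_integral_def)
  have bound: "dist (approx_position \<omega> Q \<mu> FF GG \<rho>\<^sub>o y\<^sub>o lam (dx k) t) (y t) \<le> (LINT s:{0..T}|lebesgue. \<bar>Sk k s - v s\<bar>)"
    if "t \<in> {0..T}" for k t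
  proof -
    have "approx_position \<omega> Q \<mu> FF GG \<rho>\<^sub>o y\<^sub>o lam (dx k) t = y\<^sub>o + (LINT s:{0..t}|lebesgue. Sk k s)"
      by (simp add: approx_position_def S_def U_def dt_def)
    then have "dist (approx_position \<omega> Q \<mu> FF GG \<rho>\<^sub>o y\<^sub>o lam (dx k) t) (y t) = \<bar>LINT s:{0..t}|lebesgue. Sk k s - v s\<bar>"
      by (simp add: y_def dist_real_def set_integral_diff(2)[OF Sint v_set_integrable])
    also have "\<dots> \<le> (LINT s:{0..t}|lebesgue. \<bar>Sk k s - v s\<bar>)"
      using set_integral_norm_bound[OF set_integral_diff(1)[OF Sint v_set_integrable]] by simp
    also have "\<dots> \<le> (LINT s:{0..T}|lebesgue. \<bar>Sk k s - v s\<bar>)"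
      by (rule set_integral_subset_mono[OF dint dint]) (use that in auto)
    finally show ?thesis .
  qed
  show ?thesis
  proof (rule uniform_limitI)
    fix e :: real assume "e > 0"
    then have "\<forall>\<^sub>F k in sequentially. (LINT s:{0..T}|lebesgue. \<bar>Sk k s - v s\<bar>) < e" by (rule order_tendstoD(2)[OF lim])
    then show "\<forall>\<^sub>F k in sequentially. \<forall>t\<in>{0..T}. dist (approx_position \<omega> Q \<mu> FF GG \<rho>\<^sub>o y\<^sub>o lam (dx k) t) (y t) < e"
      by eventually_elim (use bound le_less_trans in blast)
  qed
qed

lemma y_increment: "0 \<le> s \<Longrightarrow> s \<le> t \<Longrightarrow> y t - y s = integral {s..t} v \<and> \<bar>y t - y s\<bar> \<le> smax * (t - s)"
proof -
  assume st: "0 \<le> s" "s \<le> t"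
  have vi: "v integrable_on {0..t}" for t
    using v_set_integrable set_lebesgue_integral_eq_integral(1) by blast
  have "y t - y s = integral {0..t} v - integral {0..s} v"
    unfolding y_def by (simp add: set_lebesgue_integral_eq_integral(2)[OF v_set_integrable])
  also have "\<dots> = integral {s..t} v"
    using Henstock_Kurzweil_Integration.integral_combine[OF st vi] by simp
  finally have eq: "y t - y s = integral {s..t} v" .
  have "norm (integral {s..t} v) \<le> smax * (t - s)"
  proof -
    have "v integrable_on {s..t}" by (rule integrable_on_subinterval[OF vi[of t]]) (use st in auto)
    then have "norm (integral {s..t} v) \<le> integral {s..t} (\<lambda>_. smax)"
      using v_range by (intro integral_norm_bound_integral) auto
    then show ?thesis using st by (simp add: mult.commute)
  qed
  then show ?thesis using eq by simp
qed

lemma y_continuous: "continuous_on {0..T} y"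
proof -
  have "smax-lipschitz_on {0..T} y"
  proof (rule lipschitz_onI)
    fix s t assume "s \<in> {0..T}" "t \<in> {0..T}"
    then show "dist (y s) (y t) \<le> smax * dist s t"
      using y_increment[of s t] y_increment[of t s] by (cases "s \<le> t") (auto simp: dist_real_def abs_minus_commute)
  qed (rule smax_nonneg)
  then show ?thesis by (rule lipschitz_on_continuous_on)
qed

text \<open>Continuity of the speed is known at positive times, so the integral is started at one of them.\<close>

lemma y_derivative: assumes "0 < t" shows "(y has_real_derivative v t) (at t)"
proof -
  have "((\<lambda>s. integral {t / 2..s} v) has_real_derivative v t) (at t within {t / 2..2 * t})"
    by (rule integral_has_real_derivative) (use assms in \<open>auto intro: continuous_on_subset[OF v_continuous]\<close>)
  then have d: "((\<lambda>s. y (t / 2) + integral {t / 2..s} v) has_real_derivative v t) (at t within {t / 2<..<2 * t})"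
    using DERIV_add[OF DERIV_const DERIV_subset, of "\<lambda>s. integral {t / 2..s} v" "v t" t "{t / 2..2 * t}" "{t / 2<..<2 * t}" "y (t / 2)"]
    by (simp add: greaterThanLessThan_subseteq_atLeastAtMost_iff)
  have eq: "y (t / 2) + integral {t / 2..s} v = y s" if "t / 2 < s" for s
    using conjunct1[OF y_increment[of "t / 2" s]] assms that by simp
  have "(y has_real_derivative v t) (at t within {t / 2<..<2 * t})"
    by (rule has_field_derivative_transform_within[OF d zero_less_one]) (use assms eq in auto)
  then show ?thesis using assms at_within_open[of t "{t / 2<..<2 * t}"] by simp
qed

text \<open>The position is continuously differentiable on \<open>]0, T[\<close>, so the weak derivative is the classical one,
by integration by parts.\<close>

lemma W1inf: assumes "T > 0" shows "W1inf_deriv T y v"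
  unfolding W1inf_deriv_def
proof (intro conjI allI impI)
  have vc: "continuous_on {0<..<T} v" by (rule continuous_on_subset[OF v_continuous]) auto
  have yc: "continuous_on {0<..<T} y" by (rule continuous_on_subset[OF y_continuous[of T]]) auto
  have yb: "\<bar>y t\<bar> \<le> \<bar>y\<^sub>o\<bar> + smax * T" if "t \<in> {0<..<T}" for t
  proof -
    have "y 0 = y\<^sub>o" using set_lebesgue_integral_eq_integral(2)[OF v_set_integrable, of 0] unfolding y_def by simp
    moreover have "\<bar>y t - y 0\<bar> \<le> smax * (t - 0)" using conjunct2[OF y_increment[of 0 t]] that by simp
    moreover have "smax * (t - 0) \<le> smax * T" using that smax_nonneg by (intro mult_left_mono) auto
    ultimately show ?thesis by linarith
  qed
  have vb: "\<bar>v t\<bar> \<le> smax" for t using v_range[of t] by auto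
  have ess: "ess_bounded_on {0<..<T} g" if "continuous_on {0<..<T} g" "\<And>t. t \<in> {0<..<T} \<Longrightarrow> \<bar>g t\<bar> \<le> C" for g C
  proof -
    have "AE t in lebesgue_on {0<..<T}. \<bar>g t\<bar> \<le> C" by (rule AE_I2) (use that(2) in simp)
    then show ?thesis unfolding ess_bounded_on_def
      using continuous_imp_measurable_on_sets_lebesgue[OF that(1)] by auto
  qed
  show "ess_bounded_on {0<..<T} y" "ess_bounded_on {0<..<T} v"
    using ess[OF yc yb] ess[OF vc vb] by blast+
  fix \<phi> :: "real \<Rightarrow> real" assume \<phi>: "test_function_on {0<..<T} \<phi>"
  then have sm: "smooth \<phi>" by (simp add: test_function_on_def)
  note d\<phi> = smooth_real_derivative[OF sm]
  from \<phi> obtain K where K: "compact K" "K \<subseteq> {0<..<T}" "\<And>z. z \<in> {0<..<T} - K \<Longrightarrow> \<phi> z = 0"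
    by (auto simp: test_function_on_def)
  have cl: "closed K" using K(1) compact_imp_closed by blast
  have isc: "(\<phi> \<longlongrightarrow> \<phi> x) (at x within A)" for x A
    using DERIV_isCont[OF d\<phi>(1)] tendsto_mono[OF at_le[of A UNIV x], of \<phi> "\<phi> x"] by (simp add: isCont_def)
  \<comment> \<open>Test functions are constrained on the open interval only; continuity gives their values at its ends.\<close>
  have zero: "\<phi> x = 0" if x: "x \<notin> K" "x = 0 \<or> x = T" for x
  proof -
    have "\<forall>\<^sub>F t in at x. t \<in> - K" using x(1) cl by (intro eventually_at_in_open') auto
    then have ev: "\<forall>\<^sub>F t in at x within {0<..<T}. \<phi> t = 0"
      unfolding eventually_at_filter by eventually_elim (use K(3) in auto)
    have "at x within {0<..<T} \<noteq> bot"
      using x(2) assms islimpt_greaterThanLessThan1[of 0 T] islimpt_greaterThanLessThan2[of 0 T] by (auto simp: trivial_limit_within)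
    then show ?thesis using tendsto_unique[OF _ isc[of x] tendsto_eventually[OF ev]] by simp
  qed
  have ends: "\<phi> 0 = 0" "\<phi> T = 0" by (rule zero; use K(2) in force)+
  have I: "((\<lambda>t. v t * \<phi> t + y t * deriv \<phi> t) has_integral (y T * \<phi> T - y 0 * \<phi> 0)) {0..T}"
  proof (rule fundamental_theorem_of_calculus_interior)
    show "continuous_on {0..T} (\<lambda>t. y t * \<phi> t)"
      by (intro continuous_on_mult y_continuous continuous_on_subset[OF d\<phi>(2)]) simp
    fix t assume t: "t \<in> {0<..<T}"
    have "((\<lambda>t. y t * \<phi> t) has_real_derivative v t * \<phi> t + deriv \<phi> t * y t) (at t)"
      by (rule DERIV_mult[OF y_derivative d\<phi>(1)]) (use t in simp)
    then show "((\<lambda>t. y t * \<phi> t) has_vector_derivative v t * \<phi> t + y t * deriv \<phi> t) (at t)"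
      by (simp add: has_real_derivative_iff_has_vector_derivative mult.commute)
  qed (use assms in simp)
  have ai: "g absolutely_integrable_on {0<..<T}" if g: "continuous_on {0<..<T} g" "\<And>t. t \<in> {0<..<T} \<Longrightarrow> \<bar>g t\<bar> \<le> C" for g :: "real \<Rightarrow> real" and C
  proof (rule measurable_bounded_by_integrable_imp_absolutely_integrable)
    show "g \<in> borel_measurable (lebesgue_on {0<..<T})" by (rule continuous_imp_measurable_on_sets_lebesgue[OF g(1)]) simp
    have "(\<lambda>_. C) integrable_on {0..T}" by (rule integrable_const_ivl)
    then show "(\<lambda>_. C) integrable_on {0<..<T}" using integrable_on_Icc_iff_Ioo by blast
  qed (use g(2) in auto)
  have bd: "\<exists>M. \<forall>t\<in>{0..T}. \<bar>g t\<bar> \<le> M" if "continuous_on UNIV g" for g :: "real \<Rightarrow> real"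
    using compact_continuous_image[OF continuous_on_subset[OF that, of "{0..T}"]] compact_imp_bounded
    by (force simp: bounded_iff)
  obtain M1 where M1: "\<And>t. t \<in> {0..T} \<Longrightarrow> \<bar>\<phi> t\<bar> \<le> M1" using bd[OF d\<phi>(2)] by blast
  obtain M2 where M2: "\<And>t. t \<in> {0..T} \<Longrightarrow> \<bar>deriv \<phi> t\<bar> \<le> M2" using bd[OF d\<phi>(3)] by blast
  have M0: "0 \<le> M1" "0 \<le> M2" using M1[of 0] M2[of 0] assms by auto
  have a1: "(\<lambda>t. v t * \<phi> t) absolutely_integrable_on {0<..<T}"
  proof (rule ai)
    show "continuous_on {0<..<T} (\<lambda>t. v t * \<phi> t)" by (intro continuous_on_mult vc continuous_on_subset[OF d\<phi>(2)]) simp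
    show "\<bar>v t * \<phi> t\<bar> \<le> smax * M1" if "t \<in> {0<..<T}" for t
      unfolding abs_mult using vb M1[of t] that smax_nonneg by (intro mult_mono) auto
  qed
  have a2: "(\<lambda>t. y t * deriv \<phi> t) absolutely_integrable_on {0<..<T}"
  proof (rule ai)
    show "continuous_on {0<..<T} (\<lambda>t. y t * deriv \<phi> t)" by (intro continuous_on_mult yc continuous_on_subset[OF d\<phi>(3)]) simp
    show "\<bar>y t * deriv \<phi> t\<bar> \<le> (\<bar>y\<^sub>o\<bar> + smax * T) * M2" if "t \<in> {0<..<T}" for t
      unfolding abs_mult using yb[OF that] M2[of t] that smax_nonneg assms by (intro mult_mono) auto
  qed
  have "(LINT t:{0<..<T}|lebesgue. v t * \<phi> t + y t * deriv \<phi> t) = integral {0<..<T} (\<lambda>t. v t * \<phi> t + y t * deriv \<phi> t)"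
    using set_lebesgue_integral_eq_integral(2)[OF set_integral_add(1)[OF a1 a2]] .
  also have "\<dots> = 0"
    using I ends by (intro integral_unique) (simp add: has_integral_Icc_iff_Ioo)
  finally show "(LINT t:{0<..<T}|lebesgue. y t * deriv \<phi> t) = - (LINT t:{0<..<T}|lebesgue. v t * \<phi> t)"
    using set_integral_add(2)[OF a1 a2] by simp
qed

text \<open>Convergence almost everywhere on each time slice gives convergence almost everywhere in the plane.
Fubini's theorem needs a measurable exceptional set, and being a Cauchy sequence is a Borel condition.\<close>

lemma AE_plane:
  "AE z in lborel. 0 < snd z \<longrightarrow> (\<forall>k. fst z \<notin> range (\<lambda>j::int. of_int j * dx k)) \<and> (\<lambda>k. u k (fst z) (snd z)) \<longlonglongrightarrow> \<rho> (fst z) (snd z)"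
proof -
  let ?P = "\<lambda>z. 0 < fst z \<longrightarrow> (\<forall>k. \<forall>j::int. snd z \<noteq> of_int j * dx k) \<and> Cauchy (\<lambda>k. u k (snd z) (fst z))"
  have "AE z in (lborel \<Otimes>\<^sub>M lborel :: (real \<times> real) measure). ?P z"
  proof (rule lborel_pair.AE_pair_measure)
    have [measurable]: "(\<lambda>z. u k (snd z) (fst z)) \<in> borel_measurable (borel \<Otimes>\<^sub>M borel)" for k
      using measurable_compose[OF _ u_measurable, of "\<lambda>z. (snd z, fst z)" "borel \<Otimes>\<^sub>M borel" k] by simp
    have [measurable]: "Measurable.pred (borel \<Otimes>\<^sub>M borel) (\<lambda>z. Cauchy (\<lambda>k. u k (snd z) (fst z)))"
      unfolding pred_def by (rule sets_Collect_Cauchy) measurable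
    have lborel_sets: "sets (lborel \<Otimes>\<^sub>M lborel :: (real \<times> real) measure) = sets (borel \<Otimes>\<^sub>M borel)"
      by (rule sets_pair_measure_cong) simp_all
    have "Measurable.pred (borel \<Otimes>\<^sub>M borel) ?P" by measurable
    then have "Measurable.pred (lborel \<Otimes>\<^sub>M lborel) ?P"
      by (simp only: measurable_cong_sets[OF lborel_sets refl])
    then show "{z \<in> space (lborel \<Otimes>\<^sub>M lborel). ?P z} \<in> sets (lborel \<Otimes>\<^sub>M lborel)" by (rule predE)
    have "AE x in lborel. ?P (t, x)" for t
    proof (cases "0 < t")
      case True
      have "AE x in lborel. \<forall>k. \<forall>j::int. x \<noteq> of_int j * dx k"
        by (simp only: AE_all_countable AE_lborel_singleton simp_thms)
      moreover have "AE x in lborel. (\<lambda>k. u k x t) \<longlonglongrightarrow> \<rho> x t"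
        using AE_u_tendsto[of t] True by (simp add: AE_completion_iff)
      ultimately show ?thesis by eventually_elim (auto intro: LIMSEQ_imp_Cauchy)
    qed simp
    then show "AE t in lborel. AE x in lborel. ?P (t, x)" by simp
  qed
  then have "AE z in lborel. ?P z" by (subst (asm) lborel_prod)
  from AE_lborel_swap[OF this] show ?thesis
  proof eventually_elim
    case (elim z)
    show ?case
    proof
      assume "0 < snd z"
      then have "\<forall>k. \<forall>j::int. fst z \<noteq> of_int j * dx k" and C: "Cauchy (\<lambda>k. u k (fst z) (snd z))" using elim by simp_all
      moreover have "(\<lambda>k. u k (fst z) (snd z)) \<longlonglongrightarrow> \<rho> (fst z) (snd z)"
        using C by (simp add: \<rho>_def Cauchy_convergent_iff convergent_LIMSEQ_iff)
      ultimately show "(\<forall>k. fst z \<notin> range (\<lambda>j::int. of_int j * dx k)) \<and> (\<lambda>k. u k (fst z) (snd z)) \<longlonglongrightarrow> \<rho> (fst z) (snd z)" by blast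
    qed
  qed
qed

lemma approx_density_eq:
  assumes x: "x \<notin> range (\<lambda>j::int. of_int j * dx k)" and t: "0 < t" "t < T"
  shows "approx_density T \<omega> Q \<mu> FF GG \<rho>\<^sub>o y\<^sub>o lam (dx k) x t = u k x t"
proof -
  define i where "i = nat \<lfloor>t / dt k\<rfloor>"
  define j where "j = \<lfloor>x / dx k\<rfloor>"
  have i: "t \<in> {real n * dt k..<real (n + 1) * dt k} \<longleftrightarrow> n = i" for n
  proof -
    have "t \<in> {real n * dt k..<real (n + 1) * dt k} \<longleftrightarrow> real n \<le> t / dt k \<and> t / dt k < real n + 1"
      using dt(1)[of k] by (auto simp: le_divide_eq divide_less_eq add.commute)
    also have "\<dots> \<longleftrightarrow> \<lfloor>t / dt k\<rfloor> = int n" by (auto simp: floor_eq_iff)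
    also have "\<dots> \<longleftrightarrow> n = i" using t dt(1)[of k] by (auto simp: i_def)
    finally show ?thesis .
  qed
  have iN: "i \<le> nat \<lfloor>T / dt k\<rfloor>"
    using t dt(1)[of k] by (auto simp: i_def intro!: nat_mono floor_mono divide_right_mono)
  have inner: "(\<Sum>\<^sub>\<infinity>l\<in>UNIV. U (dx k) n l * indicator (cell (dx k) l \<times> {real n * dt k..<real (n + 1) * dt k}) (x, t))
     = (if n = i then U (dx k) n j else 0)" for n
  proof -
    have "x \<in> cell (dx k) l \<longleftrightarrow> j = l" for l
      using mem_cell_iff_floor[OF dx, of x k l] x by (auto simp: j_def)
    then have eq: "U (dx k) n l * indicator (cell (dx k) l \<times> {real n * dt k..<real (n + 1) * dt k}) (x, t)
      = (if l = j \<and> n = i then U (dx k) n j else 0)" for l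
      using i[of n] by (auto simp: indicator_def mem_Times_iff simp del: atLeastLessThan_iff)
    have "(\<Sum>\<^sub>\<infinity>l\<in>UNIV. (if l = j \<and> n = i then U (dx k) n j else 0)) = (\<Sum>\<^sub>\<infinity>l\<in>{j}. if n = i then U (dx k) n j else 0)"
      by (rule infsum_cong_neutral) auto
    then show ?thesis unfolding eq by simp
  qed
  have "approx_density T \<omega> Q \<mu> FF GG \<rho>\<^sub>o y\<^sub>o lam (dx k) x t = (\<Sum>n\<le>nat \<lfloor>T / dt k\<rfloor>. if n = i then U (dx k) n j else 0)"
    using inner by (simp add: approx_density_def U_def dt_def Let_def)
  also have "\<dots> = u k x t" using iN by (simp add: u_def i_def j_def)
  finally show ?thesis .
qed

lemma strip_measurable: "UNIV \<times> {0<..<T} \<in> sets (borel :: (real \<times> real) measure)"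
  by (simp add: borel_prod[symmetric])

lemma approx_density_tendsto:
  "AE (x, t) in lebesgue_on (UNIV \<times> {0<..<T}).
     (\<lambda>k. approx_density T \<omega> Q \<mu> FF GG \<rho>\<^sub>o y\<^sub>o lam (dx k) x t) \<longlonglongrightarrow> \<rho> x t"
proof -
  have "AE z in lborel. z \<in> UNIV \<times> {0<..<T} \<longrightarrow>
     (\<lambda>k. approx_density T \<omega> Q \<mu> FF GG \<rho>\<^sub>o y\<^sub>o lam (dx k) (fst z) (snd z)) \<longlonglongrightarrow> \<rho> (fst z) (snd z)"
    using AE_plane
  proof eventually_elim
    case (elim z)
    show ?case
    proof
      assume "z \<in> UNIV \<times> {0<..<T}"
      then have "0 < snd z" "snd z < T" by (auto simp: mem_Times_iff)
      then show "(\<lambda>k. approx_density T \<omega> Q \<mu> FF GG \<rho>\<^sub>o y\<^sub>o lam (dx k) (fst z) (snd z)) \<longlonglongrightarrow> \<rho> (fst z) (snd z)"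
        using elim approx_density_eq by simp
    qed
  qed
  then show ?thesis
    using strip_measurable by (subst AE_restrict_space_iff) (auto simp: AE_completion_iff case_prod_beta)
qed

lemma limit_admissible: assumes "T > 0" shows "admissible_weak_solution T R f \<omega> Q \<mu> \<rho>\<^sub>o y\<^sub>o \<rho> y"
  unfolding admissible_weak_solution_def
proof (intro conjI)
  have "(\<lambda>(x, t). \<rho> x t) \<in> borel_measurable borel" using \<rho>_measurable by (simp add: borel_prod case_prod_beta')
  then have "(\<lambda>(x, t). \<rho> x t) \<in> borel_measurable lebesgue" by (intro measurable_completion) simp
  then show "(\<lambda>(x, t). \<rho> x t) \<in> borel_measurable (lebesgue_on (UNIV \<times> {0<..<T}))" by (rule measurable_restrict_space1)
  show "AE (x, t) in lebesgue_on (UNIV \<times> {0<..<T}). \<rho> x t \<in> {0..R}" using \<rho>_range by simp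
  show "continuous_L1loc T \<rho>" by (rule continuous_L1loc_limit)
  show "AE x in lebesgue. \<rho> x 0 = \<rho>\<^sub>o (x + y\<^sub>o)" by (rule \<rho>_initial)
  show "\<exists>v. W1inf_deriv T y v \<and> entropy_inequality T R f Q \<rho> v \<and> weak_constraint T f Q \<rho> v"
    using W1inf[OF assms] entropy_inequality_limit weak_constraint_limit by blast
  show "\<forall>t\<in>{0..T}. y t = y\<^sub>o + (LINT s:{0..t}|lebesgue. \<omega> (LINT x|lebesgue. \<rho> x s * \<mu> x))"
    by (intro ballI) (simp only: y_def v_def)
qed

end

section \<open>Convergence of the scheme\<close>

lemma derivative_decreases_of_second_derivative_le:
  fixes g g' :: "real \<Rightarrow> real"
  assumes g: "\<And>r. r \<in> {a..b} \<Longrightarrow> (g has_real_derivative g' r) (at r within {a..b})"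
    and le: "\<And>r. r \<in> {a..b} \<Longrightarrow> g' r \<le> - \<alpha>"
    and xy: "a \<le> x" "x \<le> y" "y \<le> b"
  shows "g y \<le> g x - \<alpha> * (y - x)"
proof (cases "x = y")
  case False
  then have "x < y" using xy by simp
  moreover have "(g has_derivative (*) (g' z)) (at z within {x..y})" if "x \<le> z" "z \<le> y" for z
    using DERIV_subset[OF g[of z], of "{x..y}"] that xy by (simp add: has_field_derivative_def)
  ultimately obtain z where z: "z \<in> {x<..<y}" "g y - g x = g' z * (y - x)"
    using mvt_simple[of x y g "\<lambda>z. (*) (g' z)"] by blast
  have "g' z * (y - x) \<le> - \<alpha> * (y - x)" by (rule mult_right_mono) (use z xy le in auto)
  then show ?thesis using z(2) by simp
qed simp

text \<open>Needed for the range of \<open>\<omega>\<close>: the discrete speeds are values of \<open>\<omega>\<close>, whereas the maximal speed is an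
essential bound.\<close>

lemma continuous_le_Linf_norm:
  fixes g :: "real \<Rightarrow> real"
  assumes "R > 0" and g: "continuous_on {0..R} g" and C: "\<And>r. r \<in> {0..R} \<Longrightarrow> \<bar>g r\<bar> \<le> C" and r: "r \<in> {0..R}"
  shows "\<bar>g r\<bar> \<le> Linf_norm {0..R} g"
proof -
  let ?h = "\<lambda>x. \<bar>g (max 0 (min R x))\<bar>"
  have h: "?h x = \<bar>g x\<bar>" if "x \<in> {0..R}" for x using that by (cases "x = R") auto
  have "0 \<le> C" using C[OF r] by linarith
  moreover have "AE x in lebesgue_on {0..R}. \<bar>g x\<bar> \<le> C" using C by (auto intro!: AE_I2)
  ultimately have "AE x in lebesgue_on {0..R}. \<bar>g x\<bar> \<le> Linf_norm {0..R} g" by (rule AE_abs_le_Linf_norm(1))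
  then have "AE x in lebesgue. x \<in> {0..R} \<longrightarrow> \<bar>g x\<bar> \<le> Linf_norm {0..R} g" by (simp add: AE_restrict_space_iff)
  then have "AE x in lebesgue. x \<in> {0<..<R} \<longrightarrow> ?h x \<le> Linf_norm {0..R} g"
    by eventually_elim (use h in force)
  moreover have "continuous_on UNIV ?h"
    by (intro continuous_intros continuous_on_compose2[OF g]) (use \<open>R > 0\<close> in auto)
  ultimately have "?h r \<le> Linf_norm {0..R} g" using r \<open>R > 0\<close> by (intro continuous_le_of_AE_le)
  then show ?thesis using h[OF r] by simp
qed

text \<open>The interior maximum of condition (B) is a critical point.\<close>

lemma condition_B_imp_strongly_concave_flux:
  assumes R: "R > 0" and \<alpha>: "\<alpha> > 0"
    and f': "\<forall>r\<in>{0..R}. (f has_real_derivative f' r) (at r within {0..R})"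
    and f'': "\<forall>r\<in>{0..R}. (f' has_real_derivative f'' r) (at r within {0..R})" "\<forall>r\<in>{0..R}. f'' r \<le> - \<alpha>"
    and B: "condition_B R f smax" and s: "s \<in> {0..smax}"
  shows "\<exists>p. strongly_concave_flux (flux f s) (\<lambda>r. f' r - s) R \<alpha> p"
proof -
  from B s obtain p where p: "p \<in> {0<..<R}" "\<And>r. r \<in> {0..R} \<Longrightarrow> flux f s r \<le> flux f s p"
    unfolding condition_B_def turning_point_def by blast
  have d: "(flux f s has_real_derivative f' r - s) (at r within {0..R})" if "r \<in> {0..R}" for r
    unfolding flux_def using f' that by (auto intro!: derivative_eq_intros)
  have "(flux f s has_real_derivative f' p - s) (at p within {0<..<R})"
    by (rule DERIV_subset[OF d]) (use p in auto)
  then have "(flux f s has_real_derivative f' p - s) (at p)" using p(1) at_within_open[of p "{0<..<R}"] by simp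
  moreover have "\<bar>p - r\<bar> < min p (R - p) \<Longrightarrow> flux f s r \<le> flux f s p" for r using p(1) by (intro p(2)) (simp, linarith)
  ultimately have "f' p - s = 0" using p(1) by (intro DERIV_local_max[where d = "min p (R - p)"]) auto
  moreover have "f' y - s \<le> f' x - s - \<alpha> * (y - x)" if "0 \<le> x" "x \<le> y" "y \<le> R" for x y
    using derivative_decreases_of_second_derivative_le[of 0 R f' f'' \<alpha> x y] f'' that by auto
  ultimately have "strongly_concave_flux (flux f s) (\<lambda>r. f' r - s) R \<alpha> p"
    using R \<alpha> p(1) d by unfold_locales auto
  then show ?thesis ..
qed

text \<open>The slope of the constraint flux is one of those over which the supremum in the CFL condition is
taken.\<close>

lemma constraint_flux_CFL:
  assumes R: "R > 0" and lam: "lam > 0" and s: "s \<in> {0..smax}"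
    and G: "numerical_flux R (flux f s) (GG s)"
    and bdd: "bdd_above (flux_slopes R smax FF GG)" and CFL: "lam * Sup (flux_slopes R smax FF GG) \<le> 1"
  shows "\<exists>L1 L2. 0 \<le> L1 \<and> 0 \<le> L2 \<and> lam * (L1 + L2) \<le> 1
      \<and> (\<forall>a\<in>{0..R}. GG s a a = flux f s a)
      \<and> (\<forall>a\<in>{0..R}. \<forall>b\<in>{0..R}. \<forall>c\<in>{a..R}. 0 \<le> GG s c b - GG s a b \<and> GG s c b - GG s a b \<le> L1 * (c - a))
      \<and> (\<forall>a\<in>{0..R}. \<forall>b\<in>{0..R}. \<forall>c\<in>{b..R}. 0 \<le> GG s a b - GG s a c \<and> GG s a b - GG s a c \<le> L2 * (c - b))"
proof -
  from numerical_flux_increments[OF R G] obtain L1 L2 where L: "0 \<le> L1" "0 \<le> L2" "flux_slope R (GG s) = L1 + L2"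
    "\<And>a a' b. \<lbrakk>0 \<le> a; a \<le> a'; a' \<le> R; 0 \<le> b; b \<le> R\<rbrakk> \<Longrightarrow> GG s a' b - GG s a b \<le> L1 * (a' - a)"
    "\<And>a b b'. \<lbrakk>0 \<le> b; b \<le> b'; b' \<le> R; 0 \<le> a; a \<le> R\<rbrakk> \<Longrightarrow> GG s a b - GG s a b' \<le> L2 * (b' - b)" by metis
  have "flux_slope R (GG s) \<in> flux_slopes R smax FF GG" using s by (auto simp: flux_slopes_def)
  then have "flux_slope R (GG s) \<le> Sup (flux_slopes R smax FF GG)" using bdd by (rule cSup_upper)
  then have "lam * (L1 + L2) \<le> lam * Sup (flux_slopes R smax FF GG)" using L(3) lam by simp
  then have 1: "lam * (L1 + L2) \<le> 1" using CFL by simp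
  have c: "\<forall>a\<in>{0..R}. GG s a a = flux f s a" using G by (simp add: numerical_flux_def)
  have m: "GG s a b \<le> GG s c b" if "a \<in> {0..R}" "b \<in> {0..R}" "c \<in> {a..R}" for a b c
    using G that by (auto simp: numerical_flux_def intro: mono_onD[of "{0..R}" "\<lambda>a. GG s a b" a c])
  have m': "GG s a c \<le> GG s a b" if "a \<in> {0..R}" "b \<in> {0..R}" "c \<in> {b..R}" for a b c
  proof -
    have "antimono_on {0..R} (\<lambda>b. GG s a b)" using G that(1) by (simp add: numerical_flux_def)
    then show ?thesis by (rule monotone_onD) (use that in auto)
  qed
  have "\<forall>a\<in>{0..R}. \<forall>b\<in>{0..R}. \<forall>c\<in>{a..R}. 0 \<le> GG s c b - GG s a b \<and> GG s c b - GG s a b \<le> L1 * (c - a)"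
    using m L(4) by simp
  moreover have "\<forall>a\<in>{0..R}. \<forall>b\<in>{0..R}. \<forall>c\<in>{b..R}. 0 \<le> GG s a b - GG s a c \<and> GG s a b - GG s a c \<le> L2 * (c - b)"
    using m' L(5) by simp
  ultimately show ?thesis using L(1,2) 1 c by (intro exI[of _ L1] exI[of _ L2] conjI)
qed

theorem theorem4p8:
  fixes T R \<alpha> y\<^sub>o lam smax :: real
    and f f' f'' \<omega> Q \<mu> \<rho>\<^sub>o :: "real \<Rightarrow> real"
    and FF GG :: "real \<Rightarrow> real \<Rightarrow> real \<Rightarrow> real"
    and dx :: "nat \<Rightarrow> real"
  assumes "T > 0" and "R > 0"
    and "\<forall>r\<in>{0..R}. 0 \<le> \<omega> r" and "antimono_on {0..R} \<omega>" and "\<exists>C. C-lipschitz_on {0..R} \<omega>"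
    and smax: "smax = Linf_norm {0..R} \<omega>"
    and "\<forall>s\<in>{0..smax}. 0 \<le> Q s" and "\<exists>C. C-lipschitz_on {0..smax} Q"
    and "BV \<mu>" and "AE x in lebesgue. 0 \<le> \<mu> x" and "(LINT x|lebesgue. \<mu> x) = 1"
    and "integrable lebesgue \<rho>\<^sub>o" and "AE x in lebesgue. \<rho>\<^sub>o x \<in> {0..R}"
    and "bell_shaped R f" and "condition_B R f smax"
    and "\<forall>r\<in>{0..R}. (f has_real_derivative f' r) (at r within {0..R})"
    and "\<forall>r\<in>{0..R}. (f' has_real_derivative f'' r) (at r within {0..R})"
    and "continuous_on {0..R} f''"
    and "\<alpha> > 0" and "\<forall>r\<in>{0..R}. f'' r \<le> - \<alpha>"
    and "(\<forall>s\<in>{0..smax}. \<forall>a\<in>{0..R}. \<forall>b\<in>{0..R}. FF s a b = engquist_osher (flux f s) a b)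
       \<or> (\<forall>s\<in>{0..smax}. \<forall>a\<in>{0..R}. \<forall>b\<in>{0..R}. FF s a b = godunov (flux f s) a b)"
    and "\<forall>s\<in>{0..smax}. numerical_flux R (flux f s) (GG s)"
    and "bdd_above (flux_slopes R smax FF GG)"
    and "lam > 0" and CFL: "lam * Sup (flux_slopes R smax FF GG) \<le> 1"
    and "\<forall>k. dx k > 0" and "dx \<longlonglongrightarrow> 0"
  shows "\<exists>r \<rho> y. strict_mono (r :: nat \<Rightarrow> nat)
    \<and> uniform_limit {0..T}
        (\<lambda>k. approx_position \<omega> Q \<mu> FF GG \<rho>\<^sub>o y\<^sub>o lam (dx (r k))) y sequentially
    \<and> (AE (x, t) in lebesgue_on (UNIV \<times> {0<..<T}).
        (\<lambda>k. approx_density T \<omega> Q \<mu> FF GG \<rho>\<^sub>o y\<^sub>o lam (dx (r k)) x t) \<longlonglongrightarrow> \<rho> x t)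
    \<and> admissible_weak_solution T R f \<omega> Q \<mu> \<rho>\<^sub>o y\<^sub>o \<rho> y"
proof -
  note R = \<open>R > 0\<close> and lam = \<open>lam > 0\<close>
  obtain C\<omega> where C\<omega>: "C\<omega>-lipschitz_on {0..R} \<omega>" using assms(5) by blast
  obtain CQ where CQ: "CQ-lipschitz_on {0..smax} Q" using assms(8) by blast
  have \<omega>: "\<omega> r \<in> {0..smax}" if r: "r \<in> {0..R}" for r
  proof -
    have "\<bar>\<omega> x\<bar> \<le> \<omega> 0" if "x \<in> {0..R}" for x
      using assms(3) that monotone_onD[OF assms(4), of 0 x] R by auto
    from continuous_le_Linf_norm[OF R lipschitz_on_continuous_on[OF C\<omega>] this r] show ?thesis
      using assms(3) r smax by auto
  qed
  have "\<forall>s\<in>{0..smax}. \<exists>p. strongly_concave_flux (flux f s) (\<lambda>r. f' r - s) R \<alpha> p"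
    using condition_B_imp_strongly_concave_flux[OF R \<open>\<alpha> > 0\<close> assms(16,17,20,15)] by blast
  then obtain p where p: "\<And>s. s \<in> {0..smax} \<Longrightarrow> strongly_concave_flux (flux f s) (\<lambda>r. f' r - s) R \<alpha> (p s)" by metis
  have FF: "strongly_concave_flux.upwind_flux (flux f s) (\<lambda>r. f' r - s) R (p s) (FF s)" if s: "s \<in> {0..smax}" for s
  proof -
    interpret strongly_concave_flux "flux f s" "\<lambda>r. f' r - s" R \<alpha> "p s" by (rule p[OF s])
    from assms(21) show ?thesis
    proof
      assume "\<forall>s\<in>{0..smax}. \<forall>a\<in>{0..R}. \<forall>b\<in>{0..R}. FF s a b = engquist_osher (flux f s) a b"
      then show ?thesis using s engquist_osher_rising_plus_falling by (intro upwind_flux_rising_plus_falling) auto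
    next
      assume "\<forall>s\<in>{0..smax}. \<forall>a\<in>{0..R}. \<forall>b\<in>{0..R}. FF s a b = godunov (flux f s) a b"
      then show ?thesis using s godunov_demand_supply by (intro upwind_flux_demand_supply) auto
    qed
  qed
  interpret moving_constraint R \<alpha> lam smax y\<^sub>o f f' \<omega> Q \<mu> \<rho>\<^sub>o p FF GG C\<omega> CQ
  proof (rule moving_constraint.intro)
    show "f 0 = 0" "f R \<le> 0" using assms(14) by (simp_all add: bell_shaped_def)
    show "integrable lebesgue \<mu>" using \<open>BV \<mu>\<close> by (simp add: BV_def)
    show "0 \<le> Q s" if "s \<in> {0..smax}" for s using assms(7) that by blast
    show "\<exists>L1 L2. 0 \<le> L1 \<and> 0 \<le> L2 \<and> lam * (L1 + L2) \<le> 1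
      \<and> (\<forall>a\<in>{0..R}. GG s a a = flux f s a)
      \<and> (\<forall>a\<in>{0..R}. \<forall>b\<in>{0..R}. \<forall>c\<in>{a..R}. 0 \<le> GG s c b - GG s a b \<and> GG s c b - GG s a b \<le> L1 * (c - a))
      \<and> (\<forall>a\<in>{0..R}. \<forall>b\<in>{0..R}. \<forall>c\<in>{b..R}. 0 \<le> GG s a b - GG s a c \<and> GG s a b - GG s a c \<le> L2 * (c - b))"
      if "s \<in> {0..smax}" for s
      using constraint_flux_CFL[where GG = GG, OF R lam that _ assms(23) CFL] assms(22) that by blast
  qed (fact R lam \<open>\<alpha> > 0\<close> p FF \<omega> C\<omega> CQ assms(10-13))+
  obtain r P where r: "strict_mono r"
    and lim: "scheme_limit R \<alpha> lam smax y\<^sub>o f f' \<omega> Q \<mu> \<rho>\<^sub>o p FF GG C\<omega> CQ (\<lambda>k. dx (r k)) P"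
    using scheme_limit_exists \<open>\<forall>k. dx k > 0\<close> \<open>dx \<longlonglongrightarrow> 0\<close> by metis
  interpret limit: scheme_limit R \<alpha> lam smax y\<^sub>o f f' \<omega> Q \<mu> \<rho>\<^sub>o p FF GG C\<omega> CQ "\<lambda>k. dx (r k)" P by (rule lim)
  show ?thesis
    using r limit.approx_position_uniform limit.approx_density_tendsto limit.limit_admissible[OF \<open>T > 0\<close>] by blast
qed

end
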